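(* Let $1<\alpha\le2$, let $V(x)=c_0+c_1\cdot x$ with constants $c_0\in\mathbb{R}$ and $0\ne c_1\in\mathbb{R}^d$, and let the initial data $\varphi_0^\varepsilon$ satisfy (I). Let $\psi^\varepsilon$ be the exact solution of the fractional Schrödinger equation $$\mathrm{i}\varepsilon\,\partial_t\psi^\varepsilon=T(-\mathrm{i}\varepsilon\partial_x)\psi^\varepsilon+V(x)\psi^\varepsilon,\qquad T(p)=\tfrac1\alpha|p|^\alpha,\qquad\psi^\varepsilon(0,x)=\varphi^\varepsilon_0(x),\qquad x\in\mathbb{R}^d,$$ and let $\psi^\varepsilon_{\delta,\mathrm{FGA}}$ be the frozen Gaussian approximation with regularization parameter $\delta$. Let $t_{\mathrm f}>0$. There exist choices of $\delta=\delta(\varepsilon)>0$ such that, for $t\in[0,t_{\mathrm f}]$, $$\left\|\psi^\varepsilon(t,\cdot)-\psi^\varepsilon_{\delta,\mathrm{FGA}}(t,\cdot)\right\|_{L^2(\mathbb{R}^d)}\lesssim(\log\varepsilon^{-1})^{3/4}\,\varepsilon^{\frac{\alpha-1}2}.$$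
   Context: $0<\varepsilon\ll1$ is the semiclassical parameter; $A\lesssim B$ means $A\le CB$ with a constant $C$ not depending on $\varepsilon$. Fourier transform: $\hat\psi(\xi)=(2\pi\varepsilon)^{-d/2}\int_{\mathbb{R}^d}\psi(x)\mathrm{e}^{-\mathrm{i}x\cdot\xi/\varepsilon}\,dx$; for a symbol $T$, $T(-\mathrm{i}\varepsilon\partial_x)\psi$ is the function with Fourier transform $T(\xi)\hat\psi(\xi)$. Regularized kinetic symbol: $T^\delta(p)=\frac1\alpha(|p|^2+\delta^2)^{\alpha/2}$. FBI transform: $(\mathscr{F}^\varepsilon_-f)(q,p)=2^{-d/2}(\pi\varepsilon)^{-3d/4}\int_{\mathbb{R}^d}\mathrm{e}^{-\frac{\mathrm{i}}{\varepsilon}p\cdot(x-q)-\frac1{2\varepsilon}|x-q|^2}f(x)\,dx$. Phase-space set: for $\omega>0$, $B_\omega$ is the set of $(q,p)\in\mathbb{R}^{2d}$ such that $|p|^2+|q-q_0|^2<\omega^2$ for some $q_0$ with $\partial_qV(q_0)=0$ (empty for the present $V$), and $K_\omega=\{(q,p)\in\mathbb{R}^{2d}\setminus B_\omega:\ |q|^2+|p|^2\le 1/\omega^2\}$. (I): $\varphi_0^\varepsilon\in L^2(\mathbb{R}^d)$, $\|\varphi^\varepsilon_0\|_{L^2}=1$; the family is asymptotically high-frequency with cutoff $\omega$ for a fixed $\omega>0$, i.e. $\int_{\mathbb{R}^{2d}\setminus K_\omega}|(\mathscr{F}^\varepsilon_-\varphi_0^\varepsilon)(q,p)|^2\,dq\,dp=O(\varepsilon^\infty)$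 as $\varepsilon\to0$ (i.e. $o(\varepsilon^k)$ for every $k\in\mathbb{N}$); and there are $S_0\in C^\infty(\mathbb{R}^d)$ (real-valued) and $\rho_0\in\mathcal{S}(\mathbb{R}^d)$, $\rho_0\ge0$, $\|\rho_0\|_{L^1}\le2\|\varphi_0^\varepsilon\|_{L^2}$, with $$|(\mathscr{F}^\varepsilon_-\varphi^\varepsilon_0)(q,p)|^2\le\frac{\rho_0(q)}{(2\pi\varepsilon)^{d/2}}\,\mathrm{e}^{-|p-\partial_qS_0(q)|^2/(2\varepsilon)}.$$ Frozen Gaussian approximation: let $(Q,P)(t,q,p)$ solve $\dot Q=\partial_PT^\delta(P)$, $\dot P=-\partial_QV(Q)$, $(Q,P)|_{t=0}=(q,p)$; let $S$ solve $\dot S=P\cdot\partial_PT^\delta(P)-T^\delta(P)-V(Q)$, $S|_{t=0}=0$. With $\partial_{z}=\partial_{q}-\mathrm{i}\partial_{p}$, let $Z_{jk}=\partial_{z_j}(Q_k+\mathrm{i}P_k)$ (an invertible matrix), and let $a$ solve $\dot a=\frac12\mathrm{tr}(Z^{-1}\dot Z)\,a$, $a|_{t=0}=2^{d/2}\chi_\omega(q,p)$, where $\chi_\omega:\mathbb{R}^{2d}\to[0,1]$ is a fixed smooth cutoff with $\chi_\omega=1$ on $K_\omega$ and $\chi_\omega=0$ on $\mathbb{R}^{2d}\setminus K_{\omega/2}$. With $$\Phi=S+P\cdot(x-Q)+\tfrac{\mathrm{i}}2|x-Q|^2-p\cdot(y-q)+\tfrac{\mathrm{i}}2|y-q|^2,$$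 $$\psi^\varepsilon_{\delta,\mathrm{FGA}}(t,x)=\frac1{(2\pi\varepsilon)^{3d/2}}\int_{\mathbb{R}^{3d}}\mathrm{e}^{\frac{\mathrm{i}}\varepsilon\Phi(t,x,y,q,p)}\,a(t,q,p)\,\varphi_0^\varepsilon(y)\,dy\,dq\,dp.$$ *)

theory Defs
  imports "HOL-Analysis.Analysis" "HOL-Library.Landau_Symbols"
begin

text \<open>Iterated directional derivatives; the head of the list is the derivative taken last.\<close>

fun iter_deriv ::
    "'a::euclidean_space list \<Rightarrow> ('a \<Rightarrow> 'b::real_normed_vector) \<Rightarrow> 'a \<Rightarrow> 'b" where
  "iter_deriv [] f = f"
| "iter_deriv (v # vs) f = (\<lambda>x. frechet_derivative (iter_deriv vs f) (at x) v)"

definition smooth :: "('a::euclidean_space \<Rightarrow> 'b::real_normed_vector) \<Rightarrow> bool" where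
  "smooth f \<longleftrightarrow> (\<forall>vs. set vs \<subseteq> Basis \<longrightarrow> (\<forall>x. iter_deriv vs f differentiable (at x)))"

definition schwartz :: "('a::euclidean_space \<Rightarrow> 'b::real_normed_vector) \<Rightarrow> bool" where
  "schwartz f \<longleftrightarrow> smooth f \<and>
     (\<forall>vs m. set vs \<subseteq> Basis \<longrightarrow> (\<exists>C. \<forall>x. (1 + norm x) ^ m * norm (iter_deriv vs f x) \<le> C))"

definition gradient :: "(real ^ 'd \<Rightarrow> real) \<Rightarrow> real ^ 'd \<Rightarrow> real ^ 'd" where
  "gradient f x = (\<chi> j. frechet_derivative f (at x) (axis j 1))"

text \<open>Elements of the Lebesgue space are represented by Borel functions.  Since \<open>l2norm\<close> is
  meaningful only for square-integrable functions, it is always used together with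
  \<open>square_integrable\<close>.\<close>

definition square_integrable :: "('a::euclidean_space \<Rightarrow> complex) \<Rightarrow> bool" where
  "square_integrable f \<longleftrightarrow>
     f \<in> borel_measurable lborel \<and> integrable lborel (\<lambda>x. (cmod (f x))\<^sup>2)"

definition l2norm :: "('a::euclidean_space \<Rightarrow> complex) \<Rightarrow> real" where
  "l2norm f = sqrt (LINT x|lborel. (cmod (f x))\<^sup>2)"

definition l2inner :: "('a::euclidean_space \<Rightarrow> complex) \<Rightarrow> ('a \<Rightarrow> complex) \<Rightarrow> complex" where
  "l2inner f g = (LINT x|lborel. cnj (f x) * g x)"

definition fourier :: "real \<Rightarrow> (real ^ 'd \<Rightarrow> complex) \<Rightarrow> real ^ 'd \<Rightarrow> complex" where
  "fourier \<epsilon> f \<xi> = complex_of_real ((2 * pi * \<epsilon>) powr (- (CARD('d) / 2))) *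
     (LINT x|lborel. f x * exp (- \<i> * complex_of_real (x \<bullet> \<xi> / \<epsilon>)))"

definition inv_fourier :: "real \<Rightarrow> (real ^ 'd \<Rightarrow> complex) \<Rightarrow> real ^ 'd \<Rightarrow> complex" where
  "inv_fourier \<epsilon> g x = complex_of_real ((2 * pi * \<epsilon>) powr (- (CARD('d) / 2))) *
     (LINT \<xi>|lborel. g \<xi> * exp (\<i> * complex_of_real (x \<bullet> \<xi> / \<epsilon>)))"

text \<open>The operator with symbol \<open>T\<close>, i.e. \<open>T(-i\<epsilon>\<partial>)\<close>.  It is only applied to Schwartz functions
  and symbols of polynomial growth, so that both integrals converge absolutely.\<close>

definition fourier_multiplier ::
    "real \<Rightarrow> (real ^ 'd \<Rightarrow> real) \<Rightarrow> (real ^ 'd \<Rightarrow> complex) \<Rightarrow> real ^ 'd \<Rightarrow> complex" where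
  "fourier_multiplier \<epsilon> T f =
     inv_fourier \<epsilon> (\<lambda>\<xi>. complex_of_real (T \<xi>) * fourier \<epsilon> f \<xi>)"

definition fbi :: "real \<Rightarrow> (real ^ 'd \<Rightarrow> complex) \<Rightarrow> real ^ 'd \<Rightarrow> real ^ 'd \<Rightarrow> complex" where
  "fbi \<epsilon> f q p =
     complex_of_real (2 powr (- (CARD('d) / 2)) * (pi * \<epsilon>) powr (- (3 * CARD('d) / 4))) *
     (LINT x|lborel.
        exp (- (\<i> / complex_of_real \<epsilon>) * complex_of_real (p \<bullet> (x - q))
             - complex_of_real ((norm (x - q))\<^sup>2 / (2 * \<epsilon>))) * f x)"

definition kinetic :: "real \<Rightarrow> real ^ 'd \<Rightarrow> real" where
  "kinetic \<alpha> p = norm p powr \<alpha> / \<alpha>"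

definition kinetic_reg :: "real \<Rightarrow> real \<Rightarrow> real ^ 'd \<Rightarrow> real" where
  "kinetic_reg \<alpha> \<delta> p = ((norm p)\<^sup>2 + \<delta>\<^sup>2) powr (\<alpha> / 2) / \<alpha>"

text \<open>For square-integrable initial data, which need not lie in the domain of the Hamiltonian,
  the equation is understood in the usual weak sense: \<open>\<psi>\<close> is a continuous curve of
  square-integrable functions on \<open>[0, tf]\<close>, and the (symmetric) Hamiltonian is moved onto Schwartz
  test functions.  Every strong solution is a solution in this sense.\<close>

definition schroedinger_solution ::
    "real \<Rightarrow> (real ^ 'd \<Rightarrow> real) \<Rightarrow> (real ^ 'd \<Rightarrow> real) \<Rightarrow> real \<Rightarrow>
     (real ^ 'd \<Rightarrow> complex) \<Rightarrow> (real \<Rightarrow> real ^ 'd \<Rightarrow> complex) \<Rightarrow> bool" where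
  "schroedinger_solution \<epsilon> T V tf \<phi>0 \<psi> \<longleftrightarrow>
     (\<forall>t\<in>{0..tf}. square_integrable (\<psi> t)) \<and>
     (\<forall>t\<in>{0..tf}. ((\<lambda>s. l2norm (\<lambda>x. \<psi> s x - \<psi> t x)) \<longlongrightarrow> 0) (at t within {0..tf})) \<and>
     (AE x in lborel. \<psi> 0 x = \<phi>0 x) \<and>
     (\<forall>\<eta>. schwartz \<eta> \<longrightarrow>
        (\<forall>t\<in>{0..tf}. \<exists>D.
           ((\<lambda>s. l2inner \<eta> (\<psi> s)) has_vector_derivative D) (at t within {0..tf}) \<and>
           \<i> * complex_of_real \<epsilon> * D =
             l2inner (\<lambda>x. fourier_multiplier \<epsilon> T \<eta> x + complex_of_real (V x) * \<eta> x) (\<psi> t)))"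

definition B_set :: "(real ^ 'd \<Rightarrow> real) \<Rightarrow> real \<Rightarrow> ((real ^ 'd) \<times> (real ^ 'd)) set" where
  "B_set V \<omega> = {(q, p). \<exists>q0. gradient V q0 = 0 \<and> (norm p)\<^sup>2 + (norm (q - q0))\<^sup>2 < \<omega>\<^sup>2}"

definition K_set :: "(real ^ 'd \<Rightarrow> real) \<Rightarrow> real \<Rightarrow> ((real ^ 'd) \<times> (real ^ 'd)) set" where
  "K_set V \<omega> = {(q, p). (q, p) \<notin> B_set V \<omega> \<and> (norm q)\<^sup>2 + (norm p)\<^sup>2 \<le> 1 / \<omega>\<^sup>2}"

definition high_frequency ::
    "(real ^ 'd \<Rightarrow> real) \<Rightarrow> real \<Rightarrow> (real \<Rightarrow> real ^ 'd \<Rightarrow> complex) \<Rightarrow> bool" where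
  "high_frequency V \<omega> \<phi>0 \<longleftrightarrow>
     (\<forall>k::nat. (\<lambda>\<epsilon>. LINT z:(- K_set V \<omega>)|lborel. (cmod (fbi \<epsilon> (\<phi>0 \<epsilon>) (fst z) (snd z)))\<^sup>2)
        \<in> o[at_right 0](\<lambda>\<epsilon>. \<epsilon> ^ k))"

text \<open>The functions \<open>S0\<close> and \<open>\<rho>0\<close> do not depend on \<open>\<epsilon>\<close>; the conditions on the family \<open>\<phi>0\<close> are
  imposed for all sufficiently small \<open>\<epsilon> > 0\<close>.\<close>

definition admissible_data ::
    "(real ^ 'd \<Rightarrow> real) \<Rightarrow> real \<Rightarrow> (real \<Rightarrow> real ^ 'd \<Rightarrow> complex) \<Rightarrow> bool" where
  "admissible_data V \<omega> \<phi>0 \<longleftrightarrow>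
     (\<forall>\<^sub>F \<epsilon> in at_right 0. square_integrable (\<phi>0 \<epsilon>) \<and> l2norm (\<phi>0 \<epsilon>) = 1) \<and>
     high_frequency V \<omega> \<phi>0 \<and>
     (\<exists>(S0 :: real ^ 'd \<Rightarrow> real) (\<rho>0 :: real ^ 'd \<Rightarrow> real).
        smooth S0 \<and> schwartz \<rho>0 \<and> (\<forall>x. \<rho>0 x \<ge> 0) \<and>
        (\<forall>\<^sub>F \<epsilon> in at_right 0.
           (LINT x|lborel. \<bar>\<rho>0 x\<bar>) \<le> 2 * l2norm (\<phi>0 \<epsilon>) \<and>
           (\<forall>q p. (cmod (fbi \<epsilon> (\<phi>0 \<epsilon>) q p))\<^sup>2
              \<le> \<rho>0 q / (2 * pi * \<epsilon>) powr (CARD('d) / 2)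
                 * exp (- (norm (p - gradient S0 q))\<^sup>2 / (2 * \<epsilon>)))))"

definition phase_cutoff ::
    "(real ^ 'd \<Rightarrow> real) \<Rightarrow> real \<Rightarrow> ((real ^ 'd) \<times> (real ^ 'd) \<Rightarrow> real) \<Rightarrow> bool" where
  "phase_cutoff V \<omega> chi \<longleftrightarrow>
     smooth chi \<and> range chi \<subseteq> {0..1} \<and>
     (\<forall>z\<in>K_set V \<omega>. chi z = 1) \<and> (\<forall>z\<in>- K_set V (\<omega> / 2). chi z = 0)"

text \<open>In the following, trajectories and amplitudes take the arguments \<open>t\<close>, \<open>q\<close>, \<open>p\<close>, and \<open>T\<close> is the
  symbol that generates the flow.\<close>

definition hamiltonian_flow ::
    "(real ^ 'd \<Rightarrow> real) \<Rightarrow> (real ^ 'd \<Rightarrow> real) \<Rightarrow> real \<Rightarrow>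
     (real \<Rightarrow> real ^ 'd \<Rightarrow> real ^ 'd \<Rightarrow> real ^ 'd) \<Rightarrow>
     (real \<Rightarrow> real ^ 'd \<Rightarrow> real ^ 'd \<Rightarrow> real ^ 'd) \<Rightarrow> bool" where
  "hamiltonian_flow T V tf Q P \<longleftrightarrow>
     (\<forall>q p. Q 0 q p = q \<and> P 0 q p = p \<and>
       (\<forall>t\<in>{0..tf}.
          ((\<lambda>s. Q s q p) has_vector_derivative gradient T (P t q p)) (at t within {0..tf}) \<and>
          ((\<lambda>s. P s q p) has_vector_derivative - gradient V (Q t q p)) (at t within {0..tf})))"

definition action ::
    "(real ^ 'd \<Rightarrow> real) \<Rightarrow> (real ^ 'd \<Rightarrow> real) \<Rightarrow> real \<Rightarrow>
     (real \<Rightarrow> real ^ 'd \<Rightarrow> real ^ 'd \<Rightarrow> real ^ 'd) \<Rightarrow>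
     (real \<Rightarrow> real ^ 'd \<Rightarrow> real ^ 'd \<Rightarrow> real ^ 'd) \<Rightarrow>
     (real \<Rightarrow> real ^ 'd \<Rightarrow> real ^ 'd \<Rightarrow> real) \<Rightarrow> bool" where
  "action T V tf Q P S \<longleftrightarrow>
     (\<forall>q p. S 0 q p = 0 \<and>
       (\<forall>t\<in>{0..tf}.
          ((\<lambda>s. S s q p) has_real_derivative
             P t q p \<bullet> gradient T (P t q p) - T (P t q p) - V (Q t q p)) (at t within {0..tf})))"

text \<open>The derivative \<open>\<partial>\<^bsub>q j\<^esub> - i \<partial>\<^bsub>p j\<^esub>\<close> of a function on phase space.\<close>

definition dz :: "'d \<Rightarrow> (real ^ 'd \<Rightarrow> real ^ 'd \<Rightarrow> complex) \<Rightarrow> real ^ 'd \<Rightarrow> real ^ 'd \<Rightarrow> complex" where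
  "dz j f q p =
     frechet_derivative (\<lambda>(q, p). f q p) (at (q, p)) (axis j 1, 0)
     - \<i> * frechet_derivative (\<lambda>(q, p). f q p) (at (q, p)) (0, axis j 1)"

definition Z_matrix ::
    "(real \<Rightarrow> real ^ 'd \<Rightarrow> real ^ 'd \<Rightarrow> real ^ 'd) \<Rightarrow>
     (real \<Rightarrow> real ^ 'd \<Rightarrow> real ^ 'd \<Rightarrow> real ^ 'd) \<Rightarrow>
     real \<Rightarrow> real ^ 'd \<Rightarrow> real ^ 'd \<Rightarrow> complex ^ 'd ^ 'd" where
  "Z_matrix Q P t q p =
     (\<chi> j k. dz j (\<lambda>q p. complex_of_real (Q t q p $ k) + \<i> * complex_of_real (P t q p $ k)) q p)"

definition amplitude ::
    "((real ^ 'd) \<times> (real ^ 'd) \<Rightarrow> real) \<Rightarrow> real \<Rightarrow>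
     (real \<Rightarrow> real ^ 'd \<Rightarrow> real ^ 'd \<Rightarrow> real ^ 'd) \<Rightarrow>
     (real \<Rightarrow> real ^ 'd \<Rightarrow> real ^ 'd \<Rightarrow> real ^ 'd) \<Rightarrow>
     (real \<Rightarrow> real ^ 'd \<Rightarrow> real ^ 'd \<Rightarrow> complex) \<Rightarrow> bool" where
  "amplitude chi tf Q P a \<longleftrightarrow>
     (\<forall>q p. a 0 q p = complex_of_real (2 powr (CARD('d) / 2) * chi (q, p)) \<and>
       (\<forall>t\<in>{0..tf}.
          ((\<lambda>s. a s q p) has_vector_derivative
             (1 / 2) * trace (matrix_inv (Z_matrix Q P t q p) **
                 vector_derivative (\<lambda>s. Z_matrix Q P s q p) (at t within {0..tf})) * a t q p)
          (at t within {0..tf})))"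

definition fga_phase ::
    "(real \<Rightarrow> real ^ 'd \<Rightarrow> real ^ 'd \<Rightarrow> real ^ 'd) \<Rightarrow>
     (real \<Rightarrow> real ^ 'd \<Rightarrow> real ^ 'd \<Rightarrow> real ^ 'd) \<Rightarrow>
     (real \<Rightarrow> real ^ 'd \<Rightarrow> real ^ 'd \<Rightarrow> real) \<Rightarrow>
     real \<Rightarrow> real ^ 'd \<Rightarrow> real ^ 'd \<Rightarrow> real ^ 'd \<Rightarrow> real ^ 'd \<Rightarrow> complex" where
  "fga_phase Q P S t x y q p =
     complex_of_real (S t q p) + complex_of_real (P t q p \<bullet> (x - Q t q p))
     + \<i> / 2 * complex_of_real ((norm (x - Q t q p))\<^sup>2)
     - complex_of_real (p \<bullet> (y - q)) + \<i> / 2 * complex_of_real ((norm (y - q))\<^sup>2)"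

definition fga ::
    "real \<Rightarrow>
     (real \<Rightarrow> real ^ 'd \<Rightarrow> real ^ 'd \<Rightarrow> real ^ 'd) \<Rightarrow>
     (real \<Rightarrow> real ^ 'd \<Rightarrow> real ^ 'd \<Rightarrow> real ^ 'd) \<Rightarrow>
     (real \<Rightarrow> real ^ 'd \<Rightarrow> real ^ 'd \<Rightarrow> real) \<Rightarrow>
     (real \<Rightarrow> real ^ 'd \<Rightarrow> real ^ 'd \<Rightarrow> complex) \<Rightarrow>
     (real ^ 'd \<Rightarrow> complex) \<Rightarrow> real \<Rightarrow> real ^ 'd \<Rightarrow> complex" where
  "fga \<epsilon> Q P S a \<phi> t x =
     complex_of_real ((2 * pi * \<epsilon>) powr (- (3 * CARD('d) / 2))) *
     (LINT (y, q, p)|lborel.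
        exp (\<i> / complex_of_real \<epsilon> * fga_phase Q P S t x y q p) * a t q p * \<phi> y)"

end

(* With a linear potential the momenta move along p - t c1, so after the gauge transformation
   exp(i t V / epsilon) both the exact propagator and the approximation are explicit.  The exact
   propagator is the Fourier multiplier exp(-i Theta / epsilon), where Theta is the time integral of
   T(p - s c1).  The approximation without cutoff is also a Fourier multiplier: the Fourier transform
   of a wave packet is a wave packet, so Plancherel's theorem in the position variable leaves a
   Gaussian average over p of exp(-i/epsilon (Theta(p) + grad Theta(p) . (xi - p))) times the amplitude.
   The amplitude equation says exactly that the amplitude is proportional to the inverse of the complex
   Gaussian integral with quadratic form Hess Theta(p), so the average equals exp(-i Theta(xi)/epsilon)
   up to the oscillation of Hess Theta over distances sqrt(epsilon).  Since c1 is nonzero, p - s c1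
   crosses the singularity of Hess T at most once and transversally, so Hess Theta is Hoelder continuous
   of exponent alpha - 1, uniformly in delta; this gives the rate epsilon^((alpha-1)/2).  The phases for
   delta = epsilon and delta = 0 differ by O(delta^2), and the cutoff acts where the FBI transform is
   negligible. *)
theory Submission
  imports Defs "HOL-Probability.Characteristic_Functions" "HOL-Real_Asymp.Real_Asymp"
begin

text \<open>Inserting the approximation into the equation would bring in third derivatives of the
  regularized symbol, which blow up like \<open>\<delta> powr (\<alpha> - 3)\<close>. Comparing two
  Fourier multipliers avoids this: only the time-integrated Hessian enters, through its modulus of
  continuity. That modulus comes from \<open>gap m x\<close>, a difference of two singular powers
  that dominates increments of the Hessian both near the crossing and far from it; its time integral
  is at most a multiple of \<open>m powr (\<alpha> - 1)\<close>, since the distance to the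
  singularity is bounded below linearly in time. No branch of a square root is followed for the
  amplitude, because the Gaussian integral itself solves the reciprocal equation. On the exact side
  the solution is known only weakly, and the natural test functions, inverse transforms of symbols
  without smoothness, need not be Schwartz. They are damped by a Gaussian in position, that is,
  mollified in momentum, and the commutator with the symbol vanishes with the width. All comparisons
  are made on pairings with inverse transforms, and norms are recovered by duality.\<close>

abbreviation (input) invF :: "real \<Rightarrow> (real ^ 'd \<Rightarrow> complex) \<Rightarrow> real ^ 'd \<Rightarrow> complex" where "invF \<equiv> inv_fourier"
abbreviation (input) lborel2 :: "('a::euclidean_space \<times> 'b::euclidean_space) measure" where "lborel2 \<equiv> lborel \<Otimes>\<^sub>M lborel"
abbreviation (input) cr :: "real \<Rightarrow> complex" where "cr \<equiv> complex_of_real"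
abbreviation (input) miexp :: "real \<Rightarrow> complex" where "miexp x \<equiv> exp (- \<i> * cr x)"
abbreviation (input) L1 :: "('a::euclidean_space \<Rightarrow> 'b::{banach, second_countable_topology}) \<Rightarrow> bool" where "L1 \<equiv> integrable lborel"
abbreviation (input) L2 :: "('a::euclidean_space \<Rightarrow> complex) \<Rightarrow> bool" where "L2 \<equiv> square_integrable"
abbreviation (input) Borel :: "('a::topological_space \<Rightarrow> 'b::topological_space) set" where "Borel \<equiv> borel_measurable borel"
abbreviation (input) gs :: "real \<Rightarrow> 'a::real_normed_vector \<Rightarrow> real" where "gs c x \<equiv> exp (- c * (norm x)^2)"

lemmas lint_cong = Bochner_Integration.integral_cong[OF refl]
lemmas lint_diff = Bochner_Integration.integral_diff
lemmas lint_add = Bochner_Integration.integral_add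
lemmas lint_nonneg = Bochner_Integration.integral_nonneg
lemmas L1_diff = Bochner_Integration.integrable_diff
lemmas L1_add = Bochner_Integration.integrable_add
lemmas lint_norm_bound = Bochner_Integration.integral_norm_bound_integral
lemmas lint_mono = Bochner_Integration.integral_mono
lemmas lint_cnj = Bochner_Integration.integral_cnj
lemmas L1_sum = Bochner_Integration.integrable_sum
lemmas lint_sum = Bochner_Integration.integral_sum

section \<open>Gaussian integrals\<close>

lemma lborel_affine_nn_integral:
  fixes t :: "'a::euclidean_space" and c :: real
  assumes [measurable]: "f \<in> Borel" and c: "c \<noteq> 0"
  shows "(\<integral>\<^sup>+x. f x \<partial>lborel) = ennreal (\<bar>c\<bar> ^ DIM('a)) * (\<integral>\<^sup>+x. f (t + c *\<^sub>R x) \<partial>lborel)"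
  by (subst lborel_affine[OF c, of t])
     (simp add: nn_integral_density nn_integral_distr nn_integral_cmult)

lemma lborel_affine_integrable:
  fixes t :: "'a::euclidean_space" and f :: "'a \<Rightarrow> 'b :: {banach, second_countable_topology}"
  assumes f: "L1 f" and c: "c \<noteq> 0"
  shows "L1 (\<lambda>x. f (t + c *\<^sub>R x))"
proof -
  have [measurable]: "f \<in> Borel" using f by auto
  have "(\<integral>\<^sup>+x. norm (f x) \<partial>lborel) = ennreal (\<bar>c\<bar> ^ DIM('a)) * (\<integral>\<^sup>+x. norm (f (t + c *\<^sub>R x)) \<partial>lborel)"
    by (rule lborel_affine_nn_integral) (use c in auto)
  with f c show ?thesis unfolding integrable_iff_bounded by (auto simp: ennreal_mult_less_top)
qed

lemma lborel_affine_integrable_iff: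
  fixes t :: "'a::euclidean_space" and f :: "'a \<Rightarrow> 'b :: {banach, second_countable_topology}"
  assumes c: "c \<noteq> 0"
  shows "L1 (\<lambda>x. f (t + c *\<^sub>R x)) \<longleftrightarrow> L1 f" using lborel_affine_integrable[of f c t]
    lborel_affine_integrable[of "\<lambda>x. f (t + c *\<^sub>R x)" "1/c" "- (1/c) *\<^sub>R t"] c by (auto simp: algebra_simps)

lemma lborel_affine_integral:
  fixes t :: "'a::euclidean_space" and f :: "'a \<Rightarrow> 'b :: {banach, second_countable_topology}"
  assumes c: "c \<noteq> 0"
  shows "(\<integral>x. f x \<partial>lborel) = (\<bar>c\<bar> ^ DIM('a)) *\<^sub>R (\<integral>x. f (t + c *\<^sub>R x) \<partial>lborel)"
proof cases
  assume f[measurable]: "L1 f"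
  then have [measurable]: "f \<in> Borel" by auto
  from f show ?thesis using c lborel_affine_integrable[OF f c, of t] by (subst lborel_affine[OF c, of t])
       (simp add: integral_density integral_distr)
next
  assume "\<not> L1 f" with c show ?thesis by (simp add: lborel_affine_integrable_iff not_integrable_integral_eq)
qed

text \<open>Rescaling by \<open>sqrt (2 * c)\<close> turns the integrand into that of the
  characteristic function of the standard normal law, whose value is known; undoing the substitution
  produces the constant \<open>sqrt (pi / c)\<close>.\<close>

lemma gauss_fourier_real:
  fixes c w :: real
  assumes c: "c > 0"
  shows "L1 (\<lambda>x::real. exp (cr (- c * x^2)) * iexp (w * x))"
    and "(LINT x|lborel. exp (cr (- c * x^2)) * iexp (w * x))
         = cr (sqrt (pi / c) * exp (- w\<^sup>2 / (4 * c)))"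
proof -
  define r where "r = sqrt (2 * c)"
  have r: "r > 0" "r^2 = 2 * c" using c by (auto simp: r_def)
  define t where "t = w / r"
  define F where "F = (\<lambda>x. std_normal_density x *\<^sub>R iexp (t * x))"
  have i0: "L1 F" unfolding F_def by (rule Bochner_Integration.integrable_bound[of _ std_normal_density]) auto
  have "char std_normal_distribution t = (LINT x|lborel. F x)" unfolding char_def F_def by (subst integral_density) auto
  then have e0: "(LINT x|lborel. F x) = cr (exp (- (t^2) / 2))" by (simp add: char_std_normal_distribution)
  have F: "F (r * y) = cr (1 / sqrt (2 * pi)) *
      (exp (cr (- c * y^2)) * iexp (w * y))" for y
  proof -
    have e: "- (r * y)\<^sup>2 / 2 = - c * y^2" "t * (r * y) = w * y" using r by (auto simp: power_mult_distrib t_def)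
    show ?thesis unfolding F_def std_normal_density_def e by (simp only: scaleR_conv_of_real exp_of_real[symmetric] of_real_mult mult.assoc)
  qed
  have iF: "L1 (\<lambda>y. F (r * y))" using lborel_integrable_real_affine[OF i0, of r 0] r by simp
  then show I: "L1 (\<lambda>x::real. exp (cr (- c * x^2)) * iexp (w * x))"
  proof -
    have "L1 (\<lambda>y. cr (sqrt (2 * pi)) * F (r * y))" using iF by simp
    moreover have "cr (sqrt (2 * pi)) * F (r * y) = exp (cr (- c * y^2)) * iexp (w * y)" for y unfolding F by (simp add: mult.assoc[symmetric] flip: of_real_mult)
    ultimately show ?thesis by simp
  qed
  have "(LINT x|lborel. F x) = r *\<^sub>R (LINT y|lborel. F (r * y))" using lborel_integral_real_affine[of r F 0] r by simp
  also have "\<dots> = cr (r / sqrt (2 * pi)) * (LINT x|lborel. exp (cr (- c * x^2)) * iexp (w * x))" unfolding F by (simp add: scaleR_conv_of_real)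
  finally have "cr (exp (- (t^2) / 2)) = cr (r / sqrt (2 * pi)) * (LINT x|lborel. exp (cr (- c * x^2)) * iexp (w * x))" using e0 by simp
  moreover have "t^2 / 2 = w^2 / (4 * c)" using r by (simp add: t_def power_divide)
  moreover have "sqrt (2 * pi) / r = sqrt (pi / c)" unfolding r_def using c by (simp flip: real_sqrt_divide)
  ultimately have *: "cr (sqrt (2*pi) / r) * (cr (exp (- (w^2 / (4 * c))))) = (cr (sqrt (2*pi) / r) * cr (r / sqrt (2 * pi))) * (LINT x|lborel. exp (cr (- c * x^2)) * iexp (w * x))"
    by (simp add: mult.assoc)
  have "cr (sqrt (2*pi) / r) * cr (r / sqrt (2 * pi)) = 1" using r by (simp flip: of_real_mult)
  with * \<open>sqrt (2 * pi) / r = sqrt (pi / c)\<close>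
  show "(LINT x|lborel. exp (cr (- c * x^2)) * iexp (w * x))
         = cr (sqrt (pi / c) * exp (- w\<^sup>2 / (4 * c)))" by simp
qed

lemma norm_power2_eq_sum_Basis: "(norm (x::'a::euclidean_space))^2 = (\<Sum>b\<in>Basis. (x \<bullet> b)^2)"
  unfolding power2_norm_eq_inner by (subst euclidean_inner) (simp add: power2_eq_square)

text \<open>Lebesgue measure on a Euclidean space is the image of the product of one-dimensional
  Lebesgue measures under the coordinate map, so a product of functions of single coordinates
  factors. The Gaussian with an oscillating factor is of this kind.\<close>

lemma
  fixes f :: "'a::euclidean_space \<Rightarrow> real \<Rightarrow> complex"
  assumes f: "\<And>b. b \<in> Basis \<Longrightarrow> L1 (f b)"
  shows integrable_lborel_prod: "L1 (\<lambda>x::'a. \<Prod>b\<in>Basis. f b (x \<bullet> b))"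
    and integral_lborel_prod: "(LINT x|lborel. (\<Prod>b\<in>Basis. f b ((x::'a) \<bullet> b))) = (\<Prod>b\<in>Basis. (LINT y|lborel. f b y))"
proof -
  interpret product_sigma_finite "\<lambda>_::'a. lborel :: real measure" by standard
  have [measurable]: "f b \<in> Borel" if "b \<in> Basis" for b using f[OF that] by auto
  have eq: "(\<Prod>b\<in>Basis. f b ((\<Sum>i\<in>Basis. x i *\<^sub>R i) \<bullet> b)) = (\<Prod>b\<in>Basis. f b (x b))" for x by (intro prod.cong) auto
  have m: "(\<lambda>x::'a. \<Prod>b\<in>Basis. f b (x \<bullet> b)) \<in> Borel"
  proof (rule borel_measurable_prod)
    fix b :: 'a assume b: "b \<in> Basis"
    have "(\<lambda>x. x \<bullet> b) \<in> Borel" by simp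
    from measurable_compose[OF this, of "f b" borel] b
    show "(\<lambda>x. f b (x \<bullet> b)) \<in> Borel" by simp
  qed
  have s: "(\<lambda>x. \<Sum>i\<in>Basis. x i *\<^sub>R i) \<in> measurable (Pi\<^sub>M Basis (\<lambda>_::'a. lborel :: real measure)) borel" by measurable
  show "L1 (\<lambda>x::'a. \<Prod>b\<in>Basis. f b (x \<bullet> b))" by (subst lborel_eq) (simp add: integrable_distr_eq[OF s m] eq product_integrable_prod f)
  show "(LINT x|lborel. (\<Prod>b\<in>Basis. f b ((x::'a) \<bullet> b))) = (\<Prod>b\<in>Basis. (LINT y|lborel. f b y))"
    by (subst lborel_eq) (simp add: integral_distr[OF s m] eq product_integral_prod f)
qed

lemma
  fixes w :: "'a::euclidean_space"
  assumes c: "c > 0"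
  shows gauss_fourier_integrable: "L1 (\<lambda>x::'a. exp (cr (- c * (norm x)^2)) * iexp (w \<bullet> x))"
    and gauss_fourier: "(LINT x|lborel. exp (cr (- c * (norm (x::'a))^2)) * iexp (w \<bullet> x))
         = cr ((pi / c) powr (DIM('a) / 2) * exp (- (norm w)\<^sup>2 / (4 * c)))"
proof -
  have eq: "exp (cr (- c * (norm x)^2)) * iexp (w \<bullet> x)
    = (\<Prod>b\<in>Basis. exp (cr (- c * (x \<bullet> b)^2)) * iexp ((w \<bullet> b) * (x \<bullet> b)))" for x :: 'a unfolding norm_power2_eq_sum_Basis prod.distrib
    by (subst euclidean_inner) (simp add: exp_sum[symmetric] sum_distrib_left sum_negf)
  show "L1 (\<lambda>x::'a. exp (cr (- c * (norm x)^2)) * iexp (w \<bullet> x))" unfolding eq by (intro integrable_lborel_prod gauss_fourier_real c)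
  have "(LINT x|lborel. exp (cr (- c * (norm (x::'a))^2)) * iexp (w \<bullet> x))
    = (\<Prod>b\<in>(Basis::'a set). cr (sqrt (pi / c) * exp (- (w \<bullet> b)\<^sup>2 / (4 * c))))"
    unfolding eq by (subst integral_lborel_prod) (rule gauss_fourier_real c | simp only: gauss_fourier_real(2)[OF c])+
  also have "\<dots> = cr (sqrt (pi / c) ^ DIM('a) * exp (- (norm w)\<^sup>2 / (4 * c)))" unfolding norm_power2_eq_sum_Basis
    by (simp add: prod.distrib exp_sum[symmetric] sum_divide_distrib sum_negf flip: of_real_prod)
  also have "sqrt (pi / c) ^ DIM('a) = (pi / c) powr (DIM('a) / 2)" using c by (simp add: powr_half_sqrt[symmetric] powr_realpow[symmetric] powr_powr)
  finally show "(LINT x|lborel. exp (cr (- c * (norm (x::'a))^2)) * iexp (w \<bullet> x))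
         = cr ((pi / c) powr (DIM('a) / 2) * exp (- (norm w)\<^sup>2 / (4 * c)))" .
qed

lemma gauss_integrable:
  assumes c: "c > 0"
  shows "L1 (\<lambda>x::'a::euclidean_space. gs c x)" using integrable_norm[OF gauss_fourier_integrable[OF c, of "0::'a"]] by simp

lemma gauss_integral:
  assumes c: "c > 0"
  shows "(LINT x|lborel. gs c (x::'a::euclidean_space)) = (pi / c) powr (DIM('a) / 2)"
proof -
  have "cr (LINT x|lborel. gs c (x::'a)) = (LINT x|lborel. cr (gs c (x::'a)))" by simp
  also have "\<dots> = cr ((pi / c) powr (DIM('a) / 2))" using gauss_fourier[OF c, of "0::'a"] by (simp add: exp_of_real[symmetric] del: of_real_mult)
  finally show ?thesis using of_real_eq_iff by blast
qed

lemma power_times_gauss_bound: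
  fixes c :: real assumes c: "c > 0"
  shows "\<exists>C>0. \<forall>r\<ge>0. (1 + r) ^ n * exp (- c * r^2) \<le> C"
proof -
  have "((\<lambda>r::real. (1 + r) ^ n * exp (- c * r^2)) \<longlongrightarrow> 0) at_top" using c by real_asymp
  then have "eventually (\<lambda>r::real. (1 + r) ^ n * exp (- c * r^2) < 1) at_top" by (rule order_tendstoD) simp
  then obtain R where R: "\<And>r. r \<ge> R \<Longrightarrow> (1 + r) ^ n * exp (- c * r^2) < 1" by (auto simp: eventually_at_top_linorder)
  have "compact ((\<lambda>r::real. (1 + r) ^ n * exp (- c * r^2)) ` {0..R})" by (intro compact_continuous_image continuous_intros) auto
  from compact_imp_bounded[OF this] obtain B where "\<forall>x\<in>(\<lambda>r::real. (1 + r) ^ n * exp (- c * r^2)) ` {0..R}. norm x \<le> B" unfolding bounded_iff by blast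
  then have B: "norm ((1 + r) ^ n * exp (- c * r^2)) \<le> B" if "r \<in> {0..R}" for r using that by blast
  have "(1 + r) ^ n * exp (- c * r^2) \<le> max B 1" if "r \<ge> 0" for r using R[of r] B[of r] that by (cases "r \<ge> R") (auto simp: max_def split: if_splits)
  then show ?thesis by (intro exI[of _ "max B 1"]) auto
qed

text \<open>Half of the Gaussian absorbs the polynomial and the other half survives as decay. This
  loss of a factor 2 in the rate is what makes Gaussian bounds stable under multiplication by
  symbols of polynomial growth.\<close>

lemma gauss_moment_bound:
  fixes c :: real assumes c: "c > 0"
  shows "\<exists>C>0. \<forall>r\<ge>0. (1 + r) ^ n * exp (- c * r^2) \<le> C * exp (- (c/2) * r^2)"
proof -
  from c have "c/2 > 0" by simp
  from power_times_gauss_bound[OF this, of n] obtain C where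
    C: "C > 0" "\<And>r. r \<ge> 0 \<Longrightarrow> (1 + r) ^ n * exp (- (c/2) * r^2) \<le> C" by auto
  have "(1 + r) ^ n * exp (- c * r^2) \<le> C * exp (- (c/2) * r^2)" if "r \<ge> 0" for r
  proof -
    have "exp (- c * r^2) = exp (- (c/2) * r^2) * exp (- (c/2) * r^2)" by (simp flip: exp_add)
    then show ?thesis using mult_right_mono[OF C(2)[OF that], of "exp (- (c/2) * r^2)"] by (simp add: mult_ac)
  qed
  with C(1) show ?thesis by blast
qed

lemma gauss_moment_integrable:
  assumes c: "c > 0"
  shows "L1 (\<lambda>x::'a::euclidean_space. (1 + norm x) ^ n * gs c x)"
proof -
  obtain C where C: "C > 0" "\<And>r. r \<ge> 0 \<Longrightarrow> (1 + r) ^ n * exp (- c * r^2) \<le> C * exp (- (c/2) * r^2)" using gauss_moment_bound[OF c] by blast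
  have "L1 (\<lambda>x::'a. C * gs (c/2) x)" using gauss_integrable[of "c/2"] c by (intro integrable_mult_right) simp
  then show ?thesis by (rule Bochner_Integration.integrable_bound) (use C in \<open>auto simp: abs_mult\<close>)
qed

section \<open>Square-integrable and Gaussian-bounded functions\<close>

lemma borel_measurable_cnj [measurable]: "f \<in> borel_measurable M \<Longrightarrow> (\<lambda>x. cnj (f x)) \<in> borel_measurable M"
  by (rule measurable_compose[of f M borel]) (auto intro!: borel_measurable_continuous_onI continuous_intros)

lemma integrable_real_bound:
  fixes f :: "'a \<Rightarrow> 'b::{banach, second_countable_topology}"
  assumes "integrable M g" "f \<in> borel_measurable M" "\<And>x. norm (f x) \<le> g x"
  shows "integrable M f"
proof (rule Bochner_Integration.integrable_bound[OF assms(1,2)])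
  have "norm (f x) \<le> norm (g x)" for x using assms(3)[of x] by (simp add: order_trans[OF _ abs_ge_self])
  then show "AE x in M. norm (f x) \<le> norm (g x)" by simp
qed

lemma square_integrable_add:
  assumes "L2 f" "L2 g"
  shows "L2 (\<lambda>x. f x + g x)"
proof -
  note [measurable] = assms[unfolded square_integrable_def, THEN conjunct1]
  have I: "L1 (\<lambda>x. 2 * (cmod (f x))^2 + 2 * (cmod (g x))^2)" using assms unfolding square_integrable_def by auto
  have "(cmod (f x + g x))^2 \<le> 2 * (cmod (f x))^2 + 2 * (cmod (g x))^2" for x
  proof -
    have "(cmod (f x + g x))^2 \<le> (cmod (f x) + cmod (g x))^2" by (intro power_mono norm_triangle_ineq) auto
    also have "\<dots> \<le> 2 * (cmod (f x))^2 + 2 * (cmod (g x))^2" using sum_squares_bound[of "cmod (f x)" "cmod (g x)"] by (simp add: power2_sum)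
    finally show ?thesis .
  qed
  then have "norm ((cmod (f x + g x))^2) \<le> 2 * (cmod (f x))^2 + 2 * (cmod (g x))^2" for x by simp
  then have "L1 (\<lambda>x. (cmod (f x + g x))^2)" by (rule integrable_real_bound[OF I, rotated]) measurable
  then show ?thesis unfolding square_integrable_def by simp
qed

lemma square_integrable_mult_bounded:
  assumes f: "L2 f" and [measurable]: "g \<in> Borel"
    and B: "\<And>x. cmod (g x) \<le> B"
  shows "L2 (\<lambda>x. g x * f x)"
proof -
  note [measurable] = f[unfolded square_integrable_def, THEN conjunct1]
  have "0 \<le> B" using B[of undefined] norm_ge_zero order_trans by blast
  have I: "L1 (\<lambda>x. B^2 * (cmod (f x))^2)" using f unfolding square_integrable_def by auto
  have "(cmod (g x * f x))^2 \<le> B^2 * (cmod (f x))^2" for x unfolding norm_mult power_mult_distrib using B[of x] by (intro mult_right_mono power_mono) auto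
  then have "norm ((cmod (g x * f x))^2) \<le> B^2 * (cmod (f x))^2" for x by simp
  then have "L1 (\<lambda>x. (cmod (g x * f x))^2)" by (rule integrable_real_bound[OF I, rotated]) measurable
  then show ?thesis unfolding square_integrable_def by simp
qed

lemma square_integrable_cmult: "L2 f \<Longrightarrow> L2 (\<lambda>x. c * f x)" using square_integrable_mult_bounded[of f "\<lambda>_. c" "cmod c"] by simp

lemma square_integrable_diff:
  "L2 f \<Longrightarrow> L2 g \<Longrightarrow> L2 (\<lambda>x. f x - g x)" using square_integrable_add[of f "\<lambda>x. - 1 * g x"] square_integrable_cmult[of g "-1"] by simp

lemma l2norm_nonneg [simp]: "0 \<le> l2norm f" by (simp add: l2norm_def)

lemma l2norm_power2: "(l2norm f)^2 = (LINT x|lborel. (cmod (f x))^2)" by (simp add: l2norm_def)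

lemma l2norm_cmult: "l2norm (\<lambda>x. c * f x) = cmod c * l2norm f" by (simp add: l2norm_def norm_mult power_mult_distrib real_sqrt_mult)

lemma l2norm_cong: "(\<And>x. cmod (f x) = cmod (g x)) \<Longrightarrow> l2norm f = l2norm g" by (simp add: l2norm_def)

lemma l2norm_mono:
  assumes "L2 g" "f \<in> Borel" "\<And>x. cmod (f x) \<le> cmod (g x)"
  shows "L2 f" "l2norm f \<le> l2norm g"
proof -
  have g: "L1 (\<lambda>x. (cmod (g x))^2)" using assms(1) unfolding square_integrable_def by auto
  have f: "L1 (\<lambda>x. (cmod (f x))^2)" using g by (rule Bochner_Integration.integrable_bound) (use assms in \<open>auto intro!: power_mono\<close>)
  show "L2 f" using f assms(2) unfolding square_integrable_def by simp
  show "l2norm f \<le> l2norm g" unfolding l2norm_def using f g assms by (intro real_sqrt_le_mono integral_mono power_mono) auto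
qed

lemma integrable_norm_mult:
  assumes "L2 f" "L2 g"
  shows "L1 (\<lambda>x. cmod (f x) * cmod (g x))"
proof -
  note [measurable] = assms[unfolded square_integrable_def, THEN conjunct1]
  have "L1 (\<lambda>x. (cmod (f x))^2 + (cmod (g x))^2)" using assms unfolding square_integrable_def by auto
  then show ?thesis
  proof (rule integrable_real_bound)
    fix x
    have "0 \<le> cmod (f x) * cmod (g x)" by simp
    then show "norm (cmod (f x) * cmod (g x)) \<le> (cmod (f x))^2 + (cmod (g x))^2" using sum_squares_bound[of "cmod (f x)" "cmod (g x)"] unfolding real_norm_def by linarith
  qed measurable
qed

lemma cauchy_schwarz_norm:
  assumes f: "L2 f" and g: "L2 g"
  shows "(LINT x|lborel. cmod (f x) * cmod (g x)) \<le> l2norm f * l2norm g"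
proof -
  note [measurable] = assms[unfolded square_integrable_def, THEN conjunct1]
  have I: "L1 (\<lambda>x. (cmod (f x))^2)" "L1 (\<lambda>x. (cmod (g x))^2)" using assms unfolding square_integrable_def by auto
  note J = integrable_norm_mult[OF assms]
  \<comment> \<open>With the two norms as crossed weights, the square below integrates to the
    desired inequality multiplied by \<open>r * s\<close>. If this factor vanishes, one of the
    functions is zero almost everywhere, which is treated separately.\<close>
  define r where "r = l2norm f" define s where "s = l2norm g"
  have r: "r \<ge> 0" "s \<ge> 0" by (simp_all add: r_def s_def)
  have "0 \<le> (LINT x|lborel. (s * cmod (f x) - r * cmod (g x))^2)" by simp
  also have "\<dots> = (LINT x|lborel. s^2 * (cmod (f x))^2 + r^2 * (cmod (g x))^2 - 2 * r * s * (cmod (f x) * cmod (g x)))" by (simp add: power2_diff power_mult_distrib mult_ac)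
  also have "\<dots> = s^2 * r^2 + r^2 * s^2 - 2 * r * s * (LINT x|lborel. cmod (f x) * cmod (g x))" using I J by (simp add: r_def s_def l2norm_power2)
  finally have le: "(r * s) * (LINT x|lborel. cmod (f x) * cmod (g x)) \<le> (r * s) * (r * s)" by (simp add: power2_eq_square mult_ac)
  show ?thesis
  proof (cases "r * s = 0")
    case False
    then have "r * s > 0" using r by (simp add: less_le)
    with le have "(LINT x|lborel. cmod (f x) * cmod (g x)) \<le> r * s" by (rule mult_left_le_imp_le)
    then show ?thesis by (simp add: r_def s_def)
  next
    case True
    have "AE x in lborel. cmod (f x) * cmod (g x) = 0"
    proof (cases "r = 0")
      case True
      then have "(LINT x|lborel. (cmod (f x))^2) = 0" by (simp add: r_def l2norm_def)
      then have "AE x in lborel. (cmod (f x))^2 = 0" using I by (subst (asm) integral_nonneg_eq_0_iff_AE) auto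
      then show ?thesis by eventually_elim auto
    next
      case False
      with \<open>r * s = 0\<close> have "s = 0" by simp
      then have "(LINT x|lborel. (cmod (g x))^2) = 0" by (simp add: s_def l2norm_def)
      then have "AE x in lborel. (cmod (g x))^2 = 0" using I by (subst (asm) integral_nonneg_eq_0_iff_AE) auto
      then show ?thesis by eventually_elim auto
    qed
    then have "(LINT x|lborel. cmod (f x) * cmod (g x)) = 0" by (simp cong: integral_cong_AE add: integral_eq_zero_AE)
    then show ?thesis by simp
  qed
qed

lemma integrable_cnj_mult:
  assumes "L2 f" "L2 g"
  shows "L1 (\<lambda>x. cnj (f x) * g x)"
proof -
  note [measurable] = assms[unfolded square_integrable_def, THEN conjunct1]
  show ?thesis by (rule Bochner_Integration.integrable_bound[OF integrable_norm_mult[OF assms]]) (auto simp: norm_mult)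
qed

lemma l2inner_bound:
  assumes "L2 f" "L2 g"
  shows "cmod (l2inner f g) \<le> l2norm f * l2norm g"
proof -
  have "cmod (l2inner f g) \<le> (LINT x|lborel. cmod (cnj (f x) * g x))" unfolding l2inner_def by (rule integral_norm_bound)
  also have "\<dots> = (LINT x|lborel. cmod (f x) * cmod (g x))" by (simp add: norm_mult)
  also have "\<dots> \<le> l2norm f * l2norm g" by (rule cauchy_schwarz_norm[OF assms])
  finally show ?thesis .
qed

lemma l2inner_diff_right:
  "L2 f \<Longrightarrow> L2 g \<Longrightarrow> L2 h \<Longrightarrow>
   l2inner f (\<lambda>x. g x - h x) = l2inner f g - l2inner f h" unfolding l2inner_def by (simp add: ring_distribs integrable_cnj_mult)

lemma l2inner_add_right:
  "L2 f \<Longrightarrow> L2 g \<Longrightarrow> L2 h \<Longrightarrow>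
   l2inner f (\<lambda>x. g x + h x) = l2inner f g + l2inner f h" unfolding l2inner_def by (simp add: ring_distribs integrable_cnj_mult)

lemma l2inner_diff_left:
  "L2 f \<Longrightarrow> L2 g \<Longrightarrow> L2 h \<Longrightarrow>
   l2inner (\<lambda>x. g x - h x) f = l2inner g f - l2inner h f" unfolding l2inner_def by (simp add: ring_distribs integrable_cnj_mult)

lemma l2inner_add_left:
  "L2 f \<Longrightarrow> L2 g \<Longrightarrow> L2 h \<Longrightarrow>
   l2inner (\<lambda>x. g x + h x) f = l2inner g f + l2inner h f" unfolding l2inner_def by (simp add: ring_distribs integrable_cnj_mult)

lemma l2inner_cmult_left: "l2inner (\<lambda>x. c * g x) f = cnj c * l2inner g f" unfolding l2inner_def by (simp add: mult.assoc)

lemma l2inner_cmult_right: "l2inner f (\<lambda>x. c * g x) = c * l2inner f g"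
proof -
  have "cnj (f x) * (c * g x) = c * (cnj (f x) * g x)" for x by (simp add: mult_ac)
  then show ?thesis unfolding l2inner_def by (simp only: integral_mult_right_zero)
qed

lemma l2inner_commute: "l2inner f g = cnj (l2inner g f)" using lint_cnj[of lborel "\<lambda>x. cnj (g x) * f x"]
  unfolding l2inner_def by (simp only: complex_cnj_mult complex_cnj_cnj mult.commute)

lemma l2inner_self: "l2inner f f = cr ((l2norm f)^2)"
proof -
  have "cnj (f x) * f x = cr ((cmod (f x))^2)" for x using complex_norm_square[of "f x"] by (simp add: mult.commute)
  then show ?thesis unfolding l2inner_def l2norm_power2 by (simp flip: integral_complex_of_real)
qed

lemma l2norm_triangle:
  assumes f: "L2 f" and g: "L2 g"
  shows "l2norm (\<lambda>x. f x + g x) \<le> l2norm f + l2norm g"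
proof (rule power2_le_imp_le)
  have "cr ((l2norm (\<lambda>x. f x + g x))^2) = l2inner f f + l2inner g f + (l2inner f g + l2inner g g)"
    unfolding l2inner_self[symmetric] by (simp add: l2inner_add_left l2inner_add_right f g square_integrable_add)
  then have "(l2norm (\<lambda>x. f x + g x))^2 = Re (l2inner f f + l2inner g f + (l2inner f g + l2inner g g))" by (metis Re_complex_of_real)
  also have "\<dots> = (l2norm f)^2 + Re (l2inner g f) + (Re (l2inner f g) + (l2norm g)^2)" by (simp add: l2inner_self)
  also have "\<dots> \<le> (l2norm f + l2norm g)^2" using l2inner_bound[OF f g] l2inner_bound[OF g f] complex_Re_le_cmod[of "l2inner f g"] complex_Re_le_cmod[of "l2inner g f"]
    by (simp add: power2_sum algebra_simps)
  finally show "(l2norm (\<lambda>x. f x + g x))^2 \<le> (l2norm f + l2norm g)^2" .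
qed simp

text \<open>The working class of momentum symbols. It contains all truncations of Borel functions,
  hence enough to be dense in L2, and it is stable under translation and under multiplication by
  functions of polynomial growth. No smoothness is built in, because the kinetic symbol may fail to
  be smooth at the origin.\<close>

definition gauss_bounded :: "('a::euclidean_space \<Rightarrow> complex) \<Rightarrow> bool" where
  "gauss_bounded h \<longleftrightarrow> h \<in> Borel \<and>
     (\<exists>C c. C > 0 \<and> c > 0 \<and> (\<forall>x. cmod (h x) \<le> C * gs c x))"

lemma gauss_boundedE:
  assumes "gauss_bounded h"
  obtains C c where "C > 0" "c > 0" "\<And>x. cmod (h x) \<le> C * gs c x" using assms unfolding gauss_bounded_def by blast

lemma gauss_boundedI:
  assumes "h \<in> Borel" "c > 0" "\<And>x. cmod (h x) \<le> C * gs c x"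
  shows "gauss_bounded h"
proof -
  have "cmod (h x) \<le> max C 1 * gs c x" for x using assms(3)[of x] by (rule order_trans) (intro mult_right_mono, auto)
  with assms show ?thesis unfolding gauss_bounded_def by (intro conjI exI[of _ "max C 1"] exI[of _ c]) auto
qed

lemma gauss_bounded_measurable [measurable_dest]: "gauss_bounded h \<Longrightarrow> h \<in> Borel" by (simp add: gauss_bounded_def)

lemma gauss_bounded_mult_growth:
  fixes h g :: "'a::euclidean_space \<Rightarrow> complex"
  assumes h: "gauss_bounded h" and g: "g \<in> Borel"
    and B: "\<And>x. cmod (g x) \<le> K * (1 + norm x) ^ n"
  shows "gauss_bounded (\<lambda>x. g x * h x)"
proof -
  from h obtain C c where C: "C > 0" "c > 0" "\<And>x. cmod (h x) \<le> C * gs c x" by (rule gauss_boundedE) blast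
  from gauss_moment_bound[OF C(2), of n] obtain D where
    D: "D > 0" "\<And>r. r \<ge> 0 \<Longrightarrow> (1 + r) ^ n * exp (- c * r^2) \<le> D * exp (- (c/2) * r^2)" by blast
  have K: "K \<ge> 0" using B[of 0] norm_ge_zero[of "g 0"] by (simp del: norm_ge_zero)
  show ?thesis
  proof (rule gauss_boundedI)
    show "(\<lambda>x. g x * h x) \<in> Borel" using h g by measurable
    show "c / 2 > 0" using C by simp
    fix x
    have "cmod (g x * h x) \<le> (K * (1 + norm x) ^ n) * (C * gs c x)" unfolding norm_mult using B[of x] C(3)[of x] K by (intro mult_mono) auto
    also have "\<dots> = (K * C) * ((1 + norm x) ^ n * gs c x)" by simp
    also have "\<dots> \<le> (K * C) * (D * gs (c/2) x)" using D(2)[of "norm x"] K C by (intro mult_left_mono) auto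
    finally show "cmod (g x * h x) \<le> (K * C * D) * gs (c/2) x" by (simp add: mult_ac)
  qed
qed

lemma gauss_bounded_mult_bounded:
  fixes h g :: "'a::euclidean_space \<Rightarrow> complex"
  assumes "gauss_bounded h" "g \<in> Borel" "\<And>x. cmod (g x) \<le> K"
  shows "gauss_bounded (\<lambda>x. g x * h x)" using gauss_bounded_mult_growth[of h g K 0] assms by simp

lemma gauss_shift_bound:
  fixes x a :: "'a::real_normed_vector"
  assumes c: "c > 0" and a: "norm a \<le> r"
  shows "gs c (x + a) \<le> exp (c * r^2) * gs (c/2) x"
proof -
  have "norm x \<le> norm (x + a) + r" using norm_triangle_ineq4[of "x + a" a] a by simp
  then have "(norm x)^2 \<le> (norm (x + a) + r)^2" by (intro power_mono) auto
  also have "\<dots> \<le> 2 * (norm (x + a))^2 + 2 * r^2" using sum_squares_bound[of "norm (x + a)" r] by (simp add: power2_sum)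
  finally have "- c * (norm (x + a))^2 \<le> c * r^2 + (- (c/2) * (norm x)^2)" using mult_left_mono[of "(norm x)^2" "2 * (norm (x + a))^2 + 2 * r^2" "c/2"] c by (simp add: algebra_simps)
  then show ?thesis by (simp flip: exp_add)
qed

lemma gauss_bounded_shift:
  fixes h :: "'a::euclidean_space \<Rightarrow> complex"
  assumes h: "gauss_bounded h"
  shows "gauss_bounded (\<lambda>x. h (x + a))"
proof -
  from h obtain C c where C: "C > 0" "c > 0" "\<And>x. cmod (h x) \<le> C * gs c x" by (rule gauss_boundedE) blast
  show ?thesis
  proof (rule gauss_boundedI)
    show "(\<lambda>x. h (x + a)) \<in> Borel" using gauss_bounded_measurable[OF h] by measurable
    show "c / 2 > 0" using C by simp
    fix x
    have "gs c (x + a) \<le> exp (c * (norm a)^2) * gs (c/2) x" by (rule gauss_shift_bound[OF C(2) order_refl])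
    then show "cmod (h (x + a)) \<le> (C * exp (c * (norm a)^2)) * gs (c/2) x" using order_trans[OF C(3)[of "x + a"] mult_left_mono[of "gs c (x + a)" _ C]] C(1) by (simp add: mult.assoc)
  qed
qed

lemma gauss_bounded_bounded: "gauss_bounded h \<Longrightarrow> \<exists>B>0. \<forall>x. cmod (h x) \<le> B"
proof (erule gauss_boundedE)
  fix C c :: real assume C: "0 < C" "0 < c" "\<And>x. cmod (h x) \<le> C * gs c x"
  have "cmod (h x) \<le> C" for x using C(3)[of x] by (rule order_trans) (use C in \<open>simp add: mult_le_cancel_left1\<close>)
  then show ?thesis using C(1) by blast
qed

lemma gauss_bounded_integrable: "gauss_bounded h \<Longrightarrow> L1 h"
proof (frule gauss_bounded_measurable, erule gauss_boundedE)
  fix C c :: real assume C: "0 < C" "0 < c" "\<And>x. cmod (h x) \<le> C * gs c x" "h \<in> Borel"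
  have "L1 (\<lambda>x. C * gs c x)" using gauss_integrable[OF C(2)] by (intro integrable_mult_right) simp
  then show ?thesis by (rule Bochner_Integration.integrable_bound) (use C in auto)
qed

lemma gauss_bounded_square_integrable: "gauss_bounded h \<Longrightarrow> L2 h"
proof -
  assume h: "gauss_bounded h"
  then obtain B where B: "B > 0" "\<And>x. cmod (h x) \<le> B" using gauss_bounded_bounded by blast
  note [measurable] = gauss_bounded_measurable[OF h]
  have "L1 (\<lambda>x. B * cmod (h x))" using gauss_bounded_integrable[OF h] by simp
  then have "L1 (\<lambda>x. (cmod (h x))^2)" by (rule Bochner_Integration.integrable_bound) (use B in \<open>auto simp: power2_eq_square intro!: mult_right_mono AE_I2\<close>)
  then show ?thesis unfolding square_integrable_def by simp
qed

lemma integrable_mult_bounded_left: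
  fixes f m :: "_ \<Rightarrow> complex"
  assumes "integrable M f" "m \<in> borel_measurable M" "\<And>x. cmod (m x) \<le> B"
  shows "integrable M (\<lambda>x. f x * m x)"
proof -
  have "integrable M (\<lambda>x. B * cmod (f x))" using assms(1) by simp
  then show ?thesis
  proof (rule integrable_real_bound)
    show "(\<lambda>x. f x * m x) \<in> borel_measurable M" using assms by measurable
    show "norm (f x * m x) \<le> B * cmod (f x)" for x using mult_right_mono[OF assms(3)[of x], of "cmod (f x)"] by (simp add: norm_mult mult.commute)
  qed
qed

lemma integrable_pair_mult:
  fixes f :: "'a::euclidean_space \<Rightarrow> complex" and g :: "'b::euclidean_space \<Rightarrow> complex"
  assumes f: "L1 f" and g: "L1 g"
  shows "integrable lborel2 (\<lambda>(x, y). f x * g y)"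
proof (rule lborel_pair.Fubini_integrable)
  have [measurable]: "f \<in> Borel" "g \<in> Borel" using f g by auto
  show "(\<lambda>(x, y). f x * g y) \<in> borel_measurable lborel2" by measurable
  show "L1 (\<lambda>x. LINT y|lborel. norm (case (x, y) of (x, y) \<Rightarrow> f x * g y))" using f by (simp add: norm_mult)
  show "AE x in lborel. L1 (\<lambda>y. case (x, y) of (x, y) \<Rightarrow> f x * g y)" using g by simp
qed

lemma integrable_pair_kernel:
  fixes f :: "'a::euclidean_space \<Rightarrow> complex" and g :: "'b::euclidean_space \<Rightarrow> complex"
  assumes f: "L1 f" and g: "L1 g"
    and m: "(\<lambda>(x, y). m x y) \<in> borel_measurable lborel2" and B: "\<And>x y. cmod (m x y) \<le> B"
  shows "integrable lborel2 (\<lambda>(x, y). f x * g y * m x y)" using integrable_mult_bounded_left[OF integrable_pair_mult[OF f g] m, of B] B by (auto simp: split_beta')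

text \<open>The kernel is bounded rather than integrable, as for the oscillating factor of the
  Fourier transform; absolute convergence comes from the two integrable factors.\<close>

lemma fubini_kernel:
  fixes f :: "'a::euclidean_space \<Rightarrow> complex" and g :: "'b::euclidean_space \<Rightarrow> complex"
  assumes f: "L1 f" and g: "L1 g"
    and m: "(\<lambda>(x, y). m x y) \<in> borel_measurable lborel2" and B: "\<And>x y. cmod (m x y) \<le> B"
  shows "(LINT x|lborel. f x * (LINT y|lborel. g y * m x y)) = (LINT y|lborel. g y * (LINT x|lborel. f x * m x y))"
proof -
  have "(LINT x|lborel. f x * (LINT y|lborel. g y * m x y)) = (LINT x|lborel. LINT y|lborel. f x * g y * m x y)" by (simp add: mult.assoc)
  also have "\<dots> = (LINT y|lborel. LINT x|lborel. f x * g y * m x y)" by (rule lborel_pair.Fubini_integral[symmetric]) (rule integrable_pair_kernel[OF assms])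
  also have "\<dots> = (LINT y|lborel. g y * (LINT x|lborel. f x * m x y))" by (simp only: mult.assoc mult.left_commute[of "f _" "g _"] integral_mult_right_zero)
  finally show ?thesis .
qed

section \<open>The semiclassical Fourier transform\<close>

text \<open>A function that is not integrable has integral 0 by convention, and the majorant is
  nonnegative, so domination alone gives the bound.\<close>

lemma lebesgue_integral_norm_le:
  fixes f :: "'a \<Rightarrow> 'b::{banach, second_countable_topology}"
  assumes "integrable M g" "\<And>x. norm (f x) \<le> g x"
  shows "norm (integral\<^sup>L M f) \<le> integral\<^sup>L M g"
proof (cases "integrable M f")
  case True
  have "norm (integral\<^sup>L M f) \<le> (LINT x|M. norm (f x))" by (rule integral_norm_bound)
  also have "\<dots> \<le> integral\<^sup>L M g" using True assms by (intro integral_mono) auto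
  finally show ?thesis .
next
  case False
  have "0 \<le> g x" for x using assms(2)[of x] norm_ge_zero order_trans by blast
  then show ?thesis using False by (simp add: not_integrable_integral_eq)
qed

lemma gauss_fourier_of_real:
  fixes w :: "'a::euclidean_space"
  assumes c: "c > 0"
  shows "(LINT x|lborel. cr (gs c (x::'a)) * iexp (w \<bullet> x))
         = cr ((pi / c) powr (DIM('a) / 2) * exp (- (norm w)\<^sup>2 / (4 * c)))" using gauss_fourier[OF c, of w] by (simp only: exp_of_real)

lemma fourier_measurable [measurable]:
  fixes f :: "real ^ 'd \<Rightarrow> complex"
  assumes [measurable]: "f \<in> Borel"
  shows "fourier \<epsilon> f \<in> Borel" unfolding fourier_def by measurable

lemma inv_fourier_measurable [measurable]:
  fixes f :: "real ^ 'd \<Rightarrow> complex"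
  assumes [measurable]: "f \<in> Borel"
  shows "invF \<epsilon> f \<in> Borel" unfolding inv_fourier_def by measurable

lemma cmod_exp_ii_real [simp]: "cmod (iexp r) = 1" by (simp add: norm_exp_i_times)

lemma cmod_exp_minus_ii_real [simp]: "cmod (exp (- (\<i> * cr r))) = 1" by simp

lemma fourier_bound:
  "cmod (fourier \<epsilon> f \<xi>) \<le> (2 * pi * \<epsilon>) powr (- (CARD('d) / 2)) * (LINT x|lborel. cmod (f x))"
  for f :: "real ^ 'd \<Rightarrow> complex"
proof -
  have "cmod (LINT x|lborel. f x * miexp (x \<bullet> \<xi> / \<epsilon>)) \<le> (LINT x|lborel. cmod (f x * miexp (x \<bullet> \<xi> / \<epsilon>)))" by (rule integral_norm_bound)
  then show ?thesis by (simp add: fourier_def norm_mult mult_left_mono)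
qed

lemma inv_fourier_bound:
  "cmod (invF \<epsilon> f \<xi>) \<le> (2 * pi * \<epsilon>) powr (- (CARD('d) / 2)) * (LINT x|lborel. cmod (f x))"
  for f :: "real ^ 'd \<Rightarrow> complex"
proof -
  have "cmod (LINT x|lborel. f x * iexp (\<xi> \<bullet> x / \<epsilon>)) \<le> (LINT x|lborel. cmod (f x * iexp (\<xi> \<bullet> x / \<epsilon>)))" by (rule integral_norm_bound)
  then show ?thesis by (simp add: inv_fourier_def norm_mult mult_left_mono)
qed

text \<open>Parseval's relation between integrable functions is Fubini's theorem: the unimodular
  kernel can be attached to either factor. It is the rule by which transforms are moved from one
  side of a pairing to the other.\<close>

lemma l2inner_inv_fourier:
  fixes k f :: "real ^ 'd \<Rightarrow> complex"
  assumes k: "L1 k" and f: "L1 f"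
  shows "l2inner (invF \<epsilon> k) f = l2inner k (fourier \<epsilon> f)"
proof -
  let ?c = "cr ((2 * pi * \<epsilon>) powr (- (CARD('d) / 2)))"
  have e: "cnj (iexp r) = miexp r" for r by (simp add: exp_cnj)
  have "l2inner (invF \<epsilon> k) f = (LINT x|lborel. ?c * (f x * (LINT \<xi>|lborel. cnj (k \<xi>) * miexp (x \<bullet> \<xi> / \<epsilon>))))"
    unfolding l2inner_def inv_fourier_def complex_cnj_mult complex_cnj_complex_of_real lint_cnj[symmetric] e by (simp only: mult_ac)
  also have "\<dots> = ?c * (LINT x|lborel. f x * (LINT \<xi>|lborel. cnj (k \<xi>) * miexp (x \<bullet> \<xi> / \<epsilon>)))" by (rule integral_mult_right_zero)
  also have "(LINT x|lborel. f x * (LINT \<xi>|lborel. cnj (k \<xi>) * miexp (x \<bullet> \<xi> / \<epsilon>)))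
    = (LINT \<xi>|lborel. cnj (k \<xi>) * (LINT x|lborel. f x * miexp (x \<bullet> \<xi> / \<epsilon>)))" by (rule fubini_kernel[where B=1]) (use k f in simp_all)
  also have "?c * \<dots> = (LINT \<xi>|lborel. ?c * (cnj (k \<xi>) * (LINT x|lborel. f x * miexp (x \<bullet> \<xi> / \<epsilon>))))" by (rule integral_mult_right_zero[symmetric])
  also have "\<dots> = l2inner k (fourier \<epsilon> f)" unfolding l2inner_def fourier_def by (simp only: mult_ac)
  finally show ?thesis .
qed

section \<open>Gaussian mollification in momentum and Gaussian damping in position\<close>

definition gauss_mollify :: "real \<Rightarrow> (real ^ 'd \<Rightarrow> complex) \<Rightarrow> real ^ 'd \<Rightarrow> complex" where
  "gauss_mollify \<nu> y \<xi> = cr (pi powr (- (CARD('d) / 2))) *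
     (LINT u|lborel. cr (exp (- (norm u)\<^sup>2)) * y (\<xi> - \<nu> *\<^sub>R u))"

lemma gauss_complex_integrable: "c > 0 \<Longrightarrow> L1 (\<lambda>u::'a::euclidean_space. cr (gs c u))" by (intro integrable_of_real gauss_integrable)

lemma gauss_complex_integrable1: "L1 (\<lambda>u::'a::euclidean_space. cr (exp (- (norm u)\<^sup>2)))" using gauss_complex_integrable[of 1] by simp

text \<open>A Gaussian factor in position is a Gaussian convolution in momentum. The rate
  \<open>(\<nu> / (2 * \<epsilon>))^2\<close> is the one whose transform, in the scaling by
  \<open>\<epsilon>\<close>, has width exactly \<open>\<nu>\<close>. Damping makes the Fourier
  integral of an inverse transform absolutely convergent, so this is a form of Fourier inversion
  within the reach of Fubini.\<close>

lemma fourier_damped: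
  fixes y :: "real ^ 'd \<Rightarrow> complex"
  assumes y: "gauss_bounded y" and e: "\<epsilon> > 0" and l: "\<nu> > 0"
  shows "fourier \<epsilon> (\<lambda>x. cr (gs ((\<nu> / (2 * \<epsilon>))^2) x) * invF \<epsilon> y x) \<xi> = gauss_mollify \<nu> y \<xi>"
proof -
  let ?c = "(2 * pi * \<epsilon>) powr (- (CARD('d) / 2))"
  define \<kappa> where "\<kappa> = (\<nu> / (2 * \<epsilon>))^2"
  have k: "\<kappa> > 0" using e l by (simp add: \<kappa>_def)
  note [measurable] = gauss_bounded_measurable[OF y]
  have "fourier \<epsilon> (\<lambda>x. cr (gs \<kappa> x) * invF \<epsilon> y x) \<xi>
     = cr ?c * (LINT x|lborel. cr ?c * (cr (gs \<kappa> x) *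
        (LINT \<zeta>|lborel. y \<zeta> * iexp (((\<zeta> - \<xi>) /\<^sub>R \<epsilon>) \<bullet> x))))"
  proof -
    have *: "iexp (((\<zeta> - \<xi>) /\<^sub>R \<epsilon>) \<bullet> x) = iexp (x \<bullet> \<zeta> / \<epsilon>) * miexp (x \<bullet> \<xi> / \<epsilon>)" for \<zeta> x
    proof -
      have "((\<zeta> - \<xi>) /\<^sub>R \<epsilon>) \<bullet> x = x \<bullet> \<zeta> / \<epsilon> - x \<bullet> \<xi> / \<epsilon>"
        by (simp add: inner_diff_left inner_commute divide_inverse algebra_simps)
      then show ?thesis by (simp add: right_diff_distrib flip: exp_add)
    qed
    show ?thesis unfolding fourier_def inv_fourier_def * by (simp add: mult.assoc[symmetric]) (simp add: mult_ac)
  qed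
  also have "\<dots> = cr (?c * ?c) * (LINT x|lborel. cr (gs \<kappa> x) *
        (LINT \<zeta>|lborel. y \<zeta> * iexp (((\<zeta> - \<xi>) /\<^sub>R \<epsilon>) \<bullet> x)))" by (simp only: integral_mult_right_zero of_real_mult mult.assoc)
  also have "(LINT x|lborel. cr (gs \<kappa> x) *
        (LINT \<zeta>|lborel. y \<zeta> * iexp (((\<zeta> - \<xi>) /\<^sub>R \<epsilon>) \<bullet> x)))
     = (LINT \<zeta>|lborel. y \<zeta> * (LINT x|lborel. cr (gs \<kappa> x) * iexp (((\<zeta> - \<xi>) /\<^sub>R \<epsilon>) \<bullet> x)))"
    by (rule fubini_kernel[where B=1]) (use gauss_complex_integrable[OF k] gauss_bounded_integrable[OF y] in simp_all)
  also have "\<dots> = (LINT \<zeta>|lborel. cr ((pi / \<kappa>) powr (CARD('d) / 2)) * (y \<zeta> * cr (exp (- (norm ((\<zeta> - \<xi>) /\<^sub>R \<nu>))\<^sup>2))))"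
  proof (rule lint_cong)
    fix \<zeta>
    have "(norm ((\<zeta> - \<xi>) /\<^sub>R \<epsilon>))^2 / (4 * \<kappa>) = (norm ((\<zeta> - \<xi>) /\<^sub>R \<nu>))^2"
      unfolding norm_scaleR using e l by (simp add: \<kappa>_def power_divide power_mult_distrib field_simps)
    then show "y \<zeta> * (LINT x|lborel. cr (gs \<kappa> x) * iexp (((\<zeta> - \<xi>) /\<^sub>R \<epsilon>) \<bullet> x))
      = cr ((pi / \<kappa>) powr (CARD('d) / 2)) * (y \<zeta> * cr (exp (- (norm ((\<zeta> - \<xi>) /\<^sub>R \<nu>))\<^sup>2)))"
      unfolding gauss_fourier_of_real[OF k] by (simp only: minus_divide_left[symmetric] of_real_mult DIM_cart DIM_real mult_1_right mult_1_left mult_ac)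
  qed
  also have "\<dots> = cr ((pi / \<kappa>) powr (CARD('d) / 2)) * (LINT \<zeta>|lborel. y \<zeta> * cr (exp (- (norm ((\<zeta> - \<xi>) /\<^sub>R \<nu>))\<^sup>2)))"
    by (rule integral_mult_right_zero)
  also have "(LINT \<zeta>|lborel. y \<zeta> * cr (exp (- (norm ((\<zeta> - \<xi>) /\<^sub>R \<nu>))\<^sup>2)))
     = \<nu> ^ CARD('d) *\<^sub>R (LINT u|lborel. y (\<xi> + (- \<nu>) *\<^sub>R u) * cr (exp (- (norm ((\<xi> + (- \<nu>) *\<^sub>R u - \<xi>) /\<^sub>R \<nu>))\<^sup>2)))"
    using l by (subst lborel_affine_integral[of "- \<nu>" _ \<xi>]) auto
  also have "\<dots> = cr (\<nu> ^ CARD('d)) * (LINT u|lborel. cr (exp (- (norm u)\<^sup>2)) * y (\<xi> - \<nu> *\<^sub>R u))"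
  proof -
    have "norm ((\<xi> + (- \<nu>) *\<^sub>R u - \<xi>) /\<^sub>R \<nu>) = norm u" for u using l by simp
    then show ?thesis by (simp only: scaleR_conv_of_real[where 'a=complex] mult.commute[of "y _"]) simp
  qed
  finally have "fourier \<epsilon> (\<lambda>x. cr (gs \<kappa> x) * invF \<epsilon> y x) \<xi> =
      cr (?c * ?c * (pi / \<kappa>) powr (CARD('d) / 2) * \<nu> ^ CARD('d)) * (LINT u|lborel. cr (exp (- (norm u)\<^sup>2)) * y (\<xi> - \<nu> *\<^sub>R u))"
    by (simp only: mult.assoc of_real_mult)
  moreover have "?c * ?c * (pi / \<kappa>) powr (CARD('d) / 2) * \<nu> ^ CARD('d) = pi powr (- (CARD('d) / 2))"
  proof -
    \<comment> \<open>Both sides are positive, so the collected powers of \<open>pi\<close>,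
      \<open>\<epsilon>\<close> and \<open>\<nu>\<close> are compared through their
      logarithms.\<close>
    have "ln (?c * ?c * (pi / \<kappa>) powr (CARD('d) / 2) * \<nu> ^ CARD('d)) = ln (pi powr (- (CARD('d) / 2)))"
      using e l ln_realpow[of 2 2] by (simp add: ln_mult ln_div ln_powr ln_realpow \<kappa>_def field_simps)
    then show ?thesis using e l k by (subst (asm) ln_inj_iff) auto
  qed
  ultimately show ?thesis unfolding gauss_mollify_def \<kappa>_def by (simp only:)
qed

lemma gauss_mollify_measurable [measurable]:
  assumes [measurable]: "y \<in> Borel"
  shows "gauss_mollify \<nu> y \<in> Borel" unfolding gauss_mollify_def by measurable

text \<open>For widths at most 1 the triangle inequality bounds the square of
  \<open>norm \<xi>\<close> by twice the sum of the squares of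
  \<open>norm (\<xi> - \<nu> *\<^sub>R u)\<close> and \<open>norm u\<close>. The rate
  \<open>c'\<close> satisfies \<open>2 * c' \<le> c\<close> and \<open>2 * c' \<le> 1/2\<close>, so
  decay in \<open>\<xi>\<close> is extracted while half of the Gaussian in \<open>u\<close> remains
  for integration, uniformly in \<open>\<nu>\<close>.\<close>

lemma gauss_bounded_convolution_bound:
  fixes y :: "'a::euclidean_space \<Rightarrow> complex"
  assumes C: "0 < C" "0 < c" "\<And>x. cmod (y x) \<le> C * gs c x" and l: "0 < \<nu>" "\<nu> \<le> 1"
  defines "c' \<equiv> min (c / 2) (1 / 4)"
  shows "exp (- (norm u)\<^sup>2) * cmod (y (\<xi> - \<nu> *\<^sub>R u)) \<le> C * gs c' \<xi> * gs (1/2) u"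
proof -
  have c': "c' > 0" "2 * c' \<le> c" "2 * c' \<le> 1/2" using C by (auto simp: c'_def)
  have "norm \<xi> \<le> norm (\<xi> - \<nu> *\<^sub>R u) + norm u"
  proof -
    have "norm \<xi> \<le> norm (\<xi> - \<nu> *\<^sub>R u) + norm (\<nu> *\<^sub>R u)" using norm_triangle_ineq[of "\<xi> - \<nu> *\<^sub>R u" "\<nu> *\<^sub>R u"] by simp
    also have "norm (\<nu> *\<^sub>R u) \<le> norm u" using l by (simp add: mult_left_le_one_le)
    finally show ?thesis by simp
  qed
  then have "(norm \<xi>)^2 \<le> (norm (\<xi> - \<nu> *\<^sub>R u) + norm u)^2" by (intro power_mono) auto
  also have "\<dots> \<le> 2 * (norm (\<xi> - \<nu> *\<^sub>R u))^2 + 2 * (norm u)^2" using sum_squares_bound[of "norm (\<xi> - \<nu> *\<^sub>R u)" "norm u"] by (simp add: power2_sum)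
  finally have "c' * (norm \<xi>)^2 \<le> c' * (2 * (norm (\<xi> - \<nu> *\<^sub>R u))^2 + 2 * (norm u)^2)" using c' by (intro mult_left_mono) auto
  also have "\<dots> = (2 * c') * (norm (\<xi> - \<nu> *\<^sub>R u))^2 + (2 * c') * (norm u)^2" by (simp add: algebra_simps)
  also have "\<dots> \<le> c * (norm (\<xi> - \<nu> *\<^sub>R u))^2 + (1/2) * (norm u)^2" using c' by (intro add_mono mult_right_mono) auto
  finally have le: "- (norm u)\<^sup>2 + (- c * (norm (\<xi> - \<nu> *\<^sub>R u))^2) \<le> - c' * (norm \<xi>)^2 + (- (1/2) * (norm u)^2)" by simp
  have "exp (- (norm u)\<^sup>2) * cmod (y (\<xi> - \<nu> *\<^sub>R u)) \<le> exp (- (norm u)\<^sup>2) * (C * gs c (\<xi> - \<nu> *\<^sub>R u))" using C(3) by (intro mult_left_mono) auto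
  also have "\<dots> = C * exp (- (norm u)\<^sup>2 + (- c * (norm (\<xi> - \<nu> *\<^sub>R u))^2))" by (simp only: exp_add mult_ac)
  also have "\<dots> \<le> C * exp (- c' * (norm \<xi>)^2 + (- (1/2) * (norm u)^2))" using le C(1) by (intro mult_left_mono) (auto simp only: exp_le_cancel_iff)
  finally show ?thesis by (simp only: exp_add mult.assoc)
qed

lemma gauss_bounded_mollify:
  fixes y :: "real ^ 'd \<Rightarrow> complex"
  assumes y: "gauss_bounded y" and l: "0 < \<nu>" "\<nu> \<le> 1"
  shows "gauss_bounded (gauss_mollify \<nu> y)"
proof -
  from y obtain C c where C: "0 < C" "0 < c" "\<And>x. cmod (y x) \<le> C * gs c x" by (rule gauss_boundedE) blast
  define c' where "c' = min (c / 2) (1 / 4)"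
  note b = gauss_bounded_convolution_bound[OF C l, folded c'_def]
  note [measurable] = gauss_bounded_measurable[OF y]
  have I: "L1 (\<lambda>u::real^'d. gs (1/2) u)" by (rule gauss_integrable) simp
  show ?thesis
  proof (rule gauss_boundedI)
    show "c' > 0" using C by (simp add: c'_def)
    fix \<xi>
    have "cmod (LINT u|lborel. cr (exp (- (norm u)\<^sup>2)) * y (\<xi> - \<nu> *\<^sub>R u)) \<le> (LINT u|lborel. C * gs c' \<xi> * gs (1/2) (u::real^'d))"
    proof (rule lebesgue_integral_norm_le)
      show "L1 (\<lambda>u::real^'d. C * gs c' \<xi> * gs (1/2) u)" using I by (intro integrable_mult_right) simp
    qed (use b in \<open>simp add: norm_mult\<close>)
    then show "cmod (gauss_mollify \<nu> y \<xi>) \<le> (pi powr (- (CARD('d) / 2)) * C * (LINT u|lborel. gs (1/2) (u::real^'d))) * gs c' \<xi>"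
      unfolding gauss_mollify_def by (simp add: norm_mult mult_left_mono mult_ac)
  qed measurable
qed

text \<open>The converse reading of \<open>fourier_damped\<close>. Instead of going through an
  inversion theorem, Fubini and the translation rule of the exponential reduce the claim to the
  transform of a Gaussian.\<close>

lemma inv_fourier_mollify:
  fixes y :: "real ^ 'd \<Rightarrow> complex"
  assumes y: "gauss_bounded y" and e: "\<epsilon> > 0" and l: "\<nu> > 0"
  shows "invF \<epsilon> (gauss_mollify \<nu> y) x = cr (gs ((\<nu> / (2 * \<epsilon>))^2) x) * invF \<epsilon> y x"
proof -
  let ?c = "cr ((2 * pi * \<epsilon>) powr (- (CARD('d) / 2)))"
  let ?p = "cr (pi powr (- (CARD('d) / 2)))"
  note [measurable] = gauss_bounded_measurable[OF y]
  define E where "E \<xi> = iexp (x \<bullet> \<xi> / \<epsilon>)" for \<xi>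
  let ?k = "\<lambda>\<xi> u. cr (exp (- (norm u)\<^sup>2)) * (y (\<xi> - \<nu> *\<^sub>R u) * E \<xi>)"
  have Em[measurable]: "E \<in> Borel" unfolding E_def by measurable
  have Eb: "cmod (E \<xi>) = 1" for \<xi> by (simp add: E_def)
  have Ea: "E (\<xi> + \<zeta>) = E \<xi> * E \<zeta>" for \<xi> \<zeta> by (simp add: E_def inner_add_right add_divide_distrib distrib_left exp_add)
  have iy: "L1 (\<lambda>\<xi>. y \<xi> * E \<xi>)" by (rule integrable_mult_bounded_left[OF gauss_bounded_integrable[OF y], where B=1]) (simp_all add: Eb)
  have "invF \<epsilon> (gauss_mollify \<nu> y) x = ?c * (LINT \<xi>|lborel. LINT u|lborel. ?p * ?k \<xi> u)"
  proof -
    have "(LINT u|lborel. ?p * ?k \<xi> u) = gauss_mollify \<nu> y \<xi> * E \<xi>" for \<xi> unfolding gauss_mollify_def integral_mult_right_zero mult.assoc[of ?p]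
      by (simp only: mult.assoc[symmetric] integral_mult_left_zero)
    then show ?thesis unfolding inv_fourier_def E_def by simp
  qed
  also have "(LINT \<xi>|lborel. LINT u|lborel. ?p * ?k \<xi> u)
    = (LINT u|lborel. LINT \<xi>|lborel. ?p * ?k \<xi> u)"
  proof (rule lborel_pair.Fubini_integral[symmetric])
    have m: "(\<lambda>(\<xi>, u). ?p * ?k \<xi> u) \<in> borel_measurable lborel2" by measurable
    have sh: "L1 (\<lambda>\<xi>. y (\<xi> - \<nu> *\<^sub>R u))" for u using lborel_affine_integrable[OF gauss_bounded_integrable[OF y], of 1 "- \<nu> *\<^sub>R u"] by simp
    have n: "(LINT \<xi>|lborel. norm (?p * ?k \<xi> u)) =
       exp (- (norm u)\<^sup>2) * (pi powr (- (CARD('d) / 2)) * (LINT \<xi>|lborel. cmod (y \<xi>)))" for u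
      using lborel_affine_integral[of 1 "\<lambda>\<xi>. cmod (y \<xi>)" "- \<nu> *\<^sub>R u"] by (simp add: norm_mult Eb mult_ac)
    have "integrable lborel2 (\<lambda>(u, \<xi>). ?p * ?k \<xi> u)"
    proof (rule lborel_pair.Fubini_integrable)
      show "(\<lambda>(u, \<xi>). ?p * ?k \<xi> u) \<in> borel_measurable lborel2" by measurable
      show "L1 (\<lambda>u. LINT \<xi>|lborel. norm (case (u, \<xi>) of (u, \<xi>) \<Rightarrow> ?p * ?k \<xi> u))"
        unfolding prod.case n using gauss_integrable[of 1] by (intro integrable_mult_left) simp
      show "AE u in lborel. L1 (\<lambda>\<xi>. case (u, \<xi>) of (u, \<xi>) \<Rightarrow> ?p * ?k \<xi> u)" unfolding prod.case
        by (intro AE_I2 integrable_mult_right integrable_mult_bounded_left[OF sh, where B=1]) (simp_all add: Eb)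
    qed
    from lborel_pair.integrable_product_swap[OF this]
    show "integrable lborel2 (\<lambda>(\<xi>, u). ?p * ?k \<xi> u)" by (simp add: split_beta')
  qed
  also have "\<dots> = (LINT u|lborel. (?p * (LINT \<xi>|lborel. y \<xi> * E \<xi>)) * (cr (gs 1 u) * iexp (((\<nu> / \<epsilon>) *\<^sub>R x) \<bullet> u)))"
  proof (rule lint_cong)
    fix u :: "real ^ 'd"
    have "(LINT \<xi>|lborel. y \<xi> * E (\<xi> + \<nu> *\<^sub>R u)) = (LINT \<xi>|lborel. y (\<xi> - \<nu> *\<^sub>R u) * E \<xi>)"
      using lborel_affine_integral[of 1 "\<lambda>\<xi>. y \<xi> * E (\<xi> + \<nu> *\<^sub>R u)" "- \<nu> *\<^sub>R u"] by simp
    moreover have "E (\<nu> *\<^sub>R u) = iexp (((\<nu> / \<epsilon>) *\<^sub>R x) \<bullet> u)" by (simp add: E_def)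
    moreover have "(LINT \<xi>|lborel. y \<xi> * E (\<xi> + \<nu> *\<^sub>R u)) = (LINT \<xi>|lborel. y \<xi> * E \<xi>) * E (\<nu> *\<^sub>R u)"
      unfolding Ea by (simp add: mult.assoc[symmetric])
    ultimately have *: "(LINT \<xi>|lborel. y (\<xi> - \<nu> *\<^sub>R u) * E \<xi>) = (LINT \<xi>|lborel. y \<xi> * E \<xi>) * iexp (((\<nu> / \<epsilon>) *\<^sub>R x) \<bullet> u)" by simp
    show "(LINT \<xi>|lborel. ?p * ?k \<xi> u)
      = (?p * (LINT \<xi>|lborel. y \<xi> * E \<xi>)) * (cr (gs 1 u) * iexp (((\<nu> / \<epsilon>) *\<^sub>R x) \<bullet> u))"
      unfolding integral_mult_right_zero * by (simp only: mult_1 mult_minus_left mult_ac)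
  qed
  also have "\<dots> = (?p * (LINT \<xi>|lborel. y \<xi> * E \<xi>)) * (LINT u|lborel. cr (gs 1 u) * iexp (((\<nu> / \<epsilon>) *\<^sub>R x) \<bullet> u))"
    by (rule integral_mult_right_zero)
  also have "(LINT u|lborel. cr (gs 1 u) * iexp (((\<nu> / \<epsilon>) *\<^sub>R x) \<bullet> u)) = cr (pi powr (CARD('d) / 2) * gs ((\<nu> / (2 * \<epsilon>))^2) x)"
    by (subst gauss_fourier_of_real) (simp_all add: power_mult_distrib power_divide)
  finally have "invF \<epsilon> (gauss_mollify \<nu> y) x = cr (pi powr (- (CARD('d) / 2)) * pi powr (CARD('d) / 2)) * (cr (gs ((\<nu> / (2 * \<epsilon>))^2) x) * (?c * (LINT \<xi>|lborel. y \<xi> * E \<xi>)))"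
    by (simp add: mult_ac)
  then show ?thesis unfolding inv_fourier_def E_def by (simp flip: powr_add)
qed

text \<open>Continuity of translations, tested against a fixed function. As \<open>g\<close> is only
  measurable, it is replaced by bounded continuous functions that converge to it off a null set. The
  replacement error is uniform in the shift, because the shift can be moved onto \<open>h\<close>,
  whose translates by vectors of norm at most 1 have the common majorant \<open>H\<close>.\<close>

lemma correlation_tendsto:
  fixes h g :: "'a::euclidean_space \<Rightarrow> complex"
  assumes h: "gauss_bounded h" and g: "gauss_bounded g" and v: "v \<longlonglongrightarrow> 0"
  shows "(\<lambda>n. LINT x|lborel. cnj (h x) * g (x - v n)) \<longlonglongrightarrow> (LINT x|lborel. cnj (h x) * g x)"
proof -
  note [measurable] = gauss_bounded_measurable[OF h] gauss_bounded_measurable[OF g]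
  obtain C c where C: "C > 0" "c > 0" "\<And>x. cmod (h x) \<le> C * gs c x" using h by (rule gauss_boundedE) blast
  obtain B where B: "B > 0" "\<And>x. cmod (g x) \<le> B" using gauss_bounded_bounded[OF g] by blast
  have "g measurable_on UNIV" by (rule lebesgue_measurable_imp_measurable_on) (auto intro: measurable_completion)
  then obtain N f where N: "negligible N" and cont: "\<And>m. continuous_on UNIV (f m)" and lim: "\<And>x. x \<notin> N \<Longrightarrow> (\<lambda>m. f m x) \<longlonglongrightarrow> g x"
    unfolding measurable_on_def by auto
  \<comment> \<open>Values are pulled back radially to the disc of radius \<open>B\<close>. This
    keeps continuity, and also the limit, as \<open>g\<close> itself takes values in that
    disc.\<close>
  define F where "F m x = (B / max B (cmod (f m x))) *\<^sub>R f m x" for m :: nat and x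
  have Fc: "continuous_on UNIV (F m)" for m unfolding F_def using B(1) by (intro continuous_intros cont) (auto simp: max_def)
  have [measurable]: "F m \<in> Borel" for m using Fc by (rule borel_measurable_continuous_onI)
  have FB: "cmod (F m x) \<le> B" for m x using B(1) by (simp add: F_def max_def field_simps)
  have Flim: "(\<lambda>m. F m x) \<longlonglongrightarrow> g x" if "x \<notin> N" for x
  proof -
    have "(\<lambda>m. F m x) \<longlonglongrightarrow> (B / max B (cmod (g x))) *\<^sub>R g x" unfolding F_def using B(1) by (intro tendsto_intros lim[OF that]) (auto simp: max_def)
    then show ?thesis using B(1) B(2)[of x] by (simp add: max_absorb1)
  qed
  define H where "H x = C * exp (c * 1^2) * gs (c/2) x" for x :: 'a
  have H: "L1 H" "\<And>x. H x \<ge> 0" unfolding H_def using C gauss_integrable[of "c/2"] by (auto intro!: integrable_mult_right)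
  note [measurable] = borel_measurable_integrable[OF H(1)]
  define D where "D m = (LINT x|lborel. H x * cmod (F m x - g x))" for m
  have "(\<lambda>m. LINT x|lebesgue. H x * cmod (F m x - g x)) \<longlonglongrightarrow> (LINT x::'a|lebesgue. 0)"
  proof (rule integral_dominated_convergence[where w="\<lambda>x. H x * (2 * B)"])
    show "integrable lebesgue (\<lambda>x. H x * (2 * B))" using H(1) by (subst integrable_completion) (auto intro: integrable_mult_left)
    show "AE x in lebesgue. (\<lambda>m. H x * cmod (F m x - g x)) \<longlonglongrightarrow> 0" using AE_not_in[OF N[unfolded negligible_iff_null_sets]]
    proof eventually_elim
      case (elim x)
      from tendsto_mult_left[OF tendsto_norm[OF tendsto_diff[OF Flim[OF elim] tendsto_const]], of "H x" "g x"] show ?case by simp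
    qed
    show "AE x in lebesgue. norm (H x * cmod (F m x - g x)) \<le> H x * (2 * B)" for m
      using H(2) order_trans[OF norm_triangle_ineq4 add_mono[OF FB B(2)]] by (intro AE_I2) (simp add: abs_mult mult_left_mono)
  qed (auto intro: measurable_completion)
  then have D: "D \<longlonglongrightarrow> 0" unfolding D_def by (simp add: integral_completion)
  have hi: "L1 (\<lambda>x. cnj (h x))" using gauss_bounded_integrable[OF h] by simp
  have i: "L1 (\<lambda>x. cnj (h x) * u (x - w))" if "u \<in> Borel" "\<And>x. cmod (u x) \<le> B" for u w by (rule integrable_mult_bounded_left[OF hi, where B=B]) (use that in simp_all)
  have close: "cmod ((LINT x|lborel. cnj (h x) * F m (x - w)) - (LINT x|lborel. cnj (h x) * g (x - w))) \<le> D m" if w: "norm w \<le> 1" for m w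
  proof -
    have "(LINT x|lborel. cnj (h x) * F m (x - w)) - (LINT x|lborel. cnj (h x) * g (x - w)) = (LINT x|lborel. cnj (h x) * (F m (x - w) - g (x - w)))"
      unfolding right_diff_distrib by (rule lint_diff[symmetric]) (use i FB B(2) in auto)
    also have "\<dots> = (LINT x|lborel. cnj (h (x + w)) * (F m x - g x))" using lborel_affine_integral[of 1 "\<lambda>x. cnj (h x) * (F m (x - w) - g (x - w))" w] by (simp add: add.commute)
    also have "cmod \<dots> \<le> D m" unfolding D_def
    proof (rule lebesgue_integral_norm_le)
      show "L1 (\<lambda>x. H x * cmod (F m x - g x))" using order_trans[OF norm_triangle_ineq4 add_mono[OF FB B(2)]] H
        by (intro integrable_real_bound[OF integrable_mult_left[OF H(1), of "2 * B"]]) (auto simp: abs_mult intro!: mult_left_mono)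
      have "cmod (h (x + w)) \<le> H x" for x using order_trans[OF C(3)[of "x + w"] mult_left_mono[OF gauss_shift_bound[OF C(2) w]]] C(1) by (simp add: H_def mult.assoc)
      then show "norm (cnj (h (x + w)) * (F m x - g x)) \<le> H x * cmod (F m x - g x)" for x by (simp add: norm_mult mult_right_mono)
    qed
    finally show ?thesis .
  qed
  have Rm: "(\<lambda>n. LINT x|lborel. cnj (h x) * F m (x - v n)) \<longlonglongrightarrow> (LINT x|lborel. cnj (h x) * F m (x - 0))" for m
  proof (rule integral_dominated_convergence[where w="\<lambda>x. cmod (h x) * B"])
    have "(\<lambda>n. F m (x - v n)) \<longlonglongrightarrow> F m (x - 0)" for x
      by (rule isCont_tendsto_compose[OF _ tendsto_diff[OF tendsto_const v]]) (use Fc in \<open>simp add: continuous_on_eq_continuous_at\<close>)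
    then show "AE x in lborel. (\<lambda>n. cnj (h x) * F m (x - v n)) \<longlonglongrightarrow> cnj (h x) * F m (x - 0)" by (intro AE_I2 tendsto_mult_left)
    show "AE x in lborel. norm (cnj (h x) * F m (x - v n)) \<le> cmod (h x) * B" for n using FB by (intro AE_I2) (simp add: norm_mult mult_left_mono)
  qed (use gauss_bounded_integrable[OF h] in auto)
  show ?thesis
  proof (rule LIMSEQ_I)
    fix r :: real assume r: "r > 0"
    obtain m where m: "D m < r / 3" using order_tendstoD(2)[OF D, of "r / 3"] r by (auto simp: eventually_sequentially)
    have "eventually (\<lambda>n. norm (v n) < 1) sequentially" using order_tendstoD(2)[OF tendsto_norm[OF v], of 1] by simp
    moreover have "eventually (\<lambda>n. dist (LINT x|lborel. cnj (h x) * F m (x - v n)) (LINT x|lborel. cnj (h x) * F m (x - 0)) < r / 3) sequentially"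
      using tendstoD[OF Rm, of "r / 3"] r by simp
    ultimately have "eventually (\<lambda>n. norm ((LINT x|lborel. cnj (h x) * g (x - v n)) - (LINT x|lborel. cnj (h x) * g x)) < r) sequentially"
    proof eventually_elim
      case (elim n)
      have tri: "cmod (a - b) \<le> cmod (a' - a) + cmod (a' - b') + cmod (b' - b)" for a b a' b' :: complex
        using norm_triangle_ineq[of "(a - a') + (a' - b')" "b' - b"] norm_triangle_ineq[of "a - a'" "a' - b'"] by (simp add: norm_minus_commute)
      let ?g = "\<lambda>w. LINT x|lborel. cnj (h x) * g (x - w)" and ?F = "\<lambda>w. LINT x|lborel. cnj (h x) * F m (x - w)"
      have "cmod (?F (v n) - ?F 0) < r / 3" using elim(2) unfolding dist_norm .
      moreover have "cmod (?F (v n) - ?g (v n)) \<le> D m" by (rule close) (use elim(1) in simp)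
      moreover have "cmod (?F 0 - ?g 0) \<le> D m" by (rule close) simp
      ultimately have "cmod (?g (v n) - ?g 0) < r" using tri[of "?g (v n)" "?g 0" "?F (v n)" "?F 0"] m by linarith
      then show ?case by (simp only: diff_0_right)
    qed
    then show "\<exists>no. \<forall>n\<ge>no. norm ((LINT x|lborel. cnj (h x) * g (x - v n)) - (LINT x|lborel. cnj (h x) * g x)) < r" by (simp add: eventually_sequentially)
  qed
qed

text \<open>After Fubini the pairing is a Gaussian average of the correlation \<open>R\<close> at
  the points \<open>l n *\<^sub>R u\<close>, so continuity of \<open>R\<close> at 0 and dominated
  convergence suffice; the mass of the Gaussian cancels the normalising power of
  \<open>pi\<close>.\<close>

lemma l2inner_mollify_tendsto:
  fixes h g :: "real ^ 'd \<Rightarrow> complex"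
  assumes h: "gauss_bounded h" and g: "gauss_bounded g" and l: "l \<longlonglongrightarrow> 0"
  shows "(\<lambda>n. l2inner h (gauss_mollify (l n) g)) \<longlonglongrightarrow> l2inner h g"
proof -
  let ?p = "cr (pi powr (- (CARD('d) / 2)))"
  note [measurable] = gauss_bounded_measurable[OF h] gauss_bounded_measurable[OF g]
  obtain Bh where Bh: "Bh > 0" "\<And>x. cmod (h x) \<le> Bh" using gauss_bounded_bounded[OF h] by blast
  obtain Bg where Bg: "Bg > 0" "\<And>x. cmod (g x) \<le> Bg" using gauss_bounded_bounded[OF g] by blast
  define R where "R v = (LINT \<xi>|lborel. cnj (h \<xi>) * g (\<xi> - v))" for v
  have ih: "L1 (\<lambda>\<xi>. cnj (h \<xi>))" using gauss_bounded_integrable[OF h] by simp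
  have iR: "L1 (\<lambda>\<xi>. cnj (h \<xi>) * g (\<xi> - v))" for v by (rule integrable_mult_bounded_left[OF ih, where B=Bg]) (use Bg in simp_all)
  have eq: "l2inner h (gauss_mollify \<nu> g) = ?p * (LINT u|lborel. cr (exp (- (norm u)\<^sup>2)) * R (\<nu> *\<^sub>R u))" for \<nu>
  proof -
    have "l2inner h (gauss_mollify \<nu> g) = ?p * (LINT \<xi>|lborel. cnj (h \<xi>) * (LINT u|lborel. cr (exp (- (norm u)\<^sup>2)) * g (\<xi> - \<nu> *\<^sub>R u)))"
      unfolding l2inner_def gauss_mollify_def mult.left_commute[of "cnj _" ?p] by (rule integral_mult_right_zero)
    also have "(LINT \<xi>|lborel. cnj (h \<xi>) * (LINT u|lborel. cr (exp (- (norm u)\<^sup>2)) * g (\<xi> - \<nu> *\<^sub>R u))) = (LINT u|lborel. cr (exp (- (norm u)\<^sup>2)) * (LINT \<xi>|lborel. cnj (h \<xi>) * g (\<xi> - \<nu> *\<^sub>R u)))"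
      by (rule fubini_kernel[OF ih gauss_complex_integrable1, where B=Bg]) (use Bg in simp_all)
    finally show ?thesis by (simp add: R_def)
  qed
  have Rt: "(\<lambda>n. R (v n)) \<longlonglongrightarrow> R 0" if v: "v \<longlonglongrightarrow> 0" for v unfolding R_def diff_0_right by (rule correlation_tendsto[OF h g v])
  have Rb: "cmod (R v) \<le> (LINT \<xi>|lborel. cmod (h \<xi>)) * Bg" for v
  proof -
    have "cmod (R v) \<le> (LINT \<xi>|lborel. cmod (h \<xi>) * Bg)" unfolding R_def
      by (rule lebesgue_integral_norm_le) (use Bg gauss_bounded_integrable[OF h] in \<open>auto simp: norm_mult intro!: mult_left_mono\<close>)
    then show ?thesis by simp
  qed
  have [measurable]: "R \<in> Borel" unfolding R_def by measurable
  have "(\<lambda>n. LINT u|lborel. cr (exp (- (norm u)\<^sup>2)) * R (l n *\<^sub>R u)) \<longlonglongrightarrow> (LINT u::real^'d|lborel. cr (exp (- (norm u)\<^sup>2)) * R 0)"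
  proof (rule integral_dominated_convergence[where w="\<lambda>u. gs 1 u * ((LINT \<xi>|lborel. cmod (h \<xi>)) * Bg)"])
    show "L1 (\<lambda>u::real^'d. gs 1 u * ((LINT \<xi>|lborel. cmod (h \<xi>)) * Bg))" using gauss_integrable[of 1] by (intro integrable_mult_left) simp
    show "AE u in lborel. (\<lambda>n. cr (exp (- (norm u)\<^sup>2)) * R (l n *\<^sub>R u)) \<longlonglongrightarrow> cr (exp (- (norm u)\<^sup>2)) * R 0"
    proof (intro AE_I2 tendsto_mult_left Rt)
      show "(\<lambda>n. l n *\<^sub>R u) \<longlonglongrightarrow> 0" for u :: "real^'d" using tendsto_scaleR[OF l tendsto_const[of u]] by simp
    qed
    show "AE u in lborel. cmod (cr (exp (- (norm u)\<^sup>2)) * R (l n *\<^sub>R u)) \<le> gs 1 u * ((LINT \<xi>|lborel. cmod (h \<xi>)) * Bg)" for n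
      using Rb by (intro AE_I2) (simp add: norm_mult)
  qed measurable
  then have "(\<lambda>n. l2inner h (gauss_mollify (l n) g)) \<longlonglongrightarrow> ?p * (LINT u::real^'d|lborel. cr (exp (- (norm u)\<^sup>2)) * R 0)"
    unfolding eq by (rule tendsto_mult_left)
  moreover have "(LINT u::real^'d|lborel. cr (exp (- (norm u)\<^sup>2)) * R 0) = cr (pi powr (CARD('d) / 2)) * R 0"
  proof -
    have "(LINT u::real^'d|lborel. cr (exp (- (norm u)\<^sup>2)) * R 0) = cr (LINT u::real^'d|lborel. gs 1 u) * R 0" by simp
    then show ?thesis by (subst (asm) gauss_integral) simp_all
  qed
  moreover have "?p * (cr (pi powr (CARD('d) / 2)) * R 0) = l2inner h g" by (simp add: R_def l2inner_def mult.assoc[symmetric] powr_add[symmetric] flip: of_real_mult)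
  ultimately show ?thesis by (simp only:)
qed

lemma gauss_bounded_gauss:
  assumes "c > 0" "g \<in> Borel" "\<And>x. cmod (g x) \<le> B"
  shows "gauss_bounded (\<lambda>x::'a::euclidean_space. cr (gs c x) * g x)"
proof (rule gauss_boundedI[OF _ assms(1)])
  note [measurable] = assms(2)
  show "(\<lambda>x. cr (gs c x) * g x) \<in> Borel" by measurable
  show "cmod (cr (gs c x) * g x) \<le> B * gs c x" for x using mult_left_mono[OF assms(3)[of x], of "gs c x"] by (simp add: norm_mult mult.commute)
qed

section \<open>Plancherel's theorem for Gaussian-bounded functions\<close>

context
  fixes \<epsilon> :: real
  assumes e: "\<epsilon> > 0"
begin

lemma inv_fourier_bounded: "\<exists>B. \<forall>x. cmod (invF \<epsilon> h x) \<le> B" using inv_fourier_bound[of \<epsilon> h] by blast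

lemma damped_pairing:
  fixes h g :: "real ^ 'd \<Rightarrow> complex"
  assumes h: "gauss_bounded h" and g: "gauss_bounded g" and l: "\<nu> > 0"
  shows "l2inner (invF \<epsilon> h) (\<lambda>x. cr (gs ((\<nu> / (2 * \<epsilon>))^2) x) * invF \<epsilon> g x)
    = l2inner h (gauss_mollify \<nu> g)"
proof -
  note [measurable] = gauss_bounded_measurable[OF g]
  obtain B where B: "\<And>x. cmod (invF \<epsilon> g x) \<le> B" using inv_fourier_bounded by blast
  have "gauss_bounded (\<lambda>x. cr (gs ((\<nu> / (2 * \<epsilon>))^2) x) * invF \<epsilon> g x)" by (rule gauss_bounded_gauss[where B=B]) (use e l B in auto)
  then have "L1 (\<lambda>x. cr (gs ((\<nu> / (2 * \<epsilon>))^2) x) * invF \<epsilon> g x)" by (rule gauss_bounded_integrable)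
  from l2inner_inv_fourier[OF gauss_bounded_integrable[OF h] this, of \<epsilon>]
  show ?thesis by (simp only: l2inner_def fourier_damped[OF g e l])
qed

lemma damping_tendsto: "(\<lambda>n. exp (- (inverse (real (Suc n)) / (2 * \<epsilon>))\<^sup>2 * r)) \<longlonglongrightarrow> 1"
proof -
  have "(\<lambda>n. exp (- (inverse (real (Suc n)) / (2 * \<epsilon>))\<^sup>2 * r)) \<longlonglongrightarrow> exp (- (0 / (2 * \<epsilon>))\<^sup>2 * r)"
    by (intro tendsto_intros LIMSEQ_inverse_real_of_nat) (use e in auto)
  then show ?thesis by simp
qed

text \<open>The damped integrals equal pairings of \<open>h\<close> with its mollifications and so
  tend to the squared norm of \<open>h\<close>. As the width decreases the damping factor increases
  to 1, and monotone convergence yields integrability and the value of the integral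
  together.\<close>

lemma inv_fourier_l2norm_aux:
  fixes h :: "real ^ 'd \<Rightarrow> complex"
  assumes h: "gauss_bounded h"
  shows "has_bochner_integral lborel (\<lambda>x. (cmod (invF \<epsilon> h x))^2) ((l2norm h)^2)"
proof -
  note [measurable] = gauss_bounded_measurable[OF h]
  let ?l = "\<lambda>n. inverse (real (Suc n))"
  let ?f = "\<lambda>n x. gs ((?l n / (2 * \<epsilon>))^2) x * (cmod (invF \<epsilon> h x))^2"
  obtain B where B: "\<And>x. cmod (invF \<epsilon> h x) \<le> B" using inv_fourier_bounded by blast
  have I: "L1 (?f n)" for n
  proof -
    have "L1 (\<lambda>x::real^'d. B^2 * gs ((?l n / (2 * \<epsilon>))^2) x)" using e by (intro integrable_mult_right gauss_integrable) auto
    then show ?thesis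
    proof (rule integrable_real_bound)
      show "norm (?f n x) \<le> B^2 * gs ((?l n / (2 * \<epsilon>))^2) x" for x using power_mono[OF B[of x], of 2] by (simp add: mult.commute mult_left_mono)
    qed measurable
  qed
  have eq: "cr (integral\<^sup>L lborel (?f n)) = l2inner h (gauss_mollify (?l n) h)" for n
  proof -
    have "cr (integral\<^sup>L lborel (?f n)) = (LINT x|lborel. cr (?f n x))" by (rule integral_complex_of_real[symmetric])
    also have "\<dots> = l2inner (invF \<epsilon> h) (\<lambda>x. cr (gs ((?l n / (2 * \<epsilon>))^2) x) * invF \<epsilon> h x)"
      unfolding l2inner_def by (intro Bochner_Integration.integral_cong refl)
        (simp only: of_real_mult complex_norm_square mult_ac)
    also have "\<dots> = l2inner h (gauss_mollify (?l n) h)" by (rule damped_pairing[OF h h]) simp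
    finally show ?thesis .
  qed
  have "(\<lambda>n. Re (l2inner h (gauss_mollify (?l n) h))) \<longlonglongrightarrow> Re (l2inner h h)" by (intro tendsto_Re l2inner_mollify_tendsto h LIMSEQ_inverse_real_of_nat)
  moreover have "integral\<^sup>L lborel (?f n) = Re (l2inner h (gauss_mollify (?l n) h))" for n unfolding eq[symmetric] by simp
  ultimately have lim: "(\<lambda>n. integral\<^sup>L lborel (?f n)) \<longlonglongrightarrow> (l2norm h)\<^sup>2" by (simp only: l2inner_self Re_complex_of_real)
  show ?thesis
  proof (rule has_bochner_integral_monotone_convergence[OF I _ _ lim])
    show "AE x in lborel. mono (\<lambda>n. ?f n x)"
    proof (intro AE_I2 monoI mult_right_mono)
      fix x :: "real ^ 'd" and m n :: nat assume "m \<le> n"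
      then have "?l n \<le> ?l m" by simp
      then have "(?l n / (2 * \<epsilon>))^2 \<le> (?l m / (2 * \<epsilon>))^2" using e by (intro power_mono divide_right_mono) auto
      then show "gs ((?l m / (2 * \<epsilon>))^2) x \<le> gs ((?l n / (2 * \<epsilon>))^2) x" by (simp add: mult_right_mono del: of_nat_Suc)
    qed simp
    show "AE x in lborel. (\<lambda>n. ?f n x) \<longlonglongrightarrow> (cmod (invF \<epsilon> h x))\<^sup>2" using tendsto_mult_right[OF damping_tendsto] by (intro AE_I2) force
  qed measurable
qed

lemma inv_fourier_square_integrable:
  fixes h :: "real ^ 'd \<Rightarrow> complex"
  assumes h: "gauss_bounded h"
  shows "L2 (invF \<epsilon> h)" using inv_fourier_l2norm_aux[OF h] gauss_bounded_measurable[OF h] unfolding square_integrable_def by (auto simp: has_bochner_integral_iff)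

lemma inv_fourier_l2norm:
  fixes h :: "real ^ 'd \<Rightarrow> complex"
  assumes h: "gauss_bounded h"
  shows "l2norm (invF \<epsilon> h) = l2norm h" using inv_fourier_l2norm_aux[OF h] by (simp add: l2norm_def[of "invF \<epsilon> h"] has_bochner_integral_iff)

text \<open>Square integrability of both transforms is now known, so the damping can be removed
  under dominated convergence, which also covers complex-valued pairings.\<close>

lemma l2inner_inv_fourier_inv_fourier:
  fixes h g :: "real ^ 'd \<Rightarrow> complex"
  assumes h: "gauss_bounded h" and g: "gauss_bounded g"
  shows "l2inner (invF \<epsilon> h) (invF \<epsilon> g) = l2inner h g"
proof -
  note [measurable] = gauss_bounded_measurable[OF h] gauss_bounded_measurable[OF g]
  let ?l = "\<lambda>n. inverse (real (Suc n))"
  have "(\<lambda>n. l2inner (invF \<epsilon> h) (\<lambda>x. cr (gs ((?l n / (2 * \<epsilon>))^2) x) * invF \<epsilon> g x)) \<longlonglongrightarrow> l2inner (invF \<epsilon> h) (invF \<epsilon> g)"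
    unfolding l2inner_def
  proof (rule integral_dominated_convergence[OF _ _ integrable_norm_mult[OF inv_fourier_square_integrable[OF h] inv_fourier_square_integrable[OF g]]])
    show "AE x in lborel. (\<lambda>n. cnj (invF \<epsilon> h x) * (cr (gs ((?l n / (2 * \<epsilon>))^2) x) * invF \<epsilon> g x)) \<longlonglongrightarrow> cnj (invF \<epsilon> h x) * invF \<epsilon> g x"
    proof (rule AE_I2)
      fix x :: "real ^ 'd"
      have "(\<lambda>n. cnj (invF \<epsilon> h x) * (cr (gs ((?l n / (2 * \<epsilon>))^2) x) * invF \<epsilon> g x)) \<longlonglongrightarrow> cnj (invF \<epsilon> h x) * (cr 1 * invF \<epsilon> g x)"
        by (intro tendsto_mult_left tendsto_mult_right tendsto_of_real damping_tendsto)
      then show "(\<lambda>n. cnj (invF \<epsilon> h x) * (cr (gs ((?l n / (2 * \<epsilon>))^2) x) * invF \<epsilon> g x)) \<longlonglongrightarrow> cnj (invF \<epsilon> h x) * invF \<epsilon> g x"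
        by (simp only: of_real_1 mult_1_left)
    qed
    show "AE x in lborel. norm (cnj (invF \<epsilon> h x) * (cr (gs ((?l n / (2 * \<epsilon>))^2) x) * invF \<epsilon> g x)) \<le> cmod (invF \<epsilon> h x) * cmod (invF \<epsilon> g x)" for n
      by (intro AE_I2) (auto simp: norm_mult mult_left_mono mult_left_le_one_le)
  qed measurable
  moreover have "(\<lambda>n. l2inner (invF \<epsilon> h) (\<lambda>x. cr (gs ((?l n / (2 * \<epsilon>))^2) x) * invF \<epsilon> g x)) \<longlonglongrightarrow> l2inner h g"
    using l2inner_mollify_tendsto[OF h g LIMSEQ_inverse_real_of_nat] by (subst damped_pairing[OF h g]) auto
  ultimately show ?thesis by (rule LIMSEQ_unique)
qed

text \<open>Reflection exchanges the two transforms, so each Plancherel statement for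
  \<open>inv_fourier\<close> carries over to \<open>fourier\<close>.\<close>

lemma fourier_conv_inv_fourier:
  fixes f :: "real ^ 'd \<Rightarrow> complex"
  shows "fourier \<epsilon> f = invF \<epsilon> (\<lambda>x. f (- x))"
proof
  fix \<xi>
  have "(LINT x|lborel. f x * miexp (x \<bullet> \<xi> / \<epsilon>)) = (LINT x|lborel. f (- x) * iexp (\<xi> \<bullet> x / \<epsilon>))"
    using lborel_affine_integral[of "-1" "\<lambda>x. f x * miexp (x \<bullet> \<xi> / \<epsilon>)" 0] by (simp add: inner_commute)
  then show "fourier \<epsilon> f \<xi> = invF \<epsilon> (\<lambda>x. f (- x)) \<xi>" unfolding fourier_def inv_fourier_def by simp
qed

lemma gauss_bounded_reflect:
  assumes f: "gauss_bounded f"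
  shows "gauss_bounded (\<lambda>x. f (- x))"
proof -
  note [measurable] = gauss_bounded_measurable[OF f]
  obtain C c where C: "C > 0" "c > 0" "\<And>x. cmod (f x) \<le> C * gs c x" using f by (rule gauss_boundedE) blast
  show ?thesis
  proof (rule gauss_boundedI[OF _ C(2)])
    show "cmod (f (- x)) \<le> C * gs c x" for x using C(3)[of "- x"] by simp
  qed measurable
qed

lemma l2norm_reflect: "l2norm (\<lambda>x. f (- x)) = l2norm f" using lborel_affine_integral[of "-1" "\<lambda>x. (cmod (f x))^2" 0] by (simp add: l2norm_def)

lemma fourier_square_integrable:
  fixes f :: "real ^ 'd \<Rightarrow> complex"
  shows "gauss_bounded f \<Longrightarrow> L2 (fourier \<epsilon> f)" unfolding fourier_conv_inv_fourier by (intro inv_fourier_square_integrable gauss_bounded_reflect)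

lemma fourier_l2norm:
  fixes f :: "real ^ 'd \<Rightarrow> complex"
  shows "gauss_bounded f \<Longrightarrow> l2norm (fourier \<epsilon> f) = l2norm f" unfolding fourier_conv_inv_fourier by (simp add: inv_fourier_l2norm gauss_bounded_reflect l2norm_reflect)

end

section \<open>Truncation, Bessel's inequality, density and duality in L2\<close>

definition truncation :: "nat \<Rightarrow> ('a::euclidean_space \<Rightarrow> complex) \<Rightarrow> 'a \<Rightarrow> complex" where
  "truncation n f x = (if norm x \<le> real n \<and> cmod (f x) \<le> real n then f x else 0)"

lemma truncation_measurable [measurable]:
  assumes [measurable]: "f \<in> Borel"
  shows "truncation n f \<in> Borel" unfolding truncation_def by measurable

lemma truncation_le: "cmod (truncation n f x) \<le> cmod (f x)" by (simp add: truncation_def)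

lemma truncation_tendsto: "(\<lambda>n. truncation n f x) \<longlonglongrightarrow> f x"
proof (rule tendsto_eventually)
  obtain N where N: "norm x \<le> real N" "cmod (f x) \<le> real N" by (metis max.cobounded1 max.cobounded2 order_trans real_arch_simple)
  then have "\<And>n. n \<ge> N \<Longrightarrow> truncation n f x = f x" unfolding truncation_def by (smt (verit) of_nat_mono)
  then show "eventually (\<lambda>n. truncation n f x = f x) sequentially" by (auto simp: eventually_sequentially)
qed

lemma gauss_bounded_truncation:
  assumes f: "f \<in> Borel"
  shows "gauss_bounded (truncation n f)"
proof (rule gauss_boundedI[where c=1])
  show "truncation n f \<in> Borel" using f by measurable
  show "cmod (truncation n f x) \<le> (real n * exp ((real n)^2)) * gs 1 x" for x
  proof (cases "norm x \<le> real n")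
    case True
    then have "(norm x)^2 \<le> (real n)^2" by (intro power_mono) auto
    then have "1 \<le> exp ((real n)^2 - 1 * (norm x)^2)" by simp
    then have "real n \<le> real n * exp ((real n)^2 - 1 * (norm x)^2)" by (simp add: mult_le_cancel_left1)
    moreover have "cmod (truncation n f x) \<le> real n" by (simp add: truncation_def)
    ultimately show ?thesis by (simp add: mult.assoc flip: exp_add)
  qed (simp add: truncation_def)
qed simp

lemma l2norm_truncation_tendsto:
  assumes f: "L2 f"
  shows "(\<lambda>n. l2norm (\<lambda>x. truncation n f x - f x)) \<longlonglongrightarrow> 0"
proof -
  note [measurable] = f[unfolded square_integrable_def, THEN conjunct1]
  have "(\<lambda>n. LINT x|lborel. (cmod (truncation n f x - f x))^2) \<longlonglongrightarrow> (LINT x::'a|lborel. 0)"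
  proof (rule integral_dominated_convergence[where w="\<lambda>x. (cmod (f x))^2"])
    show "AE x in lborel. (\<lambda>n. (cmod (truncation n f x - f x))^2) \<longlonglongrightarrow> 0"
    proof (rule AE_I2)
      fix x
      have "(\<lambda>n. (cmod (truncation n f x - f x))^2) \<longlonglongrightarrow> (cmod (f x - f x))\<^sup>2" by (intro tendsto_intros truncation_tendsto)
      then show "(\<lambda>n. (cmod (truncation n f x - f x))^2) \<longlonglongrightarrow> 0" by simp
    qed
    show "AE x in lborel. norm ((cmod (truncation n f x - f x))^2) \<le> (cmod (f x))^2" for n by (intro AE_I2) (simp add: truncation_def)
  qed (use f in \<open>simp_all add: square_integrable_def\<close>)
  then have "(\<lambda>n. sqrt (LINT x|lborel. (cmod (truncation n f x - f x))^2)) \<longlonglongrightarrow> sqrt 0" by (intro tendsto_real_sqrt) simp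
  then show ?thesis unfolding l2norm_def by simp
qed

lemma square_integrable_truncation:
  "L2 f \<Longrightarrow> L2 (truncation n f)" by (rule l2norm_mono(1)[of f]) (auto simp: square_integrable_def truncation_le)

lemma nn_integral_square:
  "L2 f \<Longrightarrow> (\<integral>\<^sup>+x. ennreal ((cmod (f x))^2) \<partial>lborel) = ennreal ((l2norm f)^2)"
  unfolding l2norm_power2 by (rule nn_integral_eq_integral) (auto simp: square_integrable_def)

lemma square_integrable_nn_integral:
  assumes "f \<in> Borel" "(\<integral>\<^sup>+x. ennreal ((cmod (f x))^2) \<partial>lborel) \<le> ennreal (B^2)" "B \<ge> 0"
  shows "L2 f" "l2norm f \<le> B"
proof -
  have "(\<integral>\<^sup>+x. ennreal (norm ((cmod (f x))^2)) \<partial>lborel) < \<infinity>" using assms(2) by (simp add: order.strict_trans1)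
  then show si: "L2 f" unfolding square_integrable_def using assms(1) by (auto intro!: integrableI_bounded)
  from assms(2) have "(l2norm f)^2 \<le> B^2" unfolding nn_integral_square[OF si] by (simp add: ennreal_le_iff)
  then show "l2norm f \<le> B" using assms(3) by (rule power2_le_imp_le)
qed

text \<open>The transforms of the truncations converge pointwise and satisfy Plancherel's identity,
  so Fatou's lemma gives the inequality. The function is only integrable and the right-hand side may
  be infinite; nonnegative extended integrals keep both cases in one statement.\<close>

lemma fourier_bessel:
  fixes g :: "real ^ 'd \<Rightarrow> complex"
  assumes e: "\<epsilon> > 0" and g: "L1 g"
  shows "(\<integral>\<^sup>+\<xi>. ennreal ((cmod (fourier \<epsilon> g \<xi>))^2) \<partial>lborel) \<le> (\<integral>\<^sup>+x. ennreal ((cmod (g x))^2) \<partial>lborel)"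
proof -
  have [measurable]: "g \<in> Borel" using g by auto
  have lim: "(\<lambda>n. fourier \<epsilon> (truncation n g) \<xi>) \<longlonglongrightarrow> fourier \<epsilon> g \<xi>" for \<xi> unfolding fourier_def
  proof (intro tendsto_mult_left integral_dominated_convergence[where w="\<lambda>x. cmod (g x)"])
    show "AE x in lborel. (\<lambda>n. truncation n g x * miexp (x \<bullet> \<xi> / \<epsilon>)) \<longlonglongrightarrow> g x * miexp (x \<bullet> \<xi> / \<epsilon>)"
      by (intro AE_I2 tendsto_mult_right truncation_tendsto)
    show "AE x in lborel. norm (truncation n g x * miexp (x \<bullet> \<xi> / \<epsilon>)) \<le> cmod (g x)" for n by (intro AE_I2) (simp add: norm_mult truncation_le)
  qed (use g in \<open>measurable, simp_all\<close>)
  have gb: "gauss_bounded (truncation n g)" for n by (rule gauss_bounded_truncation) measurable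
  have "(\<integral>\<^sup>+\<xi>. ennreal ((cmod (fourier \<epsilon> g \<xi>))^2) \<partial>lborel) = (\<integral>\<^sup>+\<xi>. liminf (\<lambda>n. ennreal ((cmod (fourier \<epsilon> (truncation n g) \<xi>))^2)) \<partial>lborel)"
    by (intro nn_integral_cong lim_imp_Liminf[symmetric] tendsto_ennrealI tendsto_power tendsto_norm lim) simp
  also have "\<dots> \<le> liminf (\<lambda>n. \<integral>\<^sup>+\<xi>. ennreal ((cmod (fourier \<epsilon> (truncation n g) \<xi>))^2) \<partial>lborel)"
    by (rule nn_integral_liminf) measurable
  also have "\<dots> \<le> liminf (\<lambda>n. \<integral>\<^sup>+x. ennreal ((cmod (g x))^2) \<partial>lborel)"
  proof (rule Liminf_mono, rule always_eventually, rule allI)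
    fix n
    have "(\<integral>\<^sup>+\<xi>. ennreal ((cmod (fourier \<epsilon> (truncation n g) \<xi>))^2) \<partial>lborel) = (\<integral>\<^sup>+x. ennreal ((cmod (truncation n g x))^2) \<partial>lborel)"
      using gb[of n] e by (simp add: nn_integral_square fourier_square_integrable fourier_l2norm gauss_bounded_square_integrable)
    also have "\<dots> \<le> (\<integral>\<^sup>+x. ennreal ((cmod (g x))^2) \<partial>lborel)" by (intro nn_integral_mono ennreal_leI power_mono truncation_le) auto
    finally show "(\<integral>\<^sup>+\<xi>. ennreal ((cmod (fourier \<epsilon> (truncation n g) \<xi>))^2) \<partial>lborel) \<le> (\<integral>\<^sup>+x. ennreal ((cmod (g x))^2) \<partial>lborel)" .
  qed
  finally show ?thesis by (simp add: Liminf_const)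
qed

text \<open>Inversion in L2 by a norm argument. The approximating symbols are damped transforms of
  \<open>\<eta>\<close>; expanding the square bounds the squared distance by \<open>2 * (l2norm
  \<eta>)^2 - 2 * Re (l2inner (k n) (fourier \<epsilon> \<eta>))\<close>, which tends to 0 because
  the transform preserves the norm of \<open>\<eta>\<close>.\<close>

lemma inv_fourier_dense:
  fixes \<eta> :: "real ^ 'd \<Rightarrow> complex"
  assumes e: "\<epsilon> > 0" and \<eta>: "gauss_bounded \<eta>"
  obtains k where "\<And>n. gauss_bounded (k n)" "\<And>n. l2norm (k n) \<le> l2norm \<eta>"
    "(\<lambda>n. l2norm (\<lambda>x. invF \<epsilon> (k n) x - \<eta> x)) \<longlonglongrightarrow> 0"
proof -
  note [measurable] = gauss_bounded_measurable[OF \<eta>]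
  define c where "c n = (inverse (real (Suc n)) / (2 * \<epsilon>))^2" for n
  have c: "c n > 0" for n using e by (simp add: c_def)
  define k where "k n \<xi> = cr (exp (- c n * (norm \<xi>)^2)) * fourier \<epsilon> \<eta> \<xi>" for n and \<xi> :: "real^'d"
  have kgb: "gauss_bounded (k n)" for n unfolding k_def using fourier_bound[of \<epsilon> \<eta>] by (intro gauss_bounded_gauss[OF c]) auto
  have fsi: "L2 (fourier \<epsilon> \<eta>)" using e \<eta> by (rule fourier_square_integrable)
  have kle: "cmod (k n \<xi>) \<le> cmod (fourier \<epsilon> \<eta> \<xi>)" for n \<xi> using c[of n] by (simp add: k_def norm_mult mult_left_le_one_le)
  have kn: "l2norm (k n) \<le> l2norm \<eta>" for n
  proof -
    have "l2norm (k n) \<le> l2norm (fourier \<epsilon> \<eta>)" using kgb[of n] kle by (intro l2norm_mono(2)[OF fsi]) auto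
    then show ?thesis by (simp add: fourier_l2norm[OF e \<eta>])
  qed
  have lim: "(\<lambda>n. l2inner (k n) (fourier \<epsilon> \<eta>)) \<longlonglongrightarrow> l2inner (fourier \<epsilon> \<eta>) (fourier \<epsilon> \<eta>)" unfolding l2inner_def
  proof (rule integral_dominated_convergence[OF _ _ integrable_norm_mult[OF fsi fsi]])
    show "AE x in lborel. (\<lambda>n. cnj (k n x) * fourier \<epsilon> \<eta> x) \<longlonglongrightarrow> cnj (fourier \<epsilon> \<eta> x) * fourier \<epsilon> \<eta> x"
    proof (intro AE_I2 tendsto_mult_right tendsto_cnj)
      fix x :: "real ^ 'd"
      have "(\<lambda>n. k n x) \<longlonglongrightarrow> cr 1 * fourier \<epsilon> \<eta> x" unfolding k_def c_def by (intro tendsto_mult_right tendsto_of_real damping_tendsto e)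
      then show "(\<lambda>n. k n x) \<longlonglongrightarrow> fourier \<epsilon> \<eta> x" by simp
    qed
    show "AE x in lborel. norm (cnj (k n x) * fourier \<epsilon> \<eta> x) \<le> cmod (fourier \<epsilon> \<eta> x) * cmod (fourier \<epsilon> \<eta> x)" for n
      using kle by (intro AE_I2) (simp add: norm_mult mult_right_mono)
    show "(\<lambda>x. cnj (k n x) * fourier \<epsilon> \<eta> x) \<in> borel_measurable lborel" for n unfolding k_def by measurable
  qed measurable
  have le: "(l2norm (\<lambda>x. invF \<epsilon> (k n) x - \<eta> x))^2 \<le> 2 * (l2norm \<eta>)^2 - 2 * Re (l2inner (k n) (fourier \<epsilon> \<eta>))" for n
  proof -
    have a: "L2 (invF \<epsilon> (k n))" using e kgb by (rule inv_fourier_square_integrable)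
    have b: "L2 \<eta>" using \<eta> by (rule gauss_bounded_square_integrable)
    have p: "l2inner (invF \<epsilon> (k n)) \<eta> = l2inner (k n) (fourier \<epsilon> \<eta>)" using kgb \<eta> by (intro l2inner_inv_fourier gauss_bounded_integrable)
    have "l2inner (\<lambda>x. invF \<epsilon> (k n) x - \<eta> x) (\<lambda>x. invF \<epsilon> (k n) x - \<eta> x)
      = l2inner (invF \<epsilon> (k n)) (invF \<epsilon> (k n)) - l2inner (invF \<epsilon> (k n)) \<eta> - (l2inner \<eta> (invF \<epsilon> (k n)) - l2inner \<eta> \<eta>)"
      by (simp only: l2inner_diff_left l2inner_diff_right a b square_integrable_diff)
    note exp = this
    have "(l2norm (\<lambda>x. invF \<epsilon> (k n) x - \<eta> x))^2 = Re (l2inner (\<lambda>x. invF \<epsilon> (k n) x - \<eta> x) (\<lambda>x. invF \<epsilon> (k n) x - \<eta> x))"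
      by (simp add: l2inner_self)
    also have "\<dots> = (l2norm (invF \<epsilon> (k n)))^2 + (l2norm \<eta>)^2 - 2 * Re (l2inner (invF \<epsilon> (k n)) \<eta>)" using l2inner_commute[of \<eta> "invF \<epsilon> (k n)"]
      unfolding exp by (simp add: l2inner_self)
    also have "l2norm (invF \<epsilon> (k n)) = l2norm (k n)" using e kgb by (rule inv_fourier_l2norm)
    finally show ?thesis using power_mono[OF kn[of n], of 2] p by simp
  qed
  have "(\<lambda>n. 2 * (l2norm \<eta>)^2 - 2 * Re (l2inner (k n) (fourier \<epsilon> \<eta>))) \<longlonglongrightarrow> 2 * (l2norm \<eta>)^2 - 2 * Re (l2inner (fourier \<epsilon> \<eta>) (fourier \<epsilon> \<eta>))"
    by (intro tendsto_intros lim)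
  then have "(\<lambda>n. 2 * (l2norm \<eta>)^2 - 2 * Re (l2inner (k n) (fourier \<epsilon> \<eta>))) \<longlonglongrightarrow> 0" by (simp add: l2inner_self fourier_l2norm[OF e \<eta>])
  then have "(\<lambda>n. (l2norm (\<lambda>x. invF \<epsilon> (k n) x - \<eta> x))^2) \<longlonglongrightarrow> 0" by (rule Lim_null_comparison[rotated]) (use le in auto)
  then have "(\<lambda>n. sqrt ((l2norm (\<lambda>x. invF \<epsilon> (k n) x - \<eta> x))^2)) \<longlonglongrightarrow> sqrt 0" by (rule tendsto_real_sqrt)
  then show ?thesis using that[of k] kgb kn by simp
qed

text \<open>The exact solution and the approximation are both computed only in pairings with inverse
  transforms. Density extends such a bound to every Gaussian-bounded test function, and testing
  \<open>f\<close> with its own truncations turns it into a norm bound, since that pairing is the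
  squared norm of the truncation.\<close>

lemma l2norm_le_of_inv_fourier_pairing:
  fixes f :: "real ^ 'd \<Rightarrow> complex"
  assumes e: "\<epsilon> > 0" and f: "L2 f" and E: "E \<ge> 0"
    and bd: "\<And>k. gauss_bounded k \<Longrightarrow> cmod (l2inner (invF \<epsilon> k) f) \<le> E * l2norm k"
  shows "l2norm f \<le> E"
proof -
  note [measurable] = f[unfolded square_integrable_def, THEN conjunct1]
  have gb: "cmod (l2inner \<eta> f) \<le> E * l2norm \<eta>" if \<eta>: "gauss_bounded \<eta>" for \<eta>
  proof -
    obtain k where k: "\<And>n. gauss_bounded (k n)" "\<And>n. l2norm (k n) \<le> l2norm \<eta>"
      "(\<lambda>n. l2norm (\<lambda>x. invF \<epsilon> (k n) x - \<eta> x)) \<longlonglongrightarrow> 0" using inv_fourier_dense[OF e \<eta>] by blast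
    have si: "L2 (invF \<epsilon> (k n))" for n using e k(1) by (rule inv_fourier_square_integrable)
    have si2: "L2 \<eta>" using \<eta> by (rule gauss_bounded_square_integrable)
    have "cmod (l2inner \<eta> f) \<le> E * l2norm \<eta> + l2norm (\<lambda>x. invF \<epsilon> (k n) x - \<eta> x) * l2norm f" for n
    proof -
      have "l2inner \<eta> f = l2inner (invF \<epsilon> (k n)) f - l2inner (\<lambda>x. invF \<epsilon> (k n) x - \<eta> x) f" by (simp add: l2inner_diff_left si si2 f)
      also have "cmod \<dots> \<le> cmod (l2inner (invF \<epsilon> (k n)) f) + cmod (l2inner (\<lambda>x. invF \<epsilon> (k n) x - \<eta> x) f)" by (rule norm_triangle_ineq4)
      also have "cmod (l2inner (invF \<epsilon> (k n)) f) \<le> E * l2norm \<eta>" using bd[OF k(1)] mult_left_mono[OF k(2) E] by (rule order_trans)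
      also have "cmod (l2inner (\<lambda>x. invF \<epsilon> (k n) x - \<eta> x) f) \<le> l2norm (\<lambda>x. invF \<epsilon> (k n) x - \<eta> x) * l2norm f"
        by (intro l2inner_bound square_integrable_diff si si2 f)
      finally show ?thesis by simp
    qed
    moreover have "(\<lambda>n. E * l2norm \<eta> + l2norm (\<lambda>x. invF \<epsilon> (k n) x - \<eta> x) * l2norm f) \<longlonglongrightarrow> E * l2norm \<eta> + 0 * l2norm f"
      by (intro tendsto_intros k(3))
    ultimately show ?thesis using LIMSEQ_le_const by fastforce
  qed
  have tr: "l2norm (truncation n f) \<le> E" for n
  proof -
    have t: "gauss_bounded (truncation n f)" by (rule gauss_bounded_truncation) measurable
    have "l2inner (truncation n f) f = l2inner (truncation n f) (truncation n f)" unfolding l2inner_def by (intro Bochner_Integration.integral_cong refl) (simp add: truncation_def)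
    then have "(l2norm (truncation n f))^2 \<le> E * l2norm (truncation n f)" using gb[OF t] by (simp add: l2inner_self norm_power)
    then show ?thesis using E by (cases "l2norm (truncation n f) = 0") (auto simp: power2_eq_square mult_le_cancel_right less_le)
  qed
  have "l2norm f \<le> E + l2norm (\<lambda>x. truncation n f x - f x)" for n
  proof -
    have "l2norm f = l2norm (\<lambda>x. truncation n f x + -1 * (truncation n f x - f x))" by simp
    also have "\<dots> \<le> l2norm (truncation n f) + l2norm (\<lambda>x. -1 * (truncation n f x - f x))"
      by (intro l2norm_triangle square_integrable_cmult square_integrable_diff square_integrable_truncation f)
    also have "l2norm (\<lambda>x. -1 * (truncation n f x - f x)) = l2norm (\<lambda>x. truncation n f x - f x)" by (subst l2norm_cmult) simp
    finally show ?thesis using tr[of n] by simp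
  qed
  moreover have "(\<lambda>n. E + l2norm (\<lambda>x. truncation n f x - f x)) \<longlonglongrightarrow> E + 0" by (intro tendsto_intros l2norm_truncation_tendsto f)
  ultimately show ?thesis using LIMSEQ_le_const by fastforce
qed

section \<open>The weak Schroedinger equation with linear potential\<close>

text \<open>For parameter integrals a quadratic remainder is the natural certificate of
  differentiability: it follows from pointwise Taylor estimates under the integral sign.\<close>

lemma has_derivative_quadratic_remainder:
  fixes f :: "'a::real_normed_vector \<Rightarrow> 'b::real_normed_vector"
  assumes "bounded_linear f'" and r: "r > 0"
    and K: "\<And>y. norm (y - x) \<le> r \<Longrightarrow> norm (f y - f x - f' (y - x)) \<le> K * (norm (y - x))^2"
  shows "(f has_derivative f') (at x)" unfolding has_derivative_at_alt
proof (intro conjI allI impI assms(1))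
  fix e :: real assume e: "e > 0"
  define d where "d = min r (e / (\<bar>K\<bar> + 1))"
  have d: "d > 0" using e r by (simp add: d_def)
  have "norm (f y - f x - f' (y - x)) \<le> e * norm (y - x)" if y: "norm (y - x) < d" for y
  proof -
    have "norm (f y - f x - f' (y - x)) \<le> K * (norm (y - x))^2" using y by (intro K) (simp add: d_def)
    also have "\<dots> \<le> (\<bar>K\<bar> + 1) * (norm (y - x))^2" by (intro mult_right_mono) auto
    also have "\<dots> = ((\<bar>K\<bar> + 1) * norm (y - x)) * norm (y - x)" by (simp add: power2_eq_square)
    also have "\<dots> \<le> e * norm (y - x)"
    proof (rule mult_right_mono)
      have "norm (y - x) \<le> e / (\<bar>K\<bar> + 1)" using y by (simp add: d_def)
      then have "(\<bar>K\<bar> + 1) * norm (y - x) \<le> (\<bar>K\<bar> + 1) * (e / (\<bar>K\<bar> + 1))" by (intro mult_left_mono) auto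
      also have "\<dots> = e" by simp
      finally show "(\<bar>K\<bar> + 1) * norm (y - x) \<le> e" .
    qed simp
    finally show ?thesis .
  qed
  with d show "\<exists>d>0. \<forall>y. norm (y - x) < d \<longrightarrow> norm (f y - f x - f' (y - x)) \<le> e * norm (y - x)" by blast
qed

lemma cmod_iexp_minus_1: "cmod (iexp b - 1) \<le> \<bar>b\<bar>" using iexp_approx1[of b 0] by simp

lemma cmod_iexp_minus_linear: "cmod (iexp b - 1 - \<i> * cr b) \<le> b^2 / 2" using iexp_approx1[of b 1] by (simp add: numeral_2_eq_2 diff_diff_eq)

lemma gauss_bounded_moment_integrable:
  fixes h :: "'a::euclidean_space \<Rightarrow> complex"
  assumes h: "gauss_bounded h"
  shows "L1 (\<lambda>x. (1 + norm x) ^ n * cmod (h x))"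
proof -
  have "gauss_bounded (\<lambda>x. cr ((1 + norm x) ^ n) * h x)" by (rule gauss_bounded_mult_growth[OF h, where K=1 and n=n]) (measurable, simp only: norm_of_real, simp)
  from integrable_norm[OF gauss_bounded_integrable[OF this]]
  show ?thesis by (simp only: norm_mult norm_of_real) simp
qed

lemma gauss_bounded_mult_inner:
  fixes h :: "'a::euclidean_space \<Rightarrow> complex"
  assumes h: "gauss_bounded h"
  shows "gauss_bounded (\<lambda>\<xi>. (\<i> * cr (v \<bullet> \<xi> / \<epsilon>)) * h \<xi>)"
proof (rule gauss_bounded_mult_growth[OF h, where K="norm v / \<bar>\<epsilon>\<bar>" and n=1])
  fix \<xi>
  have "\<bar>v \<bullet> \<xi>\<bar> \<le> norm v * (1 + norm \<xi>)" using Cauchy_Schwarz_ineq2[of v \<xi>] by (rule order_trans) (simp add: mult_left_mono)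
  then show "cmod (\<i> * cr (v \<bullet> \<xi> / \<epsilon>)) \<le> norm v / \<bar>\<epsilon>\<bar> * (1 + norm \<xi>) ^ 1"
    by (simp only: norm_mult norm_ii mult_1_left norm_of_real abs_divide power_one_right times_divide_eq_left) (simp add: divide_right_mono)
qed measurable

text \<open>The second-order Taylor estimate of the exponential is used under the integral: the
  remainder is at most the squared norm of the increment times a second moment of \<open>h\<close>,
  finite by the Gaussian bound.\<close>

lemma inv_fourier_has_derivative:
  fixes h :: "real ^ 'd \<Rightarrow> complex"
  assumes h: "gauss_bounded h"
  shows "(invF \<epsilon> h has_derivative (\<lambda>v. invF \<epsilon> (\<lambda>\<xi>. (\<i> * cr (v \<bullet> \<xi> / \<epsilon>)) * h \<xi>) x)) (at x)"
proof (rule has_derivative_quadratic_remainder[where r=1])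
  note [measurable] = gauss_bounded_measurable[OF h]
  define c where "c = (2 * pi * \<epsilon>) powr (- (CARD('d) / 2))"
  define D where "D v \<xi> = (\<i> * cr (v \<bullet> \<xi> / \<epsilon>)) * h \<xi>" for v \<xi>
  define E where "E x \<xi> = iexp (x \<bullet> \<xi> / \<epsilon>)" for x \<xi> :: "real^'d"
  have [measurable]: "E x \<in> Borel" for x unfolding E_def by measurable
  have Eb: "cmod (E x \<xi>) = 1" for x \<xi> by (simp add: E_def)
  have I: "L1 (\<lambda>\<xi>. g \<xi> * E x \<xi>)" if "gauss_bounded g" for g x by (rule integrable_mult_bounded_left[OF gauss_bounded_integrable[OF that], where B=1]) (simp_all add: Eb)
  have Dg: "gauss_bounded (D v)" for v unfolding D_def by (rule gauss_bounded_mult_inner[OF h])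
  have inv: "invF \<epsilon> g x = cr c * (LINT \<xi>|lborel. g \<xi> * E x \<xi>)" for g x by (simp add: inv_fourier_def c_def E_def)
  have nD: "(LINT \<xi>|lborel. cmod (D v \<xi>)) \<le> norm v * ((LINT \<xi>|lborel. (1 + norm \<xi>) ^ 1 * cmod (h \<xi>)) / \<bar>\<epsilon>\<bar>)" for v
  proof -
    have "(LINT \<xi>|lborel. cmod (D v \<xi>)) \<le> (LINT \<xi>|lborel. norm v / \<bar>\<epsilon>\<bar> * ((1 + norm \<xi>) ^ 1 * cmod (h \<xi>)))"
    proof (rule integral_mono)
      show "L1 (\<lambda>\<xi>. cmod (D v \<xi>))" using gauss_bounded_integrable[OF Dg] by simp
      show "L1 (\<lambda>\<xi>. norm v / \<bar>\<epsilon>\<bar> * ((1 + norm \<xi>) ^ 1 * cmod (h \<xi>)))" by (intro integrable_mult_right gauss_bounded_moment_integrable h)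
      fix \<xi>
      have "\<bar>v \<bullet> \<xi>\<bar> \<le> norm v * (1 + norm \<xi>)" using Cauchy_Schwarz_ineq2[of v \<xi>] by (rule order_trans) (simp add: mult_left_mono)
      then have "\<bar>v \<bullet> \<xi>\<bar> / \<bar>\<epsilon>\<bar> * cmod (h \<xi>) \<le> norm v * (1 + norm \<xi>) / \<bar>\<epsilon>\<bar> * cmod (h \<xi>)"
        by (intro mult_right_mono divide_right_mono) auto
      then show "cmod (D v \<xi>) \<le> norm v / \<bar>\<epsilon>\<bar> * ((1 + norm \<xi>) ^ 1 * cmod (h \<xi>))"
        unfolding D_def norm_mult norm_ii mult_1_left norm_of_real abs_divide by (simp add: mult.assoc)
    qed
    then show ?thesis by (simp only: integral_mult_right_zero) simp
  qed
  have "bounded_linear (\<lambda>v. invF \<epsilon> (D v) x)"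
  proof (rule bounded_linear_intro)
    show "invF \<epsilon> (D (v + w)) x = invF \<epsilon> (D v) x + invF \<epsilon> (D w) x" for v w
    proof -
      have "D (v + w) \<xi> * E x \<xi> = D v \<xi> * E x \<xi> + D w \<xi> * E x \<xi>" for \<xi> by (simp add: D_def inner_add_left add_divide_distrib algebra_simps)
      then show ?thesis unfolding inv by (simp add: I Dg distrib_left)
    qed
    show "invF \<epsilon> (D (r *\<^sub>R v)) x = r *\<^sub>R invF \<epsilon> (D v) x" for r v
    proof -
      have "D (r *\<^sub>R v) \<xi> * E x \<xi> = cr r * (D v \<xi> * E x \<xi>)" for \<xi> by (simp add: D_def)
      then show ?thesis unfolding inv scaleR_conv_of_real[where 'a=complex] by (simp only: integral_mult_right_zero mult_ac)
    qed
    show "norm (invF \<epsilon> (D v) x) \<le> norm v * (c * ((LINT \<xi>|lborel. (1 + norm \<xi>) ^ 1 * cmod (h \<xi>)) / \<bar>\<epsilon>\<bar>))" for v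
    proof -
      have "norm (invF \<epsilon> (D v) x) \<le> c * (LINT \<xi>|lborel. cmod (D v \<xi>))" unfolding c_def by (rule inv_fourier_bound)
      also have "\<dots> \<le> c * (norm v * ((LINT \<xi>|lborel. (1 + norm \<xi>) ^ 1 * cmod (h \<xi>)) / \<bar>\<epsilon>\<bar>))" by (intro mult_left_mono nD) (simp add: c_def)
      finally show ?thesis by (simp only: mult.left_commute)
    qed
  qed
  then show "bounded_linear (\<lambda>v. invF \<epsilon> (\<lambda>\<xi>. (\<i> * cr (v \<bullet> \<xi> / \<epsilon>)) * h \<xi>) x)" unfolding D_def[abs_def] .
  fix y :: "real ^ 'd"
  define K where "K = c * ((LINT \<xi>|lborel. (1 + norm \<xi>) ^ 2 * cmod (h \<xi>)) / \<epsilon>^2)"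
  define v where "v = y - x"
  have "invF \<epsilon> h y - invF \<epsilon> h x - invF \<epsilon> (D v) x
     = cr c * (LINT \<xi>|lborel. h \<xi> * E y \<xi> - h \<xi> * E x \<xi> - D v \<xi> * E x \<xi>)" unfolding inv by (simp add: I h Dg algebra_simps)
  also have "cmod \<dots> \<le> c * (LINT \<xi>|lborel. (norm v)^2 / \<epsilon>^2 * ((1 + norm \<xi>) ^ 2 * cmod (h \<xi>)))" unfolding norm_mult
  proof (intro mult_mono lebesgue_integral_norm_le)
    show "L1 (\<lambda>\<xi>. (norm v)^2 / \<epsilon>^2 * ((1 + norm \<xi>) ^ 2 * cmod (h \<xi>)))" by (intro integrable_mult_right gauss_bounded_moment_integrable h)
    fix \<xi>
    have "E y \<xi> = E x \<xi> * iexp (v \<bullet> \<xi> / \<epsilon>)" by (simp add: E_def v_def inner_diff_left diff_divide_distrib right_diff_distrib flip: exp_add)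
    then have "h \<xi> * E y \<xi> - h \<xi> * E x \<xi> - D v \<xi> * E x \<xi> = h \<xi> * E x \<xi> * (iexp (v \<bullet> \<xi> / \<epsilon>) - 1 - \<i> * cr (v \<bullet> \<xi> / \<epsilon>))"
      by (simp add: D_def algebra_simps)
    then have "cmod (h \<xi> * E y \<xi> - h \<xi> * E x \<xi> - D v \<xi> * E x \<xi>) \<le> cmod (h \<xi>) * ((v \<bullet> \<xi> / \<epsilon>)^2 / 2)"
      by (simp only: norm_mult Eb mult_1_right) (intro mult_left_mono cmod_iexp_minus_linear, simp)
    also have "\<dots> \<le> cmod (h \<xi>) * ((norm v)^2 / \<epsilon>^2 * (1 + norm \<xi>) ^ 2)"
    proof (rule mult_left_mono)
      have "\<bar>v \<bullet> \<xi>\<bar> \<le> norm v * (1 + norm \<xi>)" using Cauchy_Schwarz_ineq2[of v \<xi>] by (rule order_trans) (simp add: mult_left_mono)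
      then have "(v \<bullet> \<xi>)^2 \<le> (norm v * (1 + norm \<xi>))^2" by (metis abs_ge_zero power2_abs power_mono)
      then have "(v \<bullet> \<xi>)^2 / \<epsilon>^2 \<le> (norm v * (1 + norm \<xi>))^2 / \<epsilon>^2" by (rule divide_right_mono) simp
      moreover have "0 \<le> (v \<bullet> \<xi>)^2 / \<epsilon>^2" by simp
      moreover have half: "a / 2 \<le> b" if "a \<le> b" "0 \<le> a" for a b :: real using that by simp
      ultimately show "(v \<bullet> \<xi> / \<epsilon>)^2 / 2 \<le> (norm v)^2 / \<epsilon>^2 * (1 + norm \<xi>) ^ 2"
        unfolding power_divide power_mult_distrib times_divide_eq_left by (intro half)
    qed simp
    finally show "cmod (h \<xi> * E y \<xi> - h \<xi> * E x \<xi> - D v \<xi> * E x \<xi>) \<le> (norm v)^2 / \<epsilon>^2 * ((1 + norm \<xi>) ^ 2 * cmod (h \<xi>))" by (simp only: mult_ac)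
  qed (simp_all add: c_def)
  also have "\<dots> = K * (norm v)^2" unfolding integral_mult_right_zero K_def by simp
  finally show "norm (invF \<epsilon> h y - invF \<epsilon> h x - invF \<epsilon> (\<lambda>\<xi>. (\<i> * cr ((y - x) \<bullet> \<xi> / \<epsilon>)) * h \<xi>) x) \<le> K * (norm (y - x))^2"
    unfolding v_def D_def[abs_def] .
qed simp

text \<open>A class that contains the damped transforms and is closed under differentiation: a
  derivative falls on the Gaussian and gives a linear factor in \<open>x\<close>, or on the
  transform and multiplies the symbol by a linear factor in the momentum. Schwartz estimates become
  inductions over the class.\<close>

inductive damped_transform :: "real \<Rightarrow> real \<Rightarrow> (real ^ 'd \<Rightarrow> complex) \<Rightarrow> bool" for \<epsilon> \<kappa> where
  base: "gauss_bounded z \<Longrightarrow> damped_transform \<epsilon> \<kappa> (\<lambda>x. cr (gs \<kappa> x) * invF \<epsilon> z x)"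
| add: "damped_transform \<epsilon> \<kappa> f \<Longrightarrow> damped_transform \<epsilon> \<kappa> g \<Longrightarrow> damped_transform \<epsilon> \<kappa> (\<lambda>x. f x + g x)"
| scale: "damped_transform \<epsilon> \<kappa> f \<Longrightarrow> damped_transform \<epsilon> \<kappa> (\<lambda>x. c * f x)"
| coord: "damped_transform \<epsilon> \<kappa> f \<Longrightarrow> damped_transform \<epsilon> \<kappa> (\<lambda>x. cr (x \<bullet> w) * f x)"

lemma damped_transform_derivative:
  fixes f :: "real ^ 'd \<Rightarrow> complex"
  assumes "damped_transform \<epsilon> \<kappa> f"
  shows "\<exists>f'. (\<forall>v. damped_transform \<epsilon> \<kappa> (f' v)) \<and> (\<forall>x. (f has_derivative (\<lambda>v. f' v x)) (at x))" using assms
proof induction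
  case (base z)
  let ?G = "\<lambda>x::real^'d. cr (gs \<kappa> x)"
  let ?D = "\<lambda>v \<xi>. (\<i> * cr (v \<bullet> \<xi> / \<epsilon>)) * z \<xi>"
  have G: "(?G has_derivative (\<lambda>v. cr (x \<bullet> ((- 2 * \<kappa>) *\<^sub>R v)) * ?G x)) (at x)" for x
  proof -
    have "((\<lambda>x. exp (- \<kappa> * (x \<bullet> x))) has_derivative (\<lambda>v. (x \<bullet> ((- 2 * \<kappa>) *\<^sub>R v)) * exp (- \<kappa> * (x \<bullet> x)))) (at x)"
      by (auto intro!: derivative_eq_intros simp: inner_commute algebra_simps)
    from has_derivative_of_real[OF this]
    show ?thesis unfolding power2_norm_eq_inner by simp
  qed
  have "((\<lambda>x. ?G x * invF \<epsilon> z x) has_derivative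
    (\<lambda>v. cr (x \<bullet> ((- 2 * \<kappa>) *\<^sub>R v)) * (?G x * invF \<epsilon> z x) + ?G x * invF \<epsilon> (?D v) x)) (at x)" for x
    using has_derivative_mult[OF G inv_fourier_has_derivative[OF base]] by (simp add: mult_ac add.commute)
  moreover have "damped_transform \<epsilon> \<kappa> (\<lambda>x. cr (x \<bullet> ((- 2 * \<kappa>) *\<^sub>R v)) * (?G x * invF \<epsilon> z x) + ?G x * invF \<epsilon> (?D v) x)" for v
    by (intro damped_transform.intros gauss_bounded_mult_inner base)
  ultimately show ?case by (intro exI[of _ "\<lambda>v x. cr (x \<bullet> ((- 2 * \<kappa>) *\<^sub>R v)) * (?G x * invF \<epsilon> z x) + ?G x * invF \<epsilon> (?D v) x"]) blast
next
  case (add f g)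
  then obtain f' g' where "\<And>v. damped_transform \<epsilon> \<kappa> (f' v)" "\<And>x. (f has_derivative (\<lambda>v. f' v x)) (at x)"
    "\<And>v. damped_transform \<epsilon> \<kappa> (g' v)" "\<And>x. (g has_derivative (\<lambda>v. g' v x)) (at x)" by blast
  then show ?case by (intro exI[of _ "\<lambda>v x. f' v x + g' v x"] conjI allI damped_transform.add has_derivative_add)
next
  case (scale f c)
  then obtain f' where "\<And>v. damped_transform \<epsilon> \<kappa> (f' v)" "\<And>x. (f has_derivative (\<lambda>v. f' v x)) (at x)" by blast
  then show ?case by (intro exI[of _ "\<lambda>v x. c * f' v x"] conjI allI damped_transform.scale has_derivative_mult_right)
next
  case (coord f w)
  then obtain f' where f': "\<And>v. damped_transform \<epsilon> \<kappa> (f' v)" "\<And>x. (f has_derivative (\<lambda>v. f' v x)) (at x)" by blast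
  have c: "((\<lambda>x. cr (x \<bullet> w)) has_derivative (\<lambda>v. cr (v \<bullet> w))) (at x)" for x by (intro has_derivative_of_real) (auto intro!: derivative_eq_intros)
  show ?case
  proof (intro exI[of _ "\<lambda>v x. cr (x \<bullet> w) * f' v x + cr (v \<bullet> w) * f x"] conjI allI)
    show "damped_transform \<epsilon> \<kappa> (\<lambda>x. cr (x \<bullet> w) * f' v x + cr (v \<bullet> w) * f x)" for v using f' coord by (intro damped_transform.intros)
    show "((\<lambda>x. cr (x \<bullet> w) * f x) has_derivative (\<lambda>v. cr (x \<bullet> w) * f' v x + cr (v \<bullet> w) * f x)) (at x)" for x by (rule has_derivative_mult[OF c f'(2)])
  qed
qed

lemma damped_transform_decay:
  fixes f :: "real ^ 'd \<Rightarrow> complex"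
  assumes "damped_transform \<epsilon> \<kappa> f" and \<kappa>: "\<kappa> > 0"
  shows "\<exists>C. \<forall>x. (1 + norm x) ^ m * cmod (f x) \<le> C" using assms(1)
proof (induction arbitrary: m)
  case (base z)
  obtain C where C: "C > 0" "\<And>r. r \<ge> 0 \<Longrightarrow> (1 + r) ^ m * exp (- \<kappa> * r^2) \<le> C" using power_times_gauss_bound[OF \<kappa>, of m] by blast
  define B where "B = (2 * pi * \<epsilon>) powr (- (CARD('d) / 2)) * (LINT x|lborel. cmod (z x))"
  have B: "cmod (invF \<epsilon> z x) \<le> B" for x unfolding B_def by (rule inv_fourier_bound)
  have "(1 + norm x) ^ m * cmod (cr (gs \<kappa> x) * invF \<epsilon> z x) \<le> C * B" for x
  proof -
    have "(1 + norm x) ^ m * cmod (cr (gs \<kappa> x) * invF \<epsilon> z x) = ((1 + norm x) ^ m * gs \<kappa> x) * cmod (invF \<epsilon> z x)" by (simp add: norm_mult)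
    also have "\<dots> \<le> C * B" using C B[of x] by (intro mult_mono) auto
    finally show ?thesis .
  qed
  then show ?case by blast
next
  case (add f g)
  then obtain C D where CD: "\<And>x. (1 + norm x) ^ m * cmod (f x) \<le> C" "\<And>x. (1 + norm x) ^ m * cmod (g x) \<le> D" by metis
  have "(1 + norm x) ^ m * cmod (f x + g x) \<le> C + D" for x
  proof -
    have "(1 + norm x) ^ m * cmod (f x + g x) \<le> (1 + norm x) ^ m * (cmod (f x) + cmod (g x))" by (intro mult_left_mono norm_triangle_ineq) simp
    also have "\<dots> \<le> C + D" using CD[of x] by (simp add: distrib_left)
    finally show ?thesis .
  qed
  then show ?case by blast
next
  case (scale f c)
  then obtain C where C: "\<And>x. (1 + norm x) ^ m * cmod (f x) \<le> C" by metis
  have "(1 + norm x) ^ m * cmod (c * f x) \<le> cmod c * C" for x using mult_left_mono[OF C[of x], of "cmod c"] by (simp add: norm_mult mult_ac)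
  then show ?case by blast
next
  case (coord f w)
  \<comment> \<open>The coordinate costs one power of the weight, hence the induction hypothesis is
    taken at \<open>Suc m\<close>; this is why \<open>m\<close> is generalised.\<close>
  then obtain C where C: "\<And>x. (1 + norm x) ^ Suc m * cmod (f x) \<le> C" by metis
  have "(1 + norm x) ^ m * cmod (cr (x \<bullet> w) * f x) \<le> norm w * C" for x
  proof -
    have "\<bar>x \<bullet> w\<bar> \<le> (1 + norm x) * norm w" using Cauchy_Schwarz_ineq2[of x w] by (rule order_trans) (simp add: mult_right_mono)
    then have "(1 + norm x) ^ m * (\<bar>x \<bullet> w\<bar> * cmod (f x)) \<le> (1 + norm x) ^ m * (((1 + norm x) * norm w) * cmod (f x))" by (intro mult_left_mono mult_right_mono) auto
    also have "\<dots> = norm w * ((1 + norm x) ^ Suc m * cmod (f x))" by simp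
    also have "\<dots> \<le> norm w * C" by (intro mult_left_mono C) simp
    finally show ?thesis by (simp add: norm_mult)
  qed
  then show ?case by blast
qed

lemma damped_transform_iter_deriv:
  fixes f :: "real ^ 'd \<Rightarrow> complex"
  assumes "damped_transform \<epsilon> \<kappa> f"
  shows "damped_transform \<epsilon> \<kappa> (iter_deriv vs f)"
proof (induction vs)
  case (Cons v vs)
  from damped_transform_derivative[OF Cons] obtain f' where
    f': "\<And>v. damped_transform \<epsilon> \<kappa> (f' v)" "\<And>x. (iter_deriv vs f has_derivative (\<lambda>v. f' v x)) (at x)" by blast
  have "iter_deriv (v # vs) f = f' v" using frechet_derivative_at[OF f'(2)] by (auto simp: fun_eq_iff)
  then show ?case using f'(1) by simp
qed (simp add: assms)

lemma schwartz_damped_transform: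
  fixes f :: "real ^ 'd \<Rightarrow> complex"
  assumes f: "damped_transform \<epsilon> \<kappa> f" and \<kappa>: "\<kappa> > 0"
  shows "schwartz f" unfolding schwartz_def smooth_def
proof (intro conjI allI impI)
  fix vs :: "(real ^ 'd) list" and x
  from damped_transform_derivative[OF damped_transform_iter_deriv[OF f, of vs]]
  show "iter_deriv vs f differentiable at x" unfolding differentiable_def by blast
next
  fix vs :: "(real ^ 'd) list" and m
  show "\<exists>C. \<forall>x. (1 + norm x) ^ m * norm (iter_deriv vs f x) \<le> C" by (rule damped_transform_decay[OF damped_transform_iter_deriv[OF f] \<kappa>])
qed

section \<open>Time derivatives of pairings with a moving test function\<close>

lemma has_vector_derivative_zeroI:
  fixes F :: "real \<Rightarrow> 'b::real_normed_vector"
  assumes F: "F s = 0" "\<And>s'. s' \<in> S \<Longrightarrow> norm (F s') \<le> \<bar>s' - s\<bar> * r s'" and r: "(r \<longlongrightarrow> 0) (at s within S)"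
  shows "(F has_vector_derivative 0) (at s within S)" unfolding has_vector_derivative_def has_derivative_within_alt
proof (intro conjI allI impI)
  show "bounded_linear (\<lambda>x. x *\<^sub>R (0::'b))" by (simp add: bounded_linear_zero)
  fix e :: real assume e: "e > 0"
  from tendstoD[OF r e] obtain d where d: "d > 0" "\<And>s'. s' \<in> S \<Longrightarrow> s' \<noteq> s \<Longrightarrow> dist s' s < d \<Longrightarrow> \<bar>r s'\<bar> < e"
    unfolding eventually_at by (auto simp: dist_real_def)
  have "norm (F y - F s - (y - s) *\<^sub>R 0) \<le> e * norm (y - s)" if y: "y \<in> S" "norm (y - s) < d" for y
  proof (cases "y = s")
    case False
    have "norm (F y) \<le> \<bar>y - s\<bar> * r y" using F(2)[OF y(1)] .
    also have "\<dots> \<le> \<bar>y - s\<bar> * e" using d(2)[OF y(1) False] y(2) by (intro mult_left_mono) (auto simp: dist_real_def)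
    finally show ?thesis using F(1) by (simp add: mult.commute)
  qed simp
  with d(1) show "\<exists>d>0. \<forall>y\<in>S. norm (y - s) < d \<longrightarrow> norm (F y - F s - (y - s) *\<^sub>R 0) \<le> e * norm (y - s)" by blast
qed

lemma l2norm_continuous_bounded:
  fixes \<psi> :: "real \<Rightarrow> 'a::euclidean_space \<Rightarrow> complex"
  assumes si: "\<And>t. t \<in> {0..tf} \<Longrightarrow> L2 (\<psi> t)"
    and c: "\<And>t. t \<in> {0..tf} \<Longrightarrow> ((\<lambda>s. l2norm (\<lambda>x. \<psi> s x - \<psi> t x)) \<longlongrightarrow> 0) (at t within {0..tf})"
  shows "\<exists>B>0. \<forall>t\<in>{0..tf}. l2norm (\<psi> t) \<le> B"
proof -
  have "continuous_on {0..tf} (\<lambda>t. l2norm (\<psi> t))" unfolding continuous_on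
  proof
    fix t assume t: "t \<in> {0..tf}"
    have ev: "eventually (\<lambda>s. norm (l2norm (\<psi> s) - l2norm (\<psi> t)) \<le> l2norm (\<lambda>x. \<psi> s x - \<psi> t x)) (at t within {0..tf})"
    proof (rule eventually_at_topological[THEN iffD2], intro exI[of _ UNIV] conjI ballI impI)
      fix s assume s: "s \<in> {0..tf}"
      have "l2norm (\<psi> s) \<le> l2norm (\<psi> t) + l2norm (\<lambda>x. \<psi> s x - \<psi> t x)" using l2norm_triangle[OF si[OF t] square_integrable_diff[OF si[OF s] si[OF t]]] by simp
      moreover have "l2norm (\<psi> t) \<le> l2norm (\<psi> s) + l2norm (\<lambda>x. \<psi> s x - \<psi> t x)"
        using l2norm_triangle[OF si[OF s] square_integrable_cmult[OF square_integrable_diff[OF si[OF s] si[OF t]], of "-1"]]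
          l2norm_cmult[of "-1" "\<lambda>x. \<psi> s x - \<psi> t x"] by simp
      ultimately show "norm (l2norm (\<psi> s) - l2norm (\<psi> t)) \<le> l2norm (\<lambda>x. \<psi> s x - \<psi> t x)" by simp
    qed auto
    show "((\<lambda>t. l2norm (\<psi> t)) \<longlongrightarrow> l2norm (\<psi> t)) (at t within {0..tf})" by (rule LIM_zero_cancel, rule Lim_null_comparison[OF ev c[OF t]])
  qed
  from compact_imp_bounded[OF compact_continuous_image[OF this]] obtain B where "\<forall>x\<in>(\<lambda>t. l2norm (\<psi> t)) ` {0..tf}. norm x \<le> B" unfolding bounded_iff by auto
  then have "\<forall>t\<in>{0..tf}. l2norm (\<psi> t) \<le> max B 1" by (auto simp: le_max_iff_disj)
  then show ?thesis by (intro exI[of _ "max B 1"]) auto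
qed

lemma l2inner_has_vector_derivative:
  fixes \<psi> \<eta> :: "real \<Rightarrow> 'a::euclidean_space \<Rightarrow> complex"
  assumes \<psi>: "\<And>t. t \<in> {0..tf} \<Longrightarrow> L2 (\<psi> t)"
    and c: "\<And>t. t \<in> {0..tf} \<Longrightarrow> ((\<lambda>s. l2norm (\<lambda>x. \<psi> s x - \<psi> t x)) \<longlongrightarrow> 0) (at t within {0..tf})"
    and \<eta>: "\<And>t. t \<in> {0..tf} \<Longrightarrow> L2 (\<eta> t)"
    and D: "L2 D" and s: "s \<in> {0..tf}"
    and K: "\<And>s'. s' \<in> {0..tf} \<Longrightarrow> l2norm (\<lambda>x. \<eta> s' x - \<eta> s x - cr (s' - s) * D x) \<le> K * (s' - s)^2"
    and d: "((\<lambda>s'. l2inner (\<eta> s) (\<psi> s')) has_vector_derivative d) (at s within {0..tf})"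
  shows "((\<lambda>s'. l2inner (\<eta> s') (\<psi> s')) has_vector_derivative (l2inner D (\<psi> s) + d)) (at s within {0..tf})"
proof -
  obtain B where B: "B > 0" "\<And>t. t \<in> {0..tf} \<Longrightarrow> l2norm (\<psi> t) \<le> B" using l2norm_continuous_bounded[of tf \<psi>, OF \<psi> c] by blast
  define R where "R s' = (\<lambda>x. \<eta> s' x - \<eta> s x - cr (s' - s) * D x)" for s'
  have Rsi: "L2 (R s')" if "s' \<in> {0..tf}" for s' unfolding R_def using that s by (intro square_integrable_diff square_integrable_cmult \<eta> D)
  have 1: "((\<lambda>s'. l2inner (R s') (\<psi> s')) has_vector_derivative 0) (at s within {0..tf})"
  proof (rule has_vector_derivative_zeroI)
    show "l2inner (R s) (\<psi> s) = 0" by (simp add: R_def l2inner_def)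
    show "norm (l2inner (R s') (\<psi> s')) \<le> \<bar>s' - s\<bar> * (\<bar>s' - s\<bar> * \<bar>K\<bar> * B)" if "s' \<in> {0..tf}" for s'
    proof -
      have "norm (l2inner (R s') (\<psi> s')) \<le> l2norm (R s') * l2norm (\<psi> s')" by (rule l2inner_bound[OF Rsi[OF that] \<psi>[OF that]])
      also have "\<dots> \<le> (\<bar>K\<bar> * (s' - s)^2) * B"
      proof (intro mult_mono B that)
        show "l2norm (R s') \<le> \<bar>K\<bar> * (s' - s)^2" using K[OF that] unfolding R_def by (rule order_trans) (intro mult_right_mono, auto)
      qed auto
      also have "\<dots> = \<bar>s' - s\<bar> * (\<bar>s' - s\<bar> * \<bar>K\<bar> * B)" by (subst power2_abs[symmetric]) (simp add: power2_eq_square)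
      finally show ?thesis .
    qed
    have "((\<lambda>s'. \<bar>s' - s\<bar> * \<bar>K\<bar> * B) \<longlongrightarrow> \<bar>s - s\<bar> * \<bar>K\<bar> * B) (at s within {0..tf})" by (intro tendsto_intros)
    then show "((\<lambda>s'. \<bar>s' - s\<bar> * \<bar>K\<bar> * B) \<longlongrightarrow> 0) (at s within {0..tf})" by simp
  qed
  have 2: "((\<lambda>s'. cr (s' - s) * l2inner D (\<lambda>x. \<psi> s' x - \<psi> s x)) has_vector_derivative 0) (at s within {0..tf})"
  proof (rule has_vector_derivative_zeroI)
    show "norm (cr (s' - s) * l2inner D (\<lambda>x. \<psi> s' x - \<psi> s x)) \<le> \<bar>s' - s\<bar> * (l2norm D * l2norm (\<lambda>x. \<psi> s' x - \<psi> s x))" if "s' \<in> {0..tf}" for s'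
    proof -
      have "norm (l2inner D (\<lambda>x. \<psi> s' x - \<psi> s x)) \<le> l2norm D * l2norm (\<lambda>x. \<psi> s' x - \<psi> s x)"
        by (intro l2inner_bound D square_integrable_diff \<psi> that s)
      then show ?thesis unfolding norm_mult norm_of_real by (intro mult_left_mono) auto
    qed
    show "((\<lambda>s'. l2norm D * l2norm (\<lambda>x. \<psi> s' x - \<psi> s x)) \<longlongrightarrow> 0) (at s within {0..tf})" using tendsto_mult_left[OF c[OF s], of "l2norm D"] by simp
  qed simp
  have 3: "((\<lambda>s'. cr (s' - s) * l2inner D (\<psi> s)) has_vector_derivative l2inner D (\<psi> s)) (at s within {0..tf})"
    by (auto intro!: derivative_eq_intros simp: scaleR_conv_of_real)
  have sum: "((\<lambda>s'. l2inner (R s') (\<psi> s') + cr (s' - s) * l2inner D (\<lambda>x. \<psi> s' x - \<psi> s x) + cr (s' - s) * l2inner D (\<psi> s) + l2inner (\<eta> s) (\<psi> s'))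
     has_vector_derivative (0 + 0 + l2inner D (\<psi> s) + d)) (at s within {0..tf})" by (intro has_vector_derivative_add 1 2 3 d)
  have eq: "l2inner (R s') (\<psi> s') + cr (s' - s) * l2inner D (\<lambda>x. \<psi> s' x - \<psi> s x) + cr (s' - s) * l2inner D (\<psi> s) + l2inner (\<eta> s) (\<psi> s') = l2inner (\<eta> s') (\<psi> s')" if "s' \<in> {0..tf}" for s'
  proof -
    have "l2inner (R s') (\<psi> s') = l2inner (\<eta> s') (\<psi> s') - l2inner (\<eta> s) (\<psi> s') - cr (s' - s) * l2inner D (\<psi> s')"
      unfolding R_def using \<eta>[OF that] \<eta>[OF s] \<psi>[OF that] D
      by (simp add: l2inner_diff_left square_integrable_diff square_integrable_cmult l2inner_cmult_left del: of_real_diff)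
    then show ?thesis unfolding l2inner_diff_right[OF D \<psi>[OF that] \<psi>[OF s]] by (simp only:) (simp add: algebra_simps)
  qed
  show ?thesis using has_vector_derivative_transform[OF s eq[symmetric] sum] by simp
qed

lemma inv_fourier_diff:
  fixes f g :: "real ^ 'd \<Rightarrow> complex"
  assumes "L1 f" "L1 g"
  shows "invF \<epsilon> (\<lambda>\<xi>. f \<xi> - g \<xi>) x = invF \<epsilon> f x - invF \<epsilon> g x"
proof -
  have I: "L1 (\<lambda>\<xi>. h \<xi> * iexp (x \<bullet> \<xi> / \<epsilon>))" if "L1 h" for h :: "real ^ 'd \<Rightarrow> complex"
    by (rule integrable_mult_bounded_left[OF that, where B=1]) simp_all
  show ?thesis unfolding inv_fourier_def left_diff_distrib by (subst lint_diff[OF I[OF assms(1)] I[OF assms(2)]]) (simp only: right_diff_distrib)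
qed

lemma inv_fourier_shift:
  fixes h :: "real ^ 'd \<Rightarrow> complex"
  shows "invF \<epsilon> (\<lambda>\<xi>. h (\<xi> + a)) x = miexp (x \<bullet> a / \<epsilon>) * invF \<epsilon> h x"
proof -
  define E where "E \<xi> = iexp (x \<bullet> \<xi> / \<epsilon>)" for \<xi>
  have E: "E (- a + \<xi>) = miexp (x \<bullet> a / \<epsilon>) * E \<xi>" for \<xi> by (simp add: E_def inner_diff_right diff_divide_distrib right_diff_distrib flip: exp_add)
  have "(LINT \<xi>|lborel. h (\<xi> + a) * E \<xi>) = (LINT \<xi>|lborel. h \<xi> * E (- a + \<xi>))"
    using lborel_affine_integral[of 1 "\<lambda>\<xi>. h (\<xi> + a) * E \<xi>" "- a"] by simp
  also have "\<dots> = (LINT \<xi>|lborel. miexp (x \<bullet> a / \<epsilon>) * (h \<xi> * E \<xi>))" unfolding E by (simp only: mult.left_commute)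
  also have "\<dots> = miexp (x \<bullet> a / \<epsilon>) * (LINT \<xi>|lborel. h \<xi> * E \<xi>)" by (rule integral_mult_right_zero)
  finally show ?thesis unfolding inv_fourier_def E_def[symmetric] by (simp only: mult.left_commute)
qed

text \<open>Differentiating the damped test function in time produces the mollification of
  \<open>T\<close> times a symbol, whereas the Hamiltonian applied to it produces \<open>T\<close>
  times the mollified symbol. Their difference is governed by the increment of \<open>T\<close> over
  a distance \<open>\<nu> * norm u\<close>. The factor 2 comes from bounding the sum of the weights
  at both points by \<open>2 * ((1 + norm \<xi>) * (1 + norm u))\<close>; the growth in
  \<open>\<xi>\<close> is carried by \<open>G\<close>. The constant sees \<open>y\<close> only
  through its Gaussian bound, as it has to serve along a whole curve of symbols.\<close>

lemma mollify_commutator_bound: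
  fixes T :: "real ^ 'd \<Rightarrow> real"
  assumes C: "0 < C" "0 < c" and Tm[measurable]: "T \<in> Borel" and L: "L \<ge> 0"
    and T: "\<And>a b. \<bar>T a - T b\<bar> \<le> L * norm (a - b) * (1 + norm a + norm b)"
    and Tg: "\<And>a. \<bar>T a\<bar> \<le> M * (1 + norm a) ^ 2"
  shows "\<exists>K>0. \<forall>y \<nu>. y \<in> Borel \<longrightarrow> (\<forall>x. cmod (y x) \<le> C * gs c x) \<longrightarrow> 0 < \<nu> \<longrightarrow> \<nu> \<le> 1 \<longrightarrow>
    l2norm (\<lambda>\<xi>. gauss_mollify \<nu> (\<lambda>\<zeta>. cr (T \<zeta>) * y \<zeta>) \<xi> - cr (T \<xi>) * gauss_mollify \<nu> y \<xi>) \<le> K * \<nu>"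
proof -
  define c' where "c' = min (c / 2) (1 / 4)"
  have c': "c' > 0" using C by (simp add: c'_def)
  define J where "J = (LINT u|lborel. (1 + norm (u::real^'d)) ^ 2 * gs (1/2) u)"
  have Ji: "L1 (\<lambda>u::real^'d. (1 + norm u) ^ 2 * gs (1/2) u)" by (rule gauss_moment_integrable) simp
  have J: "J \<ge> 0" unfolding J_def by simp
  define g where "g \<xi> = cr (gs c' \<xi>) * cr 1" for \<xi> :: "real^'d"
  have gg: "gauss_bounded (\<lambda>\<xi>::real^'d. cr (1 + norm \<xi>) * g \<xi>)"
    unfolding g_def by (rule gauss_bounded_mult_growth[OF gauss_bounded_gauss[OF c', where B=1], where K=1 and n=1]) (simp_all add: power_one_right del: of_real_add)
  define G where "G \<xi> = cr (1 + norm \<xi>) * g \<xi>" for \<xi> :: "real^'d"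
  have Gn: "cmod (G \<xi>) = (1 + norm \<xi>) * gs c' \<xi>" for \<xi> unfolding G_def g_def norm_mult norm_of_real by simp
  define A where "A = pi powr (- (CARD('d) / 2)) * (2 * L * C) * J"
  have A: "A \<ge> 0" using L C J by (simp add: A_def)
  have "l2norm (\<lambda>\<xi>. gauss_mollify \<nu> (\<lambda>\<zeta>. cr (T \<zeta>) * y \<zeta>) \<xi> - cr (T \<xi>) * gauss_mollify \<nu> y \<xi>) \<le> (A * l2norm G + 1) * \<nu>"
    if y[measurable]: "y \<in> Borel" and yb: "\<And>x. cmod (y x) \<le> C * gs c x" and l: "0 < \<nu>" "\<nu> \<le> 1" for y \<nu>
  proof -
    let ?d = "\<lambda>\<xi>. gauss_mollify \<nu> (\<lambda>\<zeta>. cr (T \<zeta>) * y \<zeta>) \<xi> - cr (T \<xi>) * gauss_mollify \<nu> y \<xi>"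
    have yg: "gauss_bounded y" by (rule gauss_boundedI[OF y C(2) yb])
    have Tyg: "gauss_bounded (\<lambda>\<zeta>. cr (T \<zeta>) * y \<zeta>)" by (rule gauss_bounded_mult_growth[OF yg, where K=M and n=2]) (use Tg in simp_all)
    have I: "L1 (\<lambda>u. cr (exp (- (norm u)\<^sup>2)) * z (\<xi> - \<nu> *\<^sub>R u))" if zg: "gauss_bounded z" for z \<xi>
    proof -
      obtain B where B: "\<And>x. cmod (z x) \<le> B" using gauss_bounded_bounded[OF zg] by blast
      note [measurable] = gauss_bounded_measurable[OF zg]
      show ?thesis by (rule integrable_mult_bounded_left[OF gauss_complex_integrable1, where B=B]) (use B in simp_all)
    qed
    have pt: "cmod (?d \<xi>) \<le> A * \<nu> * cmod (G \<xi>)" for \<xi>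
    proof -
      let ?p = "pi powr (- (CARD('d) / 2))"
      have deq: "?d \<xi> = cr ?p * (LINT u|lborel. cr (exp (- (norm u)\<^sup>2)) * (cr (T (\<xi> - \<nu> *\<^sub>R u)) * y (\<xi> - \<nu> *\<^sub>R u)) - cr (T \<xi>) * (cr (exp (- (norm u)\<^sup>2)) * y (\<xi> - \<nu> *\<^sub>R u)))"
        unfolding gauss_mollify_def using I[OF Tyg] I[OF yg] by (subst lint_diff) (auto simp: algebra_simps)
      have "cmod (?d \<xi>) \<le> ?p * (LINT u|lborel. (2 * L * C * \<nu> * cmod (G \<xi>)) * ((1 + norm (u::real^'d)) ^ 2 * gs (1/2) u))" unfolding deq norm_mult norm_of_real
      proof (intro mult_mono lebesgue_integral_norm_le)
        show "L1 (\<lambda>u::real^'d. (2 * L * C * \<nu> * cmod (G \<xi>)) * ((1 + norm u) ^ 2 * gs (1/2) u))" by (intro integrable_mult_right Ji)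
        fix u :: "real ^ 'd"
        have weq: "cr (exp (- (norm u)\<^sup>2)) * (cr (T (\<xi> - \<nu> *\<^sub>R u)) * y (\<xi> - \<nu> *\<^sub>R u)) - cr (T \<xi>) * (cr (exp (- (norm u)\<^sup>2)) * y (\<xi> - \<nu> *\<^sub>R u))
          = cr (T (\<xi> - \<nu> *\<^sub>R u) - T \<xi>) * (cr (exp (- (norm u)\<^sup>2)) * y (\<xi> - \<nu> *\<^sub>R u))" by (simp add: algebra_simps)
        have "cmod (cr (T (\<xi> - \<nu> *\<^sub>R u) - T \<xi>) * (cr (exp (- (norm u)\<^sup>2)) * y (\<xi> - \<nu> *\<^sub>R u))) = \<bar>T (\<xi> - \<nu> *\<^sub>R u) - T \<xi>\<bar> * (exp (- (norm u)\<^sup>2) * cmod (y (\<xi> - \<nu> *\<^sub>R u)))"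
          by (simp only: norm_mult norm_of_real) simp
        also have "\<dots> \<le> (\<nu> * (2 * L) * (1 + norm \<xi>) * (1 + norm u) ^ 2) * (C * gs c' \<xi> * gs (1/2) u)"
        proof (rule mult_mono)
          show "exp (- (norm u)\<^sup>2) * cmod (y (\<xi> - \<nu> *\<^sub>R u)) \<le> C * gs c' \<xi> * gs (1/2) u" unfolding c'_def by (rule gauss_bounded_convolution_bound[OF C yb l])
          have n1: "norm (\<nu> *\<^sub>R u) \<le> norm u" using l by (simp add: mult_left_le_one_le)
          have "norm (\<xi> - \<nu> *\<^sub>R u) \<le> norm \<xi> + norm u" using norm_triangle_ineq4[of \<xi> "\<nu> *\<^sub>R u"] n1 by linarith
          then have "1 + norm (\<xi> - \<nu> *\<^sub>R u) + norm \<xi> \<le> 2 * ((1 + norm \<xi>) * (1 + norm u))"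
          proof -
            have "2 * ((1 + norm \<xi>) * (1 + norm u)) = 2 + 2 * norm \<xi> + 2 * norm u + 2 * (norm \<xi> * norm u)" by (simp add: algebra_simps)
            moreover have "0 \<le> norm \<xi> * norm u" by simp
            ultimately show ?thesis using \<open>norm (\<xi> - \<nu> *\<^sub>R u) \<le> norm \<xi> + norm u\<close> norm_ge_zero[of \<xi>] norm_ge_zero[of u] by linarith
          qed
          then have "(L * (\<nu> * norm u)) * (1 + norm (\<xi> - \<nu> *\<^sub>R u) + norm \<xi>) \<le> (L * (\<nu> * (1 + norm u))) * (2 * ((1 + norm \<xi>) * (1 + norm u)))"
            using L l by (intro mult_mono mult_left_mono) auto
          moreover have "\<bar>T (\<xi> - \<nu> *\<^sub>R u) - T \<xi>\<bar> \<le> (L * (\<nu> * norm u)) * (1 + norm (\<xi> - \<nu> *\<^sub>R u) + norm \<xi>)"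
            using T[of "\<xi> - \<nu> *\<^sub>R u" \<xi>] l by simp
          moreover have "(L * (\<nu> * (1 + norm u))) * (2 * ((1 + norm \<xi>) * (1 + norm u))) = \<nu> * (2 * L) * (1 + norm \<xi>) * (1 + norm u) ^ 2"
            by (simp only: power2_eq_square mult_ac)
          ultimately show "\<bar>T (\<xi> - \<nu> *\<^sub>R u) - T \<xi>\<bar> \<le> \<nu> * (2 * L) * (1 + norm \<xi>) * (1 + norm u) ^ 2" by linarith
        qed (use L l C in auto)
        also have "\<dots> = (2 * L * C * \<nu> * cmod (G \<xi>)) * ((1 + norm u) ^ 2 * gs (1/2) u)" unfolding Gn by (simp only: mult_ac)
        finally show "cmod (cr (exp (- (norm u)\<^sup>2)) * (cr (T (\<xi> - \<nu> *\<^sub>R u)) * y (\<xi> - \<nu> *\<^sub>R u)) - cr (T \<xi>) * (cr (exp (- (norm u)\<^sup>2)) * y (\<xi> - \<nu> *\<^sub>R u))) \<le> \<dots>" unfolding weq .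
      qed auto
      also have "(LINT u|lborel. (2 * L * C * \<nu> * cmod (G \<xi>)) * ((1 + norm (u::real^'d)) ^ 2 * gs (1/2) u)) = (2 * L * C * \<nu> * cmod (G \<xi>)) * J"
        unfolding J_def by (rule integral_mult_right_zero)
      also have "?p * ((2 * L * C * \<nu> * cmod (G \<xi>)) * J) = A * \<nu> * cmod (G \<xi>)" by (simp add: A_def)
      finally show ?thesis .
    qed
    have Gsi: "L2 G" unfolding G_def by (rule gauss_bounded_square_integrable[OF gg])
    have "l2norm ?d \<le> l2norm (\<lambda>\<xi>. cr (A * \<nu>) * G \<xi>)"
    proof (rule l2norm_mono(2)[OF square_integrable_cmult[OF Gsi]])
      show "?d \<in> Borel" by measurable
      show "cmod (?d \<xi>) \<le> cmod (cr (A * \<nu>) * G \<xi>)" for \<xi> using pt[of \<xi>] A l by (simp only: norm_mult norm_of_real) (simp add: abs_mult)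
    qed
    also have "\<dots> = A * \<nu> * l2norm G" using A l by (simp only: l2norm_cmult norm_of_real) (simp add: abs_mult)
    also have "\<dots> \<le> (A * l2norm G + 1) * \<nu>" using l by (simp add: algebra_simps)
    finally show ?thesis .
  qed
  moreover have "A * l2norm G + 1 > 0" using A by (simp add: add_nonneg_pos)
  ultimately show ?thesis by blast
qed

lemma l2inner_damped_tendsto:
  fixes f g :: "real ^ 'd \<Rightarrow> complex"
  assumes e: "\<epsilon> > 0" and f: "L2 f" and g: "L2 g"
  shows "(\<lambda>n. l2inner (\<lambda>x. cr (gs ((inverse (real (Suc n)) / (2 * \<epsilon>))^2) x) * f x) g) \<longlonglongrightarrow> l2inner f g" unfolding l2inner_def
proof (rule integral_dominated_convergence[OF _ _ integrable_norm_mult[OF f g]])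
  note [measurable] = f[unfolded square_integrable_def, THEN conjunct1] g[unfolded square_integrable_def, THEN conjunct1]
  let ?G = "\<lambda>n x. cr (gs ((inverse (real (Suc n)) / (2 * \<epsilon>))^2) (x::real^'d))"
  show "AE x in lborel. (\<lambda>n. cnj (?G n x * f x) * g x) \<longlonglongrightarrow> cnj (f x) * g x"
  proof (intro AE_I2 tendsto_mult_right tendsto_cnj)
    fix x
    have "(\<lambda>n. ?G n x * f x) \<longlonglongrightarrow> cr 1 * f x" by (intro tendsto_mult_right tendsto_of_real damping_tendsto e)
    then show "(\<lambda>n. ?G n x * f x) \<longlonglongrightarrow> f x" by (simp only: of_real_1 mult_1_left)
  qed
  show "AE x in lborel. norm (cnj (?G n x * f x) * g x) \<le> cmod (f x) * cmod (g x)" for n by (intro AE_I2) (auto simp: norm_mult mult_right_mono mult_left_le_one_le)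
  show "(\<lambda>x. cnj (?G n x * f x) * g x) \<in> borel_measurable lborel" for n by measurable
  show "(\<lambda>x. cnj (f x) * g x) \<in> borel_measurable lborel" by measurable
qed

text \<open>In the application \<open>D\<close> is the exact increment of a phase and
  \<open>b\<close> its linearisation in time, so the error has a quadratic part and a linearisation
  part.\<close>

lemma iexp_taylor_bound:
  "cmod (iexp D - 1 - \<i> * cr b) \<le> D^2 / 2 + \<bar>D - b\<bar>"
proof -
  have "iexp D - 1 - \<i> * cr b = (iexp D - 1 - \<i> * cr D) + \<i> * cr (D - b)" by (simp add: algebra_simps)
  also have "cmod \<dots> \<le> cmod (iexp D - 1 - \<i> * cr D) + cmod (\<i> * cr (D - b))" by (rule norm_triangle_ineq)
  also have "cmod (\<i> * cr (D - b)) = \<bar>D - b\<bar>" by (simp only: norm_mult norm_ii norm_of_real mult_1_left)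
  finally show ?thesis using cmod_iexp_minus_linear[of D] by linarith
qed

text \<open>The test function is moved along the flow of the equation: in momentum variables this is
  a translation by multiples of \<open>c1\<close> together with an explicit phase, so its pairing
  with the solution should not depend on time. To be an admissible Schwartz function it is damped in
  position; the derivative of the damped pairing is then a commutator of size \<open>\<nu>\<close>,
  and the identity appears as \<open>\<nu>\<close> tends to 0.\<close>

lemma exact_solution_pairing:
  fixes T :: "real ^ 'd \<Rightarrow> real" and \<Theta> :: "real \<Rightarrow> real ^ 'd \<Rightarrow> real" and c1 :: "real ^ 'd"
  assumes e: "\<epsilon> > 0" and tf: "tf > 0"
    and Tm[measurable]: "T \<in> Borel" and L: "L \<ge> 0"
    and T: "\<And>a b. \<bar>T a - T b\<bar> \<le> L * norm (a - b) * (1 + norm a + norm b)"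
    and \<Theta>0: "\<And>\<xi>. \<Theta> 0 \<xi> = 0" and \<Theta>m[measurable]: "\<And>s. \<Theta> s \<in> Borel"
    and K: "K \<ge> 0" and \<Theta>d: "\<And>s s' \<xi>. s \<in> {0..tf} \<Longrightarrow> s' \<in> {0..tf} \<Longrightarrow>
      \<bar>\<Theta> s' \<xi> - \<Theta> s \<xi> - (s' - s) * T (\<xi> - s *\<^sub>R c1)\<bar> \<le> K * (1 + norm \<xi>) * (s' - s)^2"
    and sol: "schroedinger_solution \<epsilon> T (\<lambda>x. c0 + c1 \<bullet> x) tf \<phi> \<psi>" and \<phi>: "\<phi> \<in> Borel"
    and k: "gauss_bounded k" and t: "t \<in> {0..tf}"
  shows "l2inner (\<lambda>x. exp (- (\<i> * cr (t * (c0 + c1 \<bullet> x) / \<epsilon>))) * invF \<epsilon> k x) (\<psi> t)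
       = l2inner (invF \<epsilon> (\<lambda>\<xi>. iexp (\<Theta> t \<xi> / \<epsilon>) * k \<xi>)) \<phi>"
proof -
  have \<psi>: "\<And>s. s \<in> {0..tf} \<Longrightarrow> L2 (\<psi> s)"
    and cont: "\<And>s. s \<in> {0..tf} \<Longrightarrow> ((\<lambda>s'. l2norm (\<lambda>x. \<psi> s' x - \<psi> s x)) \<longlongrightarrow> 0) (at s within {0..tf})"
    and init: "AE x in lborel. \<psi> 0 x = \<phi> x"
    and weak: "\<And>\<eta> s. schwartz \<eta> \<Longrightarrow> s \<in> {0..tf} \<Longrightarrow> \<exists>D. ((\<lambda>s. l2inner \<eta> (\<psi> s)) has_vector_derivative D) (at s within {0..tf}) \<and>
           \<i> * cr \<epsilon> * D = l2inner (\<lambda>x. fourier_multiplier \<epsilon> T \<eta> x + cr (c0 + c1 \<bullet> x) * \<eta> x) (\<psi> s)"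
    using sol unfolding schroedinger_solution_def by blast+
  obtain B where B: "B > 0" "\<And>s. s \<in> {0..tf} \<Longrightarrow> l2norm (\<psi> s) \<le> B" using l2norm_continuous_bounded[of tf \<psi>, OF \<psi> cont] by blast
  define V where "V x = c0 + c1 \<bullet> x" for x :: "real ^ 'd"
  have [measurable]: "V \<in> Borel" unfolding V_def by measurable
  \<comment> \<open>The phase of the final time is built into the symbol. At time \<open>t\<close>
    the phases cancel and only the gauge factor is left beside \<open>k\<close>, while at time 0 the
    multiplier remains.\<close>
  define k' where "k' \<xi> = iexp (\<Theta> t \<xi> / \<epsilon>) * k \<xi>" for \<xi>
  have k'g: "gauss_bounded k'" unfolding k'_def by (rule gauss_bounded_mult_bounded[OF k, where K=1]) simp_all
  note [measurable] = gauss_bounded_measurable[OF k'g] gauss_bounded_measurable[OF k]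
  define M where "M = \<bar>T 0\<bar> + L"
  have Tg: "\<bar>T a\<bar> \<le> M * (1 + norm a) ^ 2" for a
  proof -
    have "\<bar>T a\<bar> \<le> \<bar>T 0\<bar> + \<bar>T a - T 0\<bar>" by simp
    also have "\<dots> \<le> \<bar>T 0\<bar> * 1 + L * (norm a * (1 + norm a))" using T[of a 0] by (simp add: mult.assoc)
    also have "\<dots> \<le> \<bar>T 0\<bar> * (1 + norm a) ^ 2 + L * (1 + norm a) ^ 2" using L by (intro add_mono mult_left_mono) (auto simp: power2_eq_square algebra_simps)
    finally show ?thesis by (simp add: M_def algebra_simps)
  qed
  have M: "M \<ge> 0" using L by (simp add: M_def)
  \<comment> \<open>Momenta drift with velocity \<open>- c1\<close>, so
    \<open>\<zeta> + s *\<^sub>R c1\<close> is the initial momentum of the trajectory that is at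
    \<open>\<zeta>\<close> at time \<open>s\<close>. The added phase has modulus 1.\<close>
  define y where "y s \<zeta> = exp (- (\<i> * cr ((\<Theta> s (\<zeta> + s *\<^sub>R c1) + s * c0) / \<epsilon>))) * k' (\<zeta> + s *\<^sub>R c1)" for s \<zeta>
  have yn: "cmod (y s \<zeta>) = cmod (k' (\<zeta> + s *\<^sub>R c1))" for s \<zeta> by (simp add: y_def norm_mult)
  have yg: "gauss_bounded (y s)" for s unfolding y_def by (rule gauss_bounded_mult_bounded[OF gauss_bounded_shift[OF k'g], where K=1]) simp_all
  have [measurable]: "y s \<in> Borel" for s using gauss_bounded_measurable[OF yg] .
  have Tyg: "gauss_bounded (\<lambda>\<zeta>. cr (T \<zeta>) * y s \<zeta>)" for s by (rule gauss_bounded_mult_growth[OF yg, where K=M and n=2]) (use Tg in simp_all)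
  \<comment> \<open>One Gaussian bound for all times, since the translations stay below
    \<open>tf * norm c1\<close>; the commutator constant can then be chosen independently of
    \<open>s\<close>.\<close>
  obtain C c where C: "C > 0" "c > 0" "\<And>s \<zeta>. s \<in> {0..tf} \<Longrightarrow> cmod (y s \<zeta>) \<le> C * gs c \<zeta>"
  proof -
    obtain C c where C: "C > 0" "c > 0" "\<And>x. cmod (k' x) \<le> C * gs c x" using k'g by (rule gauss_boundedE) blast
    have "cmod (y s \<zeta>) \<le> (C * exp (c * (tf * norm c1)^2)) * gs (c/2) \<zeta>" if s: "s \<in> {0..tf}" for s \<zeta>
    proof -
      let ?a = "s *\<^sub>R c1"
      have na: "norm ?a \<le> tf * norm c1" using s by (simp add: mult_right_mono)
      have "C * gs c (\<zeta> + ?a) \<le> C * (exp (c * (tf * norm c1)^2) * gs (c/2) \<zeta>)" using C(1) gauss_shift_bound[OF C(2) na, of \<zeta>] by (intro mult_left_mono) auto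
      then show ?thesis unfolding yn using C(3)[of "\<zeta> + ?a"] by (simp only: mult.assoc)
    qed
    then show ?thesis using that[of "C * exp (c * (tf * norm c1)^2)" "c/2"] C by simp
  qed
  obtain KC where KC: "KC > 0" "\<And>s \<nu>. s \<in> {0..tf} \<Longrightarrow> 0 < \<nu> \<Longrightarrow> \<nu> \<le> 1 \<Longrightarrow>
    l2norm (\<lambda>\<xi>. gauss_mollify \<nu> (\<lambda>\<zeta>. cr (T \<zeta>) * y s \<zeta>) \<xi> - cr (T \<xi>) * gauss_mollify \<nu> (y s) \<xi>) \<le> KC * \<nu>"
  proof -
    obtain KC where "KC > 0" "\<forall>y \<nu>. y \<in> Borel \<longrightarrow> (\<forall>x. cmod (y x) \<le> C * gs c x) \<longrightarrow> 0 < \<nu> \<longrightarrow> \<nu> \<le> 1 \<longrightarrow>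
      l2norm (\<lambda>\<xi>. gauss_mollify \<nu> (\<lambda>\<zeta>. cr (T \<zeta>) * y \<zeta>) \<xi> - cr (T \<xi>) * gauss_mollify \<nu> y \<xi>) \<le> KC * \<nu>"
      using mollify_commutator_bound[OF C(1,2) Tm L T Tg] by blast
    then show ?thesis using that[of KC] C(3) \<open>\<And>s. y s \<in> Borel\<close> by blast
  qed
  define cst where "cst = (2 * pi * \<epsilon>) powr (- (CARD('d) / 2))"
  \<comment> \<open>Taking the initial momentum as integration variable moves the dependence on
    \<open>s\<close> into this phase. Its time derivative is minus the total energy
    \<open>T (\<xi> - s *\<^sub>R c1) + V x\<close> divided by \<open>\<epsilon>\<close>.\<close>
  define ph where "ph s x \<xi> = (x \<bullet> \<xi> - \<Theta> s \<xi> - s * V x) / \<epsilon>" for s x \<xi>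
  have inv_form: "invF \<epsilon> (\<lambda>\<zeta>. f \<zeta> * y s \<zeta>) x = cr cst * (LINT \<xi>|lborel. f (\<xi> - s *\<^sub>R c1) * (k' \<xi> * iexp (ph s x \<xi>)))" for f s x
  proof -
    have "(LINT \<zeta>|lborel. (f \<zeta> * y s \<zeta>) * iexp (x \<bullet> \<zeta> / \<epsilon>))
      = (LINT \<xi>|lborel. (f (- (s *\<^sub>R c1) + \<xi>) * y s (- (s *\<^sub>R c1) + \<xi>)) * iexp (x \<bullet> (- (s *\<^sub>R c1) + \<xi>) / \<epsilon>))"
      using lborel_affine_integral[of 1 "\<lambda>\<zeta>. (f \<zeta> * y s \<zeta>) * iexp (x \<bullet> \<zeta> / \<epsilon>)" "- (s *\<^sub>R c1)"] by simp
    also have "\<dots> = (LINT \<xi>|lborel. f (\<xi> - s *\<^sub>R c1) * (k' \<xi> * iexp (ph s x \<xi>)))"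
    proof (rule lint_cong)
      fix \<xi>
      have "\<i> * cr (ph s x \<xi>) = - (\<i> * cr ((\<Theta> s \<xi> + s * c0) / \<epsilon>)) + \<i> * cr (x \<bullet> (- (s *\<^sub>R c1) + \<xi>) / \<epsilon>)"
      proof -
        have *: "x \<bullet> (- (s *\<^sub>R c1) + \<xi>) = x \<bullet> \<xi> - s * (c1 \<bullet> x)" by (simp add: inner_diff_right inner_commute)
        have "ph s x \<xi> = - ((\<Theta> s \<xi> + s * c0) / \<epsilon>) + x \<bullet> (- (s *\<^sub>R c1) + \<xi>) / \<epsilon>" unfolding * ph_def V_def using e by (simp add: field_simps)
        then show ?thesis by (simp only: of_real_add of_real_minus distrib_left mult_minus_right)
      qed
      then show "(f (- (s *\<^sub>R c1) + \<xi>) * y s (- (s *\<^sub>R c1) + \<xi>)) * iexp (x \<bullet> (- (s *\<^sub>R c1) + \<xi>) / \<epsilon>)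
         = f (\<xi> - s *\<^sub>R c1) * (k' \<xi> * iexp (ph s x \<xi>))" by (simp only: exp_add) (simp add: y_def mult_ac)
    qed
    finally show ?thesis by (simp only: inv_fourier_def cst_def)
  qed
  have inv_form1: "invF \<epsilon> (y s) x = cr cst * (LINT \<xi>|lborel. k' \<xi> * iexp (ph s x \<xi>))" for s x using inv_form[of "\<lambda>_. 1" s x] by simp
  have phm[measurable]: "ph s x \<in> Borel" for s x unfolding ph_def by measurable
  have Ik: "L1 (\<lambda>\<xi>. k' \<xi> * iexp (ph s x \<xi>))" for s x by (rule integrable_mult_bounded_left[OF gauss_bounded_integrable[OF k'g], where B=1]) simp_all
  define A where "A = 1 + tf * norm c1"
  have A: "A \<ge> 1" using tf by (simp add: A_def)
  have TsA: "\<bar>T (\<xi> - s *\<^sub>R c1)\<bar> \<le> (M * A ^ 2) * (1 + norm \<xi>) ^ 2" if s: "s \<in> {0..tf}" for s \<xi>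
  proof -
    have "norm (s *\<^sub>R c1) \<le> tf * norm c1" using s by (simp add: mult_right_mono)
    then have "1 + norm (\<xi> - s *\<^sub>R c1) \<le> 1 + norm \<xi> + tf * norm c1" using norm_triangle_ineq4[of \<xi> "s *\<^sub>R c1"] by linarith
    also have "\<dots> \<le> A * (1 + norm \<xi>)" using tf by (simp add: A_def algebra_simps)
    finally have "(1 + norm (\<xi> - s *\<^sub>R c1)) ^ 2 \<le> (A * (1 + norm \<xi>)) ^ 2" by (intro power_mono) auto
    from order_trans[OF Tg mult_left_mono[OF this M]] show ?thesis by (simp only: power_mult_distrib mult.assoc)
  qed
  have ITk: "L1 (\<lambda>\<xi>. cr (T (\<xi> - s *\<^sub>R c1)) * (k' \<xi> * iexp (ph s x \<xi>)))" if s: "s \<in> {0..tf}" for s x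
  proof -
    have "gauss_bounded (\<lambda>\<xi>. cr (T (\<xi> - s *\<^sub>R c1)) * k' \<xi>)" by (rule gauss_bounded_mult_growth[OF k'g, where K="M * A ^ 2" and n=2]) (use TsA[OF s] in simp_all)
    from integrable_mult_bounded_left[OF gauss_bounded_integrable[OF this], of "\<lambda>\<xi>. iexp (ph s x \<xi>)" 1]
    show ?thesis by (simp add: mult.assoc)
  qed
  define M2 where "M2 = M * A ^ 2 + \<bar>c0\<bar> + norm c1"
  have M2: "M2 \<ge> 0" using M by (simp add: M2_def)
  have TV: "\<bar>T (\<xi> - s *\<^sub>R c1) + V x\<bar> \<le> M2 * ((1 + norm \<xi>) ^ 2 * (1 + norm x))" if s: "s \<in> {0..tf}" for s \<xi> x
  proof -
    have "\<bar>V x\<bar> \<le> \<bar>c0\<bar> + norm c1 * norm x" unfolding V_def using Cauchy_Schwarz_ineq2[of c1 x] by linarith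
    also have "\<dots> \<le> (\<bar>c0\<bar> + norm c1) * (1 + norm x)" by (simp add: algebra_simps)
    also have "\<dots> \<le> (\<bar>c0\<bar> + norm c1) * ((1 + norm \<xi>) ^ 2 * (1 + norm x))"
    proof (rule mult_left_mono)
      have "1 * (1 + norm x) \<le> (1 + norm \<xi>) ^ 2 * (1 + norm x)" by (intro mult_right_mono one_le_power) auto
      then show "1 + norm x \<le> (1 + norm \<xi>) ^ 2 * (1 + norm x)" by simp
    qed simp
    finally have v: "\<bar>V x\<bar> \<le> (\<bar>c0\<bar> + norm c1) * ((1 + norm \<xi>) ^ 2 * (1 + norm x))" .
    have "\<bar>T (\<xi> - s *\<^sub>R c1)\<bar> \<le> (M * A ^ 2) * ((1 + norm \<xi>) ^ 2 * (1 + norm x))"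
    proof (rule order_trans[OF TsA[OF s] mult_left_mono])
      have "(1 + norm \<xi>) ^ 2 * 1 \<le> (1 + norm \<xi>) ^ 2 * (1 + norm x)" by (intro mult_left_mono) auto
      then show "(1 + norm \<xi>) ^ 2 \<le> (1 + norm \<xi>) ^ 2 * (1 + norm x)" by simp
    qed (use M in simp)
    with v show ?thesis unfolding M2_def by (simp add: distrib_right)
  qed
  define M3 where "M3 = (M2 + K * tf) / \<epsilon>"
  have M3: "M3 \<ge> 0" using M2 K tf e by (simp add: M3_def)
  \<comment> \<open>The pointwise remainder of the first-order expansion in time, the derivative of
    the exponential being \<open>- \<i> / \<epsilon>\<close> times the total energy. It is quadratic
    in \<open>s' - s\<close>, with polynomial weights in \<open>\<xi>\<close> and \<open>x\<close>
    that are absorbed by the Gaussian bound of \<open>k'\<close> and by the damping.\<close>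
  define R where "R s' s x \<xi> = k' \<xi> * iexp (ph s' x \<xi>) - k' \<xi> * iexp (ph s x \<xi>)
      + \<i> / cr \<epsilon> * cr (s' - s) * (cr (T (\<xi> - s *\<^sub>R c1)) * (k' \<xi> * iexp (ph s x \<xi>)) + cr (V x) * (k' \<xi> * iexp (ph s x \<xi>)))" for s' s x \<xi>
  have Rb: "cmod (R s' s x \<xi>) \<le> ((M3^2 + K / \<epsilon>) * (s' - s)^2 * (1 + norm x) ^ 2) * ((1 + norm \<xi>) ^ 4 * cmod (k' \<xi>))"
    if s: "s \<in> {0..tf}" "s' \<in> {0..tf}" for s s' x \<xi>
  proof -
    define a where "a = 1 + norm \<xi>" define bb where "bb = 1 + norm x"
    have ab: "a \<ge> 1" "bb \<ge> 1" by (simp_all add: a_def bb_def)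
    define D where "D = ph s' x \<xi> - ph s x \<xi>"
    define b where "b = - (s' - s) * (T (\<xi> - s *\<^sub>R c1) + V x) / \<epsilon>"
    have Db: "D - b = - (\<Theta> s' \<xi> - \<Theta> s \<xi> - (s' - s) * T (\<xi> - s *\<^sub>R c1)) / \<epsilon>" using e by (simp add: D_def b_def ph_def field_simps)
    have "\<bar>D - b\<bar> \<le> K * a * (s' - s)^2 / \<epsilon>" unfolding Db using \<Theta>d[OF s, of \<xi>] e by (simp add: a_def divide_right_mono)
    then have 1: "\<bar>D - b\<bar> \<le> K / \<epsilon> * (s' - s)^2 * a" by (simp add: mult_ac)
    have sl: "\<bar>s' - s\<bar> \<le> tf" using s by auto
    have "\<bar>b\<bar> \<le> \<bar>s' - s\<bar> * (M2 * (a ^ 2 * bb)) / \<epsilon>"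
    proof -
      have "\<bar>b\<bar> = \<bar>s' - s\<bar> * \<bar>T (\<xi> - s *\<^sub>R c1) + V x\<bar> / \<epsilon>" using e by (simp add: b_def abs_mult abs_minus_commute)
      also have "\<dots> \<le> \<bar>s' - s\<bar> * (M2 * (a ^ 2 * bb)) / \<epsilon>" unfolding a_def bb_def using TV[OF s(1), of \<xi> x] e by (intro divide_right_mono mult_left_mono) auto
      finally show ?thesis .
    qed
    moreover have "K / \<epsilon> * (s' - s)^2 * a \<le> \<bar>s' - s\<bar> * (K * tf * (a ^ 2 * bb)) / \<epsilon>"
    proof -
      have "a * 1 \<le> a * (a * bb)" using ab mult_mono[of 1 a 1 bb] by (intro mult_left_mono) auto
      then have ale: "a \<le> a ^ 2 * bb" by (simp add: power2_eq_square mult.assoc)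
      have "(s' - s)^2 * a = \<bar>s' - s\<bar> * (\<bar>s' - s\<bar> * a)" by (simp add: power2_eq_square mult.assoc[symmetric])
      also have "\<dots> \<le> \<bar>s' - s\<bar> * (tf * (a ^ 2 * bb))" using mult_mono[OF sl ale] ab tf by (intro mult_left_mono) auto
      finally have "(s' - s)^2 * a \<le> \<bar>s' - s\<bar> * (tf * (a ^ 2 * bb))" .
      from mult_left_mono[OF this, of "K / \<epsilon>"] K e show ?thesis by (simp add: mult_ac)
    qed
    ultimately have "\<bar>D\<bar> \<le> \<bar>s' - s\<bar> * (M2 * (a ^ 2 * bb)) / \<epsilon> + \<bar>s' - s\<bar> * (K * tf * (a ^ 2 * bb)) / \<epsilon>"
      using 1 abs_triangle_ineq[of "D - b" b] by simp
    also have "\<dots> = M3 * \<bar>s' - s\<bar> * (a ^ 2 * bb)" by (simp add: M3_def add_divide_distrib algebra_simps)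
    finally have "\<bar>D\<bar>^2 \<le> (M3 * \<bar>s' - s\<bar> * (a ^ 2 * bb))^2" by (intro power_mono) auto
    also have "\<dots> = M3^2 * (s' - s)^2 * (a ^ 4 * bb ^ 2)" by (simp add: power_mult_distrib flip: power_mult)
    finally have 2: "D^2 \<le> M3^2 * (s' - s)^2 * (a ^ 4 * bb ^ 2)" by simp
    have "a * 1 \<le> a ^ 4 * bb ^ 2" using ab by (intro mult_mono) (auto simp: self_le_power one_le_power)
    then have 3: "K / \<epsilon> * (s' - s)^2 * a \<le> K / \<epsilon> * (s' - s)^2 * (a ^ 4 * bb ^ 2)" using K e by (intro mult_left_mono) auto
    have "iexp (ph s' x \<xi>) = iexp (ph s x \<xi>) * iexp D" by (simp add: D_def right_diff_distrib flip: exp_add)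
    then have "R s' s x \<xi> = k' \<xi> * iexp (ph s x \<xi>) * (iexp D - 1 - \<i> * cr b)" using e by (simp add: R_def b_def field_simps)
    then have "cmod (R s' s x \<xi>) = cmod (k' \<xi>) * cmod (iexp D - 1 - \<i> * cr b)" by (simp add: norm_mult)
    also have "\<dots> \<le> cmod (k' \<xi>) * (D^2 / 2 + \<bar>D - b\<bar>)" by (intro mult_left_mono iexp_taylor_bound) simp
    also have "\<dots> \<le> cmod (k' \<xi>) * ((M3^2 + K / \<epsilon>) * (s' - s)^2 * (a ^ 4 * bb ^ 2))"
    proof (rule mult_left_mono)
      have "(M3^2 + K / \<epsilon>) * (s' - s)^2 * (a ^ 4 * bb ^ 2) = M3^2 * (s' - s)^2 * (a ^ 4 * bb ^ 2) + K / \<epsilon> * (s' - s)^2 * (a ^ 4 * bb ^ 2)" by (simp only: distrib_right)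
      moreover have "D^2 / 2 \<le> D^2" by simp
      ultimately show "D^2 / 2 + \<bar>D - b\<bar> \<le> (M3^2 + K / \<epsilon>) * (s' - s)^2 * (a ^ 4 * bb ^ 2)" using 1 2 3 by linarith
    qed simp
    finally show ?thesis by (simp only: a_def bb_def mult_ac)
  qed
  have main: "l2inner (\<lambda>x. cr (gs ((\<nu> / (2 * \<epsilon>))^2) x) * invF \<epsilon> (y t) x) (\<psi> t)
      - l2inner (\<lambda>x. cr (gs ((\<nu> / (2 * \<epsilon>))^2) x) * invF \<epsilon> (y 0) x) (\<psi> 0) \<in> cball 0 (tf * (KC * B / \<epsilon>) * \<nu>)"
    if \<nu>: "0 < \<nu>" "\<nu> \<le> 1" for \<nu>
  proof -
    define \<kappa> where "\<kappa> = (\<nu> / (2 * \<epsilon>))^2"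
    have \<kappa>: "\<kappa> > 0" using \<nu> e by (simp add: \<kappa>_def)
    define G where "G x = cr (gs \<kappa> x)" for x :: "real ^ 'd"
    have Gg: "gauss_bounded (\<lambda>x. G x * f x)" if "f \<in> Borel" "\<And>x. cmod (f x) \<le> b" for f b unfolding G_def by (rule gauss_bounded_gauss[OF \<kappa> that])
    have [measurable]: "G \<in> Borel" unfolding G_def by measurable
    define \<eta> where "\<eta> s x = G x * invF \<epsilon> (y s) x" for s x
    \<comment> \<open>The time derivative of the damped test function. Its kinetic part has
      \<open>T\<close> acting before the damping, whereas the Hamiltonian of the weak equation acts
      after it.\<close>
    define D where "D s x = (- \<i> / cr \<epsilon>) * (G x * invF \<epsilon> (\<lambda>\<zeta>. cr (T \<zeta>) * y s \<zeta>) x + cr (V x) * \<eta> s x)" for s x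
    have \<eta>g: "gauss_bounded (\<eta> s)" for s unfolding \<eta>_def using inv_fourier_bounded[OF e, of "y s"] by (elim exE) (rule Gg, auto)
    have Vg: "\<bar>V x\<bar> \<le> (\<bar>c0\<bar> + norm c1) * (1 + norm x) ^ 1" for x
      unfolding V_def using Cauchy_Schwarz_ineq2[of c1 x] by (simp add: algebra_simps) (smt (verit) mult_nonneg_nonneg norm_ge_zero abs_ge_zero)
    have V\<eta>g: "gauss_bounded (\<lambda>x. cr (V x) * \<eta> s x)" for s by (rule gauss_bounded_mult_growth[OF \<eta>g, where K="\<bar>c0\<bar> + norm c1" and n=1]) (use Vg in simp_all)
    have V\<eta>si: "L2 (\<lambda>x. cr (V x) * \<eta> s x)" for s using V\<eta>g by (rule gauss_bounded_square_integrable)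
    have GTg: "gauss_bounded (\<lambda>x. G x * invF \<epsilon> (\<lambda>\<zeta>. cr (T \<zeta>) * y s \<zeta>) x)" for s
      using inv_fourier_bounded[OF e, of "\<lambda>\<zeta>. cr (T \<zeta>) * y s \<zeta>"] by (elim exE) (rule Gg, auto)
    have GTsi: "L2 (\<lambda>x. G x * invF \<epsilon> (\<lambda>\<zeta>. cr (T \<zeta>) * y s \<zeta>) x)" for s using GTg by (rule gauss_bounded_square_integrable)
    have \<eta>si: "L2 (\<eta> s)" for s using \<eta>g by (rule gauss_bounded_square_integrable)
    have Dsi: "L2 (D s)" for s unfolding D_def by (intro square_integrable_cmult square_integrable_add GTsi V\<eta>si)
    have sch: "schwartz (\<eta> s)" for s unfolding \<eta>_def G_def by (rule schwartz_damped_transform[OF damped_transform.base[OF yg] \<kappa>])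
    define H where "H x = cr ((1 + norm x) ^ 2) * (G x * 1)" for x
    have Hsi: "L2 H" unfolding H_def
      by (rule gauss_bounded_square_integrable, rule gauss_bounded_mult_growth[OF Gg[of "\<lambda>_. 1" 1], where K=1 and n=2]) (measurable, simp_all only: norm_of_real, simp_all)
    define K4 where "K4 = cst * (M3^2 + K / \<epsilon>) * (LINT \<xi>|lborel. (1 + norm \<xi>) ^ 4 * cmod (k' \<xi>))"
    have K4: "K4 \<ge> 0" unfolding K4_def cst_def using K e by simp
    have rem: "l2norm (\<lambda>x. \<eta> s' x - \<eta> s x - cr (s' - s) * D s x) \<le> (K4 * l2norm H) * (s' - s)^2"
      if s: "s \<in> {0..tf}" "s' \<in> {0..tf}" for s s'
    proof -
      have "l2norm (\<lambda>x. \<eta> s' x - \<eta> s x - cr (s' - s) * D s x) \<le> l2norm (\<lambda>x. cr (K4 * (s' - s)^2) * H x)"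
      proof (rule l2norm_mono(2)[OF square_integrable_cmult[OF Hsi]])
        show "(\<lambda>x. \<eta> s' x - \<eta> s x - cr (s' - s) * D s x) \<in> Borel" using \<eta>si[of s] \<eta>si[of s'] Dsi[of s] unfolding square_integrable_def by auto
        fix x
        have IR: "(LINT \<xi>|lborel. R s' s x \<xi>) = (LINT \<xi>|lborel. k' \<xi> * iexp (ph s' x \<xi>)) - (LINT \<xi>|lborel. k' \<xi> * iexp (ph s x \<xi>))
          + \<i> / cr \<epsilon> * cr (s' - s) * ((LINT \<xi>|lborel. cr (T (\<xi> - s *\<^sub>R c1)) * (k' \<xi> * iexp (ph s x \<xi>))) + cr (V x) * (LINT \<xi>|lborel. k' \<xi> * iexp (ph s x \<xi>)))"
          unfolding R_def by (simp only: lint_add lint_diff integral_mult_right_zero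
              Ik ITk[OF s(1)] L1_diff L1_add integrable_mult_right)
        have "\<eta> s' x - \<eta> s x - cr (s' - s) * D s x = G x * (cr cst * (LINT \<xi>|lborel. R s' s x \<xi>))"
        proof -
          have alg: "g * (c * a') - g * (c * a) - d * (- w * (g * (c * t) + v * (g * (c * a)))) = g * (c * (a' - a + w * d * (t + v * a)))"
            for g c a a' d w t v :: complex by (simp add: algebra_simps)
          show ?thesis unfolding IR \<eta>_def D_def inv_form inv_form1 minus_divide_left[symmetric] by (rule alg)
        qed
        also have "cmod \<dots> \<le> cmod (G x) * (cst * (LINT \<xi>|lborel. ((M3^2 + K / \<epsilon>) * (s' - s)^2 * (1 + norm x) ^ 2) * ((1 + norm \<xi>) ^ 4 * cmod (k' \<xi>))))"
          unfolding norm_mult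
        proof (intro mult_left_mono mult_mono lebesgue_integral_norm_le Rb s)
          show "L1 (\<lambda>\<xi>. ((M3^2 + K / \<epsilon>) * (s' - s)^2 * (1 + norm x) ^ 2) * ((1 + norm \<xi>) ^ 4 * cmod (k' \<xi>)))"
            by (intro integrable_mult_right gauss_bounded_moment_integrable k'g)
        qed (auto simp: cst_def)
        also have "\<dots> = K4 * (s' - s)^2 * ((1 + norm x) ^ 2 * cmod (G x))" unfolding integral_mult_right_zero K4_def by (simp only: mult_ac)
        also have "\<dots> = cmod (cr (K4 * (s' - s)^2) * H x)" unfolding H_def norm_mult norm_of_real using K4 by simp
        finally show "cmod (\<eta> s' x - \<eta> s x - cr (s' - s) * D s x) \<le> cmod (cr (K4 * (s' - s)^2) * H x)" .
      qed
      also have "\<dots> = (K4 * l2norm H) * (s' - s)^2" unfolding l2norm_cmult norm_of_real using K4 by simp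
      finally show ?thesis .
    qed
    have der: "\<exists>E'. ((\<lambda>s'. l2inner (\<eta> s') (\<psi> s')) has_vector_derivative E') (at s within {0..tf}) \<and> cmod E' \<le> KC * B / \<epsilon> * \<nu>" if s: "s \<in> {0..tf}" for s
    proof -
      obtain d where d: "((\<lambda>s'. l2inner (\<eta> s) (\<psi> s')) has_vector_derivative d) (at s within {0..tf})"
        "\<i> * cr \<epsilon> * d = l2inner (\<lambda>x. fourier_multiplier \<epsilon> T (\<eta> s) x + cr (V x) * \<eta> s x) (\<psi> s)" using weak[OF sch[of s] s] unfolding V_def by blast
      let ?W = "gauss_mollify \<nu> (\<lambda>\<zeta>. cr (T \<zeta>) * y s \<zeta>)"
      let ?W' = "\<lambda>\<xi>. cr (T \<xi>) * gauss_mollify \<nu> (y s) \<xi>"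
      have Wg: "gauss_bounded ?W" by (rule gauss_bounded_mollify[OF Tyg \<nu>])
      have W'g: "gauss_bounded ?W'" by (rule gauss_bounded_mult_growth[OF gauss_bounded_mollify[OF yg \<nu>], where K=M and n=2]) (use Tg in simp_all)
      have GT: "(\<lambda>x. G x * invF \<epsilon> (\<lambda>\<zeta>. cr (T \<zeta>) * y s \<zeta>) x) = invF \<epsilon> ?W"
        unfolding G_def \<kappa>_def by (rule ext) (rule inv_fourier_mollify[OF Tyg e \<nu>(1), symmetric])
      have fm: "fourier_multiplier \<epsilon> T (\<eta> s) = invF \<epsilon> ?W'"
        unfolding fourier_multiplier_def \<eta>_def G_def \<kappa>_def by (simp only: fourier_damped[OF yg e \<nu>(1)])
      have si1: "L2 (invF \<epsilon> ?W)" using e Wg by (rule inv_fourier_square_integrable)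
      have si2: "L2 (invF \<epsilon> ?W')" using e W'g by (rule inv_fourier_square_integrable)
      note deriv = l2inner_has_vector_derivative[of tf \<psi> \<eta> "D s" s "K4 * l2norm H" d, OF \<psi> cont \<eta>si Dsi s rem[OF s] d(1)]
      have DD: "l2inner (D s) (\<psi> s) = \<i> / cr \<epsilon> * (l2inner (invF \<epsilon> ?W) (\<psi> s) + l2inner (\<lambda>x. cr (V x) * \<eta> s x) (\<psi> s))"
        unfolding D_def[abs_def] l2inner_cmult_left GT[symmetric] by (subst l2inner_add_left[OF \<psi>[OF s] GTsi V\<eta>si]) simp
      have "\<i> * cr \<epsilon> * d = l2inner (invF \<epsilon> ?W') (\<psi> s) + l2inner (\<lambda>x. cr (V x) * \<eta> s x) (\<psi> s)"
        unfolding d(2) fm by (rule l2inner_add_left[OF \<psi>[OF s] si2 V\<eta>si])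
      then have deq: "d = - (\<i> / cr \<epsilon>) * (l2inner (invF \<epsilon> ?W') (\<psi> s) + l2inner (\<lambda>x. cr (V x) * \<eta> s x) (\<psi> s))"
      proof -
        have solve: "d = - (\<i> / w) * X" if "\<i> * w * d = X" "w \<noteq> 0" for w X :: complex using that(2) unfolding that(1)[symmetric] by (simp add: field_simps)
        assume "\<i> * cr \<epsilon> * d = l2inner (invF \<epsilon> ?W') (\<psi> s) + l2inner (\<lambda>x. cr (V x) * \<eta> s x) (\<psi> s)"
        then show ?thesis by (rule solve) (use e in simp)
      qed
      \<comment> \<open>The potential terms cancel, as multiplication by \<open>V\<close> commutes
        with the damping. What is left is the commutator of the mollification with
        \<open>T\<close>.\<close>
      have "l2inner (D s) (\<psi> s) + d = \<i> / cr \<epsilon> * (l2inner (invF \<epsilon> ?W) (\<psi> s) - l2inner (invF \<epsilon> ?W') (\<psi> s))"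
      proof -
        have alg: "w * (a + b) + - w * (a' + b) = w * (a - a')" for w a b a' :: complex by (simp add: algebra_simps)
        show ?thesis unfolding DD deq by (rule alg)
      qed
      also have "\<dots> = \<i> / cr \<epsilon> * l2inner (invF \<epsilon> (\<lambda>\<xi>. ?W \<xi> - ?W' \<xi>)) (\<psi> s)"
      proof -
        have "invF \<epsilon> (\<lambda>\<xi>. ?W \<xi> - ?W' \<xi>) = (\<lambda>x. invF \<epsilon> ?W x - invF \<epsilon> ?W' x)"
          by (rule ext) (rule inv_fourier_diff[OF gauss_bounded_integrable[OF Wg] gauss_bounded_integrable[OF W'g]])
        then show ?thesis by (simp only: l2inner_diff_left[OF \<psi>[OF s] si1 si2])
      qed
      also have "cmod \<dots> \<le> 1 / \<epsilon> * (KC * \<nu> * B)"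
      proof -
        have WW: "gauss_bounded (\<lambda>\<xi>. ?W \<xi> - ?W' \<xi>)"
        proof -
          obtain C1 d1 where 1: "C1 > 0" "d1 > 0" "\<And>x. cmod (?W x) \<le> C1 * gs d1 x" using Wg by (rule gauss_boundedE) blast
          obtain C2 d2 where 2: "C2 > 0" "d2 > 0" "\<And>x. cmod (?W' x) \<le> C2 * gs d2 x" using W'g by (rule gauss_boundedE) blast
          show ?thesis
          proof (rule gauss_boundedI)
            show "min d1 d2 > 0" using 1 2 by simp
            fix x :: "real ^ 'd"
            have "C1 * gs d1 x \<le> C1 * exp (- min d1 d2 * (norm x)^2)" "C2 * gs d2 x \<le> C2 * exp (- min d1 d2 * (norm x)^2)" using 1 2 by (auto intro!: mult_left_mono mult_right_mono)
            then show "cmod (?W x - ?W' x) \<le> (C1 + C2) * exp (- min d1 d2 * (norm x)^2)"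
              using 1(3)[of x] 2(3)[of x] norm_triangle_ineq4[of "?W x" "?W' x"] unfolding distrib_right by linarith
          qed measurable
        qed
        have "cmod (l2inner (invF \<epsilon> (\<lambda>\<xi>. ?W \<xi> - ?W' \<xi>)) (\<psi> s)) \<le> l2norm (invF \<epsilon> (\<lambda>\<xi>. ?W \<xi> - ?W' \<xi>)) * l2norm (\<psi> s)"
          by (rule l2inner_bound[OF inv_fourier_square_integrable[OF e WW] \<psi>[OF s]])
        also have "\<dots> \<le> (KC * \<nu>) * B" unfolding inv_fourier_l2norm[OF e WW] using KC(2)[OF s \<nu>] B(2)[OF s] KC(1) \<nu> by (intro mult_mono) auto
        finally show ?thesis using e by (simp add: norm_mult norm_divide divide_right_mono)
      qed
      finally have "cmod (l2inner (D s) (\<psi> s) + d) \<le> KC * B / \<epsilon> * \<nu>" by (simp add: mult_ac)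
      with deriv show ?thesis by blast
    qed
    then obtain E' where E': "\<And>s. s \<in> {0..tf} \<Longrightarrow> ((\<lambda>s'. l2inner (\<eta> s') (\<psi> s')) has_vector_derivative E' s) (at s within {0..tf})"
      "\<And>s. s \<in> {0..tf} \<Longrightarrow> cmod (E' s) \<le> KC * B / \<epsilon> * \<nu>" by metis
    have "norm (l2inner (\<eta> t) (\<psi> t) - l2inner (\<eta> 0) (\<psi> 0)) \<le> (KC * B / \<epsilon> * \<nu>) * norm (t - 0)"
    proof (rule differentiable_bound[where S="{0..tf}" and f="\<lambda>s. l2inner (\<eta> s) (\<psi> s)" and f'="\<lambda>s x. x *\<^sub>R E' s"])
      show "((\<lambda>s. l2inner (\<eta> s) (\<psi> s)) has_derivative (\<lambda>x. x *\<^sub>R E' s)) (at s within {0..tf})" if "s \<in> {0..tf}" for s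
        using E'(1)[OF that] unfolding has_vector_derivative_def .
      show "onorm (\<lambda>x. x *\<^sub>R E' s) \<le> KC * B / \<epsilon> * \<nu>" if "s \<in> {0..tf}" for s
      proof (rule onorm_le)
        fix x :: real
        have "norm (x *\<^sub>R E' s) \<le> norm x * (KC * B / \<epsilon> * \<nu>)" unfolding norm_scaleR real_norm_def by (intro mult_left_mono E'(2) that) simp
        then show "norm (x *\<^sub>R E' s) \<le> KC * B / \<epsilon> * \<nu> * norm x" by (simp only: mult.commute)
      qed
    qed (use t tf in auto)
    also have "\<dots> \<le> (KC * B / \<epsilon> * \<nu>) * tf" using t KC B e \<nu> by (intro mult_left_mono) auto
    finally show ?thesis unfolding \<eta>_def G_def \<kappa>_def by (simp add: mult_ac)
  qed
  let ?l = "\<lambda>n. inverse (real (Suc n))"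
  let ?E = "\<lambda>n s. l2inner (\<lambda>x. cr (gs ((?l n / (2 * \<epsilon>))^2) x) * invF \<epsilon> (y s) x) (\<psi> s)"
  have z: "0 \<in> {0..tf}" using tf by simp
  have lim: "(\<lambda>n. ?E n s) \<longlonglongrightarrow> l2inner (invF \<epsilon> (y s)) (\<psi> s)" if "s \<in> {0..tf}" for s
    by (rule l2inner_damped_tendsto[OF e inv_fourier_square_integrable[OF e yg] \<psi>[OF that]])
  \<comment> \<open>With widths \<open>1 / (n + 1)\<close> the drift over the time interval is at
    most a constant times the width; the damping disappears in the limit from the pairings at both
    end times.\<close>
  have "(\<lambda>n. ?E n t - ?E n 0) \<longlonglongrightarrow> 0"
  proof (rule Lim_null_comparison)
    show "eventually (\<lambda>n. norm (?E n t - ?E n 0) \<le> tf * (KC * B / \<epsilon>) * ?l n) sequentially"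
    proof (intro always_eventually allI)
      fix n
      have "?E n t - ?E n 0 \<in> cball 0 (tf * (KC * B / \<epsilon>) * ?l n)" by (rule main) (simp_all add: inverse_le_1_iff)
      then show "norm (?E n t - ?E n 0) \<le> tf * (KC * B / \<epsilon>) * ?l n" by (simp only: mem_cball_0)
    qed
    show "(\<lambda>n. tf * (KC * B / \<epsilon>) * ?l n) \<longlonglongrightarrow> 0" using tendsto_mult_left[OF LIMSEQ_inverse_real_of_nat, of "tf * (KC * B / \<epsilon>)"] by simp
  qed
  from LIMSEQ_unique[OF this tendsto_diff[OF lim[OF t] lim[OF z]]]
  have eq: "l2inner (invF \<epsilon> (y t)) (\<psi> t) = l2inner (invF \<epsilon> (y 0)) (\<psi> 0)" by simp
  have y0: "y 0 = (\<lambda>\<xi>. iexp (\<Theta> t \<xi> / \<epsilon>) * k \<xi>)" by (rule ext) (simp add: y_def \<Theta>0 k'_def)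
  have "l2inner (invF \<epsilon> (y 0)) (\<psi> 0) = l2inner (invF \<epsilon> (y 0)) \<phi>" unfolding l2inner_def
  proof (rule integral_cong_AE)
    have [measurable]: "\<psi> 0 \<in> Borel" using \<psi>[OF z] unfolding square_integrable_def by simp
    note [measurable] = \<phi>
    show "(\<lambda>x. cnj (invF \<epsilon> (y 0) x) * \<psi> 0 x) \<in> borel_measurable lborel" by measurable
    show "(\<lambda>x. cnj (invF \<epsilon> (y 0) x) * \<phi> x) \<in> borel_measurable lborel" by measurable
    show "AE x in lborel. cnj (invF \<epsilon> (y 0) x) * \<psi> 0 x = cnj (invF \<epsilon> (y 0) x) * \<phi> x" using init by eventually_elim simp
  qed
  moreover have "invF \<epsilon> (y t) = (\<lambda>x. exp (- (\<i> * cr (t * (c0 + c1 \<bullet> x) / \<epsilon>))) * invF \<epsilon> k x)"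
  proof
    fix x
    have "y t = (\<lambda>\<zeta>. (\<lambda>\<xi>. exp (- (\<i> * cr (t * c0 / \<epsilon>))) * k \<xi>) (\<zeta> + t *\<^sub>R c1))"
    proof
      fix \<zeta>
      have "exp (- (\<i> * cr ((\<Theta> t (\<zeta> + t *\<^sub>R c1) + t * c0) / \<epsilon>))) * iexp (\<Theta> t (\<zeta> + t *\<^sub>R c1) / \<epsilon>) = exp (- (\<i> * cr (t * c0 / \<epsilon>)))"
        by (simp add: add_divide_distrib algebra_simps flip: exp_add)
      then show "y t \<zeta> = (\<lambda>\<xi>. exp (- (\<i> * cr (t * c0 / \<epsilon>))) * k \<xi>) (\<zeta> + t *\<^sub>R c1)" unfolding y_def k'_def mult.assoc[symmetric] by (simp only:)
    qed
    then have e1: "invF \<epsilon> (y t) x = miexp (x \<bullet> (t *\<^sub>R c1) / \<epsilon>) * invF \<epsilon> (\<lambda>\<xi>. exp (- (\<i> * cr (t * c0 / \<epsilon>))) * k \<xi>) x"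
      by (simp only:) (rule inv_fourier_shift)
    have e2: "invF \<epsilon> (\<lambda>\<xi>. exp (- (\<i> * cr (t * c0 / \<epsilon>))) * k \<xi>) x = exp (- (\<i> * cr (t * c0 / \<epsilon>))) * invF \<epsilon> k x"
      unfolding inv_fourier_def mult.assoc integral_mult_right_zero by (simp only: mult.left_commute)
    have r: "t * (c0 + c1 \<bullet> x) / \<epsilon> = x \<bullet> (t *\<^sub>R c1) / \<epsilon> + t * c0 / \<epsilon>" by (simp add: inner_commute add_divide_distrib distrib_left)
    have e3: "exp (- (\<i> * cr (t * (c0 + c1 \<bullet> x) / \<epsilon>))) = miexp (x \<bullet> (t *\<^sub>R c1) / \<epsilon>) * exp (- (\<i> * cr (t * c0 / \<epsilon>)))"
      unfolding r by (simp only: of_real_add distrib_left exp_add[symmetric] minus_add_distrib mult_minus_left)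
    show "invF \<epsilon> (y t) x = exp (- (\<i> * cr (t * (c0 + c1 \<bullet> x) / \<epsilon>))) * invF \<epsilon> k x" unfolding e1 e2 e3 by (simp only: mult.assoc)
  qed
  ultimately show ?thesis using eq by (simp only: y0)
qed

section \<open>Complex Gaussian integrals\<close>

definition quad_form :: "real ^ 'd ^ 'd \<Rightarrow> real ^ 'd \<Rightarrow> real" where
  "quad_form H v = (\<Sum>j\<in>UNIV. \<Sum>k\<in>UNIV. H $ j $ k * (v $ j * v $ k))"

definition quad_exp :: "real ^ 'd ^ 'd \<Rightarrow> real ^ 'd \<Rightarrow> complex" where
  "quad_exp H v = cr (exp (- (norm v)\<^sup>2)) * iexp (quad_form H v / 2)"

definition gauss_quad :: "real ^ 'd ^ 'd \<Rightarrow> complex" where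
  "gauss_quad H = (LINT v|lborel. quad_exp H v)"

definition quad_moment :: "real ^ 'd ^ 'd \<Rightarrow> 'd \<Rightarrow> 'd \<Rightarrow> complex" where
  "quad_moment H j k = (LINT v|lborel. cr (v $ j * v $ k) * quad_exp H v)"

text \<open>The exponent of \<open>quad_exp H v\<close> is \<open>- (1 / 2)\<close> times the
  quadratic form of this matrix. For the Hessian of the phase it is the matrix \<open>Z\<close> of
  the approximation, by \<open>Z_matrix_eq\<close>.\<close>

definition quad_matrix :: "real ^ 'd ^ 'd \<Rightarrow> complex ^ 'd ^ 'd" where
  "quad_matrix H = (\<chi> j k. (if j = k then 2 else 0) - \<i> * cr (H $ j $ k))"

lemma quad_form_add: "quad_form (H + K) v = quad_form H v + quad_form K v" by (simp add: quad_form_def distrib_right sum.distrib)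

lemma quad_form_bound_entries:
  fixes H :: "real ^ 'd ^ 'd"
  assumes "\<And>j k. \<bar>H $ j $ k\<bar> \<le> B"
  shows "\<bar>quad_form H v\<bar> \<le> (real CARD('d))^2 * B * (norm v)^2"
proof -
  have entry: "\<bar>H $ j $ k * (v $ j * v $ k)\<bar> \<le> B * (norm v)^2" for j k
  proof -
    have "\<bar>v $ j\<bar> * \<bar>v $ k\<bar> \<le> norm v * norm v" using component_le_norm_cart[of v] by (intro mult_mono) auto
    then have "\<bar>H $ j $ k\<bar> * (\<bar>v $ j\<bar> * \<bar>v $ k\<bar>) \<le> B * (norm v * norm v)" by (rule mult_mono[OF assms]) (auto intro: order_trans[OF abs_ge_zero assms])
    then show ?thesis unfolding abs_mult power2_eq_square .
  qed
  have "\<bar>quad_form H v\<bar> \<le> (\<Sum>j\<in>UNIV. \<bar>\<Sum>k\<in>UNIV. H $ j $ k * (v $ j * v $ k)\<bar>)" unfolding quad_form_def by (rule sum_abs)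
  also have "\<dots> \<le> (\<Sum>j\<in>UNIV. \<Sum>k\<in>UNIV. \<bar>H $ j $ k * (v $ j * v $ k)\<bar>)" by (intro sum_mono sum_abs)
  also have "\<dots> \<le> (\<Sum>j\<in>(UNIV::'d set). \<Sum>k\<in>(UNIV::'d set). B * (norm v)^2)" by (intro sum_mono entry)
  finally have "\<bar>quad_form H v\<bar> \<le> (\<Sum>j\<in>(UNIV::'d set). \<Sum>k\<in>(UNIV::'d set). B * (norm v)^2)" .
  then show ?thesis by (simp add: power2_eq_square mult_ac)
qed

lemma quad_form_bound: "\<bar>quad_form H v\<bar> \<le> ((real CARD('d))^2 * norm H) * (norm v)^2"
  for H :: "real ^ 'd ^ 'd"
proof (rule quad_form_bound_entries)
  show "\<bar>H $ j $ k\<bar> \<le> norm H" for j k using component_le_norm_cart[of "H $ j" k] Finite_Cartesian_Product.norm_nth_le[of H j] by simp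
qed

lemma measurable_vec_nth [measurable]: "(\<lambda>v::real^'d. v $ j) \<in> Borel" by (intro borel_measurable_continuous_onI continuous_intros)

lemma quad_form_measurable [measurable]: "quad_form H \<in> Borel" unfolding quad_form_def[abs_def] by measurable

lemma cmod_quad_exp: "cmod (quad_exp H v) = exp (- (norm v)\<^sup>2)" by (simp add: quad_exp_def norm_mult)

lemma gauss_bounded_quad_exp: "gauss_bounded (quad_exp H)"
proof (rule gauss_boundedI[where c=1 and C=1])
  show "quad_exp H \<in> Borel" unfolding quad_exp_def[abs_def] by measurable
qed (simp_all add: cmod_quad_exp)

lemma quad_exp_measurable [measurable]: "quad_exp H \<in> Borel" using gauss_bounded_quad_exp by (rule gauss_bounded_measurable)

lemma quad_exp_integrable: "L1 (quad_exp H)" by (rule gauss_bounded_integrable[OF gauss_bounded_quad_exp])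

lemma quad_exp_add: "quad_exp (H + K) v = quad_exp H v * iexp (quad_form K v / 2)" by (simp add: quad_exp_def quad_form_add add_divide_distrib distrib_left exp_add)

lemma quad_moment_integrable: "L1 (\<lambda>v. cr (v $ j * v $ k) * quad_exp H v)"
proof (rule gauss_bounded_integrable, rule gauss_bounded_mult_growth[OF gauss_bounded_quad_exp, where K=1 and n=2])
  fix v :: "real ^ 'a"
  have "\<bar>v $ j\<bar> * \<bar>v $ k\<bar> \<le> (1 + norm v) * (1 + norm v)" using component_le_norm_cart[of v j] component_le_norm_cart[of v k] by (intro mult_mono) auto
  then show "cmod (cr (v $ j * v $ k)) \<le> 1 * (1 + norm v) ^ 2" unfolding norm_of_real abs_mult power2_eq_square by simp
qed measurable

definition gauss_moment_const :: "('d::finite) itself \<Rightarrow> real" where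
  "gauss_moment_const _ = (LINT v|lborel. (1 + norm (v :: real ^ 'd)) ^ 2 * gs 1 v)"

text \<open>All integrands have the modulus of one real Gaussian, so the constant is a moment
  independent of the matrices. The hypothesis compares quadratic forms instead of entries because
  continuity of the Hessian of the phase is estimated with both arguments equal to
  \<open>v\<close>.\<close>

lemma gauss_quad_lipschitz:
  fixes H K :: "real ^ 'd ^ 'd"
  assumes "\<And>v. \<bar>quad_form H v - quad_form K v\<bar> \<le> \<eta> * (norm v)^2" "\<eta> \<ge> 0"
  shows "cmod (gauss_quad H - gauss_quad K) \<le> \<eta> * gauss_moment_const TYPE('d)"
proof -
  have "gauss_quad H - gauss_quad K = (LINT v|lborel. quad_exp H v - quad_exp K v)" unfolding gauss_quad_def by (rule lint_diff[symmetric]) (rule quad_exp_integrable)+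
  moreover have "cmod (LINT v|lborel. quad_exp H v - quad_exp K v) \<le> (LINT v|lborel. \<eta> * ((1 + norm (v :: real ^ 'd)) ^ 2 * gs 1 v))"
  proof (rule lebesgue_integral_norm_le)
    show "L1 (\<lambda>v::real^'d. \<eta> * ((1 + norm v) ^ 2 * gs 1 v))" by (intro integrable_mult_right gauss_moment_integrable) simp
    fix v :: "real ^ 'd"
    have "quad_exp H v = quad_exp K v * iexp ((quad_form H v - quad_form K v) / 2)" by (simp add: quad_exp_def mult.assoc diff_divide_distrib right_diff_distrib flip: exp_add)
    then have "quad_exp H v - quad_exp K v = quad_exp K v * (iexp ((quad_form H v - quad_form K v) / 2) - 1)" by (simp add: right_diff_distrib)
    then have "cmod (quad_exp H v - quad_exp K v) \<le> exp (- (norm v)\<^sup>2) * \<bar>(quad_form H v - quad_form K v) / 2\<bar>"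
      by (simp only: norm_mult cmod_quad_exp) (intro mult_left_mono cmod_iexp_minus_1, simp)
    also have "\<dots> \<le> exp (- (norm v)\<^sup>2) * (\<eta> * (1 + norm v) ^ 2)"
    proof (rule mult_left_mono)
      have "\<eta> * (norm v)^2 \<le> \<eta> * (1 + norm v) ^ 2" using assms(2) by (intro mult_left_mono power_mono) auto
      then show "\<bar>(quad_form H v - quad_form K v) / 2\<bar> \<le> \<eta> * (1 + norm v) ^ 2" using assms(1)[of v] by simp
    qed simp
    finally show "norm (quad_exp H v - quad_exp K v) \<le> \<eta> * ((1 + norm v) ^ 2 * gs 1 v)" by (simp add: mult_ac)
  qed
  ultimately show ?thesis unfolding gauss_moment_const_def by (simp only: integral_mult_right_zero)
qed

text \<open>The factor \<open>iexp (quad_form K v / 2)\<close> is expanded to first order under the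
  integral, with a fourth moment for the remainder. The second moments in the derivative are
  evaluated afterwards by integration by parts.\<close>

lemma gauss_quad_has_derivative:
  fixes H :: "real ^ 'd ^ 'd"
  shows "(gauss_quad has_derivative (\<lambda>K. \<i> / 2 * (\<Sum>j\<in>UNIV. \<Sum>k\<in>UNIV. cr (K $ j $ k) * quad_moment H j k))) (at H)"
proof (rule has_derivative_quadratic_remainder[where r=1])
  define D where "D K = \<i> / 2 * (\<Sum>j\<in>UNIV. \<Sum>k\<in>UNIV. cr (K $ j $ k) * quad_moment H j k)" for K :: "real ^ 'd ^ 'd"
  have "bounded_linear (\<lambda>K::real^'d^'d. cr (K $ j $ k) * quad_moment H j k)" for j k
    by (intro bounded_linear_mult_const bounded_linear_compose[OF bounded_linear_of_real] bounded_linear_compose[OF bounded_linear_vec_nth] bounded_linear_vec_nth)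
  then show "bounded_linear (\<lambda>K. \<i> / 2 * (\<Sum>j\<in>UNIV. \<Sum>k\<in>UNIV. cr (K $ j $ k) * quad_moment H j k))" by (intro bounded_linear_const_mult bounded_linear_sum)
  have D: "D K = (LINT v|lborel. quad_exp H v * (\<i> * cr (quad_form K v / 2)))" for K
  proof -
    have "quad_exp H v * (\<i> * cr (quad_form K v / 2)) = \<i> / 2 * (\<Sum>j\<in>UNIV. \<Sum>k\<in>UNIV. cr (K $ j $ k) * (cr (v $ j * v $ k) * quad_exp H v))" for v
      by (simp add: quad_form_def sum_distrib_left sum_distrib_right mult_ac)
    then show ?thesis unfolding D_def quad_moment_def by (simp only: integral_mult_right_zero lint_sum L1_sum integrable_mult_right quad_moment_integrable)
  qed
  have iD: "L1 (\<lambda>v. quad_exp H v * (\<i> * cr (quad_form K v / 2)))" for K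
  proof -
    have "gauss_bounded (\<lambda>v. (\<i> * cr (quad_form K v / 2)) * quad_exp H v)"
    proof (rule gauss_bounded_mult_growth[OF gauss_bounded_quad_exp, where K="(real CARD('d))^2 * norm K" and n=2])
      fix v :: "real ^ 'd"
      have "\<bar>quad_form K v\<bar> \<le> ((real CARD('d))^2 * norm K) * (1 + norm v) ^ 2" by (rule order_trans[OF quad_form_bound]) (intro mult_left_mono power_mono, auto)
      then show "cmod (\<i> * cr (quad_form K v / 2)) \<le> ((real CARD('d))^2 * norm K) * (1 + norm v) ^ 2" unfolding norm_mult norm_of_real by simp
    qed measurable
    from gauss_bounded_integrable[OF this] show ?thesis by (simp only: mult.commute)
  qed
  define c where "c = (real CARD('d))^2"
  define M where "M = c^2 * (LINT v|lborel. (1 + norm (v::real^'d)) ^ 4 * gs 1 v)"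
  fix H' :: "real ^ 'd ^ 'd"
  define K where "K = H' - H"
  have H': "H' = H + K" by (simp add: K_def)
  have "gauss_quad H' - gauss_quad H - D K = (LINT v|lborel. quad_exp H' v - quad_exp H v - quad_exp H v * (\<i> * cr (quad_form K v / 2)))"
    unfolding gauss_quad_def D by (simp only: lint_diff quad_exp_integrable iD L1_diff)
  moreover have "cmod (LINT v|lborel. quad_exp H' v - quad_exp H v - quad_exp H v * (\<i> * cr (quad_form K v / 2))) \<le> (LINT v|lborel. (norm K)^2 * c^2 * ((1 + norm (v::real^'d)) ^ 4 * gs 1 v))"
  proof (rule lebesgue_integral_norm_le)
    show "L1 (\<lambda>v::real^'d. (norm K)^2 * c^2 * ((1 + norm v) ^ 4 * gs 1 v))" by (intro integrable_mult_right gauss_moment_integrable) simp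
    fix v :: "real ^ 'd"
    have "quad_exp H' v - quad_exp H v - quad_exp H v * (\<i> * cr (quad_form K v / 2)) = quad_exp H v * (iexp (quad_form K v / 2) - 1 - \<i> * cr (quad_form K v / 2))"
      unfolding H' quad_exp_add by (simp only: right_diff_distrib mult_1_right)
    then have "cmod (quad_exp H' v - quad_exp H v - quad_exp H v * (\<i> * cr (quad_form K v / 2))) \<le> exp (- (norm v)\<^sup>2) * ((quad_form K v / 2)^2 / 2)"
      by (simp only: norm_mult cmod_quad_exp) (intro mult_left_mono cmod_iexp_minus_linear, simp)
    also have "\<dots> \<le> exp (- (norm v)\<^sup>2) * ((norm K)^2 * c^2 * (1 + norm v) ^ 4)"
    proof (rule mult_left_mono)
      have "\<bar>quad_form K v\<bar> \<le> (c * norm K) * (1 + norm v) ^ 2" unfolding c_def by (rule order_trans[OF quad_form_bound]) (intro mult_left_mono power_mono, auto)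
      then have "\<bar>quad_form K v\<bar>\<^sup>2 \<le> ((c * norm K) * (1 + norm v) ^ 2)^2" by (intro power_mono) auto
      also have "\<dots> = (norm K)^2 * c^2 * (1 + norm v) ^ 4" by (simp add: power_mult_distrib mult_ac flip: power_mult)
      finally have q: "(quad_form K v)^2 \<le> (norm K)^2 * c^2 * (1 + norm v) ^ 4" by simp
      have "(quad_form K v / 2)^2 / 2 = (quad_form K v)^2 / 8" by (simp add: power_divide)
      also have "\<dots> \<le> (quad_form K v)^2" by simp
      finally show "(quad_form K v / 2)^2 / 2 \<le> (norm K)^2 * c^2 * (1 + norm v) ^ 4" using q by simp
    qed simp
    finally show "norm (quad_exp H' v - quad_exp H v - quad_exp H v * (\<i> * cr (quad_form K v / 2))) \<le> (norm K)^2 * c^2 * ((1 + norm v) ^ 4 * gs 1 v)" by (simp add: mult_ac)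
  qed
  ultimately have "norm (gauss_quad H' - gauss_quad H - D K) \<le> M * (norm K)^2" unfolding M_def by (simp only: integral_mult_right_zero mult_ac)
  then show "norm (gauss_quad H' - gauss_quad H - \<i> / 2 * (\<Sum>j\<in>UNIV. \<Sum>k\<in>UNIV. cr ((H' - H) $ j $ k) * quad_moment H j k)) \<le> M * (norm (H' - H))^2"
    unfolding K_def D_def .
qed simp

lemma norm_power2_vec: "(norm (w::real^'d))^2 = (\<Sum>j\<in>UNIV. w $ j * w $ j)" unfolding power2_norm_eq_inner inner_vec_def by simp

text \<open>The logarithmic derivative of the Gaussian in a coordinate direction is minus one row of
  \<open>quad_matrix H\<close> applied to the point; symmetry of \<open>H\<close> merges the two
  contributions of the quadratic form.\<close>

lemma quad_exp_shift_derivative: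
  fixes H :: "real ^ 'd ^ 'd" and v :: "real ^ 'd" and k :: 'd
  assumes sym: "\<And>j k. H $ j $ k = H $ k $ j"
  defines "w \<equiv> \<lambda>s. v + s *\<^sub>R axis k 1"
  shows "((\<lambda>s. quad_exp H (w s)) has_vector_derivative (- (\<Sum>l\<in>UNIV. quad_matrix H $ k $ l * cr (w s $ l)) * quad_exp H (w s))) (at s)"
proof -
  define c where "c j = (if j = k then 1 else 0 :: real)" for j
  have ws: "w s $ j = v $ j + s * c j" for s j by (simp add: w_def axis_def c_def)
  have dw: "((\<lambda>s. w s $ j) has_real_derivative c j) (at s)" for j s unfolding ws by (auto intro!: derivative_eq_intros)
  have sumc: "(\<Sum>j\<in>UNIV. c j * f j) = f k" for f :: "'d \<Rightarrow> real" by (simp add: c_def if_distrib[of "\<lambda>x. x * _"] cong: if_cong)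
  have n: "((\<lambda>s. (norm (w s))^2) has_real_derivative 2 * w s $ k) (at s)"
  proof -
    have "((\<lambda>s. \<Sum>j\<in>UNIV. w s $ j * w s $ j) has_real_derivative (\<Sum>j\<in>UNIV. c j * w s $ j + c j * w s $ j)) (at s)" by (intro DERIV_sum DERIV_mult dw)
    moreover have "(\<Sum>j\<in>UNIV. c j * w s $ j + c j * w s $ j) = 2 * w s $ k" unfolding sum.distrib sumc by simp
    ultimately show ?thesis unfolding norm_power2_vec by simp
  qed
  have q: "((\<lambda>s. quad_form H (w s)) has_real_derivative 2 * (\<Sum>l\<in>UNIV. H $ k $ l * w s $ l)) (at s)"
  proof -
    have "((\<lambda>s. \<Sum>j\<in>UNIV. \<Sum>l\<in>UNIV. H $ j $ l * (w s $ j * w s $ l)) has_real_derivative (\<Sum>j\<in>UNIV. \<Sum>l\<in>UNIV. H $ j $ l * (c j * w s $ l + c l * w s $ j))) (at s)"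
      by (intro DERIV_sum DERIV_cmult DERIV_mult dw)
    moreover have "(\<Sum>j\<in>UNIV. \<Sum>l\<in>UNIV. H $ j $ l * (c j * w s $ l + c l * w s $ j)) = 2 * (\<Sum>l\<in>UNIV. H $ k $ l * w s $ l)"
    proof -
      have "(\<Sum>j\<in>UNIV. \<Sum>l\<in>UNIV. H $ j $ l * (c j * w s $ l + c l * w s $ j)) = (\<Sum>j\<in>UNIV. c j * (\<Sum>l\<in>UNIV. H $ j $ l * w s $ l)) + (\<Sum>j\<in>UNIV. \<Sum>l\<in>UNIV. c l * (H $ j $ l * w s $ j))"
        by (simp add: distrib_left sum.distrib sum_distrib_left mult_ac)
      also have "(\<Sum>j\<in>UNIV. \<Sum>l\<in>UNIV. c l * (H $ j $ l * w s $ j)) = (\<Sum>l\<in>UNIV. H $ k $ l * w s $ l)" unfolding sumc using sym by simp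
      finally show ?thesis by (simp add: sumc)
    qed
    ultimately show ?thesis unfolding quad_form_def by simp
  qed
  define e where "e s = cr (- (norm (w s))\<^sup>2) + \<i> * cr (quad_form H (w s) / 2)" for s
  have E: "quad_exp H (w s) = exp (e s)" for s by (simp only: quad_exp_def e_def exp_add exp_of_real)
  have "(e has_vector_derivative (cr (- (2 * w s $ k)) + \<i> * cr (2 * (\<Sum>l\<in>UNIV. H $ k $ l * w s $ l) / 2))) (at s)" unfolding e_def
    by (intro has_vector_derivative_add has_vector_derivative_mult_right has_vector_derivative_of_real DERIV_minus DERIV_cdivide n q)
  moreover have "cr (- (2 * w s $ k)) + \<i> * cr (2 * (\<Sum>l\<in>UNIV. H $ k $ l * w s $ l) / 2) = - (\<Sum>l\<in>UNIV. quad_matrix H $ k $ l * cr (w s $ l))"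
  proof -
    have "(\<Sum>l\<in>UNIV. quad_matrix H $ k $ l * cr (w s $ l)) = (\<Sum>l\<in>UNIV. (if k = l then 2 * cr (w s $ l) else 0)) - (\<Sum>l\<in>UNIV. \<i> * (cr (H $ k $ l) * cr (w s $ l)))"
      unfolding sum_subtractf[symmetric] by (intro sum.cong refl) (simp add: quad_matrix_def algebra_simps)
    moreover have "(\<Sum>l\<in>UNIV. (if k = l then 2 * cr (w s $ l) else 0)) = 2 * cr (w s $ k)" by simp
    moreover have "\<i> * cr (2 * (\<Sum>l\<in>UNIV. H $ k $ l * w s $ l) / 2) = (\<Sum>l\<in>UNIV. \<i> * (cr (H $ k $ l) * cr (w s $ l)))"
    proof -
      have "2 * (\<Sum>l\<in>UNIV. H $ k $ l * w s $ l) / 2 = (\<Sum>l\<in>UNIV. H $ k $ l * w s $ l)" by simp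
      then show ?thesis by (simp only: of_real_sum of_real_mult sum_distrib_left)
    qed
    ultimately show ?thesis by simp
  qed
  ultimately have de: "(e has_vector_derivative - (\<Sum>l\<in>UNIV. quad_matrix H $ k $ l * cr (w s $ l))) (at s)" by simp
  have "((exp \<circ> e) has_vector_derivative (- (\<Sum>l\<in>UNIV. quad_matrix H $ k $ l * cr (w s $ l)) * exp (e s))) (at s)" by (rule field_vector_diff_chain_at[OF de DERIV_exp])
  then show ?thesis unfolding E comp_def .
qed

text \<open>The partial derivative in direction \<open>k\<close> of the \<open>j\<close>-th
  coordinate times the Gaussian has integral zero: difference quotients integrate to 0 by
  translation invariance, and dominated convergence passes to the derivative. Writing this
  derivative out relates the second moments to the matrix of the exponent.\<close>

lemma gauss_integration_by_parts:
  fixes H :: "real ^ 'd ^ 'd"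
  assumes sym: "\<And>j k. H $ j $ k = H $ k $ j"
  shows "(\<Sum>l\<in>UNIV. quad_matrix H $ k $ l * quad_moment H l j) = (if j = k then gauss_quad H else 0)"
proof -
  define f where "f v = cr (v $ j) * quad_exp H v" for v
  define df where "df v = (if j = k then quad_exp H v else 0) - (\<Sum>l\<in>UNIV. quad_matrix H $ k $ l * (cr (v $ l * v $ j) * quad_exp H v))" for v
  let ?e = "axis k 1 :: real ^ 'd"
  have der: "((\<lambda>s. f (v + s *\<^sub>R ?e)) has_vector_derivative df (v + s *\<^sub>R ?e)) (at s)" for v s
  proof -
    have "((\<lambda>s. (v + s *\<^sub>R ?e) $ j) has_real_derivative (if j = k then 1 else 0)) (at s)" by (auto intro!: derivative_eq_intros simp: axis_def)
    from has_vector_derivative_mult[OF has_vector_derivative_of_real[OF this] quad_exp_shift_derivative[OF sym, of v k s]]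
    have "((\<lambda>s. f (v + s *\<^sub>R ?e)) has_vector_derivative
       (cr ((v + s *\<^sub>R ?e) $ j) * (- (\<Sum>l\<in>UNIV. quad_matrix H $ k $ l * cr ((v + s *\<^sub>R ?e) $ l)) * quad_exp H (v + s *\<^sub>R ?e))
        + cr (if j = k then 1 else 0) * quad_exp H (v + s *\<^sub>R ?e))) (at s)" unfolding f_def .
    moreover have "cr ((v + s *\<^sub>R ?e) $ j) * (- (\<Sum>l\<in>UNIV. quad_matrix H $ k $ l * cr ((v + s *\<^sub>R ?e) $ l)) * quad_exp H (v + s *\<^sub>R ?e))
        + cr (if j = k then 1 else 0) * quad_exp H (v + s *\<^sub>R ?e) = df (v + s *\<^sub>R ?e)"
    proof -
      have gen: "cr (x $ j) * (- (\<Sum>l\<in>UNIV. quad_matrix H $ k $ l * cr (x $ l)) * quad_exp H x)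
        + cr (if j = k then 1 else 0) * quad_exp H x = df x" for x by (simp add: df_def sum_distrib_left sum_distrib_right mult_ac)
      show ?thesis by (rule gen)
    qed
    ultimately show ?thesis by simp
  qed
  define Z where "Z = (\<Sum>l\<in>UNIV. cmod (quad_matrix H $ k $ l))"
  have Z: "Z \<ge> 0" by (simp add: Z_def sum_nonneg)
  have dfb: "cmod (df v) \<le> (1 + Z) * ((1 + norm v) ^ 2 * gs 1 v)" for v
  proof -
    have v1: "1 \<le> (1 + norm v) ^ 2" by (rule one_le_power) simp
    have "cmod (df v) \<le> cmod (if j = k then quad_exp H v else 0) + cmod (\<Sum>l\<in>UNIV. quad_matrix H $ k $ l * (cr (v $ l * v $ j) * quad_exp H v))"
      unfolding df_def by (rule norm_triangle_ineq4)
    also have "\<dots> \<le> 1 * ((1 + norm v) ^ 2 * exp (- (norm v)\<^sup>2)) + (\<Sum>l\<in>UNIV. cmod (quad_matrix H $ k $ l) * ((1 + norm v) ^ 2 * exp (- (norm v)\<^sup>2)))"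
    proof (rule add_mono)
      show "cmod (if j = k then quad_exp H v else 0) \<le> 1 * ((1 + norm v) ^ 2 * exp (- (norm v)\<^sup>2))" using v1 by (simp add: cmod_quad_exp)
      show "cmod (\<Sum>l\<in>UNIV. quad_matrix H $ k $ l * (cr (v $ l * v $ j) * quad_exp H v)) \<le> (\<Sum>l\<in>UNIV. cmod (quad_matrix H $ k $ l) * ((1 + norm v) ^ 2 * exp (- (norm v)\<^sup>2)))"
      proof (rule sum_norm_le)
        fix l
        have "\<bar>v $ l\<bar> * \<bar>v $ j\<bar> \<le> (1 + norm v) * (1 + norm v)" using component_le_norm_cart[of v j] component_le_norm_cart[of v l] by (intro mult_mono) auto
        then show "cmod (quad_matrix H $ k $ l * (cr (v $ l * v $ j) * quad_exp H v)) \<le> cmod (quad_matrix H $ k $ l) * ((1 + norm v) ^ 2 * exp (- (norm v)\<^sup>2))"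
          unfolding norm_mult norm_of_real abs_mult cmod_quad_exp power2_eq_square[of "1 + norm v"] by (intro mult_left_mono mult_right_mono) auto
      qed
    qed
    also have "\<dots> = (1 + Z) * ((1 + norm v) ^ 2 * gs 1 v)" by (simp add: Z_def distrib_right sum_distrib_right)
    finally show ?thesis .
  qed
  obtain C where C: "C > 0" "\<And>r::real. r \<ge> 0 \<Longrightarrow> (1 + r) ^ 2 * exp (- 1 * r^2) \<le> C * exp (- (1/2) * r^2)" using gauss_moment_bound[OF zero_less_one, of 2] by blast
  \<comment> \<open>An integrable majorant of the derivative along the whole unit segment starting
    at \<open>v\<close>; moving by at most 1 costs a constant factor and half of the Gaussian
    rate.\<close>
  define B where "B v = (1 + Z) * (C * exp (1/2)) * gs (1/4) v" for v :: "real ^ 'd"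
  have Bi: "L1 B" unfolding B_def by (intro integrable_mult_right gauss_integrable) simp
  have dfB: "cmod (df (v + s *\<^sub>R ?e)) \<le> B v" if s: "s \<in> {0..1}" for v s
  proof -
    let ?w = "v + s *\<^sub>R ?e"
    have "norm v \<le> norm ?w + 1" using norm_triangle_ineq4[of ?w "s *\<^sub>R ?e"] s by simp
    then have "(norm v)^2 \<le> (norm ?w + 1)^2" by (intro power_mono) auto
    also have "\<dots> \<le> 2 * (norm ?w)^2 + 2" using sum_squares_bound[of "norm ?w" 1] by (simp add: power2_sum)
    finally have "- (1/2) * (norm ?w)^2 \<le> 1/2 + (- (1/4) * (norm v)^2)" by simp
    then have "gs (1/2) ?w \<le> exp (1/2) * gs (1/4) v" by (simp only: exp_le_cancel_iff flip: exp_add)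
    then have "C * gs (1/2) ?w \<le> C * (exp (1/2) * gs (1/4) v)" using C(1) by (intro mult_left_mono) auto
    then have "(1 + norm ?w) ^ 2 * gs 1 ?w \<le> C * (exp (1/2) * gs (1/4) v)" using C(2)[of "norm ?w"] by (meson norm_ge_zero order_trans)
    then have "(1 + Z) * ((1 + norm ?w) ^ 2 * gs 1 ?w) \<le> (1 + Z) * (C * (exp (1/2) * gs (1/4) v))" using Z by (intro mult_left_mono) auto
    with dfb[of ?w] show ?thesis unfolding B_def by (simp only: mult.assoc)
  qed
  let ?h = "\<lambda>n. inverse (real (Suc n))"
  let ?q = "\<lambda>n v. (f (v + ?h n *\<^sub>R ?e) - f v) /\<^sub>R ?h n"
  have fm[measurable]: "f \<in> Borel" unfolding f_def by measurable
  have fi: "L1 f" unfolding f_def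
  proof (rule gauss_bounded_integrable, rule gauss_bounded_mult_growth[OF gauss_bounded_quad_exp, where K=1 and n=1])
    show "cmod (cr (v $ j)) \<le> 1 * (1 + norm v) ^ 1" for v using component_le_norm_cart[of v j] by simp
  qed measurable
  have q0: "(LINT v|lborel. ?q n v) = 0" for n
  proof -
    have "(LINT v|lborel. f (v + ?h n *\<^sub>R ?e)) = (LINT v|lborel. f v)" using lborel_affine_integral[of 1 f "?h n *\<^sub>R ?e"] by (simp add: add.commute)
    moreover have "L1 (\<lambda>v. f (v + ?h n *\<^sub>R ?e))" using lborel_affine_integrable[OF fi, of 1 "?h n *\<^sub>R ?e"] by (simp add: add.commute)
    ultimately have "(LINT v|lborel. f (v + ?h n *\<^sub>R ?e) - f v) = 0" using fi by simp
    then show ?thesis by (simp only: integral_scaleR_right) simp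
  qed
  have "(\<lambda>n. LINT v|lborel. ?q n v) \<longlonglongrightarrow> (LINT v|lborel. df v)"
  proof (rule integral_dominated_convergence[OF _ _ Bi])
    show "df \<in> borel_measurable lborel" unfolding df_def by measurable
    show "?q n \<in> borel_measurable lborel" for n by measurable
    show "AE v in lborel. (\<lambda>n. ?q n v) \<longlonglongrightarrow> df v"
    proof (rule AE_I2)
      fix v
      have "((\<lambda>s. (f (v + s *\<^sub>R ?e) - f v) /\<^sub>R s) \<longlongrightarrow> df v) (at 0)"
      proof -
        have "((\<lambda>s. norm (f (v + (0 + s) *\<^sub>R ?e) - f (v + 0 *\<^sub>R ?e) - s *\<^sub>R df (v + 0 *\<^sub>R ?e)) / norm s) \<longlongrightarrow> 0) (at 0)"
          using der[of v 0] unfolding has_vector_derivative_def has_derivative_at by blast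
        then have lim: "((\<lambda>s. norm (f (v + s *\<^sub>R ?e) - f v - s *\<^sub>R df v) / norm s) \<longlongrightarrow> 0) (at 0)" by simp
        have "((\<lambda>s. norm ((f (v + s *\<^sub>R ?e) - f v) /\<^sub>R s - df v)) \<longlongrightarrow> 0) (at 0)"
        proof (rule Lim_transform_eventually[OF lim])
          show "eventually (\<lambda>s. norm (f (v + s *\<^sub>R ?e) - f v - s *\<^sub>R df v) / norm s = norm ((f (v + s *\<^sub>R ?e) - f v) /\<^sub>R s - df v)) (at 0)"
          proof (rule eventually_at_topological[THEN iffD2], intro exI[of _ UNIV] conjI ballI impI)
            fix s :: real assume "s \<noteq> 0"
            then have "(f (v + s *\<^sub>R ?e) - f v) /\<^sub>R s - df v = (f (v + s *\<^sub>R ?e) - f v - s *\<^sub>R df v) /\<^sub>R s" by (simp add: scaleR_diff_right)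
            then show "norm (f (v + s *\<^sub>R ?e) - f v - s *\<^sub>R df v) / norm s = norm ((f (v + s *\<^sub>R ?e) - f v) /\<^sub>R s - df v)"
              by (simp only: norm_scaleR) (simp add: divide_inverse mult.commute)
          qed auto
        qed
        then show ?thesis using tendsto_norm_zero_iff LIM_zero_cancel by blast
      qed
      moreover have "filterlim ?h (at 0) sequentially" using LIMSEQ_inverse_real_of_nat by (simp add: filterlim_at)
      ultimately show "(\<lambda>n. ?q n v) \<longlonglongrightarrow> df v" by (rule filterlim_compose)
    qed
    show "AE v in lborel. norm (?q n v) \<le> B v" for n
    proof (rule AE_I2)
      fix v
      have hn: "0 < ?h n" "?h n \<le> 1" by (simp_all add: inverse_le_1_iff)
      have "norm (f (v + ?h n *\<^sub>R ?e) - f (v + 0 *\<^sub>R ?e)) \<le> B v * norm (?h n - 0)"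
      proof (rule differentiable_bound[where S="{0..1}" and f="\<lambda>s. f (v + s *\<^sub>R ?e)" and f'="\<lambda>s x. x *\<^sub>R df (v + s *\<^sub>R ?e)"])
        show "((\<lambda>s. f (v + s *\<^sub>R ?e)) has_derivative (\<lambda>x. x *\<^sub>R df (v + s *\<^sub>R ?e))) (at s within {0..1})" for s
          using der[of v s] unfolding has_vector_derivative_def by (rule has_derivative_at_withinI)
        show "onorm (\<lambda>x. x *\<^sub>R df (v + s *\<^sub>R ?e)) \<le> B v" if "s \<in> {0..1}" for s
        proof (rule onorm_le)
          fix x :: real
          have "norm (x *\<^sub>R df (v + s *\<^sub>R ?e)) \<le> norm x * B v" unfolding norm_scaleR real_norm_def by (intro mult_left_mono dfB that) simp
          then show "norm (x *\<^sub>R df (v + s *\<^sub>R ?e)) \<le> B v * norm x" by (simp only: mult.commute)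
        qed
      qed (use hn in auto)
      then have "norm (f (v + ?h n *\<^sub>R ?e) - f v) \<le> B v * ?h n" using hn by simp
      then have "inverse (?h n) * norm (f (v + ?h n *\<^sub>R ?e) - f v) \<le> inverse (?h n) * (B v * ?h n)" using hn by (intro mult_left_mono) auto
      also have "\<dots> = B v" using hn by simp
      finally show "norm (?q n v) \<le> B v" using hn by simp
    qed
  qed
  then have "(LINT v|lborel. df v) = 0" unfolding q0 using LIMSEQ_unique tendsto_const by metis
  moreover have "(LINT v|lborel. df v) = (if j = k then gauss_quad H else 0) - (\<Sum>l\<in>UNIV. quad_matrix H $ k $ l * quad_moment H l j)"
  proof -
    have i1: "L1 (\<lambda>v. if j = k then quad_exp H v else 0)" using quad_exp_integrable[of H] by (cases "j = k") auto
    have i2: "L1 (\<lambda>v. \<Sum>l\<in>UNIV. quad_matrix H $ k $ l * (cr (v $ l * v $ j) * quad_exp H v))" by (intro L1_sum integrable_mult_right quad_moment_integrable)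
    have "(LINT v|lborel. df v) = (LINT v|lborel. (if j = k then quad_exp H v else 0)) - (LINT v|lborel. (\<Sum>l\<in>UNIV. quad_matrix H $ k $ l * (cr (v $ l * v $ j) * quad_exp H v)))"
      unfolding df_def by (rule lint_diff[OF i1 i2])
    also have "(LINT v|lborel. (if j = k then quad_exp H v else 0)) = (if j = k then gauss_quad H else 0)" by (simp add: gauss_quad_def)
    also have "(LINT v|lborel. (\<Sum>l\<in>UNIV. quad_matrix H $ k $ l * (cr (v $ l * v $ j) * quad_exp H v))) = (\<Sum>l\<in>UNIV. quad_matrix H $ k $ l * quad_moment H l j)"
      unfolding quad_moment_def by (simp only: lint_sum integrable_mult_right quad_moment_integrable integral_mult_right_zero)
    finally show ?thesis .
  qed
  ultimately show ?thesis by simp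
qed

text \<open>A real symmetric \<open>H\<close> contributes a real number to the Hermitian form, which
  the factor \<open>- \<i>\<close> sends to the imaginary part. The real part is that of the
  constant 2 on the diagonal.\<close>

lemma quad_matrix_coercive:
  fixes H :: "real ^ 'd ^ 'd"
  assumes sym: "\<And>j k. H $ j $ k = H $ k $ j"
  shows "2 * (\<Sum>j\<in>UNIV. (cmod (x $ j))^2) = Re (\<Sum>j\<in>UNIV. cnj (x $ j) * (quad_matrix H *v x) $ j)"
proof -
  define S where "S = (\<Sum>j\<in>UNIV. \<Sum>k\<in>UNIV. cnj (x $ j) * (cr (H $ j $ k) * x $ k))"
  have "cnj S = (\<Sum>j\<in>UNIV. \<Sum>k\<in>UNIV. x $ j * (cr (H $ j $ k) * cnj (x $ k)))" by (simp add: S_def)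
  also have "\<dots> = (\<Sum>k\<in>UNIV. \<Sum>j\<in>UNIV. x $ j * (cr (H $ j $ k) * cnj (x $ k)))" by (rule sum.swap)
  also have "\<dots> = S" unfolding S_def by (intro sum.cong refl) (subst sym, simp add: mult_ac)
  finally have "Im S = 0" by (simp add: complex_eq_iff)
  have row: "(quad_matrix H *v x) $ j = 2 * x $ j - \<i> * (\<Sum>k\<in>UNIV. cr (H $ j $ k) * x $ k)" for j
  proof -
    have "(quad_matrix H *v x) $ j = (\<Sum>k\<in>UNIV. (if j = k then 2 * x $ k else 0)) - (\<Sum>k\<in>UNIV. \<i> * (cr (H $ j $ k) * x $ k))"
      unfolding sum_subtractf[symmetric] matrix_vector_mult_def by (simp, intro sum.cong refl) (simp add: quad_matrix_def algebra_simps)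
    then show ?thesis by (simp add: sum_distrib_left)
  qed
  have "(\<Sum>j\<in>UNIV. cnj (x $ j) * (quad_matrix H *v x) $ j) = (\<Sum>j\<in>UNIV. 2 * cr ((cmod (x $ j))^2)) - \<i> * S" unfolding S_def sum_distrib_left sum_subtractf[symmetric]
  proof (intro sum.cong refl)
    fix j
    have "cnj (x $ j) * (2 * x $ j) = 2 * cr ((cmod (x $ j))^2)" by (simp only: complex_norm_square) (simp add: mult_ac)
    then show "cnj (x $ j) * (quad_matrix H *v x) $ j = 2 * cr ((cmod (x $ j))^2) - (\<Sum>k\<in>UNIV. \<i> * (cnj (x $ j) * (cr (H $ j $ k) * x $ k)))"
      unfolding row by (simp add: right_diff_distrib sum_distrib_left mult_ac)
  qed
  also have "Re \<dots> = (\<Sum>j\<in>UNIV. 2 * (cmod (x $ j))^2)" using \<open>Im S = 0\<close> by (simp only: minus_complex.sel Re_sum) simp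
  finally show ?thesis by (simp add: sum_distrib_left)
qed

lemma quad_matrix_inv:
  fixes H :: "real ^ 'd ^ 'd"
  assumes sym: "\<And>j k. H $ j $ k = H $ k $ j"
  shows "quad_matrix H ** matrix_inv (quad_matrix H) = mat 1" "matrix_inv (quad_matrix H) ** quad_matrix H = mat 1"
proof -
  have "x = 0" if "quad_matrix H *v x = 0" for x
  proof -
    have "(\<Sum>j\<in>UNIV. (cmod (x $ j))^2) = 0" using quad_matrix_coercive[OF sym, of x] that by simp
    then have "\<forall>j. (cmod (x $ j))^2 = 0" by (subst (asm) sum_nonneg_eq_0_iff) auto
    then show ?thesis by (simp add: vec_eq_iff)
  qed
  then have "\<exists>B. B ** quad_matrix H = mat 1" unfolding matrix_left_invertible_ker by blast
  then obtain B where "B ** quad_matrix H = mat 1" ..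
  moreover then have "quad_matrix H ** B = mat 1" by (simp add: matrix_left_right_inverse)
  ultimately have "\<exists>A'. quad_matrix H ** A' = mat 1 \<and> A' ** quad_matrix H = mat 1" by blast
  from someI_ex[OF this]
  show "quad_matrix H ** matrix_inv (quad_matrix H) = mat 1" "matrix_inv (quad_matrix H) ** quad_matrix H = mat 1" unfolding matrix_inv_def by auto
qed

text \<open>Coercivity is applied to a column \<open>x\<close> of the inverse, which the matrix maps
  to a unit vector: twice the squared norm of \<open>x\<close> is at most the modulus of its
  \<open>k\<close>-th entry. This forces every entry to be at most 1/2, whatever the size of
  \<open>H\<close>.\<close>

lemma quad_matrix_inv_bound:
  fixes H :: "real ^ 'd ^ 'd"
  assumes sym: "\<And>j k. H $ j $ k = H $ k $ j"
  shows "cmod (matrix_inv (quad_matrix H) $ j $ k) \<le> 1 / 2"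
proof -
  define x :: "complex ^ 'd" where "x = (\<chi> l. matrix_inv (quad_matrix H) $ l $ k)"
  have "(quad_matrix H *v x) $ j = (if j = k then 1 else 0)" for j using quad_matrix_inv(1)[OF sym] unfolding x_def matrix_vector_mult_def
    by (simp add: vec_eq_iff matrix_matrix_mult_def mat_def)
  then have "2 * (\<Sum>j\<in>UNIV. (cmod (x $ j))^2) = Re (x $ k)" using quad_matrix_coercive[OF sym, of x] by (simp add: if_distrib[of "\<lambda>y. _ * y"] cong: if_cong)
  then have s: "2 * (\<Sum>j\<in>UNIV. (cmod (x $ j))^2) \<le> cmod (x $ k)" using complex_Re_le_cmod[of "x $ k"] by simp
  have le: "2 * (cmod (x $ l))^2 \<le> cmod (x $ k)" for l using s member_le_sum[of l UNIV "\<lambda>j. (cmod (x $ j))^2"] by simp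
  have "cmod (x $ k) \<le> 1 / 2"
  proof (cases "cmod (x $ k) = 0")
    case False
    then have "cmod (x $ k) > 0" by simp
    moreover have "cmod (x $ k) * (2 * cmod (x $ k)) \<le> cmod (x $ k) * 1" using le[of k] by (simp add: power2_eq_square)
    ultimately have "2 * cmod (x $ k) \<le> 1" by (simp only: mult_le_cancel_left_pos)
    then show ?thesis by simp
  qed simp
  then have "(cmod (x $ j))^2 \<le> (1/2)^2" using le[of j] by (simp add: power2_eq_square)
  then have "cmod (x $ j) \<le> 1 / 2" by (rule power2_le_imp_le) simp
  then show ?thesis by (simp add: x_def)
qed

lemma quad_moment_eq:
  fixes H :: "real ^ 'd ^ 'd"
  assumes sym: "\<And>j k. H $ j $ k = H $ k $ j"
  shows "quad_moment H j k = gauss_quad H * matrix_inv (quad_matrix H) $ j $ k"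
proof -
  define A :: "complex ^ 'd ^ 'd" where "A = (\<chi> j k. quad_moment H j k)"
  define I where "I = matrix_inv (quad_matrix H)"
  have ZA: "(quad_matrix H ** A) $ l $ k = (if k = l then gauss_quad H else 0)" for l k unfolding matrix_matrix_mult_def A_def by (simp add: gauss_integration_by_parts[OF sym])
  have "A = I ** (quad_matrix H ** A)" unfolding I_def matrix_mul_assoc quad_matrix_inv(2)[OF sym] by simp
  then have "A $ j $ k = (I ** (quad_matrix H ** A)) $ j $ k" by simp
  also have "\<dots> = (\<Sum>l\<in>UNIV. I $ j $ l * (quad_matrix H ** A) $ l $ k)" by (simp add: matrix_matrix_mult_def)
  also have "\<dots> = I $ j $ k * gauss_quad H" unfolding ZA by (simp add: if_distrib[of "\<lambda>y. _ * y"] cong: if_cong)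
  finally show ?thesis by (simp add: A_def I_def)
qed

text \<open>This is the amplitude equation with the opposite sign, since
  \<open>quad_matrix (H t)\<close> has derivative \<open>- \<i>\<close> times \<open>H'\<close>. The
  product of amplitude and Gaussian integral is therefore constant, and the square root of a complex
  determinant with its branches never has to be followed.\<close>

lemma gauss_quad_path_derivative:
  fixes H :: "real \<Rightarrow> real ^ 'd ^ 'd"
  assumes sym: "\<And>j k. H t $ j $ k = H t $ k $ j" and sym': "\<And>j k. H' $ j $ k = H' $ k $ j"
    and d: "(H has_vector_derivative H') (at t within S)"
  shows "((\<lambda>t. gauss_quad (H t)) has_vector_derivative
     (- (1 / 2) * trace (matrix_inv (quad_matrix (H t)) ** (\<chi> j k. - \<i> * cr (H' $ j $ k))) * gauss_quad (H t))) (at t within S)"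
proof -
  have tr: "\<i> / 2 * (\<Sum>j\<in>UNIV. \<Sum>k\<in>UNIV. cr (H' $ j $ k) * quad_moment (H t) j k)
     = - (1 / 2) * trace (matrix_inv (quad_matrix (H t)) ** (\<chi> j k. - \<i> * cr (H' $ j $ k))) * gauss_quad (H t)" unfolding trace_def matrix_matrix_mult_def quad_moment_eq[OF sym]
    by (simp add: sum_distrib_left sum_distrib_right sum_negf sym' mult_ac)
  have "((gauss_quad \<circ> H) has_vector_derivative (\<i> / 2 * (\<Sum>j\<in>UNIV. \<Sum>k\<in>UNIV. cr (H' $ j $ k) * quad_moment (H t) j k))) (at t within S)"
    by (rule vector_derivative_diff_chain_within[OF d has_derivative_at_withinI[OF gauss_quad_has_derivative]])
  then show ?thesis unfolding tr comp_def .
qed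

lemma gauss_quad_zero: "gauss_quad (0 :: real ^ 'd ^ 'd) = cr (pi powr (CARD('d) / 2))"
proof -
  have "quad_exp (0 :: real ^ 'd ^ 'd) v = cr (gs 1 v)" for v by (simp add: quad_exp_def quad_form_def)
  then have "quad_exp (0 :: real ^ 'd ^ 'd) = (\<lambda>v. cr (gs 1 v))" by (rule ext)
  then have "gauss_quad (0 :: real ^ 'd ^ 'd) = cr (LINT v|lborel. gs 1 (v::real^'d))" unfolding gauss_quad_def by (simp only: integral_complex_of_real)
  then show ?thesis by (simp only: gauss_integral[OF zero_less_one]) simp
qed

text \<open>A Gronwall argument along \<open>\<tau> *\<^sub>R H\<close> from 0 to 1: entries of the
  inverse matrix are at most 1/2, so the logarithmic derivative is bounded by a quarter of
  \<open>h\<close> times the squared dimension, and the integral cannot fall faster than that from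
  its value at the zero matrix. In particular it does not vanish.\<close>

lemma gauss_quad_lower_bound:
  fixes H :: "real ^ 'd ^ 'd"
  assumes sym: "\<And>j k. H $ j $ k = H $ k $ j" and h: "\<And>j k. \<bar>H $ j $ k\<bar> \<le> h"
  shows "pi powr (CARD('d) / 2) * exp (- ((real CARD('d))^2 * h / 4)) \<le> cmod (gauss_quad H)"
proof -
  define B where "B = (real CARD('d))^2 * h / 4"
  define g where "g \<tau> = gauss_quad (\<tau> *\<^sub>R H)" for \<tau>
  define c where "c \<tau> = - (1 / 2) * trace (matrix_inv (quad_matrix (\<tau> *\<^sub>R H)) ** (\<chi> j k. - \<i> * cr (H $ j $ k)))" for \<tau> :: real
  have h0: "h \<ge> 0" using h abs_ge_zero order_trans by blast
  have sym2: "(\<tau> *\<^sub>R H) $ j $ k = (\<tau> *\<^sub>R H) $ k $ j" for \<tau> j k using sym by simp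
  have d: "(g has_vector_derivative c \<tau> * g \<tau>) (at \<tau>)" for \<tau> unfolding g_def c_def
    by (rule gauss_quad_path_derivative[where H="\<lambda>\<tau>. \<tau> *\<^sub>R H"]) (use sym in \<open>auto intro!: derivative_eq_intros\<close>)
  have cb: "cmod (c \<tau>) \<le> B" for \<tau>
  proof -
    have "cmod (trace (matrix_inv (quad_matrix (\<tau> *\<^sub>R H)) ** (\<chi> j k. - \<i> * cr (H $ j $ k)))) \<le> (\<Sum>j\<in>(UNIV::'d set). \<Sum>k\<in>(UNIV::'d set). 1 / 2 * h)"
      unfolding trace_def matrix_matrix_mult_def vec_lambda_beta
    proof (rule sum_norm_le, rule sum_norm_le)
      fix j k :: 'd
      have "cmod (matrix_inv (quad_matrix (\<tau> *\<^sub>R H)) $ j $ k) * \<bar>H $ k $ j\<bar> \<le> 1 / 2 * h"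
        using quad_matrix_inv_bound[OF sym2, of \<tau> j k] h[of k j] by (intro mult_mono) auto
      then show "cmod (matrix_inv (quad_matrix (\<tau> *\<^sub>R H)) $ j $ k * (- \<i> * cr (H $ k $ j))) \<le> 1 / 2 * h" by (simp add: norm_mult)
    qed
    then show ?thesis by (simp add: c_def B_def norm_mult power2_eq_square)
  qed
  \<comment> \<open>The exponential compensates the fastest possible decay of the squared modulus,
    so this function is nondecreasing.\<close>
  define \<phi> where "\<phi> \<tau> = (g \<tau> \<bullet> g \<tau>) * exp (2 * B * \<tau>)" for \<tau>
  have "\<phi> 0 \<le> \<phi> 1"
  proof (rule DERIV_nonneg_imp_nondecreasing[where f=\<phi> and a=0 and b=1])
    fix \<tau> :: real
    have "((\<lambda>\<tau>. g \<tau> \<bullet> g \<tau>) has_real_derivative (g \<tau> \<bullet> (c \<tau> * g \<tau>) + (c \<tau> * g \<tau>) \<bullet> g \<tau>)) (at \<tau>)"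
      using bounded_bilinear.has_vector_derivative[OF bounded_bilinear_inner d[of \<tau>] d[of \<tau>]] unfolding has_real_derivative_iff_has_vector_derivative by simp
    then have "(\<phi> has_real_derivative ((g \<tau> \<bullet> (c \<tau> * g \<tau>) + (c \<tau> * g \<tau>) \<bullet> g \<tau>) * exp (2 * B * \<tau>) + (exp (2 * B * \<tau>) * (2 * B)) * (g \<tau> \<bullet> g \<tau>))) (at \<tau>)"
      unfolding \<phi>_def by (intro DERIV_mult) (auto intro!: derivative_eq_intros)
    moreover have "0 \<le> (g \<tau> \<bullet> (c \<tau> * g \<tau>) + (c \<tau> * g \<tau>) \<bullet> g \<tau>) * exp (2 * B * \<tau>) + (exp (2 * B * \<tau>) * (2 * B)) * (g \<tau> \<bullet> g \<tau>)"
    proof -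
      have "\<bar>g \<tau> \<bullet> (c \<tau> * g \<tau>)\<bar> \<le> cmod (g \<tau>) * (cmod (c \<tau>) * cmod (g \<tau>))"
        using Cauchy_Schwarz_ineq2[of "g \<tau>" "c \<tau> * g \<tau>"] by (simp add: norm_mult)
      also have "\<dots> \<le> cmod (g \<tau>) * (B * cmod (g \<tau>))" using cb by (intro mult_left_mono mult_right_mono) auto
      also have "\<dots> = B * (g \<tau> \<bullet> g \<tau>)" by (simp add: power2_norm_eq_inner[symmetric] power2_eq_square)
      finally have "0 \<le> 2 * (g \<tau> \<bullet> (c \<tau> * g \<tau>)) + 2 * (B * (g \<tau> \<bullet> g \<tau>))" by simp
      then have "0 \<le> exp (2 * B * \<tau>) * (2 * (g \<tau> \<bullet> (c \<tau> * g \<tau>)) + 2 * (B * (g \<tau> \<bullet> g \<tau>)))" by (intro mult_nonneg_nonneg) auto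
      then show ?thesis by (simp add: inner_commute algebra_simps)
    qed
    ultimately show "\<exists>y. (\<phi> has_real_derivative y) (at \<tau>) \<and> 0 \<le> y" by blast
  qed simp
  then have "(cmod (g 0))^2 \<le> (cmod (g 1))^2 * exp (2 * B)" by (simp add: \<phi>_def power2_norm_eq_inner)
  also have "\<dots> = (cmod (g 1) * exp B)^2" by (simp add: power_mult_distrib exp_double)
  finally have "cmod (g 0) \<le> cmod (g 1) * exp B" by (rule power2_le_imp_le) simp
  then have "cmod (g 0) * exp (- B) \<le> cmod (g 1) * exp B * exp (- B)" by (intro mult_right_mono) auto
  also have "\<dots> = cmod (g 1)" by (simp add: exp_minus)
  finally show ?thesis by (simp add: g_def gauss_quad_zero B_def)
qed

section \<open>The regularized kinetic energy\<close>

definition rad :: "real \<Rightarrow> 'a::real_inner \<Rightarrow> real" where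
  "rad \<delta> p = (norm p)^2 + \<delta>^2"

definition kin_grad :: "real \<Rightarrow> real \<Rightarrow> 'a::real_inner \<Rightarrow> 'a" where
  "kin_grad \<alpha> \<delta> p = (rad \<delta> p powr ((\<alpha> - 2) / 2)) *\<^sub>R p"

text \<open>The Hessian of \<open>kinetic_reg \<alpha> \<delta>\<close> as a bilinear form. For
  \<open>\<alpha> < 2\<close> it approaches, as \<open>\<delta>\<close> tends to 0, a form with
  singularity of order \<open>norm p powr (\<alpha> - 2)\<close> at the origin.\<close>

definition kin_hess :: "real \<Rightarrow> real \<Rightarrow> 'a::real_inner \<Rightarrow> 'a \<Rightarrow> 'a \<Rightarrow> real" where
  "kin_hess \<alpha> \<delta> p u v = rad \<delta> p powr ((\<alpha> - 2) / 2) * (u \<bullet> v)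
     + (\<alpha> - 2) * (rad \<delta> p powr ((\<alpha> - 4) / 2) * ((p \<bullet> u) * (p \<bullet> v)))"

lemma kinetic_reg_rad: "kinetic_reg \<alpha> \<delta> p = rad \<delta> p powr (\<alpha> / 2) / \<alpha>" by (simp add: kinetic_reg_def rad_def)

lemma rad_pos: "\<delta> > 0 \<Longrightarrow> rad \<delta> p > 0" unfolding rad_def by (simp add: add_nonneg_pos)

lemma rad_nonneg: "rad \<delta> p \<ge> 0" by (simp add: rad_def)

lemma rad_ge_norm: "(norm p)^2 \<le> rad \<delta> p" by (simp add: rad_def)

lemma square_powr: "x > 0 \<Longrightarrow> (x^2) powr e = x powr (2 * e)" for x :: real unfolding powr_def by (simp add: ln_realpow)

lemma square_powr_half: "x > 0 \<Longrightarrow> (x^2) powr (e / 2) = x powr e" for x :: real by (simp add: square_powr)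

lemma abs_powr: "\<bar>x powr y\<bar> = x powr y" for x y :: real by simp

lemma norm_le_rad: "norm p \<le> rad \<delta> p powr (1 / 2)"
proof -
  have "norm p = sqrt ((norm p)^2)" by simp
  also have "\<dots> \<le> sqrt (rad \<delta> p)" by (intro real_sqrt_le_mono rad_ge_norm)
  finally show ?thesis by (simp add: powr_half_sqrt rad_nonneg)
qed

lemma kinetic_eq_kinetic_reg_0: "kinetic \<alpha> = (kinetic_reg \<alpha> 0 :: real ^ 'd \<Rightarrow> real)"
proof
  fix p :: "real ^ 'd"
  have "((norm p)^2) powr (\<alpha> / 2) = norm p powr \<alpha>" by (cases "p = 0") (simp_all add: square_powr)
  then show "kinetic \<alpha> p = kinetic_reg \<alpha> 0 p" by (simp add: kinetic_def kinetic_reg_def)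
qed

lemma mean_value_bound:
  fixes f :: "real \<Rightarrow> real"
  assumes "\<And>\<tau>. \<tau> \<in> {0..1} \<Longrightarrow> (f has_real_derivative f' \<tau>) (at \<tau>)" "\<And>\<tau>. \<tau> \<in> {0..1} \<Longrightarrow> \<bar>f' \<tau>\<bar> \<le> M"
  shows "\<bar>f 1 - f 0\<bar> \<le> M"
proof -
  have "\<exists>z. 0 < z \<and> z < 1 \<and> f 1 - f 0 = (1 - 0) * f' z" by (rule MVT2) (use assms(1) in auto)
  then obtain z where "0 < z" "z < 1" "f 1 - f 0 = f' z" by auto
  then show ?thesis using assms(2)[of z] by simp
qed

lemma rad_line_derivative: "((\<lambda>\<tau>. rad \<delta> (p + \<tau> *\<^sub>R w)) has_real_derivative 2 * ((p + \<tau> *\<^sub>R w) \<bullet> w)) (at \<tau>)"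
proof -
  have "rad \<delta> (p + \<tau> *\<^sub>R w) = (p \<bullet> p + \<delta>^2) + 2 * \<tau> * (p \<bullet> w) + \<tau>^2 * (w \<bullet> w)" for \<tau>
    unfolding rad_def power2_norm_eq_inner by (simp add: inner_add_left inner_add_right inner_commute power2_eq_square algebra_simps)
  then show ?thesis by (auto intro!: derivative_eq_intros simp: inner_add_left algebra_simps)
qed

lemma kin_grad_line_derivative:
  assumes r: "rad \<delta> (p + \<tau> *\<^sub>R w) > 0"
  shows "((\<lambda>\<tau>. u \<bullet> kin_grad \<alpha> \<delta> (p + \<tau> *\<^sub>R w)) has_real_derivative kin_hess \<alpha> \<delta> (p + \<tau> *\<^sub>R w) u w) (at \<tau>)"
proof -
  let ?a = "p + \<tau> *\<^sub>R w"
  have "((\<lambda>\<tau>. rad \<delta> (p + \<tau> *\<^sub>R w) powr ((\<alpha> - 2) / 2) * (p \<bullet> u + \<tau> * (w \<bullet> u))) has_real_derivative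
    ((\<alpha> - 2) / 2 * rad \<delta> ?a powr ((\<alpha> - 2) / 2 - of_nat 1) * (2 * (?a \<bullet> w))) * (p \<bullet> u + \<tau> * (w \<bullet> u)) + (w \<bullet> u) * rad \<delta> ?a powr ((\<alpha> - 2) / 2)) (at \<tau>)"
    by (intro DERIV_mult DERIV_fun_powr[OF rad_line_derivative r]) (auto intro!: derivative_eq_intros)
  moreover have e: "(\<alpha> - 2) / 2 - of_nat 1 = (\<alpha> - 4) / 2" by (simp add: field_simps)
  moreover have "((\<alpha> - 2) / 2 * rad \<delta> ?a powr ((\<alpha> - 2) / 2 - of_nat 1) * (2 * (?a \<bullet> w))) * (p \<bullet> u + \<tau> * (w \<bullet> u)) + (w \<bullet> u) * rad \<delta> ?a powr ((\<alpha> - 2) / 2) = kin_hess \<alpha> \<delta> ?a u w"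
    unfolding e kin_hess_def by (simp add: inner_add_left inner_commute[of u] mult_ac)
  moreover have "u \<bullet> kin_grad \<alpha> \<delta> (p + \<tau> *\<^sub>R w) = rad \<delta> (p + \<tau> *\<^sub>R w) powr ((\<alpha> - 2) / 2) * (p \<bullet> u + \<tau> * (w \<bullet> u))" for \<tau>
    by (simp add: kin_grad_def inner_add_right inner_commute[of u])
  ultimately show ?thesis by simp
qed

lemma kinetic_reg_line_derivative:
  fixes p w :: "real ^ 'd"
  assumes r: "rad \<delta> (p + \<tau> *\<^sub>R w) > 0" and \<alpha>: "\<alpha> > 1"
  shows "((\<lambda>\<tau>. kinetic_reg \<alpha> \<delta> (p + \<tau> *\<^sub>R w)) has_real_derivative w \<bullet> kin_grad \<alpha> \<delta> (p + \<tau> *\<^sub>R w)) (at \<tau>)"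
proof -
  let ?a = "p + \<tau> *\<^sub>R w"
  have "((\<lambda>\<tau>. rad \<delta> (p + \<tau> *\<^sub>R w) powr (\<alpha> / 2) / \<alpha>) has_real_derivative
    (\<alpha> / 2 * rad \<delta> ?a powr (\<alpha> / 2 - of_nat 1) * (2 * (?a \<bullet> w))) / \<alpha>) (at \<tau>)" by (intro DERIV_cdivide DERIV_fun_powr[OF rad_line_derivative r])
  moreover have e: "\<alpha> / 2 - of_nat 1 = (\<alpha> - 2) / 2" by (simp add: field_simps)
  moreover have "(\<alpha> / 2 * rad \<delta> ?a powr (\<alpha> / 2 - of_nat 1) * (2 * (?a \<bullet> w))) / \<alpha> = w \<bullet> kin_grad \<alpha> \<delta> ?a"
    unfolding e using \<alpha> by (simp add: kin_grad_def inner_commute[of w])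
  ultimately show ?thesis unfolding kinetic_reg_rad by simp
qed

text \<open>The two scalar products with \<open>p\<close> in the second term are worth at most one
  factor \<open>rad \<delta> p\<close>, which brings its stronger singularity to that of the first
  term. As \<open>\<alpha> - 2\<close> has modulus at most 1, the two terms add up to the constant
  2.\<close>

lemma kin_hess_bound:
  assumes \<alpha>: "1 < \<alpha>" "\<alpha> \<le> 2" and r: "rad \<delta> p > 0"
  shows "\<bar>kin_hess \<alpha> \<delta> p u v\<bar> \<le> 2 * rad \<delta> p powr ((\<alpha> - 2) / 2) * (norm u * norm v)"
proof -
  have uv: "\<bar>u \<bullet> v\<bar> \<le> norm u * norm v" by (rule Cauchy_Schwarz_ineq2)
  have "\<bar>p \<bullet> u\<bar> * \<bar>p \<bullet> v\<bar> \<le> (norm p * norm u) * (norm p * norm v)" by (intro mult_mono Cauchy_Schwarz_ineq2) auto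
  also have "\<dots> = (norm p)^2 * (norm u * norm v)" by (simp add: power2_eq_square)
  also have "\<dots> \<le> rad \<delta> p * (norm u * norm v)" by (intro mult_right_mono rad_ge_norm) auto
  finally have "rad \<delta> p powr ((\<alpha> - 4) / 2) * (\<bar>p \<bullet> u\<bar> * \<bar>p \<bullet> v\<bar>) \<le> rad \<delta> p powr ((\<alpha> - 4) / 2) * (rad \<delta> p * (norm u * norm v))"
    by (intro mult_left_mono) auto
  also have "\<dots> = rad \<delta> p powr ((\<alpha> - 4) / 2 + 1) * (norm u * norm v)" using r by (simp add: powr_add)
  also have "(\<alpha> - 4) / 2 + 1 = (\<alpha> - 2) / 2" by (simp add: field_simps)
  finally have 1: "rad \<delta> p powr ((\<alpha> - 4) / 2) * (\<bar>p \<bullet> u\<bar> * \<bar>p \<bullet> v\<bar>) \<le> rad \<delta> p powr ((\<alpha> - 2) / 2) * (norm u * norm v)" .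
  have "\<bar>(\<alpha> - 2) * (rad \<delta> p powr ((\<alpha> - 4) / 2) * ((p \<bullet> u) * (p \<bullet> v)))\<bar> \<le> 1 * (rad \<delta> p powr ((\<alpha> - 2) / 2) * (norm u * norm v))"
    unfolding abs_mult abs_powr by (rule mult_mono) (use 1 \<alpha> in auto)
  moreover have "\<bar>rad \<delta> p powr ((\<alpha> - 2) / 2) * (u \<bullet> v)\<bar> \<le> rad \<delta> p powr ((\<alpha> - 2) / 2) * (norm u * norm v)"
    unfolding abs_mult using uv by (simp add: mult_left_mono)
  ultimately show ?thesis unfolding kin_hess_def by linarith
qed

text \<open>Every scalar product with the moving point costs at most the square root of
  \<open>rad\<close>, so all terms of the third derivative are of order \<open>rad\<close> to the
  power \<open>(\<alpha> - 3) / 2\<close>, which is largest where \<open>rad\<close> is smallest.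
  The constant 6 is 1 + 3 + 2, one summand for each product-rule term, with
  \<open>\<alpha> - 2\<close> and \<open>\<alpha> - 4\<close> bounded by 1 and 3 in modulus.\<close>

lemma kin_hess_lipschitz:
  assumes \<alpha>: "1 < \<alpha>" "\<alpha> \<le> 2" and \<rho>: "\<rho> > 0" and seg: "\<And>\<tau>. \<tau> \<in> {0..1} \<Longrightarrow> \<rho>^2 \<le> rad \<delta> (p + \<tau> *\<^sub>R w)"
  shows "\<bar>kin_hess \<alpha> \<delta> (p + w) u v - kin_hess \<alpha> \<delta> p u v\<bar> \<le> 6 * \<rho> powr (\<alpha> - 3) * (norm w * norm u * norm v)"
proof -
  define a where "a \<tau> = p + \<tau> *\<^sub>R w" for \<tau>
  define R where "R \<tau> = rad \<delta> (a \<tau>)" for \<tau>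
  define X where "X = norm w * norm u * norm v"
  define f' where "f' \<tau> = ((\<alpha> - 2) / 2 * R \<tau> powr ((\<alpha> - 4) / 2) * (2 * (a \<tau> \<bullet> w))) * (u \<bullet> v)
     + (\<alpha> - 2) * (((\<alpha> - 4) / 2 * R \<tau> powr ((\<alpha> - 6) / 2) * (2 * (a \<tau> \<bullet> w))) * ((a \<tau> \<bullet> u) * (a \<tau> \<bullet> v))
       + ((w \<bullet> u) * (a \<tau> \<bullet> v) + (w \<bullet> v) * (a \<tau> \<bullet> u)) * R \<tau> powr ((\<alpha> - 4) / 2))" for \<tau>
  have X: "X \<ge> 0" by (simp add: X_def)
  have Rp: "R \<tau> > 0" if "\<tau> \<in> {0..1}" for \<tau> using seg[OF that] \<rho> unfolding R_def a_def by (smt (verit) zero_less_power)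
  have "\<bar>kin_hess \<alpha> \<delta> (a 1) u v - kin_hess \<alpha> \<delta> (a 0) u v\<bar> \<le> 6 * \<rho> powr (\<alpha> - 3) * X"
  proof (rule mean_value_bound)
    fix \<tau> :: real assume t: "\<tau> \<in> {0..1}"
    have lin: "((\<lambda>\<tau>. a \<tau> \<bullet> z) has_real_derivative w \<bullet> z) (at \<tau>)" for z unfolding a_def inner_add_left by (auto intro!: derivative_eq_intros)
    have dR: "(R has_real_derivative 2 * (a \<tau> \<bullet> w)) (at \<tau>)" unfolding R_def a_def by (rule rad_line_derivative)
    have e1: "(\<alpha> - 2) / 2 - of_nat 1 = (\<alpha> - 4) / 2" and e2: "(\<alpha> - 4) / 2 - of_nat 1 = (\<alpha> - 6) / 2" by (simp_all add: field_simps)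
    have p1: "((\<lambda>\<tau>. R \<tau> powr ((\<alpha> - 2) / 2)) has_real_derivative (\<alpha> - 2) / 2 * R \<tau> powr ((\<alpha> - 4) / 2) * (2 * (a \<tau> \<bullet> w))) (at \<tau>)"
      using DERIV_fun_powr[OF dR Rp[OF t], of "(\<alpha> - 2) / 2"] unfolding e1 .
    have p2: "((\<lambda>\<tau>. R \<tau> powr ((\<alpha> - 4) / 2)) has_real_derivative (\<alpha> - 4) / 2 * R \<tau> powr ((\<alpha> - 6) / 2) * (2 * (a \<tau> \<bullet> w))) (at \<tau>)"
      using DERIV_fun_powr[OF dR Rp[OF t], of "(\<alpha> - 4) / 2"] unfolding e2 .
    show "((\<lambda>\<tau>. kin_hess \<alpha> \<delta> (a \<tau>) u v) has_real_derivative f' \<tau>) (at \<tau>)" unfolding kin_hess_def R_def[symmetric] f'_def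
      by (intro DERIV_add DERIV_cmult DERIV_mult DERIV_cmult_right p1 p2 lin)
    let ?s = "R \<tau> powr (1 / 2)"
    let ?Q = "R \<tau> powr ((\<alpha> - 3) / 2)"
    have az: "\<bar>a \<tau> \<bullet> z\<bar> \<le> ?s * norm z" for z
      using Cauchy_Schwarz_ineq2[of "a \<tau>" z] mult_right_mono[OF norm_le_rad[of "a \<tau>" \<delta>], of "norm z"] unfolding R_def by simp
    have q1: "R \<tau> powr ((\<alpha> - 4) / 2) * ?s = ?Q" by (simp add: powr_add[symmetric] add_divide_distrib[symmetric])
    have q2: "R \<tau> powr ((\<alpha> - 6) / 2) * (?s * ?s * ?s) = ?Q" by (simp only: powr_add[symmetric]) (simp add: field_simps)
    have A: "\<bar>((\<alpha> - 2) / 2 * R \<tau> powr ((\<alpha> - 4) / 2) * (2 * (a \<tau> \<bullet> w))) * (u \<bullet> v)\<bar> \<le> 1 * (?Q * X)"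
    proof -
      have "\<bar>((\<alpha> - 2) / 2 * R \<tau> powr ((\<alpha> - 4) / 2) * (2 * (a \<tau> \<bullet> w))) * (u \<bullet> v)\<bar> = \<bar>\<alpha> - 2\<bar> * (R \<tau> powr ((\<alpha> - 4) / 2) * (\<bar>a \<tau> \<bullet> w\<bar> * \<bar>u \<bullet> v\<bar>))"
        by (simp add: abs_mult)
      also have "\<dots> \<le> 1 * (R \<tau> powr ((\<alpha> - 4) / 2) * ((?s * norm w) * (norm u * norm v)))" using \<alpha> by (intro mult_mono az Cauchy_Schwarz_ineq2) auto
      also have "\<dots> = 1 * (?Q * X)" unfolding q1[symmetric] X_def by (simp only: mult_ac)
      finally show ?thesis .
    qed
    have B: "\<bar>((\<alpha> - 4) / 2 * R \<tau> powr ((\<alpha> - 6) / 2) * (2 * (a \<tau> \<bullet> w))) * ((a \<tau> \<bullet> u) * (a \<tau> \<bullet> v))\<bar> \<le> 3 * (?Q * X)"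
    proof -
      have "\<bar>((\<alpha> - 4) / 2 * R \<tau> powr ((\<alpha> - 6) / 2) * (2 * (a \<tau> \<bullet> w))) * ((a \<tau> \<bullet> u) * (a \<tau> \<bullet> v))\<bar> = \<bar>\<alpha> - 4\<bar> * (R \<tau> powr ((\<alpha> - 6) / 2) * (\<bar>a \<tau> \<bullet> w\<bar> * (\<bar>a \<tau> \<bullet> u\<bar> * \<bar>a \<tau> \<bullet> v\<bar>)))"
        by (simp add: abs_mult)
      also have "\<dots> \<le> 3 * (R \<tau> powr ((\<alpha> - 6) / 2) * ((?s * norm w) * ((?s * norm u) * (?s * norm v))))" using \<alpha> by (intro mult_mono az) auto
      also have "\<dots> = 3 * (?Q * X)" unfolding q2[symmetric] X_def by (simp only: mult_ac)
      finally show ?thesis .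
    qed
    have C: "\<bar>((w \<bullet> u) * (a \<tau> \<bullet> v) + (w \<bullet> v) * (a \<tau> \<bullet> u)) * R \<tau> powr ((\<alpha> - 4) / 2)\<bar> \<le> 2 * (?Q * X)"
    proof -
      have "\<bar>(w \<bullet> u) * (a \<tau> \<bullet> v) + (w \<bullet> v) * (a \<tau> \<bullet> u)\<bar> \<le> \<bar>w \<bullet> u\<bar> * \<bar>a \<tau> \<bullet> v\<bar> + \<bar>w \<bullet> v\<bar> * \<bar>a \<tau> \<bullet> u\<bar>"
        by (simp only: abs_mult[symmetric] abs_triangle_ineq)
      also have "\<dots> \<le> (norm w * norm u) * (?s * norm v) + (norm w * norm v) * (?s * norm u)" by (intro add_mono mult_mono az Cauchy_Schwarz_ineq2) auto
      also have "\<dots> = 2 * (?s * X)" by (simp add: X_def)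
      finally have "\<bar>(w \<bullet> u) * (a \<tau> \<bullet> v) + (w \<bullet> v) * (a \<tau> \<bullet> u)\<bar> * R \<tau> powr ((\<alpha> - 4) / 2) \<le> 2 * (?s * X) * R \<tau> powr ((\<alpha> - 4) / 2)"
        by (rule mult_right_mono) simp
      also have "\<dots> = 2 * (?Q * X)" unfolding q1[symmetric] by (simp only: mult_ac)
      finally show ?thesis unfolding abs_mult abs_powr by simp
    qed
    have "\<bar>f' \<tau>\<bar> \<le> 1 * (?Q * X) + 1 * (3 * (?Q * X) + 2 * (?Q * X))" unfolding f'_def
    proof (rule order_trans[OF abs_triangle_ineq add_mono[OF A]])
      show "\<bar>(\<alpha> - 2) * (((\<alpha> - 4) / 2 * R \<tau> powr ((\<alpha> - 6) / 2) * (2 * (a \<tau> \<bullet> w))) * ((a \<tau> \<bullet> u) * (a \<tau> \<bullet> v))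
       + ((w \<bullet> u) * (a \<tau> \<bullet> v) + (w \<bullet> v) * (a \<tau> \<bullet> u)) * R \<tau> powr ((\<alpha> - 4) / 2))\<bar> \<le> 1 * (3 * (?Q * X) + 2 * (?Q * X))"
        unfolding abs_mult[of "\<alpha> - 2"] using \<alpha> order_trans[OF abs_triangle_ineq add_mono[OF B C]] by (intro mult_mono) auto
    qed
    also have "\<dots> = 6 * (?Q * X)" by simp
    also have "\<dots> \<le> 6 * (\<rho> powr (\<alpha> - 3) * X)"
    proof -
      have "?Q \<le> (\<rho>^2) powr ((\<alpha> - 3) / 2)" using seg[OF t] \<rho> \<alpha> unfolding R_def a_def by (intro powr_mono2') auto
      also have "(\<rho>^2) powr ((\<alpha> - 3) / 2) = \<rho> powr (\<alpha> - 3)" using \<rho> by (rule square_powr_half)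
      finally show ?thesis using X by (intro mult_left_mono mult_right_mono) auto
    qed
    finally show "\<bar>f' \<tau>\<bar> \<le> 6 * \<rho> powr (\<alpha> - 3) * X" by simp
  qed
  then show ?thesis by (simp add: a_def X_def)
qed

lemma kinetic_lipschitz:
  fixes a b :: "real ^ 'd"
  assumes \<alpha>: "1 < \<alpha>" "\<alpha> \<le> 2"
  shows "\<bar>kinetic \<alpha> a - kinetic \<alpha> b\<bar> \<le> 1 * norm (a - b) * (1 + norm a + norm b)"
proof -
  have main: "\<bar>y powr \<alpha> / \<alpha> - x powr \<alpha> / \<alpha>\<bar> \<le> (y - x) * (1 + x + y)" if xy: "0 \<le> x" "x < y" for x y :: real
  proof -
    have "\<exists>l z. x < z \<and> z < y \<and> ((\<lambda>x. x powr \<alpha> / \<alpha>) has_real_derivative l) (at z) \<and> y powr \<alpha> / \<alpha> - x powr \<alpha> / \<alpha> = (y - x) * l"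
    proof (rule MVT[OF xy(2)])
      show "continuous_on {x..y} (\<lambda>x. x powr \<alpha> / \<alpha>)" using xy \<alpha> by (intro continuous_intros continuous_on_powr') auto
      show "(\<lambda>x. x powr \<alpha> / \<alpha>) differentiable (at z)" if "x < z" "z < y" for z
      proof -
        have "((\<lambda>x. x powr \<alpha> / \<alpha>) has_real_derivative (\<alpha> * z powr (\<alpha> - 1)) / \<alpha>) (at z)"
          using that xy by (intro DERIV_cdivide has_real_derivative_powr) auto
        then show ?thesis using real_differentiable_def by blast
      qed
    qed
    then obtain l z where z: "x < z" "z < y" "((\<lambda>x. x powr \<alpha> / \<alpha>) has_real_derivative l) (at z)" "y powr \<alpha> / \<alpha> - x powr \<alpha> / \<alpha> = (y - x) * l" by blast
    have "((\<lambda>x. x powr \<alpha> / \<alpha>) has_real_derivative (\<alpha> * z powr (\<alpha> - 1)) / \<alpha>) (at z)"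
      using z xy by (intro DERIV_cdivide has_real_derivative_powr) auto
    then have l: "l = z powr (\<alpha> - 1)" using z(3) \<alpha> DERIV_unique by fastforce
    have "z powr (\<alpha> - 1) \<le> 1 + z"
    proof (cases "z \<le> 1")
      case True
      then have "z powr (\<alpha> - 1) \<le> 1 powr (\<alpha> - 1)" using z xy \<alpha> by (intro powr_mono2) auto
      then show ?thesis using z xy by simp
    next
      case False
      then have "z powr (\<alpha> - 1) \<le> z powr 1" using \<alpha> by (intro powr_mono) auto
      then show ?thesis using False by simp
    qed
    then have "\<bar>l\<bar> \<le> 1 + x + y" using l z xy by simp
    then show ?thesis unfolding z(4) abs_mult using xy by (simp add: mult_left_mono)
  qed
  have "\<bar>kinetic \<alpha> a - kinetic \<alpha> b\<bar> \<le> \<bar>norm a - norm b\<bar> * (1 + norm a + norm b)"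
  proof (cases rule: linorder_cases[of "norm a" "norm b"])
    case less
    from main[OF norm_ge_zero this] less show ?thesis by (simp add: kinetic_def abs_minus_commute add_ac)
  next
    case greater
    from main[OF norm_ge_zero this] greater show ?thesis by (simp add: kinetic_def abs_minus_commute add_ac)
  qed (simp add: kinetic_def)
  also have "\<dots> \<le> norm (a - b) * (1 + norm a + norm b)" by (intro mult_right_mono norm_triangle_ineq3) auto
  finally show ?thesis by simp
qed

text \<open>Mean value theorem in the variable \<open>(norm p)^2\<close>, which the regularization
  moves by \<open>\<delta>^2\<close>. The exponent \<open>\<alpha> - 2\<close> exceeds -1, so the
  singular factor is integrable in time along a line of momenta and the error stays of order
  \<open>\<delta>^2\<close>.\<close>

lemma kinetic_reg_close:
  fixes p :: "real ^ 'd"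
  assumes \<alpha>: "1 < \<alpha>" "\<alpha> \<le> 2" and p: "p \<noteq> 0" and \<delta>: "\<delta> > 0"
  shows "\<bar>kinetic_reg \<alpha> \<delta> p - kinetic_reg \<alpha> 0 p\<bar> \<le> \<delta>^2 / 2 * norm p powr (\<alpha> - 2)"
proof -
  let ?x = "(norm p)^2"
  have x: "?x > 0" using p by simp
  have "\<exists>z. ?x < z \<and> z < ?x + \<delta>^2 \<and> (?x + \<delta>^2) powr (\<alpha> / 2) - ?x powr (\<alpha> / 2) = ((?x + \<delta>^2) - ?x) * (\<alpha> / 2 * z powr (\<alpha> / 2 - 1))"
  proof (rule MVT2)
    show "((\<lambda>x. x powr (\<alpha> / 2)) has_real_derivative \<alpha> / 2 * z powr (\<alpha> / 2 - 1)) (at z)" if "?x \<le> z" for z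
      by (rule has_real_derivative_powr) (use that x in linarith)
  qed (use \<delta> in simp)
  then obtain z where z: "?x < z" "(?x + \<delta>^2) powr (\<alpha> / 2) - ?x powr (\<alpha> / 2) = \<delta>^2 * (\<alpha> / 2 * z powr (\<alpha> / 2 - 1))" by auto
  have "z powr (\<alpha> / 2 - 1) \<le> ?x powr (\<alpha> / 2 - 1)" using z(1) x \<alpha> by (intro powr_mono2') auto
  also have "?x powr (\<alpha> / 2 - 1) = norm p powr (\<alpha> - 2)" using p by (simp add: square_powr right_diff_distrib)
  finally have zz: "z powr (\<alpha> / 2 - 1) \<le> norm p powr (\<alpha> - 2)" .
  have "kinetic_reg \<alpha> \<delta> p - kinetic_reg \<alpha> 0 p = ((?x + \<delta>^2) powr (\<alpha> / 2) - ?x powr (\<alpha> / 2)) / \<alpha>"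
    by (simp add: kinetic_reg_def diff_divide_distrib)
  also have "\<dots> = \<delta>^2 / 2 * z powr (\<alpha> / 2 - 1)" unfolding z(2) using \<alpha> by simp
  finally have eq: "kinetic_reg \<alpha> \<delta> p - kinetic_reg \<alpha> 0 p = \<delta>^2 / 2 * z powr (\<alpha> / 2 - 1)" .
  show ?thesis unfolding eq abs_mult abs_powr using zz by (simp add: mult_left_mono)
qed

text \<open>The constant deteriorates as \<open>\<delta>\<close> tends to 0. The estimate serves to
  differentiate the gradient of the phase at fixed positive \<open>\<delta>\<close> and does not
  enter the error bounds.\<close>

lemma kin_grad_remainder:
  fixes p v :: "real ^ 'd"
  assumes \<alpha>: "1 < \<alpha>" "\<alpha> \<le> 2" and \<delta>: "\<delta> > 0"
  shows "\<bar>u \<bullet> (kin_grad \<alpha> \<delta> (p + v) - kin_grad \<alpha> \<delta> p) - kin_hess \<alpha> \<delta> p u v\<bar> \<le> 6 * \<delta> powr (\<alpha> - 3) * norm u * (norm v)^2"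
proof -
  let ?f = "\<lambda>\<tau>. u \<bullet> kin_grad \<alpha> \<delta> (p + \<tau> *\<^sub>R v) - \<tau> * kin_hess \<alpha> \<delta> p u v"
  have "\<bar>?f 1 - ?f 0\<bar> \<le> 6 * \<delta> powr (\<alpha> - 3) * norm u * (norm v)^2"
  proof (rule mean_value_bound)
    fix \<tau> :: real assume t: "\<tau> \<in> {0..1}"
    show "(?f has_real_derivative (kin_hess \<alpha> \<delta> (p + \<tau> *\<^sub>R v) u v - kin_hess \<alpha> \<delta> p u v)) (at \<tau>)"
      using DERIV_diff[OF kin_grad_line_derivative[OF rad_pos[OF \<delta>], where u=u and \<alpha>=\<alpha> and p=p and \<tau>=\<tau> and w=v] DERIV_cmult_right[OF DERIV_ident, of "kin_hess \<alpha> \<delta> p u v"]] by simp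
    have "\<bar>kin_hess \<alpha> \<delta> (p + \<tau> *\<^sub>R v) u v - kin_hess \<alpha> \<delta> p u v\<bar> \<le> 6 * \<delta> powr (\<alpha> - 3) * (norm (\<tau> *\<^sub>R v) * norm u * norm v)"
      by (rule kin_hess_lipschitz[OF \<alpha> \<delta>]) (simp add: rad_def)
    also have "\<dots> \<le> 6 * \<delta> powr (\<alpha> - 3) * (norm v * norm u * norm v)" using t by (intro mult_left_mono mult_right_mono) (auto simp: mult_left_le_one_le)
    finally show "\<bar>kin_hess \<alpha> \<delta> (p + \<tau> *\<^sub>R v) u v - kin_hess \<alpha> \<delta> p u v\<bar> \<le> 6 * \<delta> powr (\<alpha> - 3) * norm u * (norm v)^2"
      by (simp add: power2_eq_square mult_ac)
  qed
  then show ?thesis by (simp add: inner_diff_right algebra_simps)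
qed

lemma kinetic_reg_remainder:
  fixes p v :: "real ^ 'd"
  assumes \<alpha>: "1 < \<alpha>" "\<alpha> \<le> 2" and \<delta>: "\<delta> > 0"
  shows "\<bar>kinetic_reg \<alpha> \<delta> (p + v) - kinetic_reg \<alpha> \<delta> p - kin_grad \<alpha> \<delta> p \<bullet> v\<bar> \<le> 2 * \<delta> powr (\<alpha> - 2) * (norm v)^2"
proof -
  have hb: "\<bar>kin_hess \<alpha> \<delta> x v v\<bar> \<le> 2 * \<delta> powr (\<alpha> - 2) * (norm v)^2" for x :: "real ^ 'd"
  proof -
    have "rad \<delta> x powr ((\<alpha> - 2) / 2) \<le> (\<delta>^2) powr ((\<alpha> - 2) / 2)" using \<alpha> \<delta> by (intro powr_mono2') (auto simp: rad_def)
    also have "\<dots> = \<delta> powr (\<alpha> - 2)" using \<delta> by (rule square_powr_half)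
    finally have "2 * rad \<delta> x powr ((\<alpha> - 2) / 2) * (norm v * norm v) \<le> 2 * \<delta> powr (\<alpha> - 2) * (norm v * norm v)" by (intro mult_right_mono mult_left_mono) auto
    then show ?thesis using kin_hess_bound[OF \<alpha> rad_pos[OF \<delta>], of x v v] by (simp add: power2_eq_square)
  qed
  let ?f = "\<lambda>\<tau>. kinetic_reg \<alpha> \<delta> (p + \<tau> *\<^sub>R v) - \<tau> * (kin_grad \<alpha> \<delta> p \<bullet> v)"
  have "\<bar>?f 1 - ?f 0\<bar> \<le> 2 * \<delta> powr (\<alpha> - 2) * (norm v)^2"
  proof (rule mean_value_bound)
    fix \<tau> :: real assume t: "\<tau> \<in> {0..1}"
    show "(?f has_real_derivative (v \<bullet> kin_grad \<alpha> \<delta> (p + \<tau> *\<^sub>R v) - kin_grad \<alpha> \<delta> p \<bullet> v)) (at \<tau>)"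
      using DERIV_diff[OF kinetic_reg_line_derivative[OF rad_pos[OF \<delta>] \<alpha>(1), where p=p and \<tau>=\<tau> and w=v] DERIV_cmult_right[OF DERIV_ident, of "kin_grad \<alpha> \<delta> p \<bullet> v"]] by simp
    let ?g = "\<lambda>\<sigma>. v \<bullet> kin_grad \<alpha> \<delta> (p + \<sigma> *\<^sub>R (\<tau> *\<^sub>R v))"
    have "\<bar>?g 1 - ?g 0\<bar> \<le> 2 * \<delta> powr (\<alpha> - 2) * (norm v)^2"
    proof (rule mean_value_bound)
      fix \<sigma> :: real
      show "(?g has_real_derivative kin_hess \<alpha> \<delta> (p + \<sigma> *\<^sub>R (\<tau> *\<^sub>R v)) v (\<tau> *\<^sub>R v)) (at \<sigma>)"
        by (rule kin_grad_line_derivative[OF rad_pos[OF \<delta>]])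
      have "kin_hess \<alpha> \<delta> x v (\<tau> *\<^sub>R v) = \<tau> * kin_hess \<alpha> \<delta> x v v" for x by (simp add: kin_hess_def algebra_simps)
      then have "\<bar>kin_hess \<alpha> \<delta> (p + \<sigma> *\<^sub>R (\<tau> *\<^sub>R v)) v (\<tau> *\<^sub>R v)\<bar> = \<bar>\<tau>\<bar> * \<bar>kin_hess \<alpha> \<delta> (p + \<sigma> *\<^sub>R (\<tau> *\<^sub>R v)) v v\<bar>" by (simp add: abs_mult)
      also have "\<dots> \<le> 1 * (2 * \<delta> powr (\<alpha> - 2) * (norm v)^2)" using t by (intro mult_mono hb) auto
      finally show "\<bar>kin_hess \<alpha> \<delta> (p + \<sigma> *\<^sub>R (\<tau> *\<^sub>R v)) v (\<tau> *\<^sub>R v)\<bar> \<le> 2 * \<delta> powr (\<alpha> - 2) * (norm v)^2" by simp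
    qed
    then show "\<bar>v \<bullet> kin_grad \<alpha> \<delta> (p + \<tau> *\<^sub>R v) - kin_grad \<alpha> \<delta> p \<bullet> v\<bar> \<le> 2 * \<delta> powr (\<alpha> - 2) * (norm v)^2"
      by (simp add: inner_commute)
  qed
  then show ?thesis by (simp add: algebra_simps)
qed

lemma gradient_eqI:
  assumes "(f has_derivative (\<lambda>v. g \<bullet> v)) (at x)"
  shows "gradient f x = g" unfolding gradient_def frechet_derivative_at[OF assms, symmetric] by (simp add: vec_eq_iff inner_axis)

lemma kinetic_reg_has_derivative:
  fixes p :: "real ^ 'd"
  assumes \<alpha>: "1 < \<alpha>" "\<alpha> \<le> 2" and \<delta>: "\<delta> > 0"
  shows "(kinetic_reg \<alpha> \<delta> has_derivative (\<lambda>v. kin_grad \<alpha> \<delta> p \<bullet> v)) (at p)"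
proof (rule has_derivative_quadratic_remainder[where r=1])
  show "bounded_linear (\<lambda>v. kin_grad \<alpha> \<delta> p \<bullet> v)" by (rule bounded_linear_inner_right)
  show "norm (kinetic_reg \<alpha> \<delta> y - kinetic_reg \<alpha> \<delta> p - kin_grad \<alpha> \<delta> p \<bullet> (y - p)) \<le> 2 * \<delta> powr (\<alpha> - 2) * (norm (y - p))^2" for y
    using kinetic_reg_remainder[OF \<alpha> \<delta>, of p "y - p"] by simp
qed simp

lemma gradient_kinetic_reg:
  fixes p :: "real ^ 'd"
  assumes "1 < \<alpha>" "\<alpha> \<le> 2" "\<delta> > 0"
  shows "gradient (kinetic_reg \<alpha> \<delta>) p = kin_grad \<alpha> \<delta> p" by (rule gradient_eqI[OF kinetic_reg_has_derivative[OF assms]])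

lemma gradient_affine: "gradient (\<lambda>x. c0 + c1 \<bullet> x) q = c1" by (rule gradient_eqI) (auto intro!: derivative_eq_intros)

text \<open>Majorants fail at the crossing times: there the distance is 0, and
  \<open>0 powr e\<close> is 0 by convention, which controls nothing. Finitely many points do not
  affect the integral.\<close>

lemma integral_le_except_finite:
  fixes f G :: "real \<Rightarrow> real"
  assumes f: "f integrable_on {a..b}" and G: "(G has_integral I) {a..b}" and S: "finite S"
    and le: "\<And>s. s \<in> {a..b} \<Longrightarrow> s \<notin> S \<Longrightarrow> f s \<le> G s"
  shows "integral {a..b} f \<le> I"
proof -
  define G' where "G' s = (if s \<in> S then f s else G s)" for s
  have "(G' has_integral I) {a..b}" by (rule has_integral_spike_finite[OF S _ G]) (simp add: G'_def)
  from has_integral_le[OF integrable_integral[OF f] this] show ?thesis using le by (auto simp: G'_def)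
qed

section \<open>Integrating the singularity of the Hessian along a line of momenta\<close>

locale linear_potential_phase =
  fixes \<alpha> tf :: real and c1 :: "real ^ 'd"
  assumes \<alpha>1: "1 < \<alpha>" and \<alpha>2: "\<alpha> \<le> 2" and c1: "c1 \<noteq> 0" and tf: "tf > 0"
begin

text \<open>A majorant, up to constants, for increments of the Hessian over a step of length
  \<open>m\<close> at distance \<open>x\<close> from the singularity. For
  \<open>\<alpha> < 2\<close> it is comparable to \<open>x powr (\<alpha> - 2)\<close> when
  \<open>x\<close> is of order \<open>m\<close> or less, and to
  \<open>m * x powr (\<alpha> - 3)\<close> when \<open>x\<close> is larger. One function thus serves
  both regimes, and its primitive \<open>prim m\<close>, normalised to vanish at 0, is
  elementary.\<close>

definition gap :: "real \<Rightarrow> real \<Rightarrow> real" where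
  "gap m x = x powr (\<alpha> - 2) - (x + m) powr (\<alpha> - 2)"

definition prim :: "real \<Rightarrow> real \<Rightarrow> real" where
  "prim m x = (x powr (\<alpha> - 1) - (x + m) powr (\<alpha> - 1) + m powr (\<alpha> - 1)) / (\<alpha> - 1)"

lemma gap_nonneg: "0 < x \<Longrightarrow> 0 < m \<Longrightarrow> 0 \<le> gap m x" unfolding gap_def using powr_mono2'[of "\<alpha> - 2" x "x + m"] \<alpha>2 by simp

text \<open>Nonnegativity is subadditivity of the power \<open>\<alpha> - 1\<close>, obtained by
  splitting off one factor and using that the power \<open>\<alpha> - 2\<close> is nonincreasing.
  The upper bound does not involve \<open>x\<close>, so integrals of \<open>gap\<close> stay bounded
  over intervals of any length.\<close>

lemma prim_bounds:
  assumes "0 \<le> x" "0 < m"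
  shows "0 \<le> prim m x" "prim m x \<le> m powr (\<alpha> - 1) / (\<alpha> - 1)"
proof -
  have "(x + m) powr (\<alpha> - 1) \<le> x powr (\<alpha> - 1) + m powr (\<alpha> - 1)"
  proof (cases "x = 0")
    case False
    with assms have x: "x > 0" by simp
    have split: "y powr (\<alpha> - 1) = y * y powr (\<alpha> - 2)" if "y > 0" for y :: real using that powr_add[of y 1 "\<alpha> - 2"] by simp
    have "(x + m) powr (\<alpha> - 1) = x * (x + m) powr (\<alpha> - 2) + m * (x + m) powr (\<alpha> - 2)" using x assms by (subst split) (auto simp: distrib_right)
    also have "\<dots> \<le> x * x powr (\<alpha> - 2) + m * m powr (\<alpha> - 2)" using x assms \<alpha>2 by (intro add_mono mult_left_mono powr_mono2') auto
    also have "\<dots> = x powr (\<alpha> - 1) + m powr (\<alpha> - 1)" using x assms by (simp add: split)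
    finally show ?thesis .
  qed simp
  then show "0 \<le> prim m x" unfolding prim_def using \<alpha>1 by simp
  have "x powr (\<alpha> - 1) \<le> (x + m) powr (\<alpha> - 1)" using assms \<alpha>1 by (intro powr_mono2) auto
  then show "prim m x \<le> m powr (\<alpha> - 1) / (\<alpha> - 1)" unfolding prim_def using \<alpha>1 by (intro divide_right_mono) auto
qed

lemma prim_derivative: "0 < x \<Longrightarrow> 0 < m \<Longrightarrow> (prim m has_real_derivative gap m x) (at x)"
proof -
  assume x: "0 < x" "0 < m"
  have "((\<lambda>x. (x + m) powr (\<alpha> - 1)) has_real_derivative (\<alpha> - 1) * (x + m) powr (\<alpha> - 1 - of_nat 1) * 1) (at x)"
    by (rule DERIV_fun_powr) (use x in \<open>auto intro!: derivative_eq_intros\<close>)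
  moreover have "((\<lambda>x. x powr (\<alpha> - 1)) has_real_derivative (\<alpha> - 1) * x powr (\<alpha> - 1 - 1)) (at x)" by (rule has_real_derivative_powr) (rule x)
  ultimately have "(prim m has_real_derivative ((\<alpha> - 1) * x powr (\<alpha> - 1 - 1) - (\<alpha> - 1) * (x + m) powr (\<alpha> - 1 - of_nat 1) * 1 + 0) / (\<alpha> - 1)) (at x)"
    unfolding prim_def[abs_def] by (intro DERIV_cdivide DERIV_add DERIV_diff DERIV_const)
  moreover have "\<alpha> - 1 - 1 = \<alpha> - 2" "\<alpha> - 1 - of_nat 1 = \<alpha> - 2" by simp_all
  moreover have "((\<alpha> - 1) * A - (\<alpha> - 1) * B * 1 + 0) / (\<alpha> - 1) = A - B" for A B :: real using \<alpha>1 by (simp add: right_diff_distrib[symmetric])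
  ultimately show ?thesis unfolding gap_def by (simp only:)
qed

text \<open>Each side of the singular time \<open>s0\<close> contributes at most the supremum of the
  primitive divided by the speed \<open>c\<close>, so the bound depends neither on \<open>t\<close>
  nor on \<open>s0\<close>. The power of \<open>m\<close> obtained here is the Hoelder exponent of
  the Hessian of the phase.\<close>

lemma gap_has_integral:
  assumes t: "0 \<le> t" and m: "0 < m" and c: "0 < c"
  shows "\<exists>I. ((\<lambda>s. gap m (c * \<bar>s - s0\<bar>)) has_integral I) {0..t} \<and> I \<le> 2 * m powr (\<alpha> - 1) / ((\<alpha> - 1) * c)"
proof -
  \<comment> \<open>A continuous primitive through the singular time: the two one-sided primitives
    vanish at \<open>s0\<close>, and each maximum switches off the inactive side. The fundamental
    theorem is then applied with \<open>s0\<close> as exceptional point.\<close>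
  define F where "F s = (prim m (max (c * (s - s0)) 0) - prim m (max (- (c * (s - s0))) 0)) / c" for s
  have p0: "prim m 0 = 0" by (simp add: prim_def)
  have cont: "continuous_on {0..} (prim m)" unfolding prim_def[abs_def] using \<alpha>1 m by (intro continuous_intros continuous_on_powr') auto
  have Fpos: "prim m (c * (x - s0)) / c = F x" if "x > s0" for x
  proof -
    have "0 < c * (x - s0)" using that c by simp
    then show ?thesis by (simp add: F_def p0 max_def)
  qed
  have Fneg: "- (prim m (- (c * (x - s0))) / c) = F x" if "x < s0" for x
  proof -
    have "c * (x - s0) < 0" using that c by (simp add: mult_pos_neg)
    then show ?thesis by (simp add: F_def p0 max_def)
  qed
  have "((\<lambda>s. gap m (c * \<bar>s - s0\<bar>)) has_integral (F t - F 0)) {0..t}"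
  proof (rule fundamental_theorem_of_calculus_interior_strong[of "{s0}"])
    show "continuous_on {0..t} F" unfolding F_def by (intro continuous_intros continuous_on_compose2[OF cont]) (use c in auto)
    fix s assume s: "s \<in> {0<..<t} - {s0}"
    show "(F has_vector_derivative gap m (c * \<bar>s - s0\<bar>)) (at s)"
    proof (cases "s > s0")
      case True
      have "((\<lambda>s. prim m (c * (s - s0)) / c) has_real_derivative (gap m (c * (s - s0)) * c) / c) (at s)"
        by (intro DERIV_cdivide DERIV_chain2[OF prim_derivative]) (use True c m in \<open>auto intro!: derivative_eq_intros\<close>)
      then have "(F has_real_derivative (gap m (c * (s - s0)) * c) / c) (at s)" by (rule has_field_derivative_transform_within_open[of _ _ _ "{s0<..}"]) (use True Fpos in auto)
      then show ?thesis using True c unfolding has_real_derivative_iff_has_vector_derivative by simp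
    next
      case False
      with s have less: "s < s0" by auto
      have "((\<lambda>s. - (prim m (- (c * (s - s0))) / c)) has_real_derivative - ((gap m (- (c * (s - s0))) * (- c)) / c)) (at s)"
        by (intro DERIV_minus DERIV_cdivide DERIV_chain2[OF prim_derivative]) (use less c m in \<open>auto intro!: derivative_eq_intros simp: mult_pos_neg\<close>)
      then have "(F has_real_derivative - ((gap m (- (c * (s - s0))) * (- c)) / c)) (at s)" by (rule has_field_derivative_transform_within_open[of _ _ _ "{..<s0}"]) (use less Fneg in auto)
      moreover have "- (c * (s - s0)) = c * \<bar>s - s0\<bar>" using less by (simp add: algebra_simps)
      ultimately show ?thesis using c unfolding has_real_derivative_iff_has_vector_derivative by simp
    qed
  qed (use t in auto)
  moreover have "F t - F 0 \<le> 2 * m powr (\<alpha> - 1) / ((\<alpha> - 1) * c)"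
  proof -
    let ?M = "m powr (\<alpha> - 1) / (\<alpha> - 1)"
    have "F t \<le> ?M / c" unfolding F_def using prim_bounds[of "max (c * (t - s0)) 0" m] prim_bounds[of "max (- (c * (t - s0))) 0" m] m c by (intro divide_right_mono) auto
    moreover have "- F 0 \<le> ?M / c" unfolding F_def minus_divide_left
      using prim_bounds[of "max (c * (0 - s0)) 0" m] prim_bounds[of "max (- (c * (0 - s0))) 0" m] m c by (intro divide_right_mono) auto
    moreover have "?M / c + ?M / c = 2 * m powr (\<alpha> - 1) / ((\<alpha> - 1) * c)" by (simp add: add_divide_distrib[symmetric])
    ultimately show ?thesis by linarith
  qed
  ultimately show ?thesis by blast
qed

text \<open>The time at which \<open>p - s *\<^sub>R c1\<close> is orthogonal to \<open>c1\<close>,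
  hence nearest to the origin.\<close>

definition crossing :: "real ^ 'd \<Rightarrow> real" where
  "crossing p = (p \<bullet> c1) / (norm c1)^2"

text \<open>The length of the component of \<open>p - s *\<^sub>R c1\<close> along
  \<open>c1\<close>. It bounds the distance to the origin from below and is linear in time on each
  side of the crossing, so the transversal components of \<open>p\<close> drop out of the
  estimates.\<close>

definition dist_line :: "real ^ 'd \<Rightarrow> real \<Rightarrow> real" where
  "dist_line p s = norm c1 * \<bar>s - crossing p\<bar>"

lemma norm_c1: "norm c1 > 0" using c1 by simp

lemma dist_line_pos: "s \<noteq> crossing p \<Longrightarrow> 0 < dist_line p s" using norm_c1 by (simp add: dist_line_def)

lemma dist_line_eq: "dist_line p s = \<bar>(p - s *\<^sub>R c1) \<bullet> c1\<bar> / norm c1"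
proof -
  have "(p - s *\<^sub>R c1) \<bullet> c1 = - ((norm c1)^2 * (s - crossing p))" using norm_c1 by (simp add: crossing_def inner_diff_left power2_norm_eq_inner field_simps)
  then show ?thesis using norm_c1 by (simp add: dist_line_def abs_mult power2_eq_square)
qed

lemma dist_line_le: "dist_line p s \<le> norm (p - s *\<^sub>R c1)" unfolding dist_line_eq using Cauchy_Schwarz_ineq2[of "p - s *\<^sub>R c1" c1] norm_c1 by (simp add: divide_le_eq)

lemma dist_line_lipschitz: "dist_line (p + w) s \<le> dist_line p s + norm w"
proof -
  have "\<bar>(p + w - s *\<^sub>R c1) \<bullet> c1\<bar> \<le> \<bar>(p - s *\<^sub>R c1) \<bullet> c1\<bar> + \<bar>w \<bullet> c1\<bar>" by (simp add: inner_add_left inner_diff_left)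
  also have "\<bar>w \<bullet> c1\<bar> \<le> norm w * norm c1" by (rule Cauchy_Schwarz_ineq2)
  finally have "\<bar>(p + w - s *\<^sub>R c1) \<bullet> c1\<bar> / norm c1 \<le> (\<bar>(p - s *\<^sub>R c1) \<bullet> c1\<bar> + norm w * norm c1) / norm c1"
    using norm_c1 by (intro divide_right_mono) auto
  then show ?thesis unfolding dist_line_eq using norm_c1 by (simp add: add_divide_distrib)
qed

lemma rad_powr_le_dist_line:
  assumes "s \<noteq> crossing p"
  shows "rad \<delta> (p - s *\<^sub>R c1) powr ((\<alpha> - 2) / 2) \<le> dist_line p s powr (\<alpha> - 2)"
proof -
  have d: "dist_line p s > 0" using assms by (rule dist_line_pos)
  have "(dist_line p s)^2 \<le> (norm (p - s *\<^sub>R c1))^2" using d dist_line_le[of p s] by (intro power_mono) auto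
  also have "\<dots> \<le> rad \<delta> (p - s *\<^sub>R c1)" by (rule rad_ge_norm)
  finally have "rad \<delta> (p - s *\<^sub>R c1) powr ((\<alpha> - 2) / 2) \<le> ((dist_line p s)^2) powr ((\<alpha> - 2) / 2)" using d \<alpha>2 by (intro powr_mono2') auto
  then show ?thesis using d by (simp only: square_powr_half)
qed

text \<open>For \<open>x \<le> 3 * m\<close> the shifted argument is at least
  \<open>(4/3) * x\<close>, so the subtracted power is at most the fixed fraction
  \<open>(4/3) powr (\<alpha> - 2)\<close> of the first one.\<close>

lemma gap_lower_near:
  assumes "0 < x" "x \<le> 3 * m" "\<alpha> < 2"
  shows "x powr (\<alpha> - 2) \<le> gap m x / (1 - (4/3) powr (\<alpha> - 2))"
proof -
  have k: "(4/3) powr (\<alpha> - 2) < (1::real)" using powr_less_mono[of "\<alpha> - 2" 0 "4/3"] assms by simp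
  have "(x + m) powr (\<alpha> - 2) \<le> ((4/3) * x) powr (\<alpha> - 2)" using assms by (intro powr_mono2') auto
  also have "\<dots> = (4/3) powr (\<alpha> - 2) * x powr (\<alpha> - 2)" using assms by (subst powr_mult) auto
  finally have "x powr (\<alpha> - 2) * (1 - (4/3) powr (\<alpha> - 2)) \<le> gap m x" by (simp add: gap_def algebra_simps)
  then show ?thesis using k by (simp add: pos_le_divide_eq)
qed

text \<open>Mean value theorem for the power \<open>\<alpha> - 2\<close> on the step from
  \<open>x\<close> to \<open>x + m\<close>. The intermediate point lies below \<open>2 * x\<close>,
  and \<open>2 powr (\<alpha> - 3)\<close> is at least 1/4 because
  \<open>\<alpha> > 1\<close>.\<close>

lemma gap_lower_far:
  assumes "0 < m" "2 * m \<le> x" "\<alpha> < 2"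
  shows "m * x powr (\<alpha> - 3) \<le> 4 / (2 - \<alpha>) * gap m x"
proof -
  have x: "x > 0" using assms by simp
  have "\<exists>z. x < z \<and> z < x + m \<and> (x + m) powr (\<alpha> - 2) - x powr (\<alpha> - 2) = ((x + m) - x) * ((\<alpha> - 2) * z powr (\<alpha> - 2 - 1))"
  proof (rule MVT2)
    show "((\<lambda>x. x powr (\<alpha> - 2)) has_real_derivative (\<alpha> - 2) * z powr (\<alpha> - 2 - 1)) (at z)" if "x \<le> z" for z
      by (rule has_real_derivative_powr) (use that x in linarith)
  qed (use assms in simp)
  then obtain z where z: "x < z" "z < x + m" "(x + m) powr (\<alpha> - 2) - x powr (\<alpha> - 2) = m * ((\<alpha> - 2) * z powr (\<alpha> - 2 - 1))" by auto
  have e: "\<alpha> - 2 - 1 = \<alpha> - 3" by simp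
  have gz: "gap m x = (2 - \<alpha>) * (m * z powr (\<alpha> - 3))" using z(3) unfolding gap_def e by (simp add: algebra_simps)
  have "(2 * x) powr (\<alpha> - 3) \<le> z powr (\<alpha> - 3)" using z x assms by (intro powr_mono2') auto
  then have "2 powr (\<alpha> - 3) * x powr (\<alpha> - 3) \<le> z powr (\<alpha> - 3)" using x by (simp add: powr_mult)
  moreover have "(1/4) \<le> 2 powr (\<alpha> - 3)"
  proof -
    have "2 powr (-2) \<le> 2 powr (\<alpha> - 3)" using \<alpha>1 by (intro powr_mono) auto
    moreover have "2 powr (-2) = (1/4 :: real)" by (simp add: powr_minus)
    ultimately show ?thesis by simp
  qed
  ultimately have "(1/4) * x powr (\<alpha> - 3) \<le> z powr (\<alpha> - 3)" using mult_right_mono[of "1/4" "2 powr (\<alpha> - 3)" "x powr (\<alpha> - 3)"] by simp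
  then have "x powr (\<alpha> - 3) \<le> 4 * z powr (\<alpha> - 3)" by simp
  then have "m * x powr (\<alpha> - 3) \<le> m * (4 * z powr (\<alpha> - 3))" using assms by (intro mult_left_mono) auto
  also have "\<dots> = 4 / (2 - \<alpha>) * gap m x" unfolding gz using assms by simp
  finally show ?thesis .
qed

text \<open>The far regime contributes 96 as 6 * 4 * 4: the Lipschitz constant of the Hessian, the
  halving of the distance, and \<open>gap_lower_far\<close>. The near regime contributes the second
  summand. Both blow up as \<open>\<alpha>\<close> tends to 2, where \<open>gap\<close> vanishes and
  the Hessian is constant; that case is treated apart.\<close>

definition hoelder_const :: real where
  "hoelder_const = 96 / (2 - \<alpha>) + 2 / (1 - (4/3) powr (\<alpha> - 2))"

lemma hoelder_const_nonneg: "\<alpha> < 2 \<Longrightarrow> 0 \<le> hoelder_const" using powr_less_mono[of "\<alpha> - 2" 0 "4/3"] by (simp add: hoelder_const_def)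

text \<open>Two regimes. If the distance along \<open>c1\<close> is at least
  \<open>2 * norm w\<close>, the segment joining the two momenta keeps at least half of that
  distance from the origin, and the Lipschitz bound applies. Otherwise both distances are at most
  \<open>3 * norm w\<close>, as they differ by at most \<open>norm w\<close>, and each Hessian is
  bounded on its own.\<close>

lemma kin_hess_difference:
  fixes p w v :: "real ^ 'd"
  assumes \<alpha>: "\<alpha> < 2" and \<delta>: "\<delta> > 0" and w: "w \<noteq> 0" and s: "s \<noteq> crossing p" "s \<noteq> crossing (p + w)"
  shows "\<bar>kin_hess \<alpha> \<delta> (p + w - s *\<^sub>R c1) v v - kin_hess \<alpha> \<delta> (p - s *\<^sub>R c1) v v\<bar>
    \<le> hoelder_const * (norm v)^2 * (gap (norm w) (dist_line p s) + gap (norm w) (dist_line (p + w) s))"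
proof -
  let ?m = "norm w" let ?x = "dist_line p s" let ?y = "dist_line (p + w) s" let ?a = "p - s *\<^sub>R c1"
  have m: "?m > 0" using w by simp
  have xy: "?x > 0" "?y > 0" using s by (auto intro: dist_line_pos)
  have g: "gap ?m ?x \<ge> 0" "gap ?m ?y \<ge> 0" using gap_nonneg xy m by auto
  have k: "1 - (4/3) powr (\<alpha> - 2) > (0::real)" using powr_less_mono[of "\<alpha> - 2" 0 "4/3"] \<alpha> by simp
  show ?thesis
  proof (cases "2 * ?m \<le> ?x")
    case True
    have aw: "p + w - s *\<^sub>R c1 = ?a + w" by simp
    have h1: "\<bar>kin_hess \<alpha> \<delta> (?a + w) v v - kin_hess \<alpha> \<delta> ?a v v\<bar> \<le> 6 * (?x / 2) powr (\<alpha> - 3) * (norm w * norm v * norm v)"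
    proof (rule kin_hess_lipschitz[OF \<alpha>1 \<alpha>2])
      show "?x / 2 > 0" using xy by simp
      fix \<tau> :: real assume t: "\<tau> \<in> {0..1}"
      have "?x \<le> norm ?a" by (rule dist_line_le)
      also have "norm ?a \<le> norm (?a + \<tau> *\<^sub>R w) + norm (\<tau> *\<^sub>R w)" using norm_triangle_ineq4[of "?a + \<tau> *\<^sub>R w" "\<tau> *\<^sub>R w"] by simp
      also have "norm (\<tau> *\<^sub>R w) \<le> ?m" using t by (simp add: mult_left_le_one_le)
      finally have "?x / 2 \<le> norm (?a + \<tau> *\<^sub>R w)" using True by linarith
      then have "(?x / 2)^2 \<le> (norm (?a + \<tau> *\<^sub>R w))^2" using xy by (intro power_mono) auto
      then show "(?x / 2)^2 \<le> rad \<delta> (?a + \<tau> *\<^sub>R w)" using rad_ge_norm order_trans by blast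
    qed
    have pw: "(?x / 2) powr (\<alpha> - 3) \<le> 4 * ?x powr (\<alpha> - 3)"
    proof -
      have "(?x / 2) powr (\<alpha> - 3) = ?x powr (\<alpha> - 3) * 2 powr (3 - \<alpha>)"
      proof -
        have "2 powr (3 - \<alpha>) = 1 / 2 powr (\<alpha> - 3)" using powr_minus_divide[of 2 "\<alpha> - 3"] by simp
        then show ?thesis using xy by (simp add: powr_divide)
      qed
      moreover have "2 powr (3 - \<alpha>) \<le> 2 powr (2::real)" using \<alpha>1 by (intro powr_mono) auto
      ultimately show ?thesis using mult_left_mono[of "2 powr (3 - \<alpha>)" 4 "?x powr (\<alpha> - 3)"] by (simp add: mult.commute)
    qed
    have "\<bar>kin_hess \<alpha> \<delta> (?a + w) v v - kin_hess \<alpha> \<delta> ?a v v\<bar> \<le> 6 * (4 * ?x powr (\<alpha> - 3)) * (norm w * norm v * norm v)"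
      by (rule order_trans[OF h1]) (intro mult_right_mono mult_left_mono pw, auto)
    also have "6 * (4 * ?x powr (\<alpha> - 3)) * (norm w * norm v * norm v) = 24 * (norm v)^2 * (norm w * ?x powr (\<alpha> - 3))" by (simp add: power2_eq_square)
    also have "\<dots> \<le> 24 * (norm v)^2 * (4 / (2 - \<alpha>) * gap ?m ?x)" by (intro mult_left_mono gap_lower_far) (use True m \<alpha> in auto)
    also have "\<dots> = 96 / (2 - \<alpha>) * (norm v)^2 * gap ?m ?x" by simp
    also have "\<dots> \<le> hoelder_const * (norm v)^2 * (gap ?m ?x + gap ?m ?y)" using g k \<alpha> by (intro mult_mono mult_right_mono) (auto simp: hoelder_const_def)
    finally show ?thesis unfolding aw .
  next
    case False
    have y3: "?y \<le> 3 * ?m" using dist_line_lipschitz[of p w s] False by simp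
    have near: "\<bar>kin_hess \<alpha> \<delta> (q - s *\<^sub>R c1) v v\<bar> \<le> 2 * (norm v)^2 * (gap ?m (dist_line q s) / (1 - (4/3) powr (\<alpha> - 2)))"
      if q: "s \<noteq> crossing q" "dist_line q s \<le> 3 * ?m" for q
    proof -
      have "\<bar>kin_hess \<alpha> \<delta> (q - s *\<^sub>R c1) v v\<bar> \<le> 2 * rad \<delta> (q - s *\<^sub>R c1) powr ((\<alpha> - 2) / 2) * (norm v * norm v)"
        by (rule kin_hess_bound[OF \<alpha>1 \<alpha>2 rad_pos[OF \<delta>]])
      also have "\<dots> \<le> 2 * dist_line q s powr (\<alpha> - 2) * (norm v * norm v)" using rad_powr_le_dist_line[OF q(1)] by (intro mult_right_mono mult_left_mono) auto
      also have "\<dots> = 2 * (norm v)^2 * dist_line q s powr (\<alpha> - 2)" by (simp add: power2_eq_square)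
      also have "\<dots> \<le> 2 * (norm v)^2 * (gap ?m (dist_line q s) / (1 - (4/3) powr (\<alpha> - 2)))" by (intro mult_left_mono gap_lower_near dist_line_pos q \<alpha>) auto
      finally show ?thesis .
    qed
    have "\<bar>kin_hess \<alpha> \<delta> (p + w - s *\<^sub>R c1) v v - kin_hess \<alpha> \<delta> (p - s *\<^sub>R c1) v v\<bar>
       \<le> 2 * (norm v)^2 * (gap ?m ?y / (1 - (4/3) powr (\<alpha> - 2))) + 2 * (norm v)^2 * (gap ?m ?x / (1 - (4/3) powr (\<alpha> - 2)))"
    proof -
      have x3: "?x \<le> 3 * ?m" using False m by linarith
      show ?thesis using near[OF s(2) y3] near[OF s(1) x3] by linarith
    qed
    also have "\<dots> = 2 / (1 - (4/3) powr (\<alpha> - 2)) * (norm v)^2 * (gap ?m ?x + gap ?m ?y)" by (simp add: add_divide_distrib[symmetric] distrib_left[symmetric] add.commute)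
    also have "\<dots> \<le> hoelder_const * (norm v)^2 * (gap ?m ?x + gap ?m ?y)" using g \<alpha> by (intro mult_right_mono) (auto simp: hoelder_const_def)
    finally show ?thesis .
  qed
qed

text \<open>The majorant is handed over together with its integral, so the singular power itself is
  never integrated. A multiple of \<open>gap 1\<close> controls it up to distance 3 and the constant
  1 beyond. For \<open>\<alpha> = 2\<close> the power is constant and \<open>gap\<close> vanishes,
  hence the separate case.\<close>

lemma dist_line_powr_majorant:
  "\<exists>A>0. \<forall>p. \<forall>t\<in>{0..tf}. \<exists>\<Phi> I. (\<Phi> has_integral I) {0..t} \<and> I \<le> A \<and> (\<forall>s. s \<noteq> crossing p \<longrightarrow> dist_line p s powr (\<alpha> - 2) \<le> \<Phi> s)"
proof (cases "\<alpha> = 2")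
  case True
  have "\<exists>\<Phi> I. (\<Phi> has_integral I) {0..t} \<and> I \<le> tf \<and> (\<forall>s. s \<noteq> crossing p \<longrightarrow> dist_line p s powr (\<alpha> - 2) \<le> \<Phi> s)" if "t \<in> {0..tf}" for p t
  proof (intro exI conjI)
    show "((\<lambda>s. 1::real) has_integral t) {0..t}" using has_integral_const_real[of "1::real" 0 t] that by simp
  qed (use that True in auto)
  with tf show ?thesis by blast
next
  case False
  then have \<alpha>: "\<alpha> < 2" using \<alpha>2 by simp
  let ?k = "1 - (4/3) powr (\<alpha> - 2)"
  have k: "?k > (0::real)" using powr_less_mono[of "\<alpha> - 2" 0 "4/3"] \<alpha> by simp
  define A where "A = tf + 2 / ((\<alpha> - 1) * norm c1) / ?k"
  have "A > 0" unfolding A_def using tf k \<alpha>1 norm_c1 by (simp add: add_pos_nonneg)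
  moreover have "\<exists>\<Phi> I. (\<Phi> has_integral I) {0..t} \<and> I \<le> A \<and> (\<forall>s. s \<noteq> crossing p \<longrightarrow> dist_line p s powr (\<alpha> - 2) \<le> \<Phi> s)" if t: "t \<in> {0..tf}" for p t
  proof -
    obtain I where I: "((\<lambda>s. gap 1 (dist_line p s)) has_integral I) {0..t}" "I \<le> 2 / ((\<alpha> - 1) * norm c1)"
      using gap_has_integral[of t 1 "norm c1" "crossing p"] t norm_c1 unfolding dist_line_def by auto
    have "((\<lambda>s. 1 + gap 1 (dist_line p s) / ?k) has_integral (t + I / ?k)) {0..t}"
      using has_integral_add[OF has_integral_const_real[of "1::real" 0 t] has_integral_divide[OF I(1), of ?k]] t by simp
    moreover have "t + I / ?k \<le> A" unfolding A_def using I(2) k t by (intro add_mono divide_right_mono) auto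
    moreover have "dist_line p s powr (\<alpha> - 2) \<le> 1 + gap 1 (dist_line p s) / ?k" if s: "s \<noteq> crossing p" for s
    proof (cases "dist_line p s \<le> 3")
      case True
      have "dist_line p s powr (\<alpha> - 2) \<le> gap 1 (dist_line p s) / ?k" using gap_lower_near[of "dist_line p s" 1] dist_line_pos[OF s] True \<alpha> by simp
      then show ?thesis by simp
    next
      case False
      have "dist_line p s powr (\<alpha> - 2) \<le> dist_line p s powr 0" using False \<alpha> by (intro powr_mono) auto
      moreover have "0 \<le> gap 1 (dist_line p s) / ?k" using gap_nonneg[OF dist_line_pos[OF s], of 1] k by simp
      ultimately show ?thesis using dist_line_pos[OF s] by simp
    qed
    ultimately show ?thesis by blast
  qed
  ultimately show ?thesis by blast
qed

end

section \<open>The phase and its Hessian\<close>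

lemma rad_continuous [continuous_intros]:
  "continuous_on S f \<Longrightarrow> continuous_on S (\<lambda>x. rad \<delta> (f x))" unfolding rad_def by (intro continuous_intros)

lemma kin_hess_add_right: "kin_hess \<alpha> \<delta> p u (v + w) = kin_hess \<alpha> \<delta> p u v + kin_hess \<alpha> \<delta> p u w"
  by (simp add: kin_hess_def inner_add_right algebra_simps)

lemma kin_hess_scaleR_right: "kin_hess \<alpha> \<delta> p u (r *\<^sub>R v) = r * kin_hess \<alpha> \<delta> p u v" by (simp add: kin_hess_def algebra_simps)

lemma kin_hess_commute: "kin_hess \<alpha> \<delta> p u v = kin_hess \<alpha> \<delta> p v u" by (simp add: kin_hess_def inner_commute mult.commute)

lemma quad_form_kin_hess:
  fixes p v :: "real ^ 'd"
  shows "quad_form (\<chi> j k. kin_hess \<alpha> \<delta> p (axis j 1) (axis k 1)) v = kin_hess \<alpha> \<delta> p v v"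
proof -
  let ?A = "rad \<delta> p powr ((\<alpha> - 2) / 2)" let ?B = "(\<alpha> - 2) * rad \<delta> p powr ((\<alpha> - 4) / 2)"
  have i: "axis j 1 \<bullet> (axis k 1 :: real ^ 'd) = (if j = k then 1 else 0)" "p \<bullet> axis j 1 = p $ j" for j k by (simp add: inner_axis_axis) (simp add: inner_axis)
  have e: "kin_hess \<alpha> \<delta> p (axis j 1) (axis k 1) * (v $ j * v $ k) = (if j = k then ?A * (v $ j * v $ k) else 0) + ?B * ((p $ j * v $ j) * (p $ k * v $ k))" for j k
    unfolding kin_hess_def i by (simp add: algebra_simps)
  have "quad_form (\<chi> j k. kin_hess \<alpha> \<delta> p (axis j 1) (axis k 1)) v
    = (\<Sum>j\<in>UNIV. ?A * (v $ j * v $ j)) + (\<Sum>j\<in>UNIV. \<Sum>k\<in>UNIV. ?B * ((p $ j * v $ j) * (p $ k * v $ k)))" unfolding quad_form_def by (simp add: e sum.distrib)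
  also have "(\<Sum>j\<in>UNIV. ?A * (v $ j * v $ j)) = ?A * (v \<bullet> v)" by (simp add: inner_vec_def sum_distrib_left)
  also have "(\<Sum>j\<in>UNIV. \<Sum>k\<in>UNIV. ?B * ((p $ j * v $ j) * (p $ k * v $ k))) = ?B * ((p \<bullet> v) * (p \<bullet> v))"
    unfolding inner_vec_def inner_real_def sum_product unfolding sum_distrib_left ..
  finally show ?thesis by (simp add: kin_hess_def)
qed

context linear_potential_phase
begin

text \<open>The value \<open>\<delta> = 0\<close> is included: it is the phase of the exact
  propagator, so one definition covers both multipliers that are compared.\<close>

definition phase :: "real \<Rightarrow> real \<Rightarrow> real ^ 'd \<Rightarrow> real" where
  "phase \<delta> t p = integral {0..t} (\<lambda>s. kinetic_reg \<alpha> \<delta> (p - s *\<^sub>R c1))"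

definition phase_grad :: "real \<Rightarrow> real \<Rightarrow> real ^ 'd \<Rightarrow> real ^ 'd" where
  "phase_grad \<delta> t p = integral {0..t} (\<lambda>s. kin_grad \<alpha> \<delta> (p - s *\<^sub>R c1))"

definition phase_hess :: "real \<Rightarrow> real \<Rightarrow> real ^ 'd \<Rightarrow> real ^ 'd \<Rightarrow> real ^ 'd \<Rightarrow> real" where
  "phase_hess \<delta> t p u v = integral {0..t} (\<lambda>s. kin_hess \<alpha> \<delta> (p - s *\<^sub>R c1) u v)"

definition phase_mat :: "real \<Rightarrow> real \<Rightarrow> real ^ 'd \<Rightarrow> real ^ 'd ^ 'd" where
  "phase_mat \<delta> t p = (\<chi> j k. phase_hess \<delta> t p (axis j 1) (axis k 1))"

lemma continuous_kinetic: "continuous_on S (\<lambda>s. kinetic_reg \<alpha> \<delta> (p - s *\<^sub>R c1))"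
  unfolding kinetic_reg_rad using \<alpha>1 by (intro continuous_intros continuous_on_powr') (auto simp: rad_nonneg)

lemma continuous_rad_powr: "\<delta> > 0 \<Longrightarrow> continuous_on S (\<lambda>s. rad \<delta> (p - s *\<^sub>R c1) powr e)"
  by (intro continuous_intros) (use rad_pos[of \<delta>] in \<open>metis less_irrefl\<close>)

lemma continuous_kin_grad: "\<delta> > 0 \<Longrightarrow> continuous_on S (\<lambda>s. kin_grad \<alpha> \<delta> (p - s *\<^sub>R c1))"
  unfolding kin_grad_def by (intro continuous_on_scaleR continuous_rad_powr continuous_intros)

lemma continuous_kin_hess: "\<delta> > 0 \<Longrightarrow> continuous_on S (\<lambda>s. kin_hess \<alpha> \<delta> (p - s *\<^sub>R c1) u v)"
  unfolding kin_hess_def by (intro continuous_on_mult continuous_on_add continuous_rad_powr continuous_intros)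

lemma int_kinetic: "(\<lambda>s. kinetic_reg \<alpha> \<delta> (p - s *\<^sub>R c1)) integrable_on {a..b}" by (rule integrable_continuous_real[OF continuous_kinetic])

lemma int_kin_grad: "\<delta> > 0 \<Longrightarrow> (\<lambda>s. kin_grad \<alpha> \<delta> (p - s *\<^sub>R c1)) integrable_on {a..b}"
  by (rule integrable_continuous_real[OF continuous_kin_grad])

lemma int_kin_hess: "\<delta> > 0 \<Longrightarrow> (\<lambda>s. kin_hess \<alpha> \<delta> (p - s *\<^sub>R c1) u v) integrable_on {a..b}"
  by (rule integrable_continuous_real[OF continuous_kin_hess])

lemma inner_phase_grad:
  assumes "\<delta> > 0"
  shows "u \<bullet> phase_grad \<delta> t p = integral {0..t} (\<lambda>s. u \<bullet> kin_grad \<alpha> \<delta> (p - s *\<^sub>R c1))"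
  unfolding phase_grad_def using integral_linear[OF int_kin_grad[OF assms] bounded_linear_inner_right[of u]] by (simp add: o_def)

lemma phase_hess_bounded_linear:
  assumes \<delta>: "\<delta> > 0"
  shows "bounded_linear (phase_hess \<delta> t p u)"
proof -
  have "linear (phase_hess \<delta> t p u)"
  proof (rule linearI)
    show "phase_hess \<delta> t p u (v + w) = phase_hess \<delta> t p u v + phase_hess \<delta> t p u w" for v w
      unfolding phase_hess_def kin_hess_add_right by (rule integral_add) (rule int_kin_hess[OF \<delta>])+
    show "phase_hess \<delta> t p u (r *\<^sub>R v) = r *\<^sub>R phase_hess \<delta> t p u v" for r v unfolding phase_hess_def kin_hess_scaleR_right by simp
  qed
  then show ?thesis by (simp add: linear_conv_bounded_linear)
qed

lemma phase_mat_sym: "phase_mat \<delta> t p $ j $ k = phase_mat \<delta> t p $ k $ j" by (simp add: phase_mat_def phase_hess_def kin_hess_commute)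

lemma quad_form_phase_mat:
  assumes \<delta>: "\<delta> > 0"
  shows "quad_form (phase_mat \<delta> t p) v = phase_hess \<delta> t p v v"
proof -
  have "quad_form (phase_mat \<delta> t p) v = (\<Sum>j\<in>UNIV. \<Sum>k\<in>UNIV. integral {0..t} (\<lambda>s. kin_hess \<alpha> \<delta> (p - s *\<^sub>R c1) (axis j 1) (axis k 1) * (v $ j * v $ k)))"
    by (simp add: quad_form_def phase_mat_def phase_hess_def)
  also have "\<dots> = integral {0..t} (\<lambda>s. \<Sum>j\<in>UNIV. \<Sum>k\<in>UNIV. kin_hess \<alpha> \<delta> (p - s *\<^sub>R c1) (axis j 1) (axis k 1) * (v $ j * v $ k))"
    by (subst integral_sum, (auto intro!: integrable_sum integrable_on_mult_left int_kin_hess \<delta>)[2],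
        intro sum.cong refl, subst integral_sum, auto intro!: integrable_on_mult_left int_kin_hess \<delta>)
  also have "\<dots> = phase_hess \<delta> t p v v" unfolding phase_hess_def by (simp only: quad_form_kin_hess[unfolded quad_form_def vec_lambda_beta])
  finally show ?thesis .
qed

lemma phase_grad_remainder:
  assumes \<delta>: "\<delta> > 0" and t: "t \<in> {0..tf}"
  shows "\<bar>u \<bullet> (phase_grad \<delta> t (p + v) - phase_grad \<delta> t p) - phase_hess \<delta> t p u v\<bar> \<le> 6 * \<delta> powr (\<alpha> - 3) * norm u * tf * (norm v)^2"
proof -
  have i: "(\<lambda>s. u \<bullet> kin_grad \<alpha> \<delta> (q - s *\<^sub>R c1)) integrable_on {0..t}" for q
    by (rule integrable_continuous_real) (intro continuous_on_inner continuous_kin_grad \<delta> continuous_intros)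
  have sh: "p + v - s *\<^sub>R c1 = (p - s *\<^sub>R c1) + v" for s by simp
  have "u \<bullet> (phase_grad \<delta> t (p + v) - phase_grad \<delta> t p) - phase_hess \<delta> t p u v
    = integral {0..t} (\<lambda>s. u \<bullet> kin_grad \<alpha> \<delta> (p + v - s *\<^sub>R c1) - u \<bullet> kin_grad \<alpha> \<delta> (p - s *\<^sub>R c1) - kin_hess \<alpha> \<delta> (p - s *\<^sub>R c1) u v)"
    unfolding inner_diff_right inner_phase_grad[OF \<delta>] phase_hess_def by (simp add: integral_diff i int_kin_hess[OF \<delta>] integrable_diff)
  also have "norm \<dots> \<le> (6 * \<delta> powr (\<alpha> - 3) * norm u * (norm v)^2) * (t - 0)"
  proof (rule integral_bound)
    show "continuous_on {0..t} (\<lambda>s. u \<bullet> kin_grad \<alpha> \<delta> (p + v - s *\<^sub>R c1) - u \<bullet> kin_grad \<alpha> \<delta> (p - s *\<^sub>R c1) - kin_hess \<alpha> \<delta> (p - s *\<^sub>R c1) u v)"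
      by (intro continuous_on_diff continuous_on_inner continuous_kin_grad continuous_kin_hess \<delta> continuous_intros)
    show "norm (u \<bullet> kin_grad \<alpha> \<delta> (p + v - s *\<^sub>R c1) - u \<bullet> kin_grad \<alpha> \<delta> (p - s *\<^sub>R c1) - kin_hess \<alpha> \<delta> (p - s *\<^sub>R c1) u v) \<le> 6 * \<delta> powr (\<alpha> - 3) * norm u * (norm v)^2" for s
      using kin_grad_remainder[OF \<alpha>1 \<alpha>2 \<delta>, of u "p - s *\<^sub>R c1" v] unfolding sh inner_diff_right by simp
  qed (use t in auto)
  also have "\<dots> \<le> (6 * \<delta> powr (\<alpha> - 3) * norm u * (norm v)^2) * tf" using t by (intro mult_left_mono) auto
  finally show ?thesis by (simp add: mult_ac)
qed

lemma inner_phase_grad_has_derivative: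
  assumes \<delta>: "\<delta> > 0" and t: "t \<in> {0..tf}"
  shows "((\<lambda>p. u \<bullet> phase_grad \<delta> t p) has_derivative phase_hess \<delta> t p u) (at p)"
proof (rule has_derivative_quadratic_remainder[OF phase_hess_bounded_linear[OF \<delta>] zero_less_one])
  show "norm (u \<bullet> phase_grad \<delta> t y - u \<bullet> phase_grad \<delta> t p - phase_hess \<delta> t p u (y - p)) \<le> 6 * \<delta> powr (\<alpha> - 3) * norm u * tf * (norm (y - p))^2" for y
    using phase_grad_remainder[OF \<delta> t, of u p "y - p"] by (simp add: inner_diff_right)
qed

lemma phase_has_derivative:
  assumes \<delta>: "\<delta> > 0" and t: "t \<in> {0..tf}"
  shows "(phase \<delta> t has_derivative (\<lambda>v. phase_grad \<delta> t p \<bullet> v)) (at p)"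
proof (rule has_derivative_quadratic_remainder[OF bounded_linear_inner_right zero_less_one])
  fix y
  have i: "(\<lambda>s. (y - p) \<bullet> kin_grad \<alpha> \<delta> (p - s *\<^sub>R c1)) integrable_on {0..t}"
    by (rule integrable_continuous_real) (intro continuous_on_inner continuous_kin_grad \<delta> continuous_intros)
  have "phase \<delta> t y - phase \<delta> t p - phase_grad \<delta> t p \<bullet> (y - p)
    = integral {0..t} (\<lambda>s. kinetic_reg \<alpha> \<delta> (y - s *\<^sub>R c1) - kinetic_reg \<alpha> \<delta> (p - s *\<^sub>R c1) - (y - p) \<bullet> kin_grad \<alpha> \<delta> (p - s *\<^sub>R c1))"
    unfolding inner_commute[of "phase_grad \<delta> t p"] inner_phase_grad[OF \<delta>] phase_def by (simp add: integral_diff i int_kinetic integrable_diff)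
  also have "norm \<dots> \<le> (2 * \<delta> powr (\<alpha> - 2) * (norm (y - p))^2) * (t - 0)"
  proof (rule integral_bound)
    show "continuous_on {0..t} (\<lambda>s. kinetic_reg \<alpha> \<delta> (y - s *\<^sub>R c1) - kinetic_reg \<alpha> \<delta> (p - s *\<^sub>R c1) - (y - p) \<bullet> kin_grad \<alpha> \<delta> (p - s *\<^sub>R c1))"
      by (intro continuous_on_diff continuous_on_inner continuous_kin_grad continuous_kinetic \<delta> continuous_intros)
    show "norm (kinetic_reg \<alpha> \<delta> (y - s *\<^sub>R c1) - kinetic_reg \<alpha> \<delta> (p - s *\<^sub>R c1) - (y - p) \<bullet> kin_grad \<alpha> \<delta> (p - s *\<^sub>R c1)) \<le> 2 * \<delta> powr (\<alpha> - 2) * (norm (y - p))^2" for s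
      using kinetic_reg_remainder[OF \<alpha>1 \<alpha>2 \<delta>, of "p - s *\<^sub>R c1" "y - p"] by (simp add: inner_commute)
  qed (use t in auto)
  also have "\<dots> \<le> (2 * \<delta> powr (\<alpha> - 2) * (norm (y - p))^2) * tf" using t by (intro mult_left_mono) auto
  finally show "norm (phase \<delta> t y - phase \<delta> t p - phase_grad \<delta> t p \<bullet> (y - p)) \<le> (2 * \<delta> powr (\<alpha> - 2) * tf) * (norm (y - p))^2" by (simp add: mult_ac)
qed

text \<open>Lagrange's form of the remainder, along a segment: the Hessian is taken at an
  intermediate point, so no third derivative of the phase appears and Hoelder continuity of the
  Hessian is enough later.\<close>

lemma phase_taylor:
  assumes \<delta>: "\<delta> > 0" and t: "t \<in> {0..tf}"
  shows "\<exists>\<tau>. 0 < \<tau> \<and> \<tau> \<le> 1 \<and> phase \<delta> t (p + v) = phase \<delta> t p + phase_grad \<delta> t p \<bullet> v + phase_hess \<delta> t (p + \<tau> *\<^sub>R v) v v / 2"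
proof -
  define diff where "diff m = (if m = 0 then (\<lambda>\<tau>. phase \<delta> t (p + \<tau> *\<^sub>R v)) else if m = 1 then (\<lambda>\<tau>. v \<bullet> phase_grad \<delta> t (p + \<tau> *\<^sub>R v)) else (\<lambda>\<tau>. phase_hess \<delta> t (p + \<tau> *\<^sub>R v) v v))" for m :: nat
  have line: "((\<lambda>\<tau>. p + \<tau> *\<^sub>R v) has_vector_derivative v) (at \<tau>)" for \<tau> by (auto intro!: derivative_eq_intros)
  have d0: "(diff 0 has_real_derivative diff 1 \<tau>) (at \<tau>)" for \<tau>
    using vector_derivative_diff_chain_within[OF line has_derivative_at_withinI[OF phase_has_derivative[OF \<delta> t]], of \<tau>]
    by (simp add: diff_def o_def has_real_derivative_iff_has_vector_derivative inner_commute)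
  have d1: "(diff 1 has_real_derivative diff 2 \<tau>) (at \<tau>)" for \<tau>
    using vector_derivative_diff_chain_within[OF line has_derivative_at_withinI[OF inner_phase_grad_has_derivative[OF \<delta> t, of v]], of \<tau>]
    by (simp add: diff_def o_def has_real_derivative_iff_has_vector_derivative)
  have "\<exists>\<tau>>0. \<tau> \<le> 1 \<and> (\<lambda>\<tau>. phase \<delta> t (p + \<tau> *\<^sub>R v)) 1 = (\<Sum>m<2. diff m 0 / fact m * 1 ^ m) + diff 2 \<tau> / fact 2 * 1 ^ 2"
  proof (rule Maclaurin2)
    show "\<forall>m s. m < 2 \<and> 0 \<le> s \<and> s \<le> 1 \<longrightarrow> (diff m has_real_derivative diff (Suc m) s) (at s)" using d0 d1 by (auto simp: less_Suc_eq numeral_2_eq_2)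
  qed (auto simp: diff_def)
  then show ?thesis by (auto simp: diff_def numeral_2_eq_2 inner_commute)
qed

text \<open>The pointwise comparison is integrated in time with the two crossing times excepted, and
  each of the two \<open>gap\<close> integrals gives a multiple of
  \<open>norm w powr (\<alpha> - 1)\<close>. The constant is free of \<open>\<delta>\<close>, which
  allows \<open>\<delta>\<close> to tend to 0 together with \<open>\<epsilon>\<close>.\<close>

lemma phase_hess_hoelder:
  "\<exists>C\<ge>0. \<forall>\<delta>>0. \<forall>t\<in>{0..tf}. \<forall>p w v. \<bar>phase_hess \<delta> t (p + w) v v - phase_hess \<delta> t p v v\<bar> \<le> C * norm w powr (\<alpha> - 1) * (norm v)^2"
proof (cases "\<alpha> = 2")
  case True
  have "kin_hess \<alpha> \<delta> p v v = v \<bullet> v" if "\<delta> > 0" for \<delta> and p v :: "real ^ 'd" unfolding kin_hess_def using rad_pos[OF that, of p] by (simp add: True)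
  then have "phase_hess \<delta> t (p + w) v v = phase_hess \<delta> t p v v" if "\<delta> > 0" for \<delta> t p w v unfolding phase_hess_def using that by simp
  then show ?thesis by (intro exI[of _ 0]) simp
next
  case False
  then have \<alpha>: "\<alpha> < 2" using \<alpha>2 by simp
  define J where "J = 2 / ((\<alpha> - 1) * norm c1)"
  define C where "C = hoelder_const * (J + J)"
  have J: "J \<ge> 0" using \<alpha>1 norm_c1 by (simp add: J_def)
  have C: "C \<ge> 0" using J hoelder_const_nonneg[OF \<alpha>] by (simp add: C_def)
  have "\<bar>phase_hess \<delta> t (p + w) v v - phase_hess \<delta> t p v v\<bar> \<le> C * norm w powr (\<alpha> - 1) * (norm v)^2"
    if \<delta>: "\<delta> > 0" and t: "t \<in> {0..tf}" for \<delta> t p w v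
  proof (cases "w = 0")
    case False
    then have m: "norm w > 0" by simp
    have ex: "\<exists>I. ((\<lambda>s. gap (norm w) (dist_line q s)) has_integral I) {0..t} \<and> I \<le> J * norm w powr (\<alpha> - 1)" for q
      using gap_has_integral[of t "norm w" "norm c1" "crossing q"] t m norm_c1 unfolding dist_line_def J_def by simp
    obtain I1 where I1: "((\<lambda>s. gap (norm w) (dist_line p s)) has_integral I1) {0..t}" "I1 \<le> J * norm w powr (\<alpha> - 1)" using ex by blast
    obtain I2 where I2: "((\<lambda>s. gap (norm w) (dist_line (p + w) s)) has_integral I2) {0..t}" "I2 \<le> J * norm w powr (\<alpha> - 1)" using ex by blast
    let ?h = "hoelder_const * (norm v)^2"
    have hI: "((\<lambda>s. ?h * (gap (norm w) (dist_line p s) + gap (norm w) (dist_line (p + w) s))) has_integral ?h * (I1 + I2)) {0..t}"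
      by (intro has_integral_mult_right has_integral_add I1 I2)
    let ?f = "\<lambda>s. kin_hess \<alpha> \<delta> (p + w - s *\<^sub>R c1) v v - kin_hess \<alpha> \<delta> (p - s *\<^sub>R c1) v v"
    have diff: "phase_hess \<delta> t (p + w) v v - phase_hess \<delta> t p v v = integral {0..t} ?f"
      unfolding phase_hess_def by (rule integral_diff[symmetric]) (rule int_kin_hess[OF \<delta>])+
    have fi: "?f integrable_on {0..t}" by (intro integrable_diff int_kin_hess \<delta>)
    have "norm (integral {0..t} ?f) \<le> integral {0..t} (\<lambda>s. \<bar>?f s\<bar>)"
      by (rule integral_norm_bound_integral[OF fi]) (auto intro!: integrable_continuous_real continuous_on_rabs continuous_on_diff continuous_kin_hess \<delta>)
    also have "\<dots> \<le> ?h * (I1 + I2)"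
    proof (rule integral_le_except_finite[OF _ hI, of _ "{crossing p, crossing (p + w)}"])
      show "(\<lambda>s. \<bar>?f s\<bar>) integrable_on {0..t}" by (auto intro!: integrable_continuous_real continuous_on_rabs continuous_on_diff continuous_kin_hess \<delta>)
    qed (use kin_hess_difference[OF \<alpha> \<delta> False] in auto)
    also have "\<dots> \<le> ?h * (J * norm w powr (\<alpha> - 1) + J * norm w powr (\<alpha> - 1))"
      using I1(2) I2(2) hoelder_const_nonneg[OF \<alpha>] by (intro mult_left_mono add_mono) auto
    also have "\<dots> = C * norm w powr (\<alpha> - 1) * (norm v)^2" by (simp add: C_def algebra_simps)
    finally show ?thesis unfolding diff real_norm_def .
  qed simp
  with C show ?thesis by blast
qed

text \<open>The singularity of the kinetic Hessian is integrable in time, uniformly in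
  \<open>\<delta>\<close> and \<open>p\<close>. Entries are bounded because the lower bound for the
  Gaussian integral is stated in terms of entries.\<close>

lemma phase_mat_bound: "\<exists>A>0. \<forall>\<delta>>0. \<forall>t\<in>{0..tf}. \<forall>p j k. \<bar>phase_mat \<delta> t p $ j $ k\<bar> \<le> A"
proof -
  obtain A where A: "A > 0" "\<And>p t. t \<in> {0..tf} \<Longrightarrow> \<exists>\<Phi> I. (\<Phi> has_integral I) {0..t} \<and> I \<le> A \<and> (\<forall>s. s \<noteq> crossing p \<longrightarrow> dist_line p s powr (\<alpha> - 2) \<le> \<Phi> s)"
    using dist_line_powr_majorant by blast
  have "\<bar>phase_mat \<delta> t p $ j $ k\<bar> \<le> 2 * A" if \<delta>: "\<delta> > 0" and t: "t \<in> {0..tf}" for \<delta> t p j k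
  proof -
    obtain \<Phi> I where I: "(\<Phi> has_integral I) {0..t}" "I \<le> A" "\<And>s. s \<noteq> crossing p \<Longrightarrow> dist_line p s powr (\<alpha> - 2) \<le> \<Phi> s" using A(2)[OF t, of p] by blast
    let ?f = "\<lambda>s. kin_hess \<alpha> \<delta> (p - s *\<^sub>R c1) (axis j 1) (axis k 1)"
    have "norm (integral {0..t} ?f) \<le> integral {0..t} (\<lambda>s. \<bar>?f s\<bar>)"
      by (rule integral_norm_bound_integral[OF int_kin_hess[OF \<delta>]]) (auto intro!: integrable_continuous_real continuous_on_rabs continuous_kin_hess \<delta>)
    also have "\<dots> \<le> 2 * I"
    proof (rule integral_le_except_finite[OF _ has_integral_mult_right[OF I(1)], of _ "{crossing p}"])
      show "(\<lambda>s. \<bar>?f s\<bar>) integrable_on {0..t}" by (auto intro!: integrable_continuous_real continuous_on_rabs continuous_kin_hess \<delta>)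
      fix s assume s: "s \<notin> {crossing p}"
      have "\<bar>?f s\<bar> \<le> 2 * rad \<delta> (p - s *\<^sub>R c1) powr ((\<alpha> - 2) / 2) * (norm (axis j 1 :: real^'d) * norm (axis k 1 :: real^'d))"
        by (rule kin_hess_bound[OF \<alpha>1 \<alpha>2 rad_pos[OF \<delta>]])
      also have "\<dots> \<le> 2 * \<Phi> s" using rad_powr_le_dist_line[of s p \<delta>] I(3)[of s] s by simp
      finally show "\<bar>?f s\<bar> \<le> 2 * \<Phi> s" .
    qed simp
    finally show ?thesis using I(2) by (simp add: phase_mat_def phase_hess_def)
  qed
  with A(1) show ?thesis by (intro exI[of _ "2 * A"]) auto
qed

text \<open>The regularization error of the symbol has the singular factor whose majorant has a
  bounded time integral. After division by \<open>\<epsilon>\<close> in the exponential,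
  \<open>\<delta> = \<epsilon>\<close> leaves an error of order \<open>\<epsilon>\<close>.\<close>

lemma phase_close: "\<exists>A>0. \<forall>\<delta>>0. \<forall>t\<in>{0..tf}. \<forall>p. \<bar>phase \<delta> t p - phase 0 t p\<bar> \<le> A * \<delta>^2"
proof -
  obtain A where A: "A > 0" "\<And>p t. t \<in> {0..tf} \<Longrightarrow> \<exists>\<Phi> I. (\<Phi> has_integral I) {0..t} \<and> I \<le> A \<and> (\<forall>s. s \<noteq> crossing p \<longrightarrow> dist_line p s powr (\<alpha> - 2) \<le> \<Phi> s)"
    using dist_line_powr_majorant by blast
  have "\<bar>phase \<delta> t p - phase 0 t p\<bar> \<le> A * \<delta>^2" if \<delta>: "\<delta> > 0" and t: "t \<in> {0..tf}" for \<delta> t p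
  proof -
    obtain \<Phi> I where I: "(\<Phi> has_integral I) {0..t}" "I \<le> A" "\<And>s. s \<noteq> crossing p \<Longrightarrow> dist_line p s powr (\<alpha> - 2) \<le> \<Phi> s" using A(2)[OF t, of p] by blast
    let ?f = "\<lambda>s. kinetic_reg \<alpha> \<delta> (p - s *\<^sub>R c1) - kinetic_reg \<alpha> 0 (p - s *\<^sub>R c1)"
    have diff: "phase \<delta> t p - phase 0 t p = integral {0..t} ?f" unfolding phase_def by (rule integral_diff[symmetric]) (rule int_kinetic)+
    have "norm (integral {0..t} ?f) \<le> integral {0..t} (\<lambda>s. \<bar>?f s\<bar>)"
      by (rule integral_norm_bound_integral) (auto intro!: integrable_continuous_real continuous_on_rabs continuous_on_diff continuous_kinetic)
    also have "\<dots> \<le> \<delta>^2 / 2 * I"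
    proof (rule integral_le_except_finite[OF _ has_integral_mult_right[OF I(1)], of _ "{crossing p}"])
      show "(\<lambda>s. \<bar>?f s\<bar>) integrable_on {0..t}" by (auto intro!: integrable_continuous_real continuous_on_rabs continuous_on_diff continuous_kinetic)
      fix s assume "s \<notin> {crossing p}"
      then have s: "s \<noteq> crossing p" by simp
      have nz: "p - s *\<^sub>R c1 \<noteq> 0" using dist_line_pos[OF s] dist_line_le[of p s] by auto
      have "\<bar>?f s\<bar> \<le> \<delta>^2 / 2 * norm (p - s *\<^sub>R c1) powr (\<alpha> - 2)" by (rule kinetic_reg_close[OF \<alpha>1 \<alpha>2 nz \<delta>])
      also have "\<dots> \<le> \<delta>^2 / 2 * dist_line p s powr (\<alpha> - 2)" using dist_line_pos[OF s] dist_line_le[of p s] \<alpha>2 by (intro mult_left_mono powr_mono2') auto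
      also have "\<dots> \<le> \<delta>^2 / 2 * \<Phi> s" using I(3)[OF s] by (intro mult_left_mono) auto
      finally show "\<bar>?f s\<bar> \<le> \<delta>^2 / 2 * \<Phi> s" .
    qed simp
    also have "\<dots> \<le> \<delta>^2 * A"
    proof -
      have "\<delta>^2 / 2 * I \<le> \<delta>^2 / 2 * A" using I(2) by (intro mult_left_mono) auto
      also have "\<dots> \<le> \<delta>^2 * A" using A(1) by simp
      finally show ?thesis .
    qed
    finally show ?thesis unfolding diff by (simp add: mult.commute)
  qed
  with A(1) show ?thesis by blast
qed

lemma phase_zero [simp]: "phase \<delta> 0 p = 0" by (simp add: phase_def)

lemma kinetic_0_lipschitz: "\<bar>kinetic_reg \<alpha> 0 a - kinetic_reg \<alpha> 0 b\<bar> \<le> 1 * norm (a - b) * (1 + norm a + norm b)" for a b :: "real ^ 'd"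
  using kinetic_lipschitz[OF \<alpha>1 \<alpha>2, of a b] unfolding kinetic_eq_kinetic_reg_0 .

text \<open>The time derivative of the phase is the symbol at the drifting momentum, and this is
  Lipschitz in time with a constant growing linearly in \<open>p\<close>. The estimate is the input
  for \<open>exact_solution_pairing\<close>.\<close>

lemma phase_0_time_remainder:
  assumes s: "s \<in> {0..tf}" "s' \<in> {0..tf}"
  shows "\<bar>phase 0 s' p - phase 0 s p - (s' - s) * kinetic_reg \<alpha> 0 (p - s *\<^sub>R c1)\<bar> \<le> (norm c1 * (2 + 2 * tf * norm c1)) * (1 + norm p) * (s' - s)^2"
proof -
  let ?K = "norm c1 * (2 + 2 * tf * norm c1)"
  let ?T = "\<lambda>\<sigma>. kinetic_reg \<alpha> 0 (p - \<sigma> *\<^sub>R c1)"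
  have lip: "\<bar>?T \<sigma> - ?T s\<bar> \<le> \<bar>\<sigma> - s\<bar> * (?K * (1 + norm p))" if "\<sigma> \<in> {0..tf}" for \<sigma>
  proof -
    have n: "norm (p - \<tau> *\<^sub>R c1) \<le> norm p + tf * norm c1" if "\<tau> \<in> {0..tf}" for \<tau>
      using norm_triangle_ineq4[of p "\<tau> *\<^sub>R c1"] mult_right_mono[of \<tau> tf "norm c1"] that by simp
    have "(p - \<sigma> *\<^sub>R c1) - (p - s *\<^sub>R c1) = (s - \<sigma>) *\<^sub>R c1" by (simp add: algebra_simps)
    then have "\<bar>?T \<sigma> - ?T s\<bar> \<le> (\<bar>\<sigma> - s\<bar> * norm c1) * (1 + norm (p - \<sigma> *\<^sub>R c1) + norm (p - s *\<^sub>R c1))"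
      using kinetic_0_lipschitz[of "p - \<sigma> *\<^sub>R c1" "p - s *\<^sub>R c1"] by (simp add: abs_minus_commute)
    also have "\<dots> \<le> (\<bar>\<sigma> - s\<bar> * norm c1) * ((2 + 2 * tf * norm c1) * (1 + norm p))"
    proof (rule mult_left_mono)
      have "1 + norm (p - \<sigma> *\<^sub>R c1) + norm (p - s *\<^sub>R c1) \<le> 1 + 2 * norm p + 2 * tf * norm c1" using n[OF that] n[OF s(1)] by linarith
      also have "\<dots> \<le> (2 + 2 * tf * norm c1) * (1 + norm p)" using tf by (simp add: algebra_simps)
      finally show "1 + norm (p - \<sigma> *\<^sub>R c1) + norm (p - s *\<^sub>R c1) \<le> (2 + 2 * tf * norm c1) * (1 + norm p)" .
    qed auto
    finally show ?thesis by (simp add: mult_ac)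
  qed
  \<comment> \<open>The reference time \<open>s\<close> may be the left or the right end of the
    interval, so that both orders of \<open>s\<close> and \<open>s'\<close> are covered.\<close>
  have main: "\<bar>(phase 0 b p - phase 0 a p) - (b - a) * ?T s\<bar> \<le> (?K * (1 + norm p)) * (b - a)^2" if ab: "0 \<le> a" "a \<le> b" "b \<le> tf" "s = a \<or> s = b" for a b
  proof -
    have "phase 0 a p + integral {a..b} ?T = phase 0 b p" unfolding phase_def by (rule Henstock_Kurzweil_Integration.integral_combine) (use ab int_kinetic in auto)
    moreover have "integral {a..b} (\<lambda>\<sigma>. ?T s) = (b - a) * ?T s" using ab by simp
    ultimately have "(phase 0 b p - phase 0 a p) - (b - a) * ?T s = integral {a..b} (\<lambda>\<sigma>. ?T \<sigma> - ?T s)" by (subst integral_diff) (auto intro: int_kinetic)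
    also have "norm \<dots> \<le> ((b - a) * (?K * (1 + norm p))) * (b - a)"
    proof (rule integral_bound)
      show "continuous_on {a..b} (\<lambda>\<sigma>. ?T \<sigma> - ?T s)" by (intro continuous_on_diff continuous_kinetic continuous_on_const)
      fix \<sigma> assume \<sigma>: "\<sigma> \<in> {a..b}"
      have "\<bar>?T \<sigma> - ?T s\<bar> \<le> \<bar>\<sigma> - s\<bar> * (?K * (1 + norm p))" using \<sigma> ab by (intro lip) auto
      also have "\<dots> \<le> (b - a) * (?K * (1 + norm p))" using \<sigma> ab tf by (intro mult_right_mono) auto
      finally show "norm (?T \<sigma> - ?T s) \<le> (b - a) * (?K * (1 + norm p))" by simp
    qed (use ab in auto)
    finally show ?thesis by (simp add: power2_eq_square mult_ac)
  qed
  show ?thesis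
  proof (cases "s \<le> s'")
    case True
    then show ?thesis using main[of s s'] s by simp
  next
    case False
    have "(phase 0 s p - phase 0 s' p) - (s - s') * ?T s = - (phase 0 s' p - phase 0 s p - (s' - s) * ?T s)" by (simp add: algebra_simps)
    then show ?thesis using main[of s' s] s False by (simp add: power2_commute)
  qed
qed

text \<open>The differentiability argument is confined to positive \<open>\<delta>\<close>; at 0 the
  local Lipschitz continuity of the symbol gives continuity of the phase, hence measurability. For
  negative times the integration interval is empty.\<close>

lemma phase_0_measurable: "phase 0 t \<in> Borel"
proof (rule borel_measurable_continuous_onI, cases "t \<ge> 0")
  case False
  then have "phase 0 t = (\<lambda>_. 0)" by (simp add: phase_def fun_eq_iff)
  then show "continuous_on UNIV (phase 0 t)" by simp
next
  case True
  show "continuous_on UNIV (phase 0 t)"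
  proof (rule continuous_at_imp_continuous_on, rule ballI)
    fix p :: "real ^ 'd"
    let ?B = "1 + (norm p + 1 + t * norm c1) + (norm p + t * norm c1)"
    have bound: "norm (phase 0 t y - phase 0 t p) \<le> (t * ?B) * norm (y - p)" if y: "dist y p < 1" for y
    proof -
      have "phase 0 t y - phase 0 t p = integral {0..t} (\<lambda>s. kinetic_reg \<alpha> 0 (y - s *\<^sub>R c1) - kinetic_reg \<alpha> 0 (p - s *\<^sub>R c1))"
        unfolding phase_def by (rule integral_diff[symmetric]) (rule int_kinetic)+
      also have "norm \<dots> \<le> (norm (y - p) * ?B) * (t - 0)"
      proof (rule integral_bound)
        show "continuous_on {0..t} (\<lambda>s. kinetic_reg \<alpha> 0 (y - s *\<^sub>R c1) - kinetic_reg \<alpha> 0 (p - s *\<^sub>R c1))" by (intro continuous_on_diff continuous_kinetic)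
        fix s assume s: "s \<in> {0..t}"
        have ny: "norm y \<le> norm p + 1" using y norm_triangle_ineq2[of y p] by (simp add: dist_norm)
        have n: "norm (q - s *\<^sub>R c1) \<le> norm q + t * norm c1" for q using norm_triangle_ineq4[of q "s *\<^sub>R c1"] mult_right_mono[of s t "norm c1"] s by simp
        have "\<bar>kinetic_reg \<alpha> 0 (y - s *\<^sub>R c1) - kinetic_reg \<alpha> 0 (p - s *\<^sub>R c1)\<bar> \<le> norm (y - p) * (1 + norm (y - s *\<^sub>R c1) + norm (p - s *\<^sub>R c1))"
          using kinetic_0_lipschitz[of "y - s *\<^sub>R c1" "p - s *\<^sub>R c1"] by simp
        also have "\<dots> \<le> norm (y - p) * ?B" using n[of y] n[of p] ny by (intro mult_left_mono) auto
        finally show "norm (kinetic_reg \<alpha> 0 (y - s *\<^sub>R c1) - kinetic_reg \<alpha> 0 (p - s *\<^sub>R c1)) \<le> norm (y - p) * ?B" by simp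
      qed (use True in auto)
      finally show ?thesis by (simp add: mult_ac)
    qed
    show "isCont (phase 0 t) p" unfolding isCont_def
    proof (rule LIM_zero_cancel, rule Lim_null_comparison)
      show "eventually (\<lambda>y. norm (phase 0 t y - phase 0 t p) \<le> (t * ?B) * norm (y - p)) (at p)" unfolding eventually_at using bound by (intro exI[of _ 1]) auto
      have "((\<lambda>y. (t * ?B) * norm (y - p)) \<longlongrightarrow> (t * ?B) * norm (p - p)) (at p)" by (intro tendsto_intros)
      then show "((\<lambda>y. (t * ?B) * norm (y - p)) \<longlongrightarrow> 0) (at p)" by simp
    qed
  qed
qed

end

section \<open>Flow, action and amplitude\<close>

lemma has_vector_derivative_vec_nth:
  fixes f :: "real \<Rightarrow> ('a::real_normed_vector) ^ 'n"
  assumes "\<And>j. ((\<lambda>t. f t $ j) has_vector_derivative D $ j) (at t within S)"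
  shows "(f has_vector_derivative D) (at t within S)" unfolding has_vector_derivative_def has_derivative_within
proof (intro conjI vec_tendstoI)
  show "bounded_linear (\<lambda>x. x *\<^sub>R D)" by (rule bounded_linear_scaleR_left)
  fix j
  show "((\<lambda>y. ((1 / norm (y - t)) *\<^sub>R (f y - (f t + (y - t) *\<^sub>R D))) $ j) \<longlongrightarrow> 0 $ j) (at t within S)"
    using assms[of j] unfolding has_vector_derivative_def has_derivative_within by simp
qed

context linear_potential_phase
begin

lemma flow_momentum:
  assumes \<delta>: "\<delta> > 0" and flow: "hamiltonian_flow (kinetic_reg \<alpha> \<delta>) (\<lambda>x. c0 + c1 \<bullet> x) tf Q P" and t: "t \<in> {0..tf}"
  shows "P t q p = p - t *\<^sub>R c1"
proof -
  have "((\<lambda>s. P s q p + s *\<^sub>R c1) has_vector_derivative 0) (at s within {0..tf})" if "s \<in> {0..tf}" for s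
  proof -
    have "((\<lambda>s. P s q p) has_vector_derivative - c1) (at s within {0..tf})" using flow that by (simp add: hamiltonian_flow_def gradient_affine)
    then have "((\<lambda>s. P s q p + s *\<^sub>R c1) has_vector_derivative - c1 + 1 *\<^sub>R c1) (at s within {0..tf})"
      by (intro has_vector_derivative_add) (auto intro!: derivative_eq_intros)
    then show ?thesis by simp
  qed
  then obtain c where c: "\<And>s. s \<in> {0..tf} \<Longrightarrow> P s q p + s *\<^sub>R c1 = c"
    using has_vector_derivative_zero_constant[of "{0..tf}" "\<lambda>s. P s q p + s *\<^sub>R c1"] by auto
  have "P t q p + t *\<^sub>R c1 = P 0 q p + 0 *\<^sub>R c1" using c[OF t] c[of 0] tf by simp
  then show ?thesis using flow by (simp add: hamiltonian_flow_def algebra_simps)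
qed

lemma flow_position:
  assumes \<delta>: "\<delta> > 0" and flow: "hamiltonian_flow (kinetic_reg \<alpha> \<delta>) (\<lambda>x. c0 + c1 \<bullet> x) tf Q P" and t: "t \<in> {0..tf}"
  shows "Q t q p = q + phase_grad \<delta> t p"
proof -
  have "((\<lambda>s. kin_grad \<alpha> \<delta> (p - s *\<^sub>R c1)) has_integral (Q t q p - Q 0 q p)) {0..t}"
  proof (rule fundamental_theorem_of_calculus)
    fix s assume s: "s \<in> {0..t}"
    then have s': "s \<in> {0..tf}" using t by auto
    have "((\<lambda>s. Q s q p) has_vector_derivative kin_grad \<alpha> \<delta> (p - s *\<^sub>R c1)) (at s within {0..tf})"
      using flow s' unfolding hamiltonian_flow_def by (metis flow_momentum[OF \<delta> flow s'] gradient_kinetic_reg[OF \<alpha>1 \<alpha>2 \<delta>])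
    then show "((\<lambda>s. Q s q p) has_vector_derivative kin_grad \<alpha> \<delta> (p - s *\<^sub>R c1)) (at s within {0..t})"
      by (rule has_vector_derivative_within_subset) (use t in auto)
  qed (use t in auto)
  then show ?thesis unfolding phase_grad_def using flow by (simp add: integral_unique hamiltonian_flow_def)
qed

text \<open>In the derivative of \<open>S - P \<bullet> Q\<close> the terms
  \<open>P \<bullet> gradient T\<close> cancel, and so do the terms \<open>c1 \<bullet> Q\<close> by
  the force equation. Only minus the kinetic energy and minus \<open>c0\<close> are left to
  integrate.\<close>

lemma action_eq:
  assumes \<delta>: "\<delta> > 0" and flow: "hamiltonian_flow (kinetic_reg \<alpha> \<delta>) (\<lambda>x. c0 + c1 \<bullet> x) tf Q P"
    and act: "action (kinetic_reg \<alpha> \<delta>) (\<lambda>x. c0 + c1 \<bullet> x) tf Q P S" and t: "t \<in> {0..tf}"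
  shows "S t q p = P t q p \<bullet> Q t q p - p \<bullet> q - phase \<delta> t p - c0 * t"
proof -
  have "((\<lambda>s. - kinetic_reg \<alpha> \<delta> (p - s *\<^sub>R c1) - c0) has_integral
     ((S t q p - P t q p \<bullet> Q t q p) - (S 0 q p - P 0 q p \<bullet> Q 0 q p))) {0..t}"
  proof (rule fundamental_theorem_of_calculus)
    fix s assume s: "s \<in> {0..t}"
    then have s': "s \<in> {0..tf}" using t by auto
    have sub: "{0..t} \<subseteq> {0..tf}" using t by auto
    have dQ: "((\<lambda>s. Q s q p) has_vector_derivative gradient (kinetic_reg \<alpha> \<delta>) (P s q p)) (at s within {0..t})"
      using flow s' by (auto simp: hamiltonian_flow_def intro: has_vector_derivative_within_subset[OF _ sub])
    have dP: "((\<lambda>s. P s q p) has_vector_derivative - c1) (at s within {0..t})"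
      using flow s' by (auto simp: hamiltonian_flow_def gradient_affine intro: has_vector_derivative_within_subset[OF _ sub])
    have dS: "((\<lambda>s. S s q p) has_vector_derivative (P s q p \<bullet> gradient (kinetic_reg \<alpha> \<delta>) (P s q p) - kinetic_reg \<alpha> \<delta> (P s q p) - (c0 + c1 \<bullet> Q s q p))) (at s within {0..t})"
      using act s' by (auto simp: action_def has_real_derivative_iff_has_vector_derivative intro: has_vector_derivative_within_subset[OF _ sub])
    have dPQ: "((\<lambda>s. P s q p \<bullet> Q s q p) has_vector_derivative (P s q p \<bullet> gradient (kinetic_reg \<alpha> \<delta>) (P s q p) + (- c1) \<bullet> Q s q p)) (at s within {0..t})"
      using bounded_bilinear.has_vector_derivative[OF bounded_bilinear_inner dP dQ] .
    have e: "(P s q p \<bullet> gradient (kinetic_reg \<alpha> \<delta>) (P s q p) - kinetic_reg \<alpha> \<delta> (P s q p) - (c0 + c1 \<bullet> Q s q p)) - (P s q p \<bullet> gradient (kinetic_reg \<alpha> \<delta>) (P s q p) + (- c1) \<bullet> Q s q p)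
      = - kinetic_reg \<alpha> \<delta> (p - s *\<^sub>R c1) - c0" by (simp add: flow_momentum[OF \<delta> flow s'])
    show "((\<lambda>s. S s q p - P s q p \<bullet> Q s q p) has_vector_derivative - kinetic_reg \<alpha> \<delta> (p - s *\<^sub>R c1) - c0) (at s within {0..t})"
      using has_vector_derivative_diff[OF dS dPQ] unfolding e .
  qed (use t in auto)
  then have "(S t q p - P t q p \<bullet> Q t q p) - (S 0 q p - P 0 q p \<bullet> Q 0 q p) = integral {0..t} (\<lambda>s. - kinetic_reg \<alpha> \<delta> (p - s *\<^sub>R c1) - c0)"
    by (simp add: integral_unique)
  also have "\<dots> = - phase \<delta> t p - c0 * t" using t by (subst integral_diff) (auto simp: phase_def intro!: int_kinetic integrable_neg)
  finally show ?thesis using flow act by (simp add: hamiltonian_flow_def action_def)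
qed

text \<open>The identity arises twice, once from the derivative of \<open>Q\<close> in
  \<open>q\<close> and once as \<open>- \<i>\<close> times \<open>\<i>\<close> from the derivative
  of \<open>P\<close> in \<open>p\<close>, which explains the 2 on the diagonal. The derivative of
  \<open>Q\<close> in \<open>p\<close> is the Hessian of the phase.\<close>

lemma Z_matrix_eq:
  assumes \<delta>: "\<delta> > 0" and flow: "hamiltonian_flow (kinetic_reg \<alpha> \<delta>) (\<lambda>x. c0 + c1 \<bullet> x) tf Q P" and t: "t \<in> {0..tf}"
  shows "Z_matrix Q P t q p = quad_matrix (phase_mat \<delta> t p)"
proof -
  have dz: "dz j (\<lambda>q p. cr (Q t q p $ k) + \<i> * cr (P t q p $ k)) q p
     = (if j = k then 2 else 0) - \<i> * cr (phase_mat \<delta> t p $ j $ k)" for j k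
  proof -
    let ?f = "\<lambda>z. cr (axis k 1 \<bullet> fst z + axis k 1 \<bullet> phase_grad \<delta> t (snd z)) + \<i> * cr (axis k 1 \<bullet> (snd z - t *\<^sub>R c1))"
    let ?D = "\<lambda>z. cr (axis k 1 \<bullet> fst z + phase_hess \<delta> t p (axis k 1) (snd z)) + \<i> * cr (axis k 1 \<bullet> snd z)"
    have f: "(\<lambda>(q, p). cr (Q t q p $ k) + \<i> * cr (P t q p $ k)) = ?f"
      by (auto simp: fun_eq_iff flow_momentum[OF \<delta> flow t] flow_position[OF \<delta> flow t] inner_axis' inner_diff_right)
    have "((\<lambda>z. axis k 1 \<bullet> phase_grad \<delta> t (snd z)) has_derivative (\<lambda>z. phase_hess \<delta> t p (axis k 1) (snd z))) (at (q, p))"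
      by (rule has_derivative_compose[OF has_derivative_snd[OF has_derivative_ident]])
        (simp add: inner_phase_grad_has_derivative[OF \<delta> t])
    moreover have "((\<lambda>z. cr (axis k 1 \<bullet> fst z + G z) + \<i> * cr (axis k 1 \<bullet> (snd z - t *\<^sub>R c1))) has_derivative
        (\<lambda>z. cr (axis k 1 \<bullet> fst z + G' z) + \<i> * cr (axis k 1 \<bullet> snd z))) (at (q, p))"
      if "(G has_derivative G') (at (q, p))" for G G' using that by (auto intro!: derivative_eq_intros)
    ultimately have "(?f has_derivative ?D) (at (q, p))" by blast
    then have "frechet_derivative ?f (at (q, p)) = ?D" by (rule frechet_derivative_at[symmetric])
    moreover have "phase_hess \<delta> t p (axis k 1) 0 = 0" by (rule linear_0[OF bounded_linear.linear[OF phase_hess_bounded_linear[OF \<delta>]]])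
    moreover have "phase_hess \<delta> t p (axis k 1) (axis j 1) = phase_mat \<delta> t p $ j $ k" by (simp add: phase_mat_def phase_hess_def kin_hess_commute)
    ultimately show ?thesis unfolding dz_def f by (auto simp: inner_axis_axis algebra_simps)
  qed
  show ?thesis unfolding Z_matrix_def quad_matrix_def dz ..
qed

lemma phase_mat_has_vector_derivative:
  assumes \<delta>: "\<delta> > 0" and t: "t \<in> {0..tf}"
  shows "((\<lambda>t. phase_mat \<delta> t p) has_vector_derivative (\<chi> j k. kin_hess \<alpha> \<delta> (p - t *\<^sub>R c1) (axis j 1) (axis k 1))) (at t within {0..tf})"
proof (intro has_vector_derivative_vec_nth)
  fix j k
  show "((\<lambda>t. phase_mat \<delta> t p $ j $ k) has_vector_derivative (\<chi> j k. kin_hess \<alpha> \<delta> (p - t *\<^sub>R c1) (axis j 1) (axis k 1)) $ j $ k) (at t within {0..tf})"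
    unfolding phase_mat_def phase_hess_def vec_lambda_beta by (rule integral_has_vector_derivative[OF continuous_kin_hess[OF \<delta>] t])
qed

lemma quad_matrix_phase_mat_has_vector_derivative:
  assumes \<delta>: "\<delta> > 0" and t: "t \<in> {0..tf}"
  shows "((\<lambda>t. quad_matrix (phase_mat \<delta> t p)) has_vector_derivative
     (\<chi> j k. - \<i> * cr (kin_hess \<alpha> \<delta> (p - t *\<^sub>R c1) (axis j 1) (axis k 1)))) (at t within {0..tf})"
proof (intro has_vector_derivative_vec_nth)
  fix j k
  have d: "((\<lambda>t. phase_mat \<delta> t p $ j $ k) has_vector_derivative kin_hess \<alpha> \<delta> (p - t *\<^sub>R c1) (axis j 1) (axis k 1)) (at t within {0..tf})"
    unfolding phase_mat_def phase_hess_def vec_lambda_beta by (rule integral_has_vector_derivative[OF continuous_kin_hess[OF \<delta>] t])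
  have "((\<lambda>t. (if j = k then 2 else 0) - \<i> * cr (phase_mat \<delta> t p $ j $ k)) has_vector_derivative (0 - \<i> * cr (kin_hess \<alpha> \<delta> (p - t *\<^sub>R c1) (axis j 1) (axis k 1)))) (at t within {0..tf})"
    by (intro has_vector_derivative_diff has_vector_derivative_const has_vector_derivative_mult_right has_vector_derivative_of_real d[folded has_real_derivative_iff_has_vector_derivative])
  then show "((\<lambda>t. quad_matrix (phase_mat \<delta> t p) $ j $ k) has_vector_derivative (\<chi> j k. - \<i> * cr (kin_hess \<alpha> \<delta> (p - t *\<^sub>R c1) (axis j 1) (axis k 1))) $ j $ k) (at t within {0..tf})"
    by (simp add: quad_matrix_def)
qed

text \<open>The numerator is fixed by the initial condition: \<open>gauss_quad 0\<close> is
  \<open>pi powr (CARD('d) / 2)\<close>, so at time 0 the value is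
  \<open>2 powr (CARD('d) / 2)\<close>.\<close>

definition amp :: "real \<Rightarrow> real \<Rightarrow> real ^ 'd \<Rightarrow> complex" where
  "amp \<delta> t p = cr ((2 * pi) powr (CARD('d) / 2)) / gauss_quad (phase_mat \<delta> t p)"

lemma gauss_quad_nonzero:
  fixes H :: "real ^ 'd ^ 'd"
  assumes "\<And>j k. H $ j $ k = H $ k $ j"
  shows "gauss_quad H \<noteq> 0"
proof -
  have "\<bar>H $ j $ k\<bar> \<le> norm H" for j k using component_le_norm_cart[of "H $ j" k] Finite_Cartesian_Product.norm_nth_le[of H j] by simp
  then have "pi powr (CARD('d) / 2) * exp (- ((real CARD('d))^2 * norm H / 4)) \<le> cmod (gauss_quad H)" by (intro gauss_quad_lower_bound assms) auto
  moreover have "0 < pi powr (CARD('d) / 2) * exp (- ((real CARD('d))^2 * norm H / 4))" by simp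
  ultimately show ?thesis by (metis norm_zero not_le)
qed

text \<open>The logarithmic derivatives of the amplitude and of the Gaussian integral are opposite,
  so their product is constant. The cutoff is part of the initial value and therefore remains a
  constant factor.\<close>

lemma amplitude_eq:
  assumes \<delta>: "\<delta> > 0" and flow: "hamiltonian_flow (kinetic_reg \<alpha> \<delta>) (\<lambda>x. c0 + c1 \<bullet> x) tf Q P"
    and am: "amplitude chi tf Q P a" and t: "t \<in> {0..tf}"
  shows "a t q p = cr (chi (q, p)) * amp \<delta> t p"
proof -
  let ?g = "\<lambda>t. gauss_quad (phase_mat \<delta> t p)"
  have "((\<lambda>s. a s q p * ?g s) has_vector_derivative 0) (at s within {0..tf})" if s: "s \<in> {0..tf}" for s
  proof -
    let ?H' = "\<chi> j k. kin_hess \<alpha> \<delta> (p - s *\<^sub>R c1) (axis j 1) (axis k 1) :: real ^ 'd ^ 'd"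
    let ?Z' = "\<chi> j k. - \<i> * cr (?H' $ j $ k) :: complex ^ 'd ^ 'd"
    let ?tr = "trace (matrix_inv (quad_matrix (phase_mat \<delta> s p)) ** ?Z')"
    have "((\<lambda>s. Z_matrix Q P s q p) has_vector_derivative ?Z') (at s within {0..tf})" using quad_matrix_phase_mat_has_vector_derivative[OF \<delta> s, of p]
      by (intro has_vector_derivative_transform[OF s Z_matrix_eq[OF \<delta> flow]]) auto
    \<comment> \<open>Derivatives within a closed interval of positive length are unique, so the
      choice made by \<open>vector_derivative\<close> in the amplitude equation is the derivative
      just found.\<close>
    then have "vector_derivative (\<lambda>s. Z_matrix Q P s q p) (at s within {0..tf}) = ?Z'" by (rule vector_derivative_within_closed_interval[OF tf s])
    then have da: "((\<lambda>s. a s q p) has_vector_derivative 1 / 2 * ?tr * a s q p) (at s within {0..tf})" using am s unfolding amplitude_def by (metis Z_matrix_eq[OF \<delta> flow s])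
    have dg: "(?g has_vector_derivative - (1 / 2) * ?tr * ?g s) (at s within {0..tf})"
      by (rule gauss_quad_path_derivative[OF phase_mat_sym _ phase_mat_has_vector_derivative[OF \<delta> s]]) (simp add: kin_hess_commute)
    have "((\<lambda>s. a s q p * ?g s) has_vector_derivative a s q p * (- (1 / 2) * ?tr * ?g s) + 1 / 2 * ?tr * a s q p * ?g s) (at s within {0..tf})"
      by (rule has_vector_derivative_mult[OF da dg])
    moreover have "a s q p * (- (1 / 2) * ?tr * ?g s) + 1 / 2 * ?tr * a s q p * ?g s = 0" by simp
    ultimately show ?thesis by metis
  qed
  then obtain c where c: "\<And>s. s \<in> {0..tf} \<Longrightarrow> a s q p * ?g s = c" using has_vector_derivative_zero_constant[of "{0..tf}" "\<lambda>s. a s q p * ?g s"] by auto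
  have "phase_mat \<delta> 0 p = 0" by (simp add: phase_mat_def phase_hess_def vec_eq_iff)
  then have g0: "?g 0 = cr (pi powr (CARD('d) / 2))" by (simp add: gauss_quad_zero)
  have a0: "a 0 q p = cr (2 powr (CARD('d) / 2) * chi (q, p))" using am by (simp add: amplitude_def)
  have "a t q p * ?g t = a 0 q p * ?g 0" using c[OF t] c[of 0] tf by simp
  also have "\<dots> = cr (chi (q, p)) * cr ((2 * pi) powr (CARD('d) / 2))" unfolding g0 a0 by (simp add: powr_mult)
  finally show ?thesis unfolding amp_def using gauss_quad_nonzero[OF phase_mat_sym, of \<delta> t p] by (simp add: field_simps)
qed

text \<open>The amplitude is a multiple of the reciprocal of the Gaussian integral, whose lower
  bound \<open>L\<close> rests on entry bounds uniform in \<open>\<delta>\<close> and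
  \<open>p\<close>. The difference of two reciprocals then inherits the Hoelder estimate of the
  Hessian.\<close>

lemma amp_estimates:
  "\<exists>B>0. \<forall>\<delta>>0. \<forall>t\<in>{0..tf}. (\<forall>p. cmod (amp \<delta> t p) \<le> B) \<and>
     (\<forall>p w. cmod (amp \<delta> t (p + w) - amp \<delta> t p) \<le> B * norm w powr (\<alpha> - 1))"
proof -
  obtain A where A: "A > 0" "\<And>\<delta> t p j k. \<delta> > 0 \<Longrightarrow> t \<in> {0..tf} \<Longrightarrow> \<bar>phase_mat \<delta> t p $ j $ k\<bar> \<le> A"
    using phase_mat_bound by blast
  obtain C where C: "C \<ge> 0" "\<And>\<delta> t p w v. \<delta> > 0 \<Longrightarrow> t \<in> {0..tf} \<Longrightarrow> \<bar>phase_hess \<delta> t (p + w) v v - phase_hess \<delta> t p v v\<bar> \<le> C * norm w powr (\<alpha> - 1) * (norm v)^2"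
    using phase_hess_hoelder by blast
  define L where "L = pi powr (CARD('d) / 2) * exp (- ((real CARD('d))^2 * A / 4))"
  define c where "c = (2 * pi) powr (CARD('d) / 2)"
  define G where "G = gauss_moment_const TYPE('d)"
  have L: "L > 0" "c > 0" by (simp_all add: L_def c_def)
  have G: "G \<ge> 0" unfolding G_def gauss_moment_const_def by (rule lint_nonneg) simp
  have low: "L \<le> cmod (gauss_quad (phase_mat \<delta> t p))" if "\<delta> > 0" "t \<in> {0..tf}" for \<delta> t p
    unfolding L_def by (rule gauss_quad_lower_bound[OF phase_mat_sym A(2)[OF that]])
  have b1: "cmod (amp \<delta> t p) \<le> c / L" if "\<delta> > 0" "t \<in> {0..tf}" for \<delta> t p
    unfolding amp_def using low[OF that, of p] L by (simp add: norm_divide c_def[symmetric] frac_le)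
  have b2: "cmod (amp \<delta> t (p + w) - amp \<delta> t p) \<le> (c * C * G / L^2) * norm w powr (\<alpha> - 1)" if h: "\<delta> > 0" "t \<in> {0..tf}" for \<delta> t p w
  proof -
    let ?g = "\<lambda>p. gauss_quad (phase_mat \<delta> t p)"
    have nz: "?g p \<noteq> 0" for p by (rule gauss_quad_nonzero[OF phase_mat_sym])
    have "cmod (?g p - ?g (p + w)) = cmod (?g (p + w) - ?g p)" by (rule norm_minus_commute)
    also have "\<dots> \<le> (C * norm w powr (\<alpha> - 1)) * G" unfolding G_def by (rule gauss_quad_lipschitz) (use C h in \<open>auto simp: quad_form_phase_mat\<close>)
    finally have d: "cmod (?g p - ?g (p + w)) \<le> (C * norm w powr (\<alpha> - 1)) * G" .
    have "amp \<delta> t (p + w) - amp \<delta> t p = cr c * (?g p - ?g (p + w)) / (?g (p + w) * ?g p)"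
      unfolding amp_def c_def[symmetric] using nz[of p] nz[of "p + w"] by (simp add: field_simps)
    then have "cmod (amp \<delta> t (p + w) - amp \<delta> t p) = c * cmod (?g p - ?g (p + w)) / (cmod (?g (p + w)) * cmod (?g p))" using L by (simp add: norm_divide norm_mult)
    also have "\<dots> \<le> c * ((C * norm w powr (\<alpha> - 1)) * G) / (L * L)" using L low[OF h] C(1) G d by (intro frac_le mult_mono mult_nonneg_nonneg) (auto simp: low[OF h])
    finally show ?thesis by (simp add: power2_eq_square mult_ac)
  qed
  define B where "B = c / L + c * C * G / L^2"
  have nn: "0 < c / L" "0 \<le> c * C * G / L^2" using L C(1) G by auto
  have "cmod (amp \<delta> t p) \<le> B" if "\<delta> > 0" "t \<in> {0..tf}" for \<delta> t p using b1[OF that, of p] nn unfolding B_def by linarith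
  moreover have "cmod (amp \<delta> t (p + w) - amp \<delta> t p) \<le> B * norm w powr (\<alpha> - 1)" if "\<delta> > 0" "t \<in> {0..tf}" for \<delta> t p w
  proof -
    have "(c * C * G / L^2) * norm w powr (\<alpha> - 1) \<le> B * norm w powr (\<alpha> - 1)" unfolding B_def using nn by (intro mult_right_mono) auto
    with b2[OF that, of p w] show ?thesis by linarith
  qed
  moreover have "B > 0" using nn unfolding B_def by linarith
  ultimately show ?thesis by blast
qed

lemma amp_measurable:
  assumes \<delta>: "\<delta> > 0" and t: "t \<in> {0..tf}"
  shows "amp \<delta> t \<in> Borel"
proof (rule borel_measurable_continuous_onI, rule continuous_at_imp_continuous_on, rule ballI)
  fix p :: "real ^ 'd"
  obtain B where B: "B > 0" "\<And>w. cmod (amp \<delta> t (p + w) - amp \<delta> t p) \<le> B * norm w powr (\<alpha> - 1)" using amp_estimates \<delta> t by blast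
  show "isCont (amp \<delta> t) p" unfolding isCont_def
  proof (rule LIM_zero_cancel, rule Lim_null_comparison)
    show "eventually (\<lambda>y. norm (amp \<delta> t y - amp \<delta> t p) \<le> B * norm (y - p) powr (\<alpha> - 1)) (at p)"
      using B(2)[of "y - p" for y] by (intro always_eventually) simp
    have "((\<lambda>y. norm (y - p)) \<longlongrightarrow> 0) (at p)" by (intro tendsto_eq_intros) auto
    then have "((\<lambda>y. norm (y - p) powr (\<alpha> - 1)) \<longlongrightarrow> 0) (at p)"
      using tendsto_powr'[OF _ tendsto_const, of "\<lambda>y. norm (y - p)" 0 "at p" "\<alpha> - 1"] \<alpha>1 by simp
    then show "((\<lambda>y. B * norm (y - p) powr (\<alpha> - 1)) \<longlongrightarrow> 0) (at p)" using tendsto_mult_left[of _ 0 "at p" B] by fastforce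
  qed
qed

lemma phase_measurable:
  assumes \<delta>: "\<delta> > 0" and t: "t \<in> {0..tf}"
  shows "phase \<delta> t \<in> Borel" by (intro borel_measurable_continuous_onI continuous_at_imp_continuous_on ballI
      has_derivative_continuous[OF phase_has_derivative[OF \<delta> t]])

lemma phase_grad_measurable:
  assumes \<delta>: "\<delta> > 0" and t: "t \<in> {0..tf}"
  shows "phase_grad \<delta> t \<in> Borel"
proof (rule borel_measurable_continuous_onI, rule continuous_on_componentwise[THEN iffD2], rule ballI)
  fix i :: "real ^ 'd" assume "i \<in> Basis"
  show "continuous_on UNIV (\<lambda>x. phase_grad \<delta> t x \<bullet> i)" unfolding inner_commute[of _ i]
    by (intro continuous_at_imp_continuous_on ballI has_derivative_continuous[OF inner_phase_grad_has_derivative[OF \<delta> t]])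
qed

end

section \<open>Wave packets\<close>

definition window :: "real \<Rightarrow> real ^ 'd \<Rightarrow> complex" where
  "window \<epsilon> v = cr (gs (1 / (2 * \<epsilon>)) v)"

text \<open>The FBI transform up to a constant and the unimodular factor
  \<open>iexp (p \<bullet> q / \<epsilon>)\<close>; compare \<open>fbi_norm\<close>. Without that
  factor it is, up to a constant, a windowed Fourier transform in \<open>p\<close>, to which
  Bessel's inequality applies directly.\<close>

definition packet :: "real \<Rightarrow> (real ^ 'd \<Rightarrow> complex) \<Rightarrow> real ^ 'd \<Rightarrow> real ^ 'd \<Rightarrow> complex" where
  "packet \<epsilon> f q p = (LINT y|lborel. miexp (p \<bullet> y / \<epsilon>) * window \<epsilon> (y - q) * f y)"

lemma window_measurable [measurable]: "window \<epsilon> \<in> Borel" unfolding window_def by measurable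

lemma cnj_window [simp]: "cnj (window \<epsilon> v) = window \<epsilon> v" by (simp add: window_def)

lemma window_minus: "window \<epsilon> (- v) = window \<epsilon> v" by (simp add: window_def)

lemma cmod_window_le_1: "\<epsilon> > 0 \<Longrightarrow> cmod (window \<epsilon> v) \<le> 1" by (simp add: window_def)

lemma packet_eq_fourier:
  fixes f :: "real ^ 'd \<Rightarrow> complex"
  assumes e: "\<epsilon> > 0"
  shows "packet \<epsilon> f q p = cr ((2 * pi * \<epsilon>) powr (CARD('d) / 2)) * fourier \<epsilon> (\<lambda>y. window \<epsilon> (y - q) * f y) p"
proof -
  have "(2 * pi * \<epsilon>) powr (CARD('d) / 2) * (2 * pi * \<epsilon>) powr (- (CARD('d) / 2)) = 1" using e by (simp flip: powr_add)
  then have "cr ((2 * pi * \<epsilon>) powr (CARD('d) / 2)) * (cr ((2 * pi * \<epsilon>) powr (- (CARD('d) / 2))) * z) = z" for z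
    unfolding mult.assoc[symmetric] of_real_mult[symmetric] by simp
  then show ?thesis unfolding packet_def fourier_def by (simp add: inner_commute mult_ac)
qed

lemma packet_measurable [measurable]:
  assumes [measurable]: "f \<in> Borel" "g \<in> borel_measurable M" "h \<in> borel_measurable M"
  shows "(\<lambda>z. packet \<epsilon> f (g z) (h z)) \<in> borel_measurable M" unfolding packet_def by measurable

lemma cmod_window_square:
  assumes "\<epsilon> > 0" shows "(cmod (window \<epsilon> v))^2 = gs (1 / \<epsilon>) v"
proof -
  have "(cmod (window \<epsilon> v))^2 = exp (2 * (- (1 / (2 * \<epsilon>)) * (norm v)^2))" unfolding window_def norm_of_real power2_abs by (rule exp_double[symmetric])
  then show ?thesis by (simp add: field_simps)
qed

lemma window_square_lborel:
  fixes q :: "real ^ 'd"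
  assumes e: "\<epsilon> > 0"
  shows "(\<integral>\<^sup>+y. ennreal ((cmod (window \<epsilon> (y - q)))^2) \<partial>lborel) = ennreal ((pi * \<epsilon>) powr (CARD('d) / 2))"
    and "(\<integral>\<^sup>+y. ennreal ((cmod (window \<epsilon> (q - y)))^2) \<partial>lborel) = ennreal ((pi * \<epsilon>) powr (CARD('d) / 2))"
proof -
  have "(\<integral>\<^sup>+y. ennreal ((cmod (window \<epsilon> (y - q)))^2) \<partial>lborel) = (\<integral>\<^sup>+y. ennreal ((cmod (window \<epsilon> (y::real^'d)))^2) \<partial>lborel)"
    using lborel_affine_nn_integral[of "\<lambda>y. ennreal ((cmod (window \<epsilon> (y - q)))^2)" 1 q] by simp
  also have "\<dots> = ennreal (LINT y|lborel. gs (1 / \<epsilon>) (y::real^'d))"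
    unfolding cmod_window_square[OF e] by (rule nn_integral_eq_integral) (use gauss_integrable[of "1 / \<epsilon>"] e in auto)
  also have "(LINT y|lborel. gs (1 / \<epsilon>) (y::real^'d)) = (pi * \<epsilon>) powr (CARD('d) / 2)" using gauss_integral[of "1 / \<epsilon>", where 'a="real^'d"] e by simp
  finally show 1: "(\<integral>\<^sup>+y. ennreal ((cmod (window \<epsilon> (y - q)))^2) \<partial>lborel) = ennreal ((pi * \<epsilon>) powr (CARD('d) / 2))" .
  have "window \<epsilon> (q - y) = window \<epsilon> (y - q)" for y using window_minus[of \<epsilon> "y - q"] by simp
  with 1 show "(\<integral>\<^sup>+y. ennreal ((cmod (window \<epsilon> (q - y)))^2) \<partial>lborel) = ennreal ((pi * \<epsilon>) powr (CARD('d) / 2))" by simp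
qed

lemma powr_half_square: "x > 0 \<Longrightarrow> (x powr (r / 2))^2 = x powr r"
  for x r :: real by (simp add: power2_eq_square flip: powr_add)

lemma window_l2:
  fixes q :: "real ^ 'd"
  assumes e: "\<epsilon> > 0"
  shows "L2 (\<lambda>y. window \<epsilon> (y - q))" "l2norm (\<lambda>y. window \<epsilon> (y - q)) \<le> (pi * \<epsilon>) powr (CARD('d) / 4)"
proof -
  have "((pi * \<epsilon>) powr (CARD('d) / 4))^2 = (pi * \<epsilon>) powr (CARD('d) / 2)" using powr_half_square[of "pi * \<epsilon>" "CARD('d) / 2"] e by simp
  then have "(\<integral>\<^sup>+y. ennreal ((cmod (window \<epsilon> (y - q)))^2) \<partial>lborel) \<le> ennreal (((pi * \<epsilon>) powr (CARD('d) / 4))^2)"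
    using window_square_lborel(1)[OF e, of q] by simp
  from square_integrable_nn_integral[OF _ this]
  show "L2 (\<lambda>y. window \<epsilon> (y - q))" "l2norm (\<lambda>y. window \<epsilon> (y - q)) \<le> (pi * \<epsilon>) powr (CARD('d) / 4)" by auto
qed

lemma window_mult_integrable:
  assumes e: "\<epsilon> > 0" and f: "L2 f"
  shows "L1 (\<lambda>y. window \<epsilon> (y - q) * f y)" using integrable_cnj_mult[OF window_l2(1)[OF e] f, of q] by simp

lemma packet_integrable:
  assumes e: "\<epsilon> > 0" and f: "L2 f"
  shows "L1 (\<lambda>y. miexp (p \<bullet> y / \<epsilon>) * window \<epsilon> (y - q) * f y)"
  using integrable_mult_bounded_left[OF window_mult_integrable[OF e f], of "\<lambda>y. miexp (p \<bullet> y / \<epsilon>)" 1 q] by (simp add: mult_ac)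

lemma packet_abs_bound:
  fixes f :: "real ^ 'd \<Rightarrow> complex"
  assumes e: "\<epsilon> > 0" and f: "L2 f"
  shows "(LINT y|lborel. cmod (miexp (p \<bullet> y / \<epsilon>) * window \<epsilon> (y - q) * f y)) \<le> (pi * \<epsilon>) powr (CARD('d) / 4) * l2norm f"
proof -
  have "(LINT y|lborel. cmod (miexp (p \<bullet> y / \<epsilon>) * window \<epsilon> (y - q) * f y)) = (LINT y|lborel. cmod (window \<epsilon> (y - q)) * cmod (f y))"
    by (simp add: norm_mult)
  also have "\<dots> \<le> l2norm (\<lambda>y. window \<epsilon> (y - q)) * l2norm f" by (rule cauchy_schwarz_norm[OF window_l2(1)[OF e] f])
  also have "\<dots> \<le> (pi * \<epsilon>) powr (CARD('d) / 4) * l2norm f" by (intro mult_right_mono window_l2(2)[OF e] l2norm_nonneg)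
  finally show ?thesis .
qed

lemma packet_bound:
  fixes f :: "real ^ 'd \<Rightarrow> complex"
  assumes "\<epsilon> > 0" "L2 f"
  shows "cmod (packet \<epsilon> f q p) \<le> (pi * \<epsilon>) powr (CARD('d) / 4) * l2norm f" unfolding packet_def by (rule order_trans[OF integral_norm_bound packet_abs_bound[OF assms]])

lemma packet_diff:
  assumes e: "\<epsilon> > 0" and f: "L2 f" and g: "L2 g"
  shows "packet \<epsilon> (\<lambda>y. f y - g y) q p = packet \<epsilon> f q p - packet \<epsilon> g q p" unfolding packet_def right_diff_distrib
  by (rule lint_diff) (rule packet_integrable[OF e f] packet_integrable[OF e g])+

text \<open>A bound for the norm of the map from functions to packets: the first factor is the
  normalisation of the Fourier transform in \<open>p\<close>, the second the L2 norm of the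
  window.\<close>

definition packet_const :: "('d::finite) itself \<Rightarrow> real \<Rightarrow> real" where
  "packet_const _ \<epsilon> = (2 * pi * \<epsilon>) powr (CARD('d) / 2) * (pi * \<epsilon>) powr (CARD('d) / 4)"

text \<open>For fixed \<open>p\<close> the displacement \<open>g p\<close> disappears by translation
  invariance of the integral over \<open>q\<close>. After exchanging the integrals, Bessel's
  inequality is applied in \<open>p\<close> to the windowed function, and the integral over
  \<open>q\<close> falls on the squared window. Nonnegative extended integrals permit these
  exchanges before integrability is known.\<close>

lemma packet_shift_l2:
  fixes f g :: "real ^ 'd \<Rightarrow> _"
  assumes e: "\<epsilon> > 0" and f: "L2 f" and [measurable]: "g \<in> Borel"
  shows "L2 (\<lambda>z. packet \<epsilon> f (fst z + g (snd z)) (snd z))" (is ?A)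
    and "l2norm (\<lambda>z. packet \<epsilon> f (fst z + g (snd z)) (snd z)) \<le> packet_const TYPE('d) \<epsilon> * l2norm f" (is ?B)
proof -
  note [measurable] = f[unfolded square_integrable_def, THEN conjunct1, unfolded measurable_lborel1]
  define c where "c = (2 * pi * \<epsilon>) powr (CARD('d) / 2)"
  define c' where "c' = (pi * \<epsilon>) powr (CARD('d) / 2)"
  let ?F = "\<lambda>q p. ennreal ((cmod (packet \<epsilon> f q p))^2)"
  let ?W = "\<lambda>q y. ennreal ((cmod (window \<epsilon> (y - q)))^2)"
  have c: "c \<ge> 0" "c' \<ge> 0" by (auto simp: c_def c'_def)
  have inner: "(\<integral>\<^sup>+p. ?F q p \<partial>lborel) \<le> ennreal (c^2) * (\<integral>\<^sup>+y. ?W q y * ennreal ((cmod (f y))^2) \<partial>lborel)" for q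
  proof -
    have "(\<integral>\<^sup>+p. ?F q p \<partial>lborel) = ennreal (c^2) * (\<integral>\<^sup>+p. ennreal ((cmod (fourier \<epsilon> (\<lambda>y. window \<epsilon> (y - q) * f y) p))^2) \<partial>lborel)"
      using c by (subst nn_integral_cmult[symmetric]) (auto simp: packet_eq_fourier[OF e] c_def[symmetric] norm_mult power_mult_distrib ennreal_mult')
    also have "\<dots> \<le> ennreal (c^2) * (\<integral>\<^sup>+y. ennreal ((cmod (window \<epsilon> (y - q) * f y))^2) \<partial>lborel)"
      by (intro mult_left_mono fourier_bessel[OF e] window_mult_integrable[OF e f]) auto
    finally show ?thesis by (simp add: norm_mult power_mult_distrib ennreal_mult)
  qed
  have "(\<integral>\<^sup>+z. ennreal ((cmod (packet \<epsilon> f (fst z + g (snd z)) (snd z)))^2) \<partial>(lborel :: ((real^'d) \<times> (real^'d)) measure))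
     = (\<integral>\<^sup>+p. \<integral>\<^sup>+q. ?F (q + g p) p \<partial>lborel \<partial>lborel)"
    unfolding lborel_prod[symmetric] by (subst lborel_pair.nn_integral_snd[symmetric]) (auto simp: case_prod_unfold)
  also have "\<dots> = (\<integral>\<^sup>+p. \<integral>\<^sup>+q. ?F q p \<partial>lborel \<partial>lborel)"
  proof (rule nn_integral_cong)
    fix p :: "real ^ 'd"
    show "(\<integral>\<^sup>+q. ?F (q + g p) p \<partial>lborel) = (\<integral>\<^sup>+q. ?F q p \<partial>lborel)"
      using lborel_affine_nn_integral[of "\<lambda>q. ?F q p" 1 "g p"] by (simp add: add.commute)
  qed
  also have "\<dots> = (\<integral>\<^sup>+q. \<integral>\<^sup>+p. ?F q p \<partial>lborel \<partial>lborel)" by (rule lborel_pair.Fubini') measurable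
  also have "\<dots> \<le> (\<integral>\<^sup>+q. ennreal (c^2) * (\<integral>\<^sup>+y. ?W q y * ennreal ((cmod (f y))^2) \<partial>lborel) \<partial>lborel)"
    by (intro nn_integral_mono inner)
  also have "\<dots> = ennreal (c^2) * (\<integral>\<^sup>+q. \<integral>\<^sup>+y. ?W q y * ennreal ((cmod (f y))^2) \<partial>lborel \<partial>lborel)"
    by (rule nn_integral_cmult) measurable
  also have "(\<integral>\<^sup>+q. \<integral>\<^sup>+y. ?W q y * ennreal ((cmod (f y))^2) \<partial>lborel \<partial>lborel) = (\<integral>\<^sup>+y. \<integral>\<^sup>+q. ?W q y * ennreal ((cmod (f y))^2) \<partial>lborel \<partial>lborel)"
    by (rule lborel_pair.Fubini'[symmetric]) measurable
  also have "\<dots> = (\<integral>\<^sup>+y. ennreal c' * ennreal ((cmod (f y))^2) \<partial>lborel)"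
    by (intro nn_integral_cong, subst nn_integral_multc) (auto simp: window_square_lborel(2)[OF e] c'_def)
  also have "\<dots> = ennreal c' * ennreal ((l2norm f)^2)" by (subst nn_integral_cmult) (auto simp: nn_integral_square[OF f])
  also have "ennreal (c^2) * (ennreal c' * ennreal ((l2norm f)^2)) = ennreal ((packet_const TYPE('d) \<epsilon> * l2norm f)^2)"
  proof -
    have "((pi * \<epsilon>) powr (CARD('d) / 4))^2 = c'" using powr_half_square[of "pi * \<epsilon>" "CARD('d) / 2"] e by (simp add: c'_def)
    moreover have "packet_const TYPE('d) \<epsilon> = c * (pi * \<epsilon>) powr (CARD('d) / 4)" by (simp only: packet_const_def c_def)
    ultimately show ?thesis using c by (simp add: power_mult_distrib mult.assoc flip: ennreal_mult)
  qed
  finally have nn: "(\<integral>\<^sup>+z. ennreal ((cmod (packet \<epsilon> f (fst z + g (snd z)) (snd z)))^2) \<partial>(lborel :: ((real^'d) \<times> (real^'d)) measure))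
     \<le> ennreal ((packet_const TYPE('d) \<epsilon> * l2norm f)^2)" .
  have m: "(\<lambda>z. packet \<epsilon> f (fst z + g (snd z)) (snd z)) \<in> Borel" unfolding borel_prod[symmetric] by measurable
  show ?A ?B using square_integrable_nn_integral[OF m nn] by (auto simp: packet_const_def)
qed

lemma packet_l2:
  fixes f :: "real ^ 'd \<Rightarrow> complex"
  assumes e: "\<epsilon> > 0" and f: "L2 f"
  shows "L2 (\<lambda>z. packet \<epsilon> f (fst z) (snd z))"
    and "l2norm (\<lambda>z. packet \<epsilon> f (fst z) (snd z)) \<le> packet_const TYPE('d) \<epsilon> * l2norm f" using packet_shift_l2[OF e f, of "\<lambda>_. 0"] by auto

text \<open>The Fourier transform of a Gaussian wave packet is again one, with position and momentum
  exchanged. Moving the transform onto the packet exhibits the left side, up to a phase, as an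
  inverse transform in the variable \<open>q\<close>, ready for Plancherel.\<close>

lemma packet_inv_fourier:
  fixes h :: "real ^ 'd \<Rightarrow> complex"
  assumes e: "\<epsilon> > 0" and h: "gauss_bounded h"
  shows "packet \<epsilon> (invF \<epsilon> h) q p = miexp (q \<bullet> p / \<epsilon>) *
     (cr ((2 * pi * \<epsilon>) powr (CARD('d) / 2)) * invF \<epsilon> (\<lambda>\<xi>. window \<epsilon> (\<xi> - p) * h \<xi>) q)"
proof -
  define w where "w y = iexp (p \<bullet> y / \<epsilon>) * window \<epsilon> (y - q)" for y
  define c where "c = (2 * pi * \<epsilon>) powr (- (CARD('d) / 2))"
  define c' where "c' = (2 * pi * \<epsilon>) powr (CARD('d) / 2)"
  have cc: "c * c' = 1" "c' * c = 1" using e by (auto simp: c_def c'_def simp flip: powr_add)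
  have gbw: "gauss_bounded (window \<epsilon> :: real^'d \<Rightarrow> complex)"
    using gauss_bounded_gauss[of "1 / (2 * \<epsilon>)" "\<lambda>_::real^'d. 1" 1] e unfolding window_def by simp
  have wi: "L1 w" using gauss_bounded_integrable[OF gauss_bounded_mult_bounded[OF gauss_bounded_shift[OF gbw, of "- q"], of "\<lambda>y. iexp (p \<bullet> y / \<epsilon>)" 1]]
    unfolding w_def by simp
  have fw: "fourier \<epsilon> w \<xi> = iexp (q \<bullet> (p - \<xi>) / \<epsilon>) * window \<epsilon> (\<xi> - p)" for \<xi>
  proof -
    have "(LINT y|lborel. w y * miexp (y \<bullet> \<xi> / \<epsilon>))
      = (LINT v|lborel. w (q + v) * miexp ((q + v) \<bullet> \<xi> / \<epsilon>))" using lborel_affine_integral[of 1 "\<lambda>y. w y * miexp (y \<bullet> \<xi> / \<epsilon>)" q] by simp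
    also have "\<dots> = (LINT v|lborel. iexp (q \<bullet> (p - \<xi>) / \<epsilon>) * (window \<epsilon> v * iexp (((p - \<xi>) /\<^sub>R \<epsilon>) \<bullet> v)))"
    proof (rule lint_cong)
      fix v
      have "iexp (p \<bullet> (q + v) / \<epsilon>) * miexp ((q + v) \<bullet> \<xi> / \<epsilon>)
        = iexp (q \<bullet> (p - \<xi>) / \<epsilon>) * iexp (((p - \<xi>) /\<^sub>R \<epsilon>) \<bullet> v)" unfolding exp_add[symmetric]
        by (rule arg_cong[where f=exp]) (simp add: inner_add_left inner_add_right inner_diff_left inner_diff_right inner_commute divide_inverse algebra_simps)
      then show "w (q + v) * miexp ((q + v) \<bullet> \<xi> / \<epsilon>) = iexp (q \<bullet> (p - \<xi>) / \<epsilon>) * (window \<epsilon> v * iexp (((p - \<xi>) /\<^sub>R \<epsilon>) \<bullet> v))"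
        unfolding w_def by (simp add: mult_ac)
    qed
    also have "\<dots> = iexp (q \<bullet> (p - \<xi>) / \<epsilon>) * (LINT v|lborel. window \<epsilon> v * iexp (((p - \<xi>) /\<^sub>R \<epsilon>) \<bullet> v))"
      by (simp only: integral_mult_right_zero)
    also have "(LINT v|lborel. window \<epsilon> v * iexp (((p - \<xi>) /\<^sub>R \<epsilon>) \<bullet> v))
      = cr ((pi / (1 / (2 * \<epsilon>))) powr (CARD('d) / 2) * exp (- (norm ((p - \<xi>) /\<^sub>R \<epsilon>))\<^sup>2 / (4 * (1 / (2 * \<epsilon>)))))"
      using gauss_fourier_of_real[of "1 / (2 * \<epsilon>)" "(p - \<xi>) /\<^sub>R \<epsilon>"] e unfolding window_def by simp
    also have "\<dots> = cr c' * window \<epsilon> (\<xi> - p)"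
    proof -
      have "(norm ((p - \<xi>) /\<^sub>R \<epsilon>))^2 / (4 * (1 / (2 * \<epsilon>))) = 1 / (2 * \<epsilon>) * (norm (\<xi> - p))^2"
        unfolding norm_scaleR power_mult_distrib norm_minus_commute[of p \<xi>] using e by (simp add: power2_eq_square field_simps)
      moreover have "pi / (1 / (2 * \<epsilon>)) = 2 * pi * \<epsilon>" by simp
      ultimately show ?thesis unfolding c'_def window_def by (simp only: minus_divide_left[symmetric] minus_mult_left[symmetric] of_real_mult)
    qed
    finally have "fourier \<epsilon> w \<xi> = cr (c * c') * (iexp (q \<bullet> (p - \<xi>) / \<epsilon>) * window \<epsilon> (\<xi> - p))"
      unfolding fourier_def c_def[symmetric] by (simp add: mult_ac)
    then show ?thesis unfolding cc by simp
  qed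
  have "packet \<epsilon> (invF \<epsilon> h) q p = l2inner w (invF \<epsilon> h)" unfolding packet_def l2inner_def w_def by (simp add: exp_cnj)
  also have "\<dots> = cnj (l2inner h (fourier \<epsilon> w))" unfolding l2inner_commute[of w] l2inner_inv_fourier[OF gauss_bounded_integrable[OF h] wi] ..
  also have "\<dots> = (LINT \<xi>|lborel. miexp (q \<bullet> p / \<epsilon>) * (window \<epsilon> (\<xi> - p) * h \<xi> * iexp (q \<bullet> \<xi> / \<epsilon>)))"
    unfolding l2inner_def lint_cnj[symmetric] fw
  proof (rule lint_cong)
    fix \<xi>
    have "cnj (iexp (q \<bullet> (p - \<xi>) / \<epsilon>)) = miexp (q \<bullet> p / \<epsilon>) * iexp (q \<bullet> \<xi> / \<epsilon>)"
      unfolding exp_cnj exp_add[symmetric] by (rule arg_cong[where f=exp]) (simp add: inner_diff_right diff_divide_distrib right_diff_distrib)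
    then show "cnj (cnj (h \<xi>) * (iexp (q \<bullet> (p - \<xi>) / \<epsilon>) * window \<epsilon> (\<xi> - p)))
      = miexp (q \<bullet> p / \<epsilon>) * (window \<epsilon> (\<xi> - p) * h \<xi> * iexp (q \<bullet> \<xi> / \<epsilon>))" by (simp add: mult_ac)
  qed
  also have "\<dots> = miexp (q \<bullet> p / \<epsilon>) * (LINT \<xi>|lborel. (window \<epsilon> (\<xi> - p) * h \<xi> * iexp (q \<bullet> \<xi> / \<epsilon>)))"
    by (simp only: integral_mult_right_zero)
  also have "\<dots> = miexp (q \<bullet> p / \<epsilon>) * (cr (c' * c) * (LINT \<xi>|lborel. (window \<epsilon> (\<xi> - p) * h \<xi> * iexp (q \<bullet> \<xi> / \<epsilon>))))"
    unfolding cc by simp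
  also have "\<dots> = miexp (q \<bullet> p / \<epsilon>) * (cr c' * invF \<epsilon> (\<lambda>\<xi>. window \<epsilon> (\<xi> - p) * h \<xi>) q)"
    unfolding inv_fourier_def c_def[symmetric] of_real_mult by (simp only: mult.assoc)
  finally show ?thesis unfolding c'_def .
qed

lemma window_mult_gauss_bounded:
  assumes e: "\<epsilon> > 0" and h: "gauss_bounded h"
  shows "gauss_bounded (\<lambda>\<xi>. window \<epsilon> (\<xi> - p) * h \<xi>)" by (rule gauss_bounded_mult_bounded[OF h _ cmod_window_le_1[OF e]]) measurable

text \<open>For fixed \<open>p\<close> both packets are inverse transforms in \<open>q\<close>, so
  Plancherel removes the position variable. The displacement \<open>a\<close> becomes a modulation:
  this is where the motion of the packet centre turns into a phase linear in
  \<open>\<xi> - p\<close>.\<close>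

lemma packet_fibre_inner:
  fixes h k :: "real ^ 'd \<Rightarrow> complex"
  assumes e: "\<epsilon> > 0" and h: "gauss_bounded h" and k: "gauss_bounded k"
  shows "(LINT q|lborel. cnj (packet \<epsilon> (invF \<epsilon> k) (q + a) p) * packet \<epsilon> (invF \<epsilon> h) q p)
    = cr ((2 * pi * \<epsilon>) powr CARD('d)) *
      (LINT \<xi>|lborel. miexp (a \<bullet> (\<xi> - p) / \<epsilon>) * (window \<epsilon> (\<xi> - p))^2 * (cnj (k \<xi>) * h \<xi>))"
proof -
  define c where "c = cr ((2 * pi * \<epsilon>) powr (CARD('d) / 2))"
  define wk where "wk \<xi> = iexp (a \<bullet> \<xi> / \<epsilon>) * (window \<epsilon> (\<xi> - p) * k \<xi>)" for \<xi>
  define wh where "wh \<xi> = window \<epsilon> (\<xi> - p) * h \<xi>" for \<xi>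
  have gb: "gauss_bounded wk" "gauss_bounded wh" unfolding wk_def wh_def
    by (rule gauss_bounded_mult_bounded[OF window_mult_gauss_bounded[OF e k], of _ 1], simp_all add: window_mult_gauss_bounded[OF e h])
  have shift: "invF \<epsilon> (\<lambda>\<xi>. window \<epsilon> (\<xi> - p) * k \<xi>) (q + a) = invF \<epsilon> wk q" for q unfolding inv_fourier_def wk_def
    by (simp add: inner_add_left add_divide_distrib distrib_left exp_add mult_ac)
  have c2: "c * c = cr ((2 * pi * \<epsilon>) powr CARD('d))" "cnj c = c" using e by (auto simp: c_def simp flip: of_real_mult powr_add)
  have ph: "cnj (miexp ((q + a) \<bullet> p / \<epsilon>)) * miexp (q \<bullet> p / \<epsilon>) = iexp (a \<bullet> p / \<epsilon>)" for q
    unfolding exp_cnj exp_add[symmetric] by (rule arg_cong[where f=exp]) (simp add: inner_add_left add_divide_distrib distrib_left)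
  have "cnj (packet \<epsilon> (invF \<epsilon> k) (q + a) p) * packet \<epsilon> (invF \<epsilon> h) q p
    = (c * c * iexp (a \<bullet> p / \<epsilon>)) * (cnj (invF \<epsilon> wk q) * invF \<epsilon> wh q)" for q
    unfolding packet_inv_fourier[OF e k] packet_inv_fourier[OF e h] ph[of q, symmetric] shift c_def[symmetric] wh_def[symmetric] by (simp add: c2 mult_ac)
  then have "(LINT q|lborel. cnj (packet \<epsilon> (invF \<epsilon> k) (q + a) p) * packet \<epsilon> (invF \<epsilon> h) q p)
    = (c * c * iexp (a \<bullet> p / \<epsilon>)) * l2inner (invF \<epsilon> wk) (invF \<epsilon> wh)" unfolding l2inner_def by (simp only: integral_mult_right_zero)
  also have "l2inner (invF \<epsilon> wk) (invF \<epsilon> wh) = l2inner wk wh" by (rule l2inner_inv_fourier_inv_fourier[OF e gb])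
  also have "(c * c * iexp (a \<bullet> p / \<epsilon>)) * l2inner wk wh = c * c * (LINT \<xi>|lborel. iexp (a \<bullet> p / \<epsilon>) * (cnj (wk \<xi>) * wh \<xi>))"
    unfolding l2inner_def by (simp only: integral_mult_right_zero mult.assoc)
  also have "(LINT \<xi>|lborel. iexp (a \<bullet> p / \<epsilon>) * (cnj (wk \<xi>) * wh \<xi>))
     = (LINT \<xi>|lborel. miexp (a \<bullet> (\<xi> - p) / \<epsilon>) * (window \<epsilon> (\<xi> - p))^2 * (cnj (k \<xi>) * h \<xi>))"
  proof (rule lint_cong)
    fix \<xi>
    have "miexp (a \<bullet> (\<xi> - p) / \<epsilon>) = iexp (a \<bullet> p / \<epsilon>) * cnj (iexp (a \<bullet> \<xi> / \<epsilon>))"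
      unfolding exp_cnj exp_add[symmetric] by (rule arg_cong[where f=exp]) (simp add: inner_diff_right diff_divide_distrib right_diff_distrib)
    then show "iexp (a \<bullet> p / \<epsilon>) * (cnj (wk \<xi>) * wh \<xi>) = miexp (a \<bullet> (\<xi> - p) / \<epsilon>) * (window \<epsilon> (\<xi> - p))^2 * (cnj (k \<xi>) * h \<xi>)"
      unfolding wk_def wh_def by (simp add: power2_eq_square mult_ac)
  qed
  finally show ?thesis unfolding c2 .
qed

lemma fbi_norm:
  fixes f :: "real ^ 'd \<Rightarrow> complex"
  assumes e: "\<epsilon> > 0"
  shows "cmod (fbi \<epsilon> f q p) = 2 powr (- (CARD('d) / 2)) * (pi * \<epsilon>) powr (- (3 * CARD('d) / 4)) * cmod (packet \<epsilon> f q p)"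
proof -
  have "exp (- (\<i> / cr \<epsilon>) * cr (p \<bullet> (x - q)) - cr ((norm (x - q))^2 / (2 * \<epsilon>))) * f x
     = iexp (p \<bullet> q / \<epsilon>) * (miexp (p \<bullet> x / \<epsilon>) * window \<epsilon> (x - q) * f x)" for x
  proof -
    have "window \<epsilon> (x - q) = exp (cr (- (1 / (2 * \<epsilon>)) * (norm (x - q))^2))" unfolding window_def by (rule exp_of_real[symmetric])
    moreover have "exp (- (\<i> / cr \<epsilon>) * cr (p \<bullet> (x - q)) - cr ((norm (x - q))^2 / (2 * \<epsilon>)))
       = iexp (p \<bullet> q / \<epsilon>) * (miexp (p \<bullet> x / \<epsilon>) * exp (cr (- (1 / (2 * \<epsilon>)) * (norm (x - q))^2)))"
      unfolding exp_add[symmetric] using e by (intro arg_cong[where f=exp]) (simp add: inner_diff_right diff_divide_distrib right_diff_distrib)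
    ultimately show ?thesis by (simp add: mult_ac)
  qed
  then have "fbi \<epsilon> f q p = cr (2 powr (- (CARD('d) / 2)) * (pi * \<epsilon>) powr (- (3 * CARD('d) / 4))) * (iexp (p \<bullet> q / \<epsilon>) * packet \<epsilon> f q p)"
    unfolding fbi_def packet_def by (simp only: integral_mult_right_zero)
  then show ?thesis by (simp only: norm_mult norm_of_real cmod_exp_ii_real mult_1_left) simp
qed

context linear_potential_phase
begin

text \<open>After rescaling the integration variable by \<open>sqrt \<epsilon>\<close> the prefactor
  becomes \<open>(2 * pi) powr (- (CARD('d) / 2))\<close>, the reciprocal of the numerator of
  \<open>amp\<close>.\<close>

definition fga_mult :: "real \<Rightarrow> real \<Rightarrow> real \<Rightarrow> real ^ 'd \<Rightarrow> complex" where
  "fga_mult \<epsilon> \<delta> t \<xi> = cr ((2 * pi * \<epsilon>) powr (- (CARD('d) / 2))) *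
     (LINT p|lborel. amp \<delta> t p * miexp (phase \<delta> t p / \<epsilon>) *
        (miexp (phase_grad \<delta> t p \<bullet> (\<xi> - p) / \<epsilon>) * (window \<epsilon> (\<xi> - p))^2))"

lemma powr_le_one_plus: "0 \<le> x \<Longrightarrow> x powr (\<alpha> - 1) \<le> 1 + x" for x :: real
proof (cases "x \<le> 1")
  case True
  assume "0 \<le> x"
  then have "x powr (\<alpha> - 1) \<le> 1" using True \<alpha>1 by (simp add: powr_le1)
  with \<open>0 \<le> x\<close> show ?thesis by simp
next
  case False
  then have "x powr (\<alpha> - 1) \<le> x powr 1" using \<alpha>2 by (intro powr_mono) auto
  with False show ?thesis by simp
qed

text \<open>On the scale \<open>sqrt \<epsilon>\<close> the linearised phase differs from the phase
  at \<open>\<xi>\<close> by half the Hessian at an intermediate point. Freezing Hessian and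
  amplitude at \<open>\<xi>\<close> leaves exactly the integral that normalises the amplitude. Each
  freezing error is of order \<open>(sqrt \<epsilon>) powr (\<alpha> - 1)\<close>, with polynomial
  weights under the Gaussian.\<close>

lemma fga_mult_close:
  "\<exists>C\<ge>0. \<forall>\<epsilon>>0. \<forall>\<delta>>0. \<forall>t\<in>{0..tf}. \<forall>\<xi>. cmod (fga_mult \<epsilon> \<delta> t \<xi> - miexp (phase \<delta> t \<xi> / \<epsilon>)) \<le> C * \<epsilon> powr ((\<alpha> - 1) / 2)"
proof -
  obtain B where B: "B > 0" "\<And>\<delta> t p. \<delta> > 0 \<Longrightarrow> t \<in> {0..tf} \<Longrightarrow> cmod (amp \<delta> t p) \<le> B"
      "\<And>\<delta> t p w. \<delta> > 0 \<Longrightarrow> t \<in> {0..tf} \<Longrightarrow> cmod (amp \<delta> t (p + w) - amp \<delta> t p) \<le> B * norm w powr (\<alpha> - 1)"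
    using amp_estimates by blast
  obtain H where H: "H \<ge> 0" "\<And>\<delta> t p w v. \<delta> > 0 \<Longrightarrow> t \<in> {0..tf} \<Longrightarrow> \<bar>phase_hess \<delta> t (p + w) v v - phase_hess \<delta> t p v v\<bar> \<le> H * norm w powr (\<alpha> - 1) * (norm v)^2"
    using phase_hess_hoelder by blast
  define K where "K = B * (1 + H)"
  define G where "G = (LINT v|lborel. (1 + norm (v :: real ^ 'd)) ^ 3 * gs 1 v)"
  define c where "c = (2 * pi) powr (- (CARD('d) / 2))"
  have K: "K \<ge> 0" using B(1) H(1) by (simp add: K_def)
  have G: "G \<ge> 0" unfolding G_def by (rule lint_nonneg) simp
  have main: "cmod (fga_mult \<epsilon> \<delta> t \<xi> - miexp (phase \<delta> t \<xi> / \<epsilon>)) \<le> (c * (K * G)) * \<epsilon> powr ((\<alpha> - 1) / 2)"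
    if e: "\<epsilon> > 0" and h: "\<delta> > 0" "t \<in> {0..tf}" for \<epsilon> \<delta> t \<xi>
  proof -
    note [measurable] = amp_measurable[OF h] phase_measurable[OF h] phase_grad_measurable[OF h]
    define s where "s = sqrt \<epsilon>"
    have s: "s > 0" "s * s = \<epsilon>" using e by (auto simp: s_def)
    define w where "w = miexp (phase \<delta> t \<xi> / \<epsilon>)"
    define f where "f p = amp \<delta> t p * miexp (phase \<delta> t p / \<epsilon>) *
        (miexp (phase_grad \<delta> t p \<bullet> (\<xi> - p) / \<epsilon>) * (window \<epsilon> (\<xi> - p))^2)" for p
    define F where "F v = f (\<xi> + s *\<^sub>R v)" for v
    define g where "g v = w * amp \<delta> t \<xi> * quad_exp (phase_mat \<delta> t \<xi>) v" for v
    have win: "(window \<epsilon> (\<xi> - (\<xi> + s *\<^sub>R v)))^2 = cr (exp (- (norm v)\<^sup>2))" for v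
    proof -
      have "(window \<epsilon> (\<xi> - (\<xi> + s *\<^sub>R v)))^2 = cr ((gs (1 / (2 * \<epsilon>)) (s *\<^sub>R v))^2)" by (simp add: window_def)
      also have "(gs (1 / (2 * \<epsilon>)) (s *\<^sub>R v))^2 = exp (2 * (- (1 / (2 * \<epsilon>)) * (norm (s *\<^sub>R v))^2))" by (rule exp_double[symmetric])
      also have "2 * (- (1 / (2 * \<epsilon>)) * (norm (s *\<^sub>R v))^2) = - (norm v)\<^sup>2" using e s by (simp add: power_mult_distrib power2_eq_square field_simps)
      finally show ?thesis .
    qed
    have pt: "cmod (F v - g v) \<le> (K * s powr (\<alpha> - 1)) * ((1 + norm v) ^ 3 * gs 1 v)" for v
    proof -
      define p where "p = \<xi> + s *\<^sub>R v"
      \<comment> \<open>The expansion is made about \<open>p\<close> and evaluated at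
        \<open>\<xi>\<close>, not the other way round: its linear part is what the multiplier
        contains, so the phase at \<open>\<xi>\<close> minus the second-order term remains.\<close>
      obtain \<tau> where \<tau>: "0 < \<tau>" "\<tau> \<le> 1" "phase \<delta> t (p + (\<xi> - p)) = phase \<delta> t p + phase_grad \<delta> t p \<bullet> (\<xi> - p) + phase_hess \<delta> t (p + \<tau> *\<^sub>R (\<xi> - p)) (\<xi> - p) (\<xi> - p) / 2"
        using phase_taylor[OF h] by blast
      define z where "z = ((1 - \<tau>) * s) *\<^sub>R v"
      have pz: "p + \<tau> *\<^sub>R (\<xi> - p) = \<xi> + z" by (simp add: p_def z_def algebra_simps)
      have nz: "norm z \<le> s * norm v" using s \<tau> by (simp add: z_def mult_left_le_one_le mult_right_mono)
      have hs: "phase_hess \<delta> t q (\<xi> - p) (\<xi> - p) = \<epsilon> * phase_hess \<delta> t q v v" for q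
        unfolding phase_hess_def kin_hess_def p_def by (simp add: mult_ac s(2)[symmetric] distrib_left distrib_right flip: integral_mult_right)
      have ph: "phase \<delta> t p + phase_grad \<delta> t p \<bullet> (\<xi> - p) = phase \<delta> t \<xi> - \<epsilon> * phase_hess \<delta> t (\<xi> + z) v v / 2"
        using \<tau>(3) unfolding pz hs by simp
      have "miexp (phase \<delta> t p / \<epsilon>) * miexp (phase_grad \<delta> t p \<bullet> (\<xi> - p) / \<epsilon>)
        = miexp ((phase \<delta> t p + phase_grad \<delta> t p \<bullet> (\<xi> - p)) / \<epsilon>)" unfolding exp_add[symmetric] by (simp add: add_divide_distrib distrib_left)
      also have "\<dots> = w * iexp (phase_hess \<delta> t (\<xi> + z) v v / 2)" unfolding ph w_def exp_add[symmetric] using e by (intro arg_cong[where f=exp]) (simp add: field_simps)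
      finally have osc: "miexp (phase \<delta> t p / \<epsilon>) * miexp (phase_grad \<delta> t p \<bullet> (\<xi> - p) / \<epsilon>) = w * iexp (phase_hess \<delta> t (\<xi> + z) v v / 2)" .
      let ?E = "\<lambda>x. iexp (phase_hess \<delta> t x v v / 2)"
      let ?r = "cr (exp (- (norm v)\<^sup>2))"
      have Feq: "F v = w * amp \<delta> t p * (?r * ?E (\<xi> + z))" unfolding F_def f_def p_def[symmetric] win[of v, folded p_def] using osc by (simp add: mult_ac)
      have geq: "g v = w * amp \<delta> t \<xi> * (?r * ?E \<xi>)" unfolding g_def quad_exp_def quad_form_phase_mat[OF h(1)] ..
      have cw: "cmod w = 1" by (simp add: w_def)
      have "F v - g v = w * ?r * ((amp \<delta> t p - amp \<delta> t \<xi>) * ?E (\<xi> + z) + amp \<delta> t \<xi> * (?E (\<xi> + z) - ?E \<xi>))"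
        unfolding Feq geq by (simp add: algebra_simps)
      then have "cmod (F v - g v) = exp (- (norm v)\<^sup>2) * cmod ((amp \<delta> t p - amp \<delta> t \<xi>) * ?E (\<xi> + z) + amp \<delta> t \<xi> * (?E (\<xi> + z) - ?E \<xi>))"
        by (simp add: norm_mult cw)
      moreover have "cmod ((amp \<delta> t p - amp \<delta> t \<xi>) * ?E (\<xi> + z) + amp \<delta> t \<xi> * (?E (\<xi> + z) - ?E \<xi>)) \<le> K * s powr (\<alpha> - 1) * (1 + norm v) ^ 3"
      proof -
        let ?y = "(s * norm v) powr (\<alpha> - 1)"
        have "cmod ((amp \<delta> t p - amp \<delta> t \<xi>) * ?E (\<xi> + z)) = cmod (amp \<delta> t (\<xi> + s *\<^sub>R v) - amp \<delta> t \<xi>)" by (simp add: norm_mult p_def)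
        also have "\<dots> \<le> B * ?y" using B(3)[OF h, of \<xi> "s *\<^sub>R v"] s by simp
        finally have 1: "cmod ((amp \<delta> t p - amp \<delta> t \<xi>) * ?E (\<xi> + z)) \<le> B * ?y" .
        have "cmod (?E (\<xi> + z) - ?E \<xi>) \<le> \<bar>phase_hess \<delta> t (\<xi> + z) v v / 2 - phase_hess \<delta> t \<xi> v v / 2\<bar>"
        proof -
          have "?E (\<xi> + z) - ?E \<xi> = ?E \<xi> * (iexp (phase_hess \<delta> t (\<xi> + z) v v / 2 - phase_hess \<delta> t \<xi> v v / 2) - 1)"
            unfolding right_diff_distrib exp_add[symmetric] by (simp add: algebra_simps)
          then show ?thesis using cmod_iexp_minus_1[of "phase_hess \<delta> t (\<xi> + z) v v / 2 - phase_hess \<delta> t \<xi> v v / 2"] by (simp add: norm_mult)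
        qed
        also have "\<dots> \<le> \<bar>phase_hess \<delta> t (\<xi> + z) v v - phase_hess \<delta> t \<xi> v v\<bar>" by (simp add: diff_divide_distrib[symmetric])
        also have "\<dots> \<le> H * norm z powr (\<alpha> - 1) * (norm v)^2" by (rule H(2)[OF h])
        also have "\<dots> \<le> H * ?y * (norm v)^2" using nz \<alpha>1 H(1) by (intro mult_right_mono mult_left_mono powr_mono2) auto
        finally have 2: "cmod (amp \<delta> t \<xi> * (?E (\<xi> + z) - ?E \<xi>)) \<le> B * (H * ?y * (norm v)^2)"
          unfolding norm_mult using B(2)[OF h, of \<xi>] B(1) by (intro mult_mono) auto
        have "cmod ((amp \<delta> t p - amp \<delta> t \<xi>) * ?E (\<xi> + z) + amp \<delta> t \<xi> * (?E (\<xi> + z) - ?E \<xi>)) \<le> B * ?y + B * (H * ?y * (norm v)^2)"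
          using 1 2 by (rule norm_triangle_le[OF add_mono])
        also have "\<dots> = B * ?y * (1 + H * (norm v)^2)" by (simp add: algebra_simps)
        \<comment> \<open>One power of the weight comes from
          \<open>norm v powr (\<alpha> - 1)\<close>, which is at most \<open>1 + norm v\<close>, and
          two from the quadratic form; hence the weight of degree 3 in \<open>G\<close>.\<close>
        also have "\<dots> \<le> B * (s powr (\<alpha> - 1) * (1 + norm v)) * ((1 + H) * (1 + norm v)^2)"
        proof (intro mult_mono mult_left_mono)
          show "?y \<le> s powr (\<alpha> - 1) * (1 + norm v)" unfolding powr_mult using powr_le_one_plus[of "norm v"] by (intro mult_left_mono) auto
          have "(norm v)^2 \<le> (1 + norm v)^2" "1 \<le> (1 + norm v)^2" by (simp_all add: power2_eq_square algebra_simps)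
          then have "1 + H * (norm v)^2 \<le> (1 + norm v)^2 + H * (1 + norm v)^2" using H(1) by (intro add_mono mult_left_mono)
          then show "1 + H * (norm v)^2 \<le> (1 + H) * (1 + norm v)^2" by (simp add: algebra_simps)
        qed (use B(1) H(1) in auto)
        also have "\<dots> = K * s powr (\<alpha> - 1) * (1 + norm v) ^ 3" by (simp add: K_def power2_eq_square power3_eq_cube mult_ac)
        finally show ?thesis .
      qed
      ultimately have "cmod (F v - g v) \<le> exp (- (norm v)\<^sup>2) * (K * s powr (\<alpha> - 1) * (1 + norm v) ^ 3)" by simp
      then show ?thesis by (simp add: mult_ac)
    qed
    have fm [measurable]: "f \<in> Borel" unfolding f_def by measurable
    have Fi: "L1 F"
    proof (rule integrable_real_bound[of _ "\<lambda>v. B * gs 1 v"])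
      show "L1 (\<lambda>v::real^'d. B * gs 1 v)" using gauss_integrable[of 1] by (intro integrable_mult_right) simp
      show "F \<in> borel_measurable lborel" unfolding F_def by measurable
      show "norm (F v) \<le> B * gs 1 v" for v unfolding F_def f_def win using B(2)[OF h, of "\<xi> + s *\<^sub>R v"] by (simp add: norm_mult)
    qed
    have gi: "L1 g" unfolding g_def by (intro integrable_mult_right quad_exp_integrable)
    have Gi: "L1 (\<lambda>v::real^'d. (1 + norm v) ^ 3 * gs 1 v)" by (rule gauss_moment_integrable) simp
    have cpos: "c > 0" by (simp add: c_def)
    have scale: "(2 * pi * \<epsilon>) powr (- (CARD('d) / 2)) * s ^ CARD('d) = c"
    proof -
      have "s ^ CARD('d) = \<epsilon> powr (CARD('d) / 2)" using e by (simp add: s_def powr_half_sqrt[symmetric] powr_powr flip: powr_realpow)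
      then show ?thesis using e by (simp add: c_def powr_mult powr_minus field_simps)
    qed
    have "(LINT p|lborel. f p) = (\<bar>s\<bar> ^ CARD('d)) *\<^sub>R (LINT v|lborel. F v)" using lborel_affine_integral[of s f \<xi>] s by (simp add: F_def)
    then have m: "fga_mult \<epsilon> \<delta> t \<xi> = cr c * (LINT v|lborel. F v)"
      unfolding fga_mult_def f_def[symmetric] scale[symmetric] using s by (simp add: scaleR_conv_of_real mult_ac)
    have "(LINT v|lborel. g v) = w * amp \<delta> t \<xi> * gauss_quad (phase_mat \<delta> t \<xi>)" unfolding g_def gauss_quad_def by (simp only: integral_mult_right_zero)
    also have "\<dots> = w * cr ((2 * pi) powr (CARD('d) / 2))" unfolding amp_def using gauss_quad_nonzero[OF phase_mat_sym, of \<delta> t \<xi>] by simp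
    finally have gint: "(LINT v|lborel. g v) = w * cr ((2 * pi) powr (CARD('d) / 2))" .
    have "c * (2 * pi) powr (CARD('d) / 2) = 1" by (simp add: c_def flip: powr_add)
    then have one: "cr c * cr ((2 * pi) powr (CARD('d) / 2)) = 1" unfolding of_real_mult[symmetric] by simp
    have "cr c * (LINT v|lborel. g v) = w * (cr c * cr ((2 * pi) powr (CARD('d) / 2)))" unfolding gint by (rule mult.left_commute)
    then have wg: "w = cr c * (LINT v|lborel. g v)" unfolding one by simp
    have "fga_mult \<epsilon> \<delta> t \<xi> - w = cr c * (LINT v|lborel. F v - g v)" unfolding lint_diff[OF Fi gi] right_diff_distrib m wg[symmetric] ..
    then have "cmod (fga_mult \<epsilon> \<delta> t \<xi> - w) = c * cmod (LINT v|lborel. F v - g v)" using cpos by (simp add: norm_mult)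
    moreover have "cmod (LINT v|lborel. F v - g v) \<le> K * s powr (\<alpha> - 1) * G"
    proof -
      have "cmod (LINT v|lborel. F v - g v) \<le> (LINT v|lborel. (K * s powr (\<alpha> - 1)) * ((1 + norm v) ^ 3 * gs 1 (v::real^'d)))"
        by (rule lint_norm_bound[OF L1_diff[OF Fi gi] integrable_mult_right[OF Gi] pt])
      then show ?thesis unfolding G_def by (simp only: integral_mult_right_zero)
    qed
    ultimately have "cmod (fga_mult \<epsilon> \<delta> t \<xi> - w) \<le> c * (K * s powr (\<alpha> - 1) * G)" using cpos by simp
    moreover have "s powr (\<alpha> - 1) = \<epsilon> powr ((\<alpha> - 1) / 2)" using e by (simp add: s_def powr_half_sqrt[symmetric] powr_powr mult.commute)
    ultimately show ?thesis unfolding w_def by (simp add: mult_ac)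
  qed
  show ?thesis using main K G by (intro exI[of _ "c * (K * G)"] conjI) (auto simp: c_def)
qed

end

lemma fst_borel [measurable]: "fst \<in> borel_measurable (borel :: ('a::euclidean_space \<times> 'b::euclidean_space) measure)" by (intro borel_measurable_continuous_onI continuous_intros)

lemma snd_borel [measurable]: "snd \<in> borel_measurable (borel :: ('a::euclidean_space \<times> 'b::euclidean_space) measure)" by (intro borel_measurable_continuous_onI continuous_intros)

lemma integrable_pair_iterated:
  fixes F :: "'a::euclidean_space \<Rightarrow> 'b::euclidean_space \<Rightarrow> complex"
  assumes m: "(\<lambda>(x, y). F x y) \<in> borel_measurable lborel2" and i: "\<And>x. L1 (F x)"
    and b: "\<And>x. (LINT y|lborel. cmod (F x y)) \<le> G x" and G: "L1 G"
  shows "integrable lborel2 (\<lambda>(x, y). F x y)"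
proof (rule lborel_pair.Fubini_integrable[OF m])
  have "L1 (\<lambda>x. LINT y|lborel. cmod (F x y))"
  proof (rule integrable_real_bound[OF G])
    show "(\<lambda>x. LINT y|lborel. cmod (F x y)) \<in> borel_measurable lborel" using m by measurable
    show "norm (LINT y|lborel. cmod (F x y)) \<le> G x" for x using b[of x] by (subst real_norm_def, subst abs_of_nonneg) (auto intro: lint_nonneg)
  qed
  then show "L1 (\<lambda>x. LINT y|lborel. norm (case (x, y) of (x, y) \<Rightarrow> F x y))" by simp
  show "AE x in lborel. L1 (\<lambda>y. case (x, y) of (x, y) \<Rightarrow> F x y)" using i by simp
qed

lemma window_integrable:
  fixes a :: "real ^ 'd"
  assumes e: "\<epsilon> > 0"
  shows "L1 (\<lambda>y. window \<epsilon> (y - a))" "(LINT y|lborel. cmod (window \<epsilon> (y - a))) = (2 * pi * \<epsilon>) powr (CARD('d) / 2)"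
proof -
  have c: "1 / (2 * \<epsilon>) > 0" using e by simp
  have i: "L1 (\<lambda>y::real^'d. window \<epsilon> y)" unfolding window_def by (rule gauss_complex_integrable[OF c])
  show "L1 (\<lambda>y. window \<epsilon> (y - a))" using lborel_affine_integrable[OF i, of 1 "- a"] by (simp add: add.commute)
  have "(LINT y|lborel. cmod (window \<epsilon> (y - a))) = (LINT y|lborel. cmod (window \<epsilon> (y::real^'d)))"
    using lborel_affine_integral[of 1 "\<lambda>y. cmod (window \<epsilon> (y - a))" a] by simp
  also have "\<dots> = (2 * pi * \<epsilon>) powr (CARD('d) / 2)" using gauss_integral[OF c, where 'a="real^'d"] by (simp add: window_def mult_ac)
  finally show "(LINT y|lborel. cmod (window \<epsilon> (y - a))) = (2 * pi * \<epsilon>) powr (CARD('d) / 2)" .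
qed

lemma window_square_integrable:
  fixes a :: "real ^ 'd"
  assumes e: "\<epsilon> > 0"
  shows "L1 (\<lambda>y. (window \<epsilon> (a - y))^2)" "(LINT y|lborel. cmod ((window \<epsilon> (a - y))^2)) = (pi * \<epsilon>) powr (CARD('d) / 2)"
proof -
  have sw: "(window \<epsilon> (a - y))^2 = (window \<epsilon> (y - a))^2" for y using window_minus[of \<epsilon> "y - a"] by simp
  have eq: "(window \<epsilon> y)^2 = cr (gs (1 / \<epsilon>) y)" for y :: "real^'d" unfolding cmod_window_square[OF e, symmetric] by (simp add: window_def)
  have c: "1 / \<epsilon> > 0" using e by simp
  have i: "L1 (\<lambda>y::real^'d. (window \<epsilon> y)^2)" unfolding eq by (rule gauss_complex_integrable[OF c])
  show "L1 (\<lambda>y. (window \<epsilon> (a - y))^2)" using lborel_affine_integrable[OF i, of 1 "- a"] unfolding sw by (simp add: add.commute)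
  have "(LINT y|lborel. cmod ((window \<epsilon> (a - y))^2)) = (LINT y|lborel. cmod ((window \<epsilon> (y::real^'d))^2))"
    unfolding sw using lborel_affine_integral[of 1 "\<lambda>y. cmod ((window \<epsilon> (y - a))^2)" a] by simp
  also have "\<dots> = (pi * \<epsilon>) powr (CARD('d) / 2)" unfolding eq using gauss_integral[OF c, where 'a="real^'d"] by simp
  finally show "(LINT y|lborel. cmod ((window \<epsilon> (a - y))^2)) = (pi * \<epsilon>) powr (CARD('d) / 2)" .
qed

text \<open>Two approximations in succession: truncation makes the function Gaussian-bounded, and
  Gaussian-bounded functions are limits of inverse transforms.\<close>

lemma inv_fourier_dense_l2:
  fixes f :: "real ^ 'd \<Rightarrow> complex"
  assumes e: "\<epsilon> > 0" and f: "L2 f" and \<eta>: "\<eta> > 0"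
  shows "\<exists>h. gauss_bounded h \<and> l2norm (\<lambda>x. f x - invF \<epsilon> h x) \<le> \<eta>"
proof -
  note [measurable] = f[unfolded square_integrable_def, THEN conjunct1]
  obtain n where n: "l2norm (\<lambda>x. truncation n f x - f x) < \<eta> / 2"
    using order_tendstoD(2)[OF l2norm_truncation_tendsto[OF f], of "\<eta> / 2"] \<eta> by (auto simp: eventually_sequentially)
  have t: "gauss_bounded (truncation n f)" by (rule gauss_bounded_truncation) measurable
  obtain k where k: "\<And>n. gauss_bounded (k n)" and "\<And>m. l2norm (k m) \<le> l2norm (truncation n f)"
    and lim: "(\<lambda>m. l2norm (\<lambda>x. invF \<epsilon> (k m) x - truncation n f x)) \<longlonglongrightarrow> 0" using inv_fourier_dense[OF e t] by blast
  obtain m where m: "l2norm (\<lambda>x. invF \<epsilon> (k m) x - truncation n f x) < \<eta> / 2"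
    using order_tendstoD(2)[OF lim, of "\<eta> / 2"] \<eta> by (auto simp: eventually_sequentially)
  let ?a = "\<lambda>x. truncation n f x - f x" and ?b = "\<lambda>x. invF \<epsilon> (k m) x - truncation n f x"
  have "l2norm (\<lambda>x. f x - invF \<epsilon> (k m) x) = l2norm (\<lambda>x. ?a x + ?b x)" by (rule l2norm_cong) (simp add: norm_minus_commute)
  also have "\<dots> \<le> l2norm ?a + l2norm ?b" by (intro l2norm_triangle square_integrable_diff square_integrable_truncation f inv_fourier_square_integrable e k)
  finally show ?thesis using n m k by (intro exI[of _ "k m"]) auto
qed

text \<open>The shear \<open>(q, p) \<mapsto> (q + g p, p)\<close> is the flow of a kinetic energy: \<open>g\<close> is the velocity integrated
  along the (explicit) momentum trajectory.\<close>

lemma packet_form_integrable: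
  fixes u :: "real ^ 'd \<Rightarrow> complex" and g :: "real ^ 'd \<Rightarrow> real ^ 'd"
  assumes e: "\<epsilon> > 0" and u: "L2 u" and g: "g \<in> Borel"
    and w: "L2 w" and \<rho>: "\<rho> \<in> Borel" "\<And>z. cmod (\<rho> z) \<le> B"
  shows "L1 (\<lambda>z. \<rho> z * (cnj (packet \<epsilon> u (fst z + g (snd z)) (snd z)) * w z))"
  using integrable_mult_bounded_left[OF integrable_cnj_mult[OF packet_shift_l2(1)[OF e u g] w], of \<rho> B] \<rho> by (simp add: mult_ac)

lemma packet_form_bound:
  fixes u :: "real ^ 'd \<Rightarrow> complex" and g :: "real ^ 'd \<Rightarrow> real ^ 'd"
  assumes e: "\<epsilon> > 0" and u: "L2 u" and g: "g \<in> Borel"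
    and w: "L2 w" and \<rho>: "\<rho> \<in> Borel" "\<And>z. cmod (\<rho> z) \<le> B"
  shows "cmod (LINT z|lborel. \<rho> z * (cnj (packet \<epsilon> u (fst z + g (snd z)) (snd z)) * w z)) \<le> B * (packet_const TYPE('d) \<epsilon> * l2norm u) * l2norm w"
proof -
  let ?A = "\<lambda>z. packet \<epsilon> u (fst z + g (snd z)) (snd z)"
  have B: "B \<ge> 0" using \<rho>(2)[of undefined] norm_ge_zero order_trans by blast
  have "cmod (LINT z|lborel. \<rho> z * (cnj (?A z) * w z)) \<le> (LINT z|lborel. B * (cmod (?A z) * cmod (w z)))"
  proof (rule lint_norm_bound[OF packet_form_integrable[OF assms]])
    show "L1 (\<lambda>z. B * (cmod (?A z) * cmod (w z)))" by (intro integrable_mult_right integrable_norm_mult packet_shift_l2(1)[OF e u g] w)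
    show "norm (\<rho> z * (cnj (?A z) * w z)) \<le> B * (cmod (?A z) * cmod (w z))" for z using mult_right_mono[OF \<rho>(2)[of z], of "cmod (?A z) * cmod (w z)"] by (simp add: norm_mult)
  qed
  also have "\<dots> = B * (LINT z|lborel. cmod (?A z) * cmod (w z))" by (simp only: integral_mult_right_zero)
  also have "\<dots> \<le> B * (l2norm ?A * l2norm w)" by (intro mult_left_mono cauchy_schwarz_norm packet_shift_l2(1)[OF e u g] w B)
  also have "\<dots> \<le> B * ((packet_const TYPE('d) \<epsilon> * l2norm u) * l2norm w)" by (intro mult_left_mono mult_right_mono packet_shift_l2(2)[OF e u g] B l2norm_nonneg)
  finally show ?thesis by (simp add: mult_ac)
qed

section \<open>The Fourier multiplier represented by a sheared packet form\<close>

definition packet_symbol :: "real \<Rightarrow> (real ^ 'd \<Rightarrow> complex) \<Rightarrow> (real ^ 'd \<Rightarrow> real ^ 'd) \<Rightarrow> real ^ 'd \<Rightarrow> complex" where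
  "packet_symbol \<epsilon> \<beta> g \<xi> = cr ((2 * pi * \<epsilon>) powr CARD('d)) *
     (LINT p|lborel. \<beta> p * (miexp (g p \<bullet> (\<xi> - p) / \<epsilon>) * (window \<epsilon> (\<xi> - p))^2))"

lemma packet_symbol_measurable [measurable]:
  assumes [measurable]: "\<beta> \<in> Borel" "g \<in> Borel"
  shows "packet_symbol \<epsilon> \<beta> g \<in> Borel" unfolding packet_symbol_def by measurable

lemma packet_symbol_kernel:
  fixes \<beta> :: "real ^ 'd \<Rightarrow> complex"
  assumes e: "\<epsilon> > 0" and m: "\<beta> \<in> Borel" "g \<in> Borel" and B: "\<And>p. cmod (\<beta> p) \<le> B"
  shows "L1 (\<lambda>p. \<beta> p * (miexp (g p \<bullet> (\<xi> - p) / \<epsilon>) * (window \<epsilon> (\<xi> - p))^2))"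
    and "(LINT p|lborel. cmod (\<beta> p * (miexp (g p \<bullet> (\<xi> - p) / \<epsilon>) * (window \<epsilon> (\<xi> - p))^2))) \<le> B * (pi * \<epsilon>) powr (CARD('d) / 2)"
proof -
  note [measurable] = m
  let ?F = "\<lambda>p. \<beta> p * (miexp (g p \<bullet> (\<xi> - p) / \<epsilon>) * (window \<epsilon> (\<xi> - p))^2)"
  have le: "cmod (?F p) \<le> B * cmod ((window \<epsilon> (\<xi> - p))^2)" for p using mult_right_mono[OF B[of p], of "cmod ((window \<epsilon> (\<xi> - p))^2)"] by (simp add: norm_mult)
  have wi: "L1 (\<lambda>p. B * cmod ((window \<epsilon> (\<xi> - p))^2))" using window_square_integrable(1)[OF e] by (intro integrable_mult_right integrable_norm)
  show i: "L1 ?F" by (rule integrable_real_bound[OF wi _ le]) measurable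
  have "(LINT p|lborel. cmod (?F p)) \<le> (LINT p|lborel. B * cmod ((window \<epsilon> (\<xi> - p))^2))" by (intro lint_mono integrable_norm i wi le)
  then show "(LINT p|lborel. cmod (?F p)) \<le> B * (pi * \<epsilon>) powr (CARD('d) / 2)" by (simp only: integral_mult_right_zero window_square_integrable(2)[OF e])
qed

lemma packet_symbol_bound:
  fixes \<beta> :: "real ^ 'd \<Rightarrow> complex"
  assumes "\<epsilon> > 0" "\<beta> \<in> Borel" "g \<in> Borel" "\<And>p. cmod (\<beta> p) \<le> B"
  shows "cmod (packet_symbol \<epsilon> \<beta> g \<xi>) \<le> (2 * pi * \<epsilon>) powr CARD('d) * (B * (pi * \<epsilon>) powr (CARD('d) / 2))"
  unfolding packet_symbol_def norm_mult norm_of_real abs_of_nonneg[OF powr_ge_zero] by (intro mult_left_mono order_trans[OF integral_norm_bound packet_symbol_kernel(2)[OF assms]]) auto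

text \<open>Integrating over the position first makes the fibrewise Plancherel identity available.
  The second exchange, of \<open>p\<close> and \<open>\<xi>\<close>, is justified by the squared
  window, whose integral over \<open>p\<close> does not depend on \<open>\<xi>\<close>, and by
  integrability of \<open>cnj (k \<xi>) * h \<xi>\<close>.\<close>

lemma packet_form_inv_fourier:
  fixes h k \<beta> :: "real ^ 'd \<Rightarrow> complex"
  assumes e: "\<epsilon> > 0" and h: "gauss_bounded h" and k: "gauss_bounded k"
    and \<beta>: "\<beta> \<in> Borel" "\<And>p. cmod (\<beta> p) \<le> B" and g: "g \<in> Borel"
  shows "(LINT z|lborel. \<beta> (snd z) * (cnj (packet \<epsilon> (invF \<epsilon> k) (fst z + g (snd z)) (snd z)) * packet \<epsilon> (invF \<epsilon> h) (fst z) (snd z)))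
    = l2inner (\<lambda>\<xi>. cnj (packet_symbol \<epsilon> \<beta> g \<xi>) * k \<xi>) h"
proof -
  note [measurable] = \<beta>(1) g gauss_bounded_measurable[OF h] gauss_bounded_measurable[OF k]
  let ?A = "\<lambda>q p. cnj (packet \<epsilon> (invF \<epsilon> k) (q + g p) p) * packet \<epsilon> (invF \<epsilon> h) q p"
  let ?E = "\<lambda>\<xi> p. \<beta> p * (miexp (g p \<bullet> (\<xi> - p) / \<epsilon>) * (window \<epsilon> (\<xi> - p))^2)"
  let ?\<kappa> = "\<lambda>\<xi>. cnj (k \<xi>) * h \<xi>"
  define c where "c = cr ((2 * pi * \<epsilon>) powr CARD('d))"
  have si: "L2 (invF \<epsilon> h)" "L2 (invF \<epsilon> k)" using h k by (auto intro: inv_fourier_square_integrable[OF e])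
  have \<kappa>: "L1 ?\<kappa>" by (intro integrable_cnj_mult gauss_bounded_square_integrable h k)
  have \<beta>': "(\<lambda>z :: (real^'d) \<times> (real^'d). \<beta> (snd z)) \<in> Borel" by measurable
  have I: "integrable lborel2 (\<lambda>(q, p). \<beta> p * ?A q p)" using packet_form_integrable[OF e si(2) g packet_l2(1)[OF e si(1)] \<beta>' \<beta>(2)]
    by (simp add: lborel_prod case_prod_unfold)
  have "(LINT z|lborel. \<beta> (snd z) * ?A (fst z) (snd z)) = (LINT p|lborel. LINT q|lborel. \<beta> p * ?A q p)"
    unfolding lborel_pair.integral_snd[OF I] by (simp add: lborel_prod case_prod_unfold)
  also have "\<dots> = (LINT p|lborel. \<beta> p * (LINT q|lborel. ?A q p))" by (simp only: integral_mult_right_zero)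
  also have "\<dots> = (LINT p|lborel. c * (LINT \<xi>|lborel. ?E \<xi> p * ?\<kappa> \<xi>))"
  proof (rule lint_cong)
    fix p :: "real ^ 'd"
    have "\<beta> p * (LINT q|lborel. ?A q p) = c * (\<beta> p * (LINT \<xi>|lborel. miexp (g p \<bullet> (\<xi> - p) / \<epsilon>) * (window \<epsilon> (\<xi> - p))^2 * ?\<kappa> \<xi>))"
      unfolding packet_fibre_inner[OF e h k] c_def by (rule mult.left_commute)
    also have "\<beta> p * (LINT \<xi>|lborel. miexp (g p \<bullet> (\<xi> - p) / \<epsilon>) * (window \<epsilon> (\<xi> - p))^2 * ?\<kappa> \<xi>) = (LINT \<xi>|lborel. ?E \<xi> p * ?\<kappa> \<xi>)"
      by (simp only: integral_mult_right_zero[symmetric] mult.assoc)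
    finally show "\<beta> p * (LINT q|lborel. ?A q p) = c * (LINT \<xi>|lborel. ?E \<xi> p * ?\<kappa> \<xi>)" .
  qed
  also have "\<dots> = c * (LINT p|lborel. LINT \<xi>|lborel. ?E \<xi> p * ?\<kappa> \<xi>)" by (simp only: integral_mult_right_zero)
  also have "(LINT p|lborel. LINT \<xi>|lborel. ?E \<xi> p * ?\<kappa> \<xi>) = (LINT \<xi>|lborel. LINT p|lborel. ?E \<xi> p * ?\<kappa> \<xi>)"
  proof (rule lborel_pair.Fubini_integral, rule integrable_pair_iterated[where G="\<lambda>\<xi>. B * (pi * \<epsilon>) powr (CARD('d) / 2) * cmod (?\<kappa> \<xi>)"])
    show "(\<lambda>(\<xi>, p). ?E \<xi> p * ?\<kappa> \<xi>) \<in> borel_measurable lborel2" by measurable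
    show "L1 (\<lambda>p. ?E \<xi> p * ?\<kappa> \<xi>)" for \<xi> by (intro integrable_mult_left packet_symbol_kernel(1)[OF e \<beta>(1) g \<beta>(2)])
    show "(LINT p|lborel. cmod (?E \<xi> p * ?\<kappa> \<xi>)) \<le> B * (pi * \<epsilon>) powr (CARD('d) / 2) * cmod (?\<kappa> \<xi>)" for \<xi>
    proof -
      have "(LINT p|lborel. cmod (?E \<xi> p * ?\<kappa> \<xi>)) = (LINT p|lborel. cmod (?E \<xi> p)) * cmod (?\<kappa> \<xi>)"
        unfolding norm_mult[of "?E \<xi> _"] by (simp only: integral_mult_left_zero)
      then show ?thesis using mult_right_mono[OF packet_symbol_kernel(2)[OF e \<beta>(1) g \<beta>(2), of \<xi>], of "cmod (?\<kappa> \<xi>)"] by simp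
    qed
    show "L1 (\<lambda>\<xi>. B * (pi * \<epsilon>) powr (CARD('d) / 2) * cmod (?\<kappa> \<xi>))" using \<kappa> by (intro integrable_mult_right integrable_norm)
  qed
  also have "\<dots> = (LINT \<xi>|lborel. (LINT p|lborel. ?E \<xi> p) * ?\<kappa> \<xi>)" by (simp only: integral_mult_left_zero)
  also have "c * \<dots> = (LINT \<xi>|lborel. packet_symbol \<epsilon> \<beta> g \<xi> * ?\<kappa> \<xi>)"
    unfolding packet_symbol_def c_def[symmetric] mult.assoc[of c] by (simp only: integral_mult_right_zero)
  finally show ?thesis unfolding l2inner_def by (simp add: mult_ac)
qed

text \<open>Both sides are continuous in \<open>f\<close>, with joint constant \<open>K\<close>, and
  they agree when \<open>f\<close> is the inverse transform of a Gaussian-bounded symbol. Such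
  functions are dense, so the identity extends to all of L2.\<close>

lemma packet_form_eq:
  fixes f k \<beta> :: "real ^ 'd \<Rightarrow> complex"
  assumes e: "\<epsilon> > 0" and f: "L2 f" and k: "gauss_bounded k"
    and \<beta>: "\<beta> \<in> Borel" "\<And>p. cmod (\<beta> p) \<le> B" and g: "g \<in> Borel"
  shows "(LINT z|lborel. \<beta> (snd z) * (cnj (packet \<epsilon> (invF \<epsilon> k) (fst z + g (snd z)) (snd z)) * packet \<epsilon> f (fst z) (snd z)))
    = l2inner (invF \<epsilon> (\<lambda>\<xi>. cnj (packet_symbol \<epsilon> \<beta> g \<xi>) * k \<xi>)) f"
proof -
  note [measurable] = \<beta>(1) g
  let ?k = "invF \<epsilon> k"
  define L where "L f = (LINT z|lborel. \<beta> (snd z) * (cnj (packet \<epsilon> ?k (fst z + g (snd z)) (snd z)) * packet \<epsilon> f (fst z) (snd z)))" for f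
  define r where "r = invF \<epsilon> (\<lambda>\<xi>. cnj (packet_symbol \<epsilon> \<beta> g \<xi>) * k \<xi>)"
  have gbr: "gauss_bounded (\<lambda>\<xi>. cnj (packet_symbol \<epsilon> \<beta> g \<xi>) * k \<xi>)"
    by (rule gauss_bounded_mult_bounded[OF k, where K="(2 * pi * \<epsilon>) powr CARD('d) * (B * (pi * \<epsilon>) powr (CARD('d) / 2))"])
      (use packet_symbol_bound[OF e \<beta>(1) g \<beta>(2)] in simp_all)
  have r: "L2 r" unfolding r_def by (rule inv_fourier_square_integrable[OF e gbr])
  have ksi: "L2 ?k" by (rule inv_fourier_square_integrable[OF e k])
  have \<beta>': "(\<lambda>z :: (real^'d) \<times> (real^'d). \<beta> (snd z)) \<in> Borel" "\<And>z :: (real^'d) \<times> (real^'d). cmod (\<beta> (snd z)) \<le> B"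
    using \<beta>(2) by measurable
  define K where "K = B * (packet_const TYPE('d) \<epsilon> * l2norm ?k) * packet_const TYPE('d) \<epsilon> + l2norm r"
  have B: "B \<ge> 0" using \<beta>(2)[of undefined] norm_ge_zero order_trans by blast
  have pc: "packet_const TYPE('d) \<epsilon> \<ge> 0" by (simp add: packet_const_def)
  have K: "K \<ge> 0" unfolding K_def using B pc by (intro add_nonneg_nonneg mult_nonneg_nonneg l2norm_nonneg)
  have small: "cmod (L f - l2inner r f) \<le> K * \<eta>" if \<eta>: "\<eta> > 0" for \<eta>
  proof -
    obtain h where h: "gauss_bounded h" "l2norm (\<lambda>x. f x - invF \<epsilon> h x) \<le> \<eta>" using inv_fourier_dense_l2[OF e f \<eta>] by blast
    let ?h = "invF \<epsilon> h" and ?D = "\<lambda>x. f x - invF \<epsilon> h x"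
    have hsi: "L2 ?h" by (rule inv_fourier_square_integrable[OF e h(1)])
    have Dsi: "L2 ?D" by (rule square_integrable_diff[OF f hsi])
    have Lh: "L ?h = l2inner r ?h" unfolding L_def r_def packet_form_inv_fourier[OF e h(1) k \<beta> g] by (rule l2inner_inv_fourier_inv_fourier[OF e gbr h(1), symmetric])
    have "L ?D = L f - L ?h" unfolding L_def packet_diff[OF e f hsi] right_diff_distrib
      by (rule lint_diff) (rule packet_form_integrable[OF e ksi g _ \<beta>'], rule packet_l2[OF e] , rule f hsi)+
    moreover have "l2inner r ?D = l2inner r f - l2inner r ?h" by (rule l2inner_diff_right[OF r f hsi])
    ultimately have "L f - l2inner r f = L ?D - l2inner r ?D" using Lh by simp
    then have "cmod (L f - l2inner r f) \<le> cmod (L ?D) + cmod (l2inner r ?D)" by (metis norm_triangle_ineq4)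
    also have "\<dots> \<le> B * (packet_const TYPE('d) \<epsilon> * l2norm ?k) * (packet_const TYPE('d) \<epsilon> * \<eta>) + l2norm r * \<eta>"
    proof (rule add_mono)
      have "cmod (L ?D) \<le> B * (packet_const TYPE('d) \<epsilon> * l2norm ?k) * l2norm (\<lambda>z. packet \<epsilon> ?D (fst z) (snd z))"
        unfolding L_def by (rule packet_form_bound[OF e ksi g packet_l2(1)[OF e Dsi] \<beta>'])
      also have "\<dots> \<le> B * (packet_const TYPE('d) \<epsilon> * l2norm ?k) * (packet_const TYPE('d) \<epsilon> * \<eta>)"
        using packet_l2(2)[OF e Dsi] mult_left_mono[OF h(2) pc] B pc by (intro mult_left_mono mult_nonneg_nonneg l2norm_nonneg) auto
      finally show "cmod (L ?D) \<le> B * (packet_const TYPE('d) \<epsilon> * l2norm ?k) * (packet_const TYPE('d) \<epsilon> * \<eta>)" .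
      show "cmod (l2inner r ?D) \<le> l2norm r * \<eta>" using l2inner_bound[OF r Dsi] mult_left_mono[OF h(2) l2norm_nonneg[of r]] by linarith
    qed
    also have "\<dots> = K * \<eta>" by (simp add: K_def algebra_simps)
    finally show ?thesis .
  qed
  have "cmod (L f - l2inner r f) \<le> 0"
  proof (rule field_le_epsilon)
    fix x :: real assume x: "x > 0"
    \<comment> \<open>Dividing by \<open>K + 1\<close> instead of \<open>K\<close> keeps the
      argument valid when \<open>K\<close> is 0.\<close>
    have "cmod (L f - l2inner r f) \<le> K * (x / (K + 1))" by (rule small) (use x K in simp)
    also have "\<dots> \<le> x" using x K by (simp add: field_simps)
    finally show "cmod (L f - l2inner r f) \<le> 0 + x" by simp
  qed
  then show ?thesis unfolding L_def r_def by simp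
qed

section \<open>Superpositions of wave packets\<close>

definition synth ::
    "real \<Rightarrow> ((real ^ 'd) \<times> (real ^ 'd) \<Rightarrow> complex) \<Rightarrow> (real ^ 'd \<Rightarrow> real ^ 'd) \<Rightarrow> (real ^ 'd \<Rightarrow> complex) \<Rightarrow> real ^ 'd \<Rightarrow> complex" where
  "synth \<epsilon> \<rho> g f x = (LINT z|lborel. \<rho> z * packet \<epsilon> f (fst z) (snd z) *
     (iexp (snd z \<bullet> x / \<epsilon>) * window \<epsilon> (x - (fst z + g (snd z)))))"

context
  fixes \<epsilon> :: real and \<rho> :: "(real ^ 'd) \<times> (real ^ 'd) \<Rightarrow> complex" and g :: "real ^ 'd \<Rightarrow> real ^ 'd" and f :: "real ^ 'd \<Rightarrow> complex"
  assumes e: "\<epsilon> > 0" and \<rho>: "L1 \<rho>" and g: "g \<in> Borel" and f: "L2 f"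
begin

private lemma measurability: "\<rho> \<in> Borel" "f \<in> Borel" using \<rho> f by (auto simp: square_integrable_def)

private abbreviation (input) "atom z x \<equiv> iexp (snd z \<bullet> x / \<epsilon>) * window \<epsilon> (x - (fst z + g (snd z)))"

text \<open>Integrability of the weight over phase space makes the superposition absolutely
  convergent, as packets are bounded and the windows have a fixed integral. In the application the
  weight contains the cutoff and so has bounded support.\<close>

lemma synth_pair_integrable:
  fixes u :: "real ^ 'd \<Rightarrow> complex"
  assumes u: "u \<in> Borel" "\<And>x. cmod (u x) \<le> U"
  shows "integrable lborel2 (\<lambda>(z, x). \<rho> z * packet \<epsilon> f (fst z) (snd z) * (u x * atom z x))"
proof (rule integrable_pair_iterated)
  note [measurable] = measurability u(1) g
  let ?M = "(pi * \<epsilon>) powr (CARD('d) / 4) * l2norm f"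
  have U: "U \<ge> 0" using u(2)[of undefined] norm_ge_zero order_trans by blast
  show "(\<lambda>(z, x). \<rho> z * packet \<epsilon> f (fst z) (snd z) * (u x * atom z x)) \<in> borel_measurable lborel2" by measurable
  have le: "cmod (u x * atom z x) \<le> U * cmod (window \<epsilon> (x - (fst z + g (snd z))))" for x z using mult_right_mono[OF u(2)[of x]] by (simp add: norm_mult)
  have wi: "L1 (\<lambda>x. U * cmod (window \<epsilon> (x - (fst z + g (snd z)))))" for z by (intro integrable_mult_right integrable_norm window_integrable(1)[OF e])
  have i: "L1 (\<lambda>x. u x * atom z x)" for z by (rule integrable_real_bound[OF wi _ le]) measurable
  then show "L1 (\<lambda>x. \<rho> z * packet \<epsilon> f (fst z) (snd z) * (u x * atom z x))" for z by (rule integrable_mult_right)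
  show "(LINT x|lborel. cmod (\<rho> z * packet \<epsilon> f (fst z) (snd z) * (u x * atom z x))) \<le> cmod (\<rho> z) * (?M * (U * (2 * pi * \<epsilon>) powr (CARD('d) / 2)))" for z
  proof -
    have "(LINT x|lborel. cmod (\<rho> z * packet \<epsilon> f (fst z) (snd z) * (u x * atom z x))) = cmod (\<rho> z) * (cmod (packet \<epsilon> f (fst z) (snd z)) * (LINT x|lborel. cmod (u x * atom z x)))"
      unfolding norm_mult[of "\<rho> z * packet \<epsilon> f (fst z) (snd z)"] norm_mult[of "\<rho> z"] by (simp only: integral_mult_right_zero mult.assoc)
    also have "\<dots> \<le> cmod (\<rho> z) * (?M * (U * (2 * pi * \<epsilon>) powr (CARD('d) / 2)))"
    proof (rule mult_left_mono, rule mult_mono)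
      show "cmod (packet \<epsilon> f (fst z) (snd z)) \<le> ?M" by (rule packet_bound[OF e f])
      have "(LINT x|lborel. cmod (u x * atom z x)) \<le> (LINT x|lborel. U * cmod (window \<epsilon> (x - (fst z + g (snd z)))))" by (intro lint_mono integrable_norm i wi le)
      then show "(LINT x|lborel. cmod (u x * atom z x)) \<le> U * (2 * pi * \<epsilon>) powr (CARD('d) / 2)" by (simp only: integral_mult_right_zero window_integrable(2)[OF e])
    qed (auto intro: lint_nonneg)
    finally show ?thesis .
  qed
  show "L1 (\<lambda>z. cmod (\<rho> z) * (?M * (U * (2 * pi * \<epsilon>) powr (CARD('d) / 2))))" by (intro integrable_mult_left integrable_norm \<rho>)
qed

text \<open>The superposition is integrable by Fubini and bounded by \<open>K\<close>; the two
  together give square integrability.\<close>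

lemma synth_square_integrable: "L2 (synth \<epsilon> \<rho> g f)"
proof -
  note [measurable] = measurability g
  let ?M = "(pi * \<epsilon>) powr (CARD('d) / 4) * l2norm f"
  have m [measurable]: "synth \<epsilon> \<rho> g f \<in> Borel" unfolding synth_def by measurable
  have i: "L1 (synth \<epsilon> \<rho> g f)" using lborel_pair.integrable_snd[OF synth_pair_integrable[of "\<lambda>_. 1" 1]] by (simp add: synth_def[abs_def])
  have i2: "L1 (\<lambda>z. cmod (\<rho> z) * ?M)" by (intro integrable_mult_left integrable_norm \<rho>)
  define K where "K = (LINT z|lborel. cmod (\<rho> z) * ?M)"
  have b: "cmod (synth \<epsilon> \<rho> g f x) \<le> K" for x
  proof -
    have le: "cmod (\<rho> z * packet \<epsilon> f (fst z) (snd z) * atom z x) \<le> cmod (\<rho> z) * ?M" for z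
    proof -
      have "cmod (\<rho> z * packet \<epsilon> f (fst z) (snd z) * atom z x) = cmod (\<rho> z) * (cmod (packet \<epsilon> f (fst z) (snd z)) * cmod (window \<epsilon> (x - (fst z + g (snd z)))))"
        by (simp add: norm_mult)
      also have "\<dots> \<le> cmod (\<rho> z) * (?M * 1)" by (rule mult_left_mono, rule mult_mono) (auto intro: packet_bound[OF e f] cmod_window_le_1[OF e])
      finally show ?thesis by simp
    qed
    have "L1 (\<lambda>z. \<rho> z * packet \<epsilon> f (fst z) (snd z) * atom z x)" by (rule integrable_real_bound[OF i2 _ le]) measurable
    then show ?thesis unfolding synth_def K_def by (rule lint_norm_bound[OF _ i2 le])
  qed
  show ?thesis unfolding square_integrable_def
  proof
    show "L1 (\<lambda>x. (cmod (synth \<epsilon> \<rho> g f x))^2)"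
    proof (rule integrable_real_bound[of _ "\<lambda>x. K * cmod (synth \<epsilon> \<rho> g f x)"])
      show "L1 (\<lambda>x. K * cmod (synth \<epsilon> \<rho> g f x))" using i by (intro integrable_mult_right integrable_norm)
      show "norm ((cmod (synth \<epsilon> \<rho> g f x))^2) \<le> K * cmod (synth \<epsilon> \<rho> g f x)" for x
        using mult_right_mono[OF b[of x], of "cmod (synth \<epsilon> \<rho> g f x)"] by (simp add: power2_eq_square)
    qed measurable
  qed measurable
qed

text \<open>Fubini moves the atoms onto the test function, where they assemble its packet at the
  transported point. This puts the superposition into the shape of the packet form already
  identified with a multiplier.\<close>

lemma l2inner_synth:
  fixes u :: "real ^ 'd \<Rightarrow> complex"
  assumes u: "u \<in> Borel" "\<And>x. cmod (u x) \<le> U"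
  shows "l2inner u (synth \<epsilon> \<rho> g f) = (LINT z|lborel. \<rho> z * (cnj (packet \<epsilon> u (fst z + g (snd z)) (snd z)) * packet \<epsilon> f (fst z) (snd z)))"
proof -
  note [measurable] = measurability g u(1)
  have I: "integrable lborel2 (\<lambda>(z, x). \<rho> z * packet \<epsilon> f (fst z) (snd z) * (cnj (u x) * atom z x))"
    by (rule synth_pair_integrable[of "\<lambda>x. cnj (u x)" U]) (use u(2) in simp_all)
  have "l2inner u (synth \<epsilon> \<rho> g f) = (LINT x|lborel. LINT z|lborel. \<rho> z * packet \<epsilon> f (fst z) (snd z) * (cnj (u x) * atom z x))"
    unfolding l2inner_def synth_def integral_mult_right_zero[symmetric] by (simp only: mult.left_commute)
  also have "\<dots> = (LINT z|lborel. LINT x|lborel. \<rho> z * packet \<epsilon> f (fst z) (snd z) * (cnj (u x) * atom z x))" by (rule lborel_pair.Fubini_integral[OF I])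
  also have "\<dots> = (LINT z|lborel. \<rho> z * packet \<epsilon> f (fst z) (snd z) * (LINT x|lborel. cnj (u x) * atom z x))" by (simp only: integral_mult_right_zero)
  also have "\<dots> = (LINT z|lborel. \<rho> z * (cnj (packet \<epsilon> u (fst z + g (snd z)) (snd z)) * packet \<epsilon> f (fst z) (snd z)))"
  proof (rule lint_cong)
    fix z :: "(real ^ 'd) \<times> (real ^ 'd)"
    have "cnj (packet \<epsilon> u (fst z + g (snd z)) (snd z)) = (LINT x|lborel. cnj (u x) * atom z x)" unfolding packet_def lint_cnj[symmetric] by (simp add: exp_cnj mult_ac)
    then show "\<rho> z * packet \<epsilon> f (fst z) (snd z) * (LINT x|lborel. cnj (u x) * atom z x)
      = \<rho> z * (cnj (packet \<epsilon> u (fst z + g (snd z)) (snd z)) * packet \<epsilon> f (fst z) (snd z))" by (simp only: mult_ac)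
  qed
  finally show ?thesis .
qed

text \<open>The approximation is defined by one integral over \<open>(y, q, p)\<close>. Absolute
  convergence allows \<open>y\<close> to be integrated first, which collects the packet of the
  initial datum.\<close>

lemma synth_eq_triple_integral:
  "(LINT (y, q, p)|lborel. \<rho> (q, p) * atom (q, p) x * (miexp (p \<bullet> y / \<epsilon>) * window \<epsilon> (y - q) * f y)) = synth \<epsilon> \<rho> g f x"
proof -
  note [measurable] = measurability g
  let ?M = "(pi * \<epsilon>) powr (CARD('d) / 4) * l2norm f"
  let ?w = "\<lambda>z y. miexp (snd z \<bullet> y / \<epsilon>) * window \<epsilon> (y - fst z) * f y"
  have I: "integrable lborel2 (\<lambda>(z, y). \<rho> z * atom z x * ?w z y)"
  proof (rule integrable_pair_iterated)
    show "(\<lambda>(z, y). \<rho> z * atom z x * ?w z y) \<in> borel_measurable lborel2" by measurable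
    show "L1 (\<lambda>y. \<rho> z * atom z x * ?w z y)" for z by (intro integrable_mult_right packet_integrable[OF e f])
    show "(LINT y|lborel. cmod (\<rho> z * atom z x * ?w z y)) \<le> cmod (\<rho> z) * ?M" for z
    proof -
      have "(LINT y|lborel. cmod (\<rho> z * atom z x * ?w z y)) = cmod (\<rho> z * atom z x) * (LINT y|lborel. cmod (?w z y))"
        unfolding norm_mult[of "\<rho> z * atom z x"] by (simp only: integral_mult_right_zero)
      also have "\<dots> \<le> cmod (\<rho> z) * ?M"
      proof (rule mult_mono)
        show "cmod (\<rho> z * atom z x) \<le> cmod (\<rho> z)" using mult_left_mono[OF cmod_window_le_1[OF e, of "x - (fst z + g (snd z))"], of "cmod (\<rho> z)"] by (simp add: norm_mult)
        show "(LINT y|lborel. cmod (?w z y)) \<le> ?M" by (rule packet_abs_bound[OF e f])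
      qed (auto intro: lint_nonneg)
      finally show ?thesis .
    qed
    show "L1 (\<lambda>z. cmod (\<rho> z) * ?M)" by (intro integrable_mult_left integrable_norm \<rho>)
  qed
  have I2: "integrable lborel2 (\<lambda>(y, z). \<rho> z * atom z x * ?w z y)" using lborel_pair.integrable_product_swap[OF I] by (simp add: case_prod_unfold)
  have "(LINT (y, q, p)|lborel. \<rho> (q, p) * atom (q, p) x * (miexp (p \<bullet> y / \<epsilon>) * window \<epsilon> (y - q) * f y))
     = integral\<^sup>L lborel2 (\<lambda>(y, z). \<rho> z * atom z x * ?w z y)" unfolding lborel_prod by (simp add: case_prod_unfold)
  also have "\<dots> = (LINT z|lborel. LINT y|lborel. \<rho> z * atom z x * ?w z y)" by (rule lborel_pair.integral_snd[OF I2, symmetric])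
  also have "\<dots> = (LINT z|lborel. \<rho> z * atom z x * packet \<epsilon> f (fst z) (snd z))" unfolding packet_def by (simp only: integral_mult_right_zero)
  finally show ?thesis unfolding synth_def by (simp only: mult_ac)
qed

end

section \<open>The error of the frozen Gaussian approximation\<close>

text \<open>Writing the cutoff as 1 minus \<open>1 - chi\<close> separates an exact Fourier
  multiplier from a term that lives off \<open>X\<close>. In that term the packet of the datum may
  be restricted to the complement of \<open>X\<close>; the restriction is \<open>w\<close>, whose
  norm is the FBI tail up to the factor \<open>\<kappa>\<close>.\<close>

lemma synth_pairing_error:
  fixes k \<phi> \<beta> :: "real ^ 'd \<Rightarrow> complex" and chi :: "(real ^ 'd) \<times> (real ^ 'd) \<Rightarrow> real"
  assumes e: "\<epsilon> > 0" and \<phi>: "L2 \<phi>" and k: "gauss_bounded k"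
    and \<beta>: "\<beta> \<in> Borel" "\<And>p. cmod (\<beta> p) \<le> B" and g: "g \<in> Borel"
    and chi: "chi \<in> Borel" "\<And>z. 0 \<le> chi z" "\<And>z. chi z \<le> 1" "\<And>z. z \<in> X \<Longrightarrow> chi z = 1"
    and X: "X \<in> sets borel"
    and \<rho>: "L1 (\<lambda>z. cr (chi z) * \<beta> (snd z))"
  defines "c \<equiv> cr ((2 * pi * \<epsilon>) powr (- (3 * CARD('d) / 2)))"
  shows "cmod (l2inner (invF \<epsilon> k) (\<lambda>x. c * synth \<epsilon> (\<lambda>z. cr (chi z) * \<beta> (snd z)) g \<phi> x)
      - l2inner (invF \<epsilon> (\<lambda>\<xi>. cnj (c * packet_symbol \<epsilon> \<beta> g \<xi>) * k \<xi>)) \<phi>)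
    \<le> B * l2norm k * sqrt (LINT z:(- X)|lborel. (cmod (fbi \<epsilon> \<phi> (fst z) (snd z)))^2)"
proof -
  note [measurable] = \<beta>(1) g chi(1) X
  let ?\<rho> = "\<lambda>z. cr (chi z) * \<beta> (snd z)"
  let ?A = "\<lambda>z. packet \<epsilon> (invF \<epsilon> k) (fst z + g (snd z)) (snd z)"
  let ?\<Phi> = "\<lambda>z. packet \<epsilon> \<phi> (fst z) (snd z)"
  define w where "w z = cr (indicator (- X) z) * ?\<Phi> z" for z
  define E where "E = (LINT z:(- X)|lborel. (cmod (fbi \<epsilon> \<phi> (fst z) (snd z)))^2)"
  define d where "d = real CARD('d)"
  define \<kappa> where "\<kappa> = 2 powr (d / 2) * (pi * \<epsilon>) powr (3 * d / 4)"
  have ksi: "L2 (invF \<epsilon> k)" by (rule inv_fourier_square_integrable[OF e k])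
  have B: "B \<ge> 0" using \<beta>(2)[of undefined] norm_ge_zero order_trans by blast
  have \<Phi>: "L2 ?\<Phi>" by (rule packet_l2(1)[OF e \<phi>])
  have \<beta>': "(\<lambda>z :: (real^'d) \<times> (real^'d). \<beta> (snd z)) \<in> Borel" by measurable
  have wsi: "L2 w" unfolding w_def by (rule square_integrable_mult_bounded[OF \<Phi>, of _ 1]) (auto simp: indicator_def)
  let ?r = "\<lambda>z. cr (1 - chi z) * \<beta> (snd z)"
  have r: "?r \<in> Borel" by measurable
  have rB: "cmod (?r z) \<le> B" for z
  proof -
    have "\<bar>1 - chi z\<bar> * cmod (\<beta> (snd z)) \<le> 1 * B" using chi(2,3)[of z] \<beta>(2)[of "snd z"] by (intro mult_mono) auto
    then show ?thesis by (simp add: norm_mult del: of_real_diff)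
  qed
  obtain U where U: "\<And>x. cmod (invF \<epsilon> k x) \<le> U" using inv_fourier_bounded[OF e, of k] by blast
  have um: "invF \<epsilon> k \<in> Borel" using ksi by (simp add: square_integrable_def)
  have split: "?\<rho> z * (cnj (?A z) * ?\<Phi> z) = \<beta> (snd z) * (cnj (?A z) * ?\<Phi> z) - ?r z * (cnj (?A z) * w z)" for z
    using chi(4)[of z] by (cases "z \<in> X") (auto simp: w_def algebra_simps)
  have "l2inner (invF \<epsilon> k) (synth \<epsilon> ?\<rho> g \<phi>) = (LINT z|lborel. ?\<rho> z * (cnj (?A z) * ?\<Phi> z))" by (rule l2inner_synth[OF e \<rho> g \<phi> um U])
  also have "\<dots> = (LINT z|lborel. \<beta> (snd z) * (cnj (?A z) * ?\<Phi> z)) - (LINT z|lborel. ?r z * (cnj (?A z) * w z))"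
    unfolding split by (rule lint_diff[OF packet_form_integrable[OF e ksi g \<Phi> \<beta>' \<beta>(2)] packet_form_integrable[OF e ksi g wsi r rB]])
  also have "(LINT z|lborel. \<beta> (snd z) * (cnj (?A z) * ?\<Phi> z)) = l2inner (invF \<epsilon> (\<lambda>\<xi>. cnj (packet_symbol \<epsilon> \<beta> g \<xi>) * k \<xi>)) \<phi>"
    by (rule packet_form_eq[OF e \<phi> k \<beta> g])
  finally have s: "l2inner (invF \<epsilon> k) (synth \<epsilon> ?\<rho> g \<phi>) = l2inner (invF \<epsilon> (\<lambda>\<xi>. cnj (packet_symbol \<epsilon> \<beta> g \<xi>) * k \<xi>)) \<phi> - (LINT z|lborel. ?r z * (cnj (?A z) * w z))" .
  have cc: "cnj c = c" by (simp add: c_def)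
  have inv: "invF \<epsilon> (\<lambda>\<xi>. cnj (c * packet_symbol \<epsilon> \<beta> g \<xi>) * k \<xi>) x = c * invF \<epsilon> (\<lambda>\<xi>. cnj (packet_symbol \<epsilon> \<beta> g \<xi>) * k \<xi>) x" for x
    unfolding inv_fourier_def complex_cnj_mult cc mult.assoc[of c] integral_mult_right_zero by (rule mult.left_commute)
  have "l2inner (invF \<epsilon> k) (\<lambda>x. c * synth \<epsilon> ?\<rho> g \<phi> x) - l2inner (invF \<epsilon> (\<lambda>\<xi>. cnj (c * packet_symbol \<epsilon> \<beta> g \<xi>) * k \<xi>)) \<phi>
     = - (c * (LINT z|lborel. ?r z * (cnj (?A z) * w z)))" unfolding inv l2inner_cmult_left l2inner_cmult_right s cc by (simp add: algebra_simps)
  then have "cmod (l2inner (invF \<epsilon> k) (\<lambda>x. c * synth \<epsilon> ?\<rho> g \<phi> x) - l2inner (invF \<epsilon> (\<lambda>\<xi>. cnj (c * packet_symbol \<epsilon> \<beta> g \<xi>) * k \<xi>)) \<phi>)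
     = (2 * pi * \<epsilon>) powr (- (3 * d / 2)) * cmod (LINT z|lborel. ?r z * (cnj (?A z) * w z))" by (simp add: norm_mult c_def d_def)
  also have "\<dots> \<le> (2 * pi * \<epsilon>) powr (- (3 * d / 2)) * (B * (packet_const TYPE('d) \<epsilon> * l2norm k) * l2norm w)"
    using packet_form_bound[OF e ksi g wsi r rB] unfolding inv_fourier_l2norm[OF e k] by (intro mult_left_mono) auto
  also have "l2norm w = \<kappa> * sqrt E"
  proof -
    have \<kappa>: "\<kappa> > 0" using e by (simp add: \<kappa>_def)
    have pk: "cmod (packet \<epsilon> \<phi> q p) = \<kappa> * cmod (fbi \<epsilon> \<phi> q p)" for q p
    proof -
      have "2 powr (d / 2) * 2 powr (- (d / 2)) = 1" "(pi * \<epsilon>) powr (3 * d / 4) * (pi * \<epsilon>) powr (- (3 * d / 4)) = 1" using e by (simp_all flip: powr_add)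
      then have "\<kappa> * (2 powr (- (d / 2)) * (pi * \<epsilon>) powr (- (3 * d / 4))) = 1" unfolding \<kappa>_def by (metis mult.assoc mult.left_commute mult_1_right)
      then have "\<kappa> * (2 powr (- (d / 2)) * (pi * \<epsilon>) powr (- (3 * d / 4)) * cmod (packet \<epsilon> \<phi> q p)) = cmod (packet \<epsilon> \<phi> q p)"
        by (metis mult.assoc mult_1_left)
      then show ?thesis unfolding fbi_norm[OF e] by (simp add: d_def)
    qed
    have "(cmod (w z))^2 = \<kappa>^2 * (indicator (- X) z *\<^sub>R (cmod (fbi \<epsilon> \<phi> (fst z) (snd z)))\<^sup>2)" for z
      by (simp add: w_def norm_mult pk power_mult_distrib indicator_def)
    then have "(LINT z|lborel. (cmod (w z))^2) = \<kappa>^2 * E" unfolding E_def set_lebesgue_integral_def by (simp only: integral_mult_right_zero)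
    then show ?thesis unfolding l2norm_def using \<kappa> by (simp add: real_sqrt_mult)
  qed
  also have "(2 * pi * \<epsilon>) powr (- (3 * d / 2)) * (B * (packet_const TYPE('d) \<epsilon> * l2norm k) * (\<kappa> * sqrt E))
     = ((2 * pi * \<epsilon>) powr (- (3 * d / 2)) * packet_const TYPE('d) \<epsilon> * \<kappa>) * (B * l2norm k * sqrt E)" by (simp only: mult_ac)
  \<comment> \<open>All powers of \<open>pi * \<epsilon>\<close> cancel and a negative power of 2 is
    left, so the tail enters without any loss in \<open>\<epsilon>\<close>.\<close>
  also have "\<dots> \<le> 1 * (B * l2norm k * sqrt E)"
  proof (rule mult_right_mono)
    have "(2 * pi * \<epsilon>) powr x = 2 powr x * (pi * \<epsilon>) powr x" for x using e powr_mult[of 2 "pi * \<epsilon>" x] by (simp add: mult.assoc)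
    then have "(2 * pi * \<epsilon>) powr (- (3 * d / 2)) * packet_const TYPE('d) \<epsilon> * \<kappa>
       = (2 powr (- (3 * d / 2)) * 2 powr (d / 2) * 2 powr (d / 2)) * ((pi * \<epsilon>) powr (- (3 * d / 2)) * (pi * \<epsilon>) powr (d / 2) * (pi * \<epsilon>) powr (d / 4) * (pi * \<epsilon>) powr (3 * d / 4))"
      unfolding packet_const_def \<kappa>_def d_def[symmetric] by (simp only: mult_ac)
    also have "\<dots> = 2 powr (- (d / 2)) * (pi * \<epsilon>) powr 0" unfolding powr_add[symmetric] by (rule arg_cong2[where f=times]; rule arg_cong2[where f="(powr)"]) simp_all
    also have "\<dots> \<le> 1" using e powr_mono[of "- (d / 2)" 0 2] by (simp add: d_def)
    finally show "(2 * pi * \<epsilon>) powr (- (3 * d / 2)) * packet_const TYPE('d) \<epsilon> * \<kappa> \<le> 1" .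
    have "E \<ge> 0" unfolding E_def set_lebesgue_integral_def by (rule lint_nonneg) simp
    then show "0 \<le> B * l2norm k * sqrt E" using B by simp
  qed
  finally show ?thesis by (simp add: E_def)
qed

context linear_potential_phase
begin

text \<open>With the explicit action, \<open>P \<bullet> Q\<close> and \<open>p \<bullet> q\<close>
  cancel against the centres of the two packets. The real phase is then the plane waves in
  \<open>x\<close> and \<open>y\<close>, minus \<open>phase \<delta> t p\<close>, minus the gauge
  term \<open>t * (c0 + c1 \<bullet> x)\<close>, which does not involve the integration variables
  and leaves the integral.\<close>

lemma fga_eq_synth:
  assumes e: "\<epsilon> > 0" and \<delta>: "\<delta> > 0" and t: "t \<in> {0..tf}"
    and flow: "hamiltonian_flow (kinetic_reg \<alpha> \<delta>) (\<lambda>x. c0 + c1 \<bullet> x) tf Q P"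
    and act: "action (kinetic_reg \<alpha> \<delta>) (\<lambda>x. c0 + c1 \<bullet> x) tf Q P S"
    and am: "amplitude chi tf Q P a" and \<phi>: "L2 \<phi>"
  defines "\<beta> \<equiv> \<lambda>p. amp \<delta> t p * miexp (phase \<delta> t p / \<epsilon>)"
  assumes \<rho>: "L1 (\<lambda>z. cr (chi z) * \<beta> (snd z))"
  shows "fga \<epsilon> Q P S a \<phi> t x = exp (- (\<i> * cr (t * (c0 + c1 \<bullet> x) / \<epsilon>))) *
     (cr ((2 * pi * \<epsilon>) powr (- (3 * CARD('d) / 2))) * synth \<epsilon> (\<lambda>z. cr (chi z) * \<beta> (snd z)) (phase_grad \<delta> t) \<phi> x)"
proof -
  let ?\<rho> = "\<lambda>z. cr (chi z) * \<beta> (snd z)"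
  let ?\<gamma> = "exp (- (\<i> * cr (t * (c0 + c1 \<bullet> x) / \<epsilon>)))"
  let ?g = "phase_grad \<delta> t"
  have pt: "exp (\<i> / cr \<epsilon> * fga_phase Q P S t x y q p) * a t q p * \<phi> y
    = ?\<gamma> * (?\<rho> (q, p) * (iexp (snd (q, p) \<bullet> x / \<epsilon>) * window \<epsilon> (x - (fst (q, p) + ?g (snd (q, p)))))
       * (miexp (p \<bullet> y / \<epsilon>) * window \<epsilon> (y - q) * \<phi> y))" for y q p
  proof -
    let ?n = "(norm (x - (q + ?g p)))^2" and ?m = "(norm (y - q))^2"
    define R where "R = p \<bullet> x - t * (c0 + c1 \<bullet> x) - phase \<delta> t p - p \<bullet> y"
    have "S t q p + P t q p \<bullet> (x - Q t q p) - p \<bullet> (y - q) = R"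
      unfolding action_eq[OF \<delta> flow act t] R_def flow_momentum[OF \<delta> flow t] by (simp add: inner_diff_right inner_diff_left algebra_simps)
    then have "cr R = cr (S t q p) + cr (P t q p \<bullet> (x - Q t q p)) - cr (p \<bullet> (y - q))" by force
    then have "fga_phase Q P S t x y q p = cr R + \<i> / 2 * cr ?n + \<i> / 2 * cr ?m" unfolding fga_phase_def flow_position[OF \<delta> flow t] by simp
    then have "\<i> / cr \<epsilon> * fga_phase Q P S t x y q p
      = \<i> * cr (R / \<epsilon>) + cr (- (1 / (2 * \<epsilon>)) * ?n) + cr (- (1 / (2 * \<epsilon>)) * ?m)" using e by (simp only:) (simp add: complex_eq_iff field_simps)
    moreover have "\<i> * cr (R / \<epsilon>) = - (\<i> * cr (t * (c0 + c1 \<bullet> x) / \<epsilon>)) + - \<i> * cr (phase \<delta> t p / \<epsilon>) + \<i> * cr (p \<bullet> x / \<epsilon>) + - \<i> * cr (p \<bullet> y / \<epsilon>)"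
      unfolding R_def by (simp add: diff_divide_distrib right_diff_distrib)
    ultimately have "\<i> / cr \<epsilon> * fga_phase Q P S t x y q p
      = (- (\<i> * cr (t * (c0 + c1 \<bullet> x) / \<epsilon>)) + - \<i> * cr (phase \<delta> t p / \<epsilon>) + \<i> * cr (p \<bullet> x / \<epsilon>) + - \<i> * cr (p \<bullet> y / \<epsilon>))
        + cr (- (1 / (2 * \<epsilon>)) * ?n) + cr (- (1 / (2 * \<epsilon>)) * ?m)" by (simp only:)
    then have "exp (\<i> / cr \<epsilon> * fga_phase Q P S t x y q p)
      = ?\<gamma> * miexp (phase \<delta> t p / \<epsilon>) * iexp (p \<bullet> x / \<epsilon>) * miexp (p \<bullet> y / \<epsilon>)
        * window \<epsilon> (x - (q + ?g p)) * window \<epsilon> (y - q)" unfolding window_def exp_of_real[symmetric] by (simp only: exp_add)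
    then show ?thesis unfolding amplitude_eq[OF \<delta> flow am t] \<beta>_def fst_conv snd_conv by (simp only: mult_ac)
  qed
  have "(LINT (y, q, p)|lborel. exp (\<i> / cr \<epsilon> * fga_phase Q P S t x y q p) * a t q p * \<phi> y) = ?\<gamma> * synth \<epsilon> ?\<rho> ?g \<phi> x"
    unfolding pt synth_eq_triple_integral[OF e \<rho> phase_grad_measurable[OF \<delta> t] \<phi>, symmetric] by (simp only: case_prod_unfold integral_mult_right_zero)
  then show ?thesis unfolding fga_def by (simp only: mult.left_commute)
qed

lemma fga_mult_eq_symbol:
  assumes e: "\<epsilon> > 0"
  shows "fga_mult \<epsilon> \<delta> t \<xi> = cr ((2 * pi * \<epsilon>) powr (- (3 * CARD('d) / 2))) *
    packet_symbol \<epsilon> (\<lambda>p. amp \<delta> t p * miexp (phase \<delta> t p / \<epsilon>)) (phase_grad \<delta> t) \<xi>"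
proof -
  have "(2 * pi * \<epsilon>) powr (- (CARD('d) / 2)) = (2 * pi * \<epsilon>) powr (- (3 * CARD('d) / 2)) * (2 * pi * \<epsilon>) powr CARD('d)"
    unfolding powr_add[symmetric] by (rule arg_cong[where f="\<lambda>x. _ powr x"]) simp
  then show ?thesis unfolding fga_mult_def packet_symbol_def by (simp only: of_real_mult mult.assoc)
qed

text \<open>One constant is fixed before \<open>\<epsilon>\<close>, the datum, the flow and the
  cutoff, so uniformity in time and in \<open>\<epsilon>\<close> is part of the statement.
  \<open>X\<close> is a set where the cutoff is 1 and \<open>Y\<close> a bounded set outside which
  it vanishes; the regularization parameter is already \<open>\<epsilon>\<close>.\<close>

lemma fga_error:
  "\<exists>C\<ge>0. \<forall>\<epsilon> c0 \<phi> \<psi> chi X Y Q P S a. 0 < \<epsilon> \<longrightarrow> \<epsilon> \<le> 1 \<longrightarrow> L2 \<phi> \<longrightarrow> l2norm \<phi> = 1 \<longrightarrow>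
     schroedinger_solution \<epsilon> (kinetic \<alpha>) (\<lambda>x. c0 + c1 \<bullet> x) tf \<phi> \<psi> \<longrightarrow>
     hamiltonian_flow (kinetic_reg \<alpha> \<epsilon>) (\<lambda>x. c0 + c1 \<bullet> x) tf Q P \<longrightarrow>
     action (kinetic_reg \<alpha> \<epsilon>) (\<lambda>x. c0 + c1 \<bullet> x) tf Q P S \<longrightarrow>
     amplitude chi tf Q P a \<longrightarrow>
     chi \<in> Borel \<longrightarrow> (\<forall>z. 0 \<le> chi z \<and> chi z \<le> 1) \<longrightarrow> (\<forall>z\<in>X. chi z = 1) \<longrightarrow> (\<forall>z. z \<notin> Y \<longrightarrow> chi z = 0) \<longrightarrow>
     X \<in> sets borel \<longrightarrow> bounded Y \<longrightarrow> Y \<in> sets borel \<longrightarrow>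
     (\<forall>t\<in>{0..tf}. L2 (\<lambda>x. \<psi> t x - fga \<epsilon> Q P S a \<phi> t x) \<and>
        l2norm (\<lambda>x. \<psi> t x - fga \<epsilon> Q P S a \<phi> t x)
          \<le> C * (\<epsilon> powr ((\<alpha> - 1) / 2) + sqrt (LINT z:(- X)|lborel. (cmod (fbi \<epsilon> \<phi> (fst z) (snd z)))^2)))"
proof -
  obtain B where B: "B > 0" "\<And>\<delta> t p. \<delta> > 0 \<Longrightarrow> t \<in> {0..tf} \<Longrightarrow> cmod (amp \<delta> t p) \<le> B" using amp_estimates by blast
  obtain M where M: "M \<ge> 0" "\<And>\<epsilon> \<delta> t \<xi>. \<epsilon> > 0 \<Longrightarrow> \<delta> > 0 \<Longrightarrow> t \<in> {0..tf} \<Longrightarrow>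
      cmod (fga_mult \<epsilon> \<delta> t \<xi> - miexp (phase \<delta> t \<xi> / \<epsilon>)) \<le> M * \<epsilon> powr ((\<alpha> - 1) / 2)" using fga_mult_close by blast
  obtain A where A: "A > 0" "\<And>\<delta> t p. \<delta> > 0 \<Longrightarrow> t \<in> {0..tf} \<Longrightarrow> \<bar>phase \<delta> t p - phase 0 t p\<bar> \<le> A * \<delta>^2"
    using phase_close by blast
  have km: "(kinetic_reg \<alpha> 0 :: real ^ 'd \<Rightarrow> real) \<in> Borel" unfolding kinetic_reg_def[abs_def] by measurable
  have K: "norm c1 * (2 + 2 * tf * norm c1) \<ge> 0" using tf by simp
  have main: "L2 (\<lambda>x. \<psi> t x - fga \<epsilon> Q P S a \<phi> t x) \<and>
      l2norm (\<lambda>x. \<psi> t x - fga \<epsilon> Q P S a \<phi> t x) \<le> (B + M + A) * (\<epsilon> powr ((\<alpha> - 1) / 2) + sqrt (LINT z:(- X)|lborel. (cmod (fbi \<epsilon> \<phi> (fst z) (snd z)))^2))"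
    if e: "0 < \<epsilon>" "\<epsilon> \<le> 1" and \<phi>: "L2 \<phi>" "l2norm \<phi> = 1"
      and sol: "schroedinger_solution \<epsilon> (kinetic \<alpha>) (\<lambda>x. c0 + c1 \<bullet> x) tf \<phi> \<psi>"
      and flow: "hamiltonian_flow (kinetic_reg \<alpha> \<epsilon>) (\<lambda>x. c0 + c1 \<bullet> x) tf Q P"
      and act: "action (kinetic_reg \<alpha> \<epsilon>) (\<lambda>x. c0 + c1 \<bullet> x) tf Q P S" and am: "amplitude chi tf Q P a"
      and chi: "chi \<in> Borel" "\<forall>z. 0 \<le> chi z \<and> chi z \<le> 1" "\<forall>z\<in>X. chi z = 1" "\<forall>z. z \<notin> Y \<longrightarrow> chi z = 0"
      and X: "X \<in> sets borel" and Y: "bounded Y" "Y \<in> sets borel" and t: "t \<in> {0..tf}"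
    for \<epsilon> c0 \<phi> \<psi> chi X Y Q P S a t
  proof -
    note [measurable] = chi(1) X Y(2) amp_measurable[OF e(1) t] phase_measurable[OF e(1) t] phase_grad_measurable[OF e(1) t]
    define \<beta> where "\<beta> = (\<lambda>p. amp \<epsilon> t p * miexp (phase \<epsilon> t p / \<epsilon>))"
    define E where "E = sqrt (LINT z:(- X)|lborel. (cmod (fbi \<epsilon> \<phi> (fst z) (snd z)))^2)"
    \<comment> \<open>Multiplication by this unimodular function removes the gauge from the solution
      and from the approximation at once and leaves norms unchanged.\<close>
    define \<gamma> where "\<gamma> x = iexp (t * (c0 + c1 \<bullet> x) / \<epsilon>)" for x
    define c where "c = cr ((2 * pi * \<epsilon>) powr (- (3 * CARD('d) / 2)))"
    let ?\<rho> = "\<lambda>z. cr (chi z) * \<beta> (snd z)"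
    define W where "W x = c * synth \<epsilon> ?\<rho> (phase_grad \<epsilon> t) \<phi> x" for x
    have \<beta>: "\<beta> \<in> Borel" "cmod (\<beta> p) \<le> B" for p using B(2)[OF e(1) t] unfolding \<beta>_def by (measurable, simp add: norm_mult)
    note [measurable] = \<beta>(1)
    have E: "E \<ge> 0" unfolding E_def set_lebesgue_integral_def by (intro real_sqrt_ge_zero lint_nonneg) simp
    have \<rho>: "L1 ?\<rho>"
    proof (rule integrable_real_bound[of _ "\<lambda>z. indicator Y z * B"])
      show "L1 (\<lambda>z. indicator Y z * B :: real)" using emeasure_bounded_finite[OF Y(1)] Y(2) by (intro integrable_mult_left integrable_real_indicator) auto
      show "norm (?\<rho> z) \<le> indicator Y z * B" for z
      proof (cases "z \<in> Y")
        case True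
        have c01: "0 \<le> chi z" "chi z \<le> 1" using chi(2) by blast+
        then have "chi z * cmod (\<beta> (snd z)) \<le> 1 * B" using \<beta>(2)[of "snd z"] by (intro mult_mono) auto
        with True c01 show ?thesis by (simp add: norm_mult)
      next
        case False
        then have "chi z = 0" using chi(4) by blast
        with False show ?thesis by simp
      qed
    qed measurable
    have fga: "fga \<epsilon> Q P S a \<phi> t x = cnj (\<gamma> x) * W x" for x using fga_eq_synth[OF e(1) e(1) t flow act am \<phi>(1) \<rho>[unfolded \<beta>_def]]
      unfolding W_def \<beta>_def \<gamma>_def c_def by (simp add: exp_cnj)
    have \<gamma>1: "cmod (\<gamma> x) = 1" "\<gamma> x * cnj (\<gamma> x) = 1" for x by (simp_all add: \<gamma>_def exp_cnj flip: exp_add)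
    have \<gamma>m [measurable]: "\<gamma> \<in> Borel" unfolding \<gamma>_def by measurable
    have Wsi: "L2 W" unfolding W_def by (intro square_integrable_cmult synth_square_integrable e \<rho> \<phi>) measurable
    have \<psi>si: "L2 (\<psi> t)" using sol t by (simp add: schroedinger_solution_def)
    have g\<psi>: "L2 (\<lambda>x. \<gamma> x * \<psi> t x)" by (rule square_integrable_mult_bounded[OF \<psi>si, of _ 1]) (auto simp: \<gamma>1)
    define U where "U x = \<gamma> x * \<psi> t x - W x" for x
    have Usi: "L2 U" unfolding U_def by (intro square_integrable_diff g\<psi> Wsi)
    have diff: "\<psi> t x - fga \<epsilon> Q P S a \<phi> t x = cnj (\<gamma> x) * U x" for x unfolding fga U_def using \<gamma>1(2)[of x] by (simp add: algebra_simps flip: mult.assoc)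
    have si: "L2 (\<lambda>x. \<psi> t x - fga \<epsilon> Q P S a \<phi> t x)" unfolding diff by (rule square_integrable_mult_bounded[OF Usi, of _ 1]) (auto simp: \<gamma>1)
    have nU: "l2norm (\<lambda>x. \<psi> t x - fga \<epsilon> Q P S a \<phi> t x) = l2norm U" unfolding diff by (rule l2norm_cong) (simp add: norm_mult \<gamma>1)
    let ?y = "\<epsilon> powr ((\<alpha> - 1) / 2)"
    \<comment> \<open>By duality: paired with an inverse transform of \<open>k\<close>, the solution
      becomes the multiplier of \<open>phase 0\<close> and the approximation becomes
      \<open>fga_mult\<close> up to the FBI tail, so only a pointwise comparison of two symbols is
      left.\<close>
    have "l2norm U \<le> (M + A) * ?y + B * E"
    proof (rule l2norm_le_of_inv_fourier_pairing[OF e(1) Usi])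
      show "0 \<le> (M + A) * ?y + B * E" using M(1) A(1) B(1) E by simp
      fix k :: "real ^ 'd \<Rightarrow> complex" assume k: "gauss_bounded k"
      note [measurable] = gauss_bounded_measurable[OF k] phase_0_measurable
      let ?m = "fga_mult \<epsilon> \<epsilon> t"
      let ?k1 = "\<lambda>\<xi>. iexp (phase 0 t \<xi> / \<epsilon>) * k \<xi>" and ?k2 = "\<lambda>\<xi>. cnj (?m \<xi>) * k \<xi>"
      have m_eq: "?m \<xi> = c * packet_symbol \<epsilon> \<beta> (phase_grad \<epsilon> t) \<xi>" for \<xi> unfolding fga_mult_eq_symbol[OF e(1)] c_def \<beta>_def ..
      have mm [measurable]: "?m \<in> Borel" unfolding m_eq[abs_def] by measurable
      have close: "cmod (iexp (phase 0 t \<xi> / \<epsilon>) - cnj (?m \<xi>)) \<le> (M + A) * ?y" for \<xi>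
      proof -
        let ?w = "\<lambda>\<delta>. iexp (phase \<delta> t \<xi> / \<epsilon>)"
        have "cmod (?w \<epsilon> - cnj (?m \<xi>)) = cmod (cnj (?m \<xi> - miexp (phase \<epsilon> t \<xi> / \<epsilon>)))" by (simp add: exp_cnj norm_minus_commute)
        then have 1: "cmod (?w \<epsilon> - cnj (?m \<xi>)) \<le> M * ?y" using M(2)[OF e(1) e(1) t, of \<xi>] by (simp only: complex_mod_cnj)
        have "?w 0 - ?w \<epsilon> = ?w \<epsilon> * (iexp (phase 0 t \<xi> / \<epsilon> - phase \<epsilon> t \<xi> / \<epsilon>) - 1)"
          unfolding right_diff_distrib exp_add[symmetric] by (simp add: algebra_simps)
        then have "cmod (?w 0 - ?w \<epsilon>) \<le> \<bar>phase 0 t \<xi> / \<epsilon> - phase \<epsilon> t \<xi> / \<epsilon>\<bar>"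
          using cmod_iexp_minus_1[of "phase 0 t \<xi> / \<epsilon> - phase \<epsilon> t \<xi> / \<epsilon>"] by (simp add: norm_mult)
        also have "\<dots> = \<bar>phase \<epsilon> t \<xi> - phase 0 t \<xi>\<bar> / \<epsilon>" using e(1) by (simp add: diff_divide_distrib[symmetric] abs_minus_commute)
        \<comment> \<open>The phase error of order \<open>\<epsilon>^2\<close> is divided by
          \<open>\<epsilon>\<close>. The quotient stays below the rate because
          \<open>\<epsilon> \<le> 1\<close> and \<open>(\<alpha> - 1) / 2 \<le> 1\<close>.\<close>
        also have "\<dots> \<le> A * \<epsilon>^2 / \<epsilon>" using A(2)[OF e(1) t, of \<xi>] e(1) by (intro divide_right_mono) auto
        also have "\<dots> = A * \<epsilon> powr 1" using e(1) by (simp add: power2_eq_square)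
        also have "\<dots> \<le> A * ?y" using A(1) e \<alpha>2 by (intro mult_left_mono powr_mono') auto
        finally have 2: "cmod (?w 0 - ?w \<epsilon>) \<le> A * ?y" .
        have "cmod (?w 0 - cnj (?m \<xi>)) \<le> A * ?y + M * ?y" using norm_triangle_le[OF add_mono[OF 2 1]] by simp
        then show ?thesis by (simp add: algebra_simps)
      qed
      have bk: "gauss_bounded ?k1" by (rule gauss_bounded_mult_bounded[OF k, of _ 1]) simp_all
      have bm: "gauss_bounded (\<lambda>\<xi>. (iexp (phase 0 t \<xi> / \<epsilon>) - cnj (?m \<xi>)) * k \<xi>)" by (rule gauss_bounded_mult_bounded[OF k _ close]) measurable
      have bk2: "gauss_bounded ?k2"
      proof (rule gauss_bounded_mult_bounded[OF k, of _ "1 + (M + A) * ?y"])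
        fix \<xi>
        have "cmod (cnj (?m \<xi>)) \<le> cmod (iexp (phase 0 t \<xi> / \<epsilon>)) + cmod (iexp (phase 0 t \<xi> / \<epsilon>) - cnj (?m \<xi>))"
          by (metis add.commute norm_minus_commute norm_triangle_sub)
        then show "cmod (cnj (?m \<xi>)) \<le> 1 + (M + A) * ?y" using close[of \<xi>] by (simp only: cmod_exp_ii_real)
      qed measurable
      let ?u = "invF \<epsilon> k"
      have ksi: "L2 ?u" by (rule inv_fourier_square_integrable[OF e(1) k])
      have "l2inner ?u U = l2inner ?u (\<lambda>x. \<gamma> x * \<psi> t x) - l2inner ?u W" unfolding U_def by (rule l2inner_diff_right[OF ksi g\<psi> Wsi])
      also have "l2inner ?u (\<lambda>x. \<gamma> x * \<psi> t x) = l2inner (\<lambda>x. exp (- (\<i> * cr (t * (c0 + c1 \<bullet> x) / \<epsilon>))) * ?u x) (\<psi> t)"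
        unfolding l2inner_def \<gamma>_def by (simp add: exp_cnj mult_ac)
      also have "\<dots> = l2inner (invF \<epsilon> ?k1) \<phi>"
        by (rule exact_solution_pairing[where T="kinetic_reg \<alpha> 0" and L=1, OF e(1) tf _ _ kinetic_0_lipschitz phase_zero phase_0_measurable K phase_0_time_remainder
              sol[unfolded kinetic_eq_kinetic_reg_0] _ k t])
          (use \<phi>(1) km in \<open>auto simp: square_integrable_def\<close>)
      finally have "l2inner ?u U = (l2inner (invF \<epsilon> ?k1) \<phi> - l2inner (invF \<epsilon> ?k2) \<phi>) - (l2inner ?u W - l2inner (invF \<epsilon> ?k2) \<phi>)" by simp
      then have "cmod (l2inner ?u U) \<le> cmod (l2inner (invF \<epsilon> ?k1) \<phi> - l2inner (invF \<epsilon> ?k2) \<phi>) + cmod (l2inner ?u W - l2inner (invF \<epsilon> ?k2) \<phi>)"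
        by (simp only: norm_triangle_ineq4)
      moreover have "cmod (l2inner ?u W - l2inner (invF \<epsilon> ?k2) \<phi>) \<le> B * l2norm k * E" unfolding W_def m_eq E_def c_def
        by (rule synth_pairing_error[OF e(1) \<phi>(1) k \<beta>]) (use chi(2,3) \<rho> in auto)
      moreover have "cmod (l2inner (invF \<epsilon> ?k1) \<phi> - l2inner (invF \<epsilon> ?k2) \<phi>) \<le> (M + A) * ?y * l2norm k"
      proof -
        let ?kd = "\<lambda>\<xi>. (iexp (phase 0 t \<xi> / \<epsilon>) - cnj (?m \<xi>)) * k \<xi>"
        have inv: "invF \<epsilon> ?kd x = invF \<epsilon> ?k1 x - invF \<epsilon> ?k2 x" for x
          unfolding left_diff_distrib by (rule inv_fourier_diff) (intro gauss_bounded_integrable bk bk2)+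
        have "l2inner (invF \<epsilon> ?k1) \<phi> - l2inner (invF \<epsilon> ?k2) \<phi> = l2inner (invF \<epsilon> ?kd) \<phi>"
          unfolding inv[abs_def] by (rule l2inner_diff_left[symmetric]) (intro inv_fourier_square_integrable e(1) bk bk2 \<phi>(1))+
        also have "cmod \<dots> \<le> l2norm ?kd * 1" using l2inner_bound[OF inv_fourier_square_integrable[OF e(1) bm] \<phi>(1)] unfolding inv_fourier_l2norm[OF e(1) bm] \<phi>(2) .
        also have "l2norm ?kd * 1 \<le> (M + A) * ?y * l2norm k"
        proof -
          have nn: "0 \<le> (M + A) * ?y" using M(1) A(1) by simp
          have "l2norm ?kd \<le> l2norm (\<lambda>\<xi>. cr ((M + A) * ?y) * k \<xi>)"
          proof (rule l2norm_mono(2))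
            show "L2 (\<lambda>\<xi>. cr ((M + A) * ?y) * k \<xi>)" by (intro square_integrable_cmult gauss_bounded_square_integrable k)
            show "?kd \<in> Borel" by measurable
            show "cmod (?kd \<xi>) \<le> cmod (cr ((M + A) * ?y) * k \<xi>)" for \<xi> unfolding norm_mult norm_of_real abs_of_nonneg[OF nn] by (intro mult_right_mono close norm_ge_zero)
          qed
          also have "\<dots> = (M + A) * ?y * l2norm k" unfolding l2norm_cmult norm_of_real abs_of_nonneg[OF nn] ..
          finally show ?thesis by simp
        qed
        finally show ?thesis .
      qed
      ultimately show "cmod (l2inner ?u U) \<le> ((M + A) * ?y + B * E) * l2norm k" by (simp add: algebra_simps)
    qed
    also have "\<dots> \<le> (B + M + A) * (?y + E)"
    proof -
      have "0 \<le> B * ?y + (M + A) * E" using B(1) M(1) A(1) E by simp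
      then show ?thesis by (simp add: algebra_simps)
    qed
    finally show ?thesis using si unfolding nU E_def by simp
  qed
  show ?thesis by (rule exI[of _ "B + M + A"], rule conjI, use B(1) M(1) A(1) in simp, intro allI impI ballI, rule main) assumption+
qed

end

lemma smooth_borel:
  fixes f :: "'a::euclidean_space \<Rightarrow> real"
  assumes "smooth f" shows "f \<in> Borel"
proof (rule borel_measurable_continuous_onI, rule continuous_at_imp_continuous_on, rule ballI)
  fix x
  have "iter_deriv [] f differentiable (at x)" using assms unfolding smooth_def by (metis empty_set empty_subsetI)
  then show "isCont f x" by (simp add: differentiable_imp_continuous_within)
qed

text \<open>The gradient of the potential is the nonzero constant \<open>c1\<close>, so no
  neighbourhood of an equilibrium is removed and a closed ball in phase space remains.\<close>

lemma K_set_linear_potential: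
  fixes c1 :: "real ^ 'd"
  assumes "c1 \<noteq> 0"
  shows "K_set (\<lambda>x. c0 + c1 \<bullet> x) \<omega> = {z. (norm (fst z))^2 + (norm (snd z))^2 \<le> 1 / \<omega>^2}" using assms by (auto simp: K_set_def B_set_def gradient_affine)

lemma K_set_linear_potential_compact:
  fixes c1 :: "real ^ 'd"
  assumes "c1 \<noteq> 0"
  shows "K_set (\<lambda>x. c0 + c1 \<bullet> x) \<omega> \<in> sets borel" "bounded (K_set (\<lambda>x. c0 + c1 \<bullet> x) \<omega>)"
proof -
  have eq: "K_set (\<lambda>x. c0 + c1 \<bullet> x) \<omega> = {z. (norm z)^2 \<le> 1 / \<omega>^2}" unfolding K_set_linear_potential[OF assms] by (auto simp: norm_prod_def)
  show "K_set (\<lambda>x. c0 + c1 \<bullet> x) \<omega> \<in> sets borel" unfolding eq by measurable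
  show "bounded (K_set (\<lambda>x. c0 + c1 \<bullet> x) \<omega>)" unfolding eq bounded_iff by (rule exI[of _ "sqrt (1 / \<omega>^2)"]) (auto intro: real_le_rsqrt)
qed

theorem theorem4p4:
  fixes \<alpha> c0 \<omega> tf :: real
    and c1 :: "real ^ 'd"
    and V :: "real ^ 'd \<Rightarrow> real"
    and \<phi>0 :: "real \<Rightarrow> real ^ 'd \<Rightarrow> complex"
    and \<psi> :: "real \<Rightarrow> real \<Rightarrow> real ^ 'd \<Rightarrow> complex"
    and chi :: "(real ^ 'd) \<times> (real ^ 'd) \<Rightarrow> real"
    and Q P :: "real \<Rightarrow> real \<Rightarrow> real ^ 'd \<Rightarrow> real ^ 'd \<Rightarrow> real ^ 'd"
    and S :: "real \<Rightarrow> real \<Rightarrow> real ^ 'd \<Rightarrow> real ^ 'd \<Rightarrow> real"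
    and a :: "real \<Rightarrow> real \<Rightarrow> real ^ 'd \<Rightarrow> real ^ 'd \<Rightarrow> complex"
  assumes "1 < \<alpha>" and "\<alpha> \<le> 2"
    and "c1 \<noteq> 0" and "V = (\<lambda>x. c0 + c1 \<bullet> x)"
    and "\<omega> > 0" and "tf > 0"
    and "admissible_data V \<omega> \<phi>0"
    and "\<forall>\<^sub>F \<epsilon> in at_right 0. schroedinger_solution \<epsilon> (kinetic \<alpha>) V tf (\<phi>0 \<epsilon>) (\<psi> \<epsilon>)"
    and "phase_cutoff V \<omega> chi"
    and "\<And>\<delta>. \<delta> > 0 \<Longrightarrow> hamiltonian_flow (kinetic_reg \<alpha> \<delta>) V tf (Q \<delta>) (P \<delta>)"
    and "\<And>\<delta>. \<delta> > 0 \<Longrightarrow> action (kinetic_reg \<alpha> \<delta>) V tf (Q \<delta>) (P \<delta>) (S \<delta>)"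
    and "\<And>\<delta>. \<delta> > 0 \<Longrightarrow> amplitude chi tf (Q \<delta>) (P \<delta>) (a \<delta>)"
  shows "\<exists>\<delta> :: real \<Rightarrow> real. (\<forall>\<epsilon>>0. \<delta> \<epsilon> > 0) \<and>
    (\<exists>C. \<forall>\<^sub>F \<epsilon> in at_right 0. \<forall>t\<in>{0..tf}.
       square_integrable
         (\<lambda>x. \<psi> \<epsilon> t x - fga \<epsilon> (Q (\<delta> \<epsilon>)) (P (\<delta> \<epsilon>)) (S (\<delta> \<epsilon>)) (a (\<delta> \<epsilon>)) (\<phi>0 \<epsilon>) t x) \<and>
       l2norm
         (\<lambda>x. \<psi> \<epsilon> t x - fga \<epsilon> (Q (\<delta> \<epsilon>)) (P (\<delta> \<epsilon>)) (S (\<delta> \<epsilon>)) (a (\<delta> \<epsilon>)) (\<phi>0 \<epsilon>) t x)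
         \<le> C * ((ln (1 / \<epsilon>)) powr (3 / 4) * \<epsilon> powr ((\<alpha> - 1) / 2)))"
proof -
  interpret linear_potential_phase \<alpha> tf c1 using assms(1,2,3,6) by unfold_locales
  let ?V = "\<lambda>x. c0 + c1 \<bullet> x"
  note V = assms(4)
  obtain C where C: "C \<ge> 0 \<and> (\<forall>\<epsilon> c0 \<phi> \<psi> chi X Y Q P S a. 0 < \<epsilon> \<longrightarrow> \<epsilon> \<le> 1 \<longrightarrow> L2 \<phi> \<longrightarrow> l2norm \<phi> = 1 \<longrightarrow>
     schroedinger_solution \<epsilon> (kinetic \<alpha>) (\<lambda>x. c0 + c1 \<bullet> x) tf \<phi> \<psi> \<longrightarrow>
     hamiltonian_flow (kinetic_reg \<alpha> \<epsilon>) (\<lambda>x. c0 + c1 \<bullet> x) tf Q P \<longrightarrow>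
     action (kinetic_reg \<alpha> \<epsilon>) (\<lambda>x. c0 + c1 \<bullet> x) tf Q P S \<longrightarrow>
     amplitude chi tf Q P a \<longrightarrow>
     chi \<in> Borel \<longrightarrow> (\<forall>z. 0 \<le> chi z \<and> chi z \<le> 1) \<longrightarrow> (\<forall>z\<in>X. chi z = 1) \<longrightarrow> (\<forall>z. z \<notin> Y \<longrightarrow> chi z = 0) \<longrightarrow>
     X \<in> sets borel \<longrightarrow> bounded Y \<longrightarrow> Y \<in> sets borel \<longrightarrow>
     (\<forall>t\<in>{0..tf}. L2 (\<lambda>x. \<psi> t x - fga \<epsilon> Q P S a \<phi> t x) \<and>
        l2norm (\<lambda>x. \<psi> t x - fga \<epsilon> Q P S a \<phi> t x)
          \<le> C * (\<epsilon> powr ((\<alpha> - 1) / 2) + sqrt (LINT z:(- X)|lborel. (cmod (fbi \<epsilon> \<phi> (fst z) (snd z)))^2))))" using fga_error ..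
  note err = C[THEN conjunct2, rule_format] and C = C[THEN conjunct1]
  let ?E = "\<lambda>\<epsilon>. LINT z:(- K_set ?V \<omega>)|lborel. (cmod (fbi \<epsilon> (\<phi>0 \<epsilon>) (fst z) (snd z)))^2"
  have chi: "smooth chi" "range chi \<subseteq> {0..1}" "\<forall>z\<in>K_set ?V \<omega>. chi z = 1" "\<forall>z. z \<notin> K_set ?V (\<omega> / 2) \<longrightarrow> chi z = 0"
    using assms(9) unfolding phase_cutoff_def V by auto
  have chi01: "\<forall>z. 0 \<le> chi z \<and> chi z \<le> 1" using chi(2) by (auto simp: image_subset_iff)
  have ev1: "\<forall>\<^sub>F \<epsilon> in at_right 0. L2 (\<phi>0 \<epsilon>) \<and> l2norm (\<phi>0 \<epsilon>) = 1" using assms(7) unfolding admissible_data_def by blast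
  \<comment> \<open>The first order of decay is the right one to extract: the tail enters through
    its square root, and \<open>sqrt \<epsilon>\<close> is at most
    \<open>\<epsilon> powr ((\<alpha> - 1) / 2)\<close> for \<open>\<epsilon> \<le> 1\<close> and
    \<open>\<alpha> \<le> 2\<close>.\<close>
  have "?E \<in> o[at_right 0](\<lambda>\<epsilon>. \<epsilon> ^ 1)" using assms(7) unfolding admissible_data_def high_frequency_def V by blast
  then have ev2: "\<forall>\<^sub>F \<epsilon> in at_right 0. norm (?E \<epsilon>) \<le> 1 * norm (\<epsilon> ^ 1)" by (rule landau_o.smallD) simp
  \<comment> \<open>Below \<open>exp (- 1)\<close> the logarithm \<open>ln (1 / \<epsilon>)\<close>
    is at least 1, so the logarithmic factor can be inserted on the right-hand side.\<close>
  have ev3: "\<forall>\<^sub>F \<epsilon> in at_right (0::real). \<epsilon> \<in> {0<..<exp (- 1)}" by (rule eventually_at_right_real) simp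
  have "\<forall>\<^sub>F \<epsilon> in at_right 0. \<forall>t\<in>{0..tf}.
       L2 (\<lambda>x. \<psi> \<epsilon> t x - fga \<epsilon> (Q \<epsilon>) (P \<epsilon>) (S \<epsilon>) (a \<epsilon>) (\<phi>0 \<epsilon>) t x) \<and>
       l2norm (\<lambda>x. \<psi> \<epsilon> t x - fga \<epsilon> (Q \<epsilon>) (P \<epsilon>) (S \<epsilon>) (a \<epsilon>) (\<phi>0 \<epsilon>) t x)
         \<le> (2 * C) * ((ln (1 / \<epsilon>)) powr (3 / 4) * \<epsilon> powr ((\<alpha> - 1) / 2))" using ev1 ev2 ev3 assms(8)
  proof eventually_elim
    case (elim \<epsilon>)
    then have e: "0 < \<epsilon>" "\<epsilon> < exp (- 1)" by auto
    have e1: "\<epsilon> \<le> 1" using e(2) by (rule order.strict_implies_order[OF order.strict_trans2]) simp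
    let ?y = "\<epsilon> powr ((\<alpha> - 1) / 2)"
    have "sqrt (?E \<epsilon>) \<le> sqrt \<epsilon>" using elim(2) e(1) by (intro real_sqrt_le_mono) auto
    also have "sqrt \<epsilon> = \<epsilon> powr (1 / 2)" using e(1) by (simp add: powr_half_sqrt)
    also have "\<dots> \<le> ?y" using e(1) e1 assms(2) by (intro powr_mono') auto
    finally have s: "sqrt (?E \<epsilon>) \<le> ?y" .
    have "ln \<epsilon> < - 1" using e ln_less_cancel_iff[of \<epsilon> "exp (- 1)"] by simp
    then have "1 \<le> ln (1 / \<epsilon>)" using e(1) by (simp add: ln_div)
    then have ln: "1 \<le> (ln (1 / \<epsilon>)) powr (3 / 4)" by (intro ge_one_powr_ge_zero) auto
    have le: "C * (?y + sqrt (?E \<epsilon>)) \<le> (2 * C) * ((ln (1 / \<epsilon>)) powr (3 / 4) * ?y)"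
    proof -
      have "C * (?y + sqrt (?E \<epsilon>)) \<le> C * (2 * ?y)" using s C by (intro mult_left_mono) auto
      also have "\<dots> = (2 * C) * (1 * ?y)" by simp
      also have "\<dots> \<le> (2 * C) * ((ln (1 / \<epsilon>)) powr (3 / 4) * ?y)" using ln C by (intro mult_left_mono mult_right_mono) auto
      finally show ?thesis .
    qed
    show ?case
    proof
      fix t assume t: "t \<in> {0..tf}"
      have "L2 (\<lambda>x. \<psi> \<epsilon> t x - fga \<epsilon> (Q \<epsilon>) (P \<epsilon>) (S \<epsilon>) (a \<epsilon>) (\<phi>0 \<epsilon>) t x) \<and>
        l2norm (\<lambda>x. \<psi> \<epsilon> t x - fga \<epsilon> (Q \<epsilon>) (P \<epsilon>) (S \<epsilon>) (a \<epsilon>) (\<phi>0 \<epsilon>) t x) \<le> C * (?y + sqrt (?E \<epsilon>))"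
        by (rule err[where Y="K_set ?V (\<omega> / 2)" and chi=chi, OF e(1) e1 _ _ elim(4)[unfolded V] assms(10-12)[OF e(1), unfolded V] smooth_borel[OF chi(1)]])
          (rule elim(1)[THEN conjunct1] elim(1)[THEN conjunct2] chi01[rule_format] chi(3)[rule_format] chi(4)[rule_format]
            K_set_linear_potential_compact[OF assms(3)] t | assumption)+
      then show "L2 (\<lambda>x. \<psi> \<epsilon> t x - fga \<epsilon> (Q \<epsilon>) (P \<epsilon>) (S \<epsilon>) (a \<epsilon>) (\<phi>0 \<epsilon>) t x) \<and>
        l2norm (\<lambda>x. \<psi> \<epsilon> t x - fga \<epsilon> (Q \<epsilon>) (P \<epsilon>) (S \<epsilon>) (a \<epsilon>) (\<phi>0 \<epsilon>) t x) \<le> (2 * C) * ((ln (1 / \<epsilon>)) powr (3 / 4) * ?y)"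
        using le by linarith
    qed
  qed
  \<comment> \<open>The regularization parameter is \<open>\<epsilon>\<close> itself; the factor 2
    in the constant accounts for the FBI tail, which is absorbed into the rate.\<close>
  then show ?thesis by (intro exI[of _ "\<lambda>\<epsilon>. \<epsilon>"] conjI exI[of _ "2 * C"]) simp_all
qed

end
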